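(* Let $d\ge3$ and $2\sqrt{d-1}<\mu<d$ be fixed, and let $\mathcal G$ be the random infinite $d$-regular graph described in the context. Then there exists $\delta>0$, not depending on $N$, such that with probability $1-o_N(1)$ we have $|\lambda_1(\mathcal G)-\mu|=O(N^{-0.05})$ and $\lambda_2(\mathcal G)\le(1-\delta)\mu$.
   Context: Construction of $\mathcal G$. Let $\theta$ be the unique solution of $\theta^2-\mu\theta+d-1=0$ with $\theta\in(\sqrt{d-1},d-1)$ and put $p=\theta/(d-1)$. Let $V_0$ be a set of $N$ vertices, and let $\mathcal H$ be the random $d$-regular graph on $V_0$ given by the configuration model: choose a uniformly random perfect matching of the set of half-edges $V_0\times[d]$ and add an edge $i_1i_2$ for every matched pair $(i_1,j_1),(i_2,j_2)$ (loops and multiedges allowed). Let $\mathcal G_0$ be the random subgraph of $\mathcal H$ on $V_0$ obtained by including every edge independently with probability $p$. Let $\mathcal G=T^\infty\mathcal G_0$ be the infinite $d$-regular graph obtained by attaching to each $v\in V_0$ exactly $d-\deg_{\mathcal G_0}(v)$ disjoint infinite rooted $(d-1)$-ary trees, each root being joined to $v$ by an edge. Asymptotics are as $N\to\infty$ with $d,\mu$ fixed. For a possibly infinite graph with vertex set $V$ and adjacency operator $A$ on $\ell^2(V)$, $\lambda_i(\mathcal G)=\sup_{S}\inf_{v\in S,\|v\|=1}\langle v,Av\rangle$, the supremum being over $i$-dimensional subspaces $S$ of $\ell^2(V)$. *)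

theory Defs
  imports
    "HOL-Analysis.Analysis"
    "HOL-Probability.Probability"
    "HOL-Library.Function_Algebras"
begin

section \<open>Multigraphs\<close>

text \<open>
  An undirected multigraph is given by its vertices and its adjacency matrix. The entry at
  \<open>(u, v)\<close> counts the ways to walk along an edge from \<open>u\<close> to \<open>v\<close>; hence every loop at \<open>v\<close>
  contributes 2 to the diagonal entry at \<open>(v, v)\<close>, and row sums are degrees.
  Entries outside \<open>verts\<close> carry no meaning and are never used.
\<close>

record 'v multigraph =
  verts :: "'v set"
  edge_mult :: "'v \<Rightarrow> 'v \<Rightarrow> nat"

definition vdegree :: "'v multigraph \<Rightarrow> 'v \<Rightarrow> nat" where
  "vdegree G v = (\<Sum>w\<in>verts G. edge_mult G v w)"

text \<open>
  The extension of a finite multigraph \<open>G\<close> of maximal degree at most \<open>d\<close> to an infinite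
  \<open>d\<close>-regular one. The vertex \<open>(v, [])\<close> is \<open>v\<close> itself. The vertex \<open>(v, x # xs)\<close> lies in the
  \<open>x\<close>-th of the \<open>d - vdegree G v\<close> trees attached to \<open>v\<close> and is reached from the root of that
  tree by following the child indices \<open>xs\<close>.
\<close>

definition tree_extension :: "nat \<Rightarrow> 'v multigraph \<Rightarrow> ('v \<times> nat list) multigraph" where
  "tree_extension d G = \<lparr>
     verts = {(v, p). v \<in> verts G \<and>
       (case p of [] \<Rightarrow> True | x # xs \<Rightarrow> x < d - vdegree G v \<and> set xs \<subseteq> {..<d - 1})},
     edge_mult = (\<lambda>(v, p) (w, q).
       if p = [] \<and> q = [] then edge_mult G v w
       else if v = w \<and> ((\<exists>k. q = p @ [k]) \<or> (\<exists>k. p = q @ [k])) then 1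
       else 0)\<rparr>"

section \<open>The adjacency operator and its min-max values\<close>

instantiation "fun" :: (type, real_vector) real_vector
begin

definition scaleR_fun :: "real \<Rightarrow> ('a \<Rightarrow> 'b) \<Rightarrow> 'a \<Rightarrow> 'b" where
  "scaleR_fun c f = (\<lambda>x. c *\<^sub>R f x)"

instance
  by standard (simp_all add: scaleR_fun_def fun_eq_iff scaleR_add_right scaleR_add_left)

end

text \<open>
  Elements of the real Hilbert space of square-summable functions on \<open>V\<close> are represented by
  functions on the whole type that vanish outside \<open>V\<close>.
\<close>

definition l2 :: "'v set \<Rightarrow> ('v \<Rightarrow> real) set" where
  "l2 V = {f. (\<forall>v. v \<notin> V \<longrightarrow> f v = 0) \<and> (\<lambda>v. (f v)\<^sup>2) summable_on V}"

definition l2_inner :: "'v set \<Rightarrow> ('v \<Rightarrow> real) \<Rightarrow> ('v \<Rightarrow> real) \<Rightarrow> real" where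
  "l2_inner V f g = (\<Sum>\<^sub>\<infinity>v\<in>V. f v * g v)"

definition l2_norm :: "'v set \<Rightarrow> ('v \<Rightarrow> real) \<Rightarrow> real" where
  "l2_norm V f = sqrt (l2_inner V f f)"

definition adj_op :: "'v multigraph \<Rightarrow> ('v \<Rightarrow> real) \<Rightarrow> 'v \<Rightarrow> real" where
  "adj_op G f u =
     (if u \<in> verts G then \<Sum>\<^sub>\<infinity>v\<in>verts G. real (edge_mult G u v) * f v else 0)"

text \<open>
  The index \<open>i\<close> starts at 1; since \<open>dim\<close> is 0 for infinite-dimensional spaces, \<open>dim S = i\<close> then
  forces \<open>S\<close> to be finite-dimensional. For graphs of bounded degree the quadratic form is bounded
  on the unit sphere, so that the real-valued infima and suprema below are the true ones, provided
  that \<open>G\<close> has at least \<open>i\<close> vertices.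
\<close>

definition graph_eigenvalue :: "nat \<Rightarrow> 'v multigraph \<Rightarrow> real" where
  "graph_eigenvalue i G =
     (SUP S \<in> {S. subspace S \<and> dim S = i \<and> S \<subseteq> l2 (verts G)}.
        INF f \<in> {f \<in> S. l2_norm (verts G) f = 1}. l2_inner (verts G) f (adj_op G f))"

section \<open>The random graph\<close>

definition half_edges :: "nat \<Rightarrow> nat \<Rightarrow> (nat \<times> nat) set" where
  "half_edges N d = {..<N} \<times> {..<d}"

definition perfect_matchings :: "'a set \<Rightarrow> 'a set set set" where
  "perfect_matchings X = {M. partition_on X M \<and> (\<forall>e\<in>M. card e = 2)}"

text \<open>
  Graphs on \<open>{..<N}\<close> are sampled as sets of pairs of half-edges, so that parallel edges stay
  distinguishable and are retained independently. Perfect matchings exist iff \<open>N * d\<close> is even;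
  otherwise \<open>config_model N d\<close> is meaningless.
\<close>

definition config_model :: "nat \<Rightarrow> nat \<Rightarrow> (nat \<times> nat) set set pmf" where
  "config_model N d = pmf_of_set (perfect_matchings (half_edges N d))"

definition percolation :: "real \<Rightarrow> 'e set \<Rightarrow> 'e set pmf" where
  "percolation p E = map_pmf (\<lambda>b. {e \<in> E. b e}) (Pi_pmf E False (\<lambda>_. bernoulli_pmf p))"

definition paired_multigraph :: "nat \<Rightarrow> (nat \<times> nat) set set \<Rightarrow> nat multigraph" where
  "paired_multigraph N E = \<lparr>
     verts = {..<N},
     edge_mult = (\<lambda>u v. card {(j, k). {(u, j), (v, k)} \<in> E})\<rparr>"

definition theta :: "nat \<Rightarrow> real \<Rightarrow> real" where
  "theta d \<mu> = (THE t. t\<^sup>2 - \<mu> * t + real d - 1 = 0 \<and> sqrt (real d - 1) < t \<and> t < real d - 1)"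

lemma theta_ex1:
  assumes "d \<ge> 3" "2 * sqrt (real d - 1) < \<mu>" "\<mu> < real d"
  shows "\<exists>!t. t\<^sup>2 - \<mu> * t + real d - 1 = 0 \<and> sqrt (real d - 1) < t \<and> t < real d - 1"
proof -
  define a where "a = real d - 1"
  define s where "s = sqrt a"
  have a: "a \<ge> 2" using assms(1) by (simp add: a_def)
  have s2: "s * s = a" and s0: "s > 0" using a by (simp_all add: s_def)
  have \<mu>: "2 * s < \<mu>" "\<mu> < a + 1" using assms by (simp_all add: a_def s_def)
  have "s < a" using a unfolding s_def by (intro real_less_lsqrt) (auto simp: power2_eq_square)
  define f where "f = (\<lambda>t::real. t * t - \<mu> * t + a)"
  have fs: "f s < 0"
  proof -
    have "f s = s * (2 * s - \<mu>)" unfolding f_def using s2 by (simp add: algebra_simps)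
    then show ?thesis using s0 \<mu>(1) by (simp add: mult_pos_neg)
  qed
  have fa: "f a > 0"
  proof -
    have "f a = a * (a + 1 - \<mu>)" unfolding f_def by (simp add: algebra_simps)
    then show ?thesis using a \<mu>(2) by simp
  qed
  have "\<exists>t. s \<le> t \<and> t \<le> a \<and> f t = 0"
    using fs fa \<open>s < a\<close> by (intro IVT') (auto simp: f_def intro!: continuous_intros)
  then obtain t where t: "s \<le> t" "t \<le> a" "f t = 0" by blast
  then have t': "s < t" "t < a" using fs fa by (auto simp: less_le)
  have "u = t" if u: "f u = 0" "s < u" for u
  proof (rule ccontr)
    assume "u \<noteq> t"
    have "(u - t) * (u + t - \<mu>) = f u - f t" unfolding f_def by (simp add: algebra_simps)
    then have "u = \<mu> - t" using u(1) t(3) \<open>u \<noteq> t\<close> by simp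
    then have "u * t = (\<mu> - t) * t" by simp
    also have "\<dots> = a" using t(3) unfolding f_def by (simp add: algebra_simps)
    finally have "u * t = a" .
    moreover have "s * s < u * t" using u(2) t'(1) s0 by (intro mult_strict_mono) auto
    ultimately show False using s2 by simp
  qed
  then have "\<exists>!t. f t = 0 \<and> s < t \<and> t < a" using t t' by blast
  then show ?thesis by (simp add: f_def s_def a_def power2_eq_square add_diff_eq)
qed

definition random_graph :: "nat \<Rightarrow> nat \<Rightarrow> real \<Rightarrow> (nat \<times> nat list) multigraph pmf" where
  "random_graph N d \<mu> =
     map_pmf (\<lambda>E. tree_extension d (paired_multigraph N E))
       (config_model N d \<bind> percolation (theta d \<mu> / (real d - 1)))"

end

theory Submission
  imports Defs "Jordan_Normal_Form.Schur_Decomposition" "HOL-Real_Asymp.Real_Asymp"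
begin

text \<open>
  Write \<open>\<lambda> = t + (d - 1) / t\<close>. Completing the square along the edges of the attached trees reduces
  the form of \<open>\<lambda> - A\<close> to a quadratic form \<open>Q t\<close> on the finite graph, and the kernels of these forms are
  eigenspaces, for the eigenvalue \<open>t\<close>, of the nonbacktracking operator of the finite graph (Ihara-Bass).
  Hence the claim is that this operator has one eigenvalue close to \<open>\<theta>\<close> and no other real eigenvalue
  close to it. Both facts are read off from the traces of its powers \<open>k\<close> and \<open>2 * k\<close> with \<open>k\<close> of order
  \<open>ln N\<close>, that is, from the numbers of closed nonbacktracking walks of these lengths.

  The number of simple closed walks is concentrated around \<open>\<theta> ^ k\<close> by the second moment method. All other
  closed walks are negligible in expectation on the likely event that no set of few vertices spans more
  edges than vertices: when a walk is explored step by step, every new edge that hits an old vertex costs a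
  factor of order \<open>1 / N\<close> up to logarithms, there are few ways to move along old edges, and a closed walk
  with only one such collision winds at least twice around a shorter cycle.
\<close>

section \<open>Eigenvalues and closed walks of a matrix\<close>

text \<open>The nonbacktracking operator is not normal, so no norm of it is estimated. Instead, an
  eigenvalue of modulus above \<open>sqrt (d - 1)\<close> is real, because the finite form is
  symmetric at every parameter. In an even power it contributes positively, while each of the at
  most \<open>N * d\<close> others contributes at most \<open>sqrt (d - 1) ^ k\<close>, negligible
  against \<open>\<theta> ^ k\<close> once \<open>k\<close> is about
  \<open>2 * ln N / ln (\<theta> / sqrt (d - 1))\<close>. The remaining normalised terms have sum
  and sum of squares close to 1, which leaves room for one large term. The price is that
  \<open>k\<close> exceeds the scale on which the graph looks like a tree. A subgraph with two
  cycles on few vertices has probability of order \<open>1 / N\<close> but carries exponentially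
  many walks, so expectations could be dominated by it; this is the obstacle that tangle-freeness
  removes. It is available only for vertex sets of size a small multiple of \<open>ln N\<close>, so
  runs over old edges are cut into blocks of length \<open>l\<close>, whose factor
  \<open>4 * k + 1\<close> is beaten by \<open>\<theta> ^ l\<close>. For the second min-max value
  multiplicities matter: independent kernel vectors at one parameter must count as two
  eigenvalues.\<close>

lemma mat_mult_entry:
  assumes "A \<in> carrier_mat n m" "B \<in> carrier_mat m l" "i < n" "j < l"
  shows "(A * B) $$ (i, j) = (\<Sum>k<m. A $$ (i, k) * B $$ (k, j))"
  using assms by (auto simp: scalar_prod_def lessThan_atLeast0)

lemma mat_mult_vec_entry:
  assumes "A \<in> carrier_mat n m" "v \<in> carrier_vec m" "i < n"
  shows "vec_index (A *\<^sub>v v) i = (\<Sum>k<m. A $$ (i, k) * vec_index v k)"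
  using assms by (auto simp: scalar_prod_def lessThan_atLeast0)

lemma upper_triangular_mult:
  fixes A B :: "'a::comm_ring_1 mat"
  assumes A: "A \<in> carrier_mat n n" "upper_triangular A"
    and B: "B \<in> carrier_mat n n" "upper_triangular B"
  shows "upper_triangular (A * B)"
    and "i < n \<Longrightarrow> (A * B) $$ (i, i) = A $$ (i, i) * B $$ (i, i)"
proof -
  have zero: "A $$ (i, k) * B $$ (k, j) = 0" if "i < n" "k < n" "j < n" "j \<le> i" "k \<noteq> i \<or> j \<noteq> i" for i j k
  proof (cases "k < i")
    case True
    then show ?thesis using A that by (auto simp: upper_triangular_def)
  next
    case False
    then have "j < k" using that by auto
    then show ?thesis using B that by (auto simp: upper_triangular_def)
  qed
  show "upper_triangular (A * B)"
  proof (rule upper_triangularI)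
    fix i j assume "j < i" "i < dim_row (A * B)"
    then show "(A * B) $$ (i, j) = 0"
      using A B by (subst mat_mult_entry[OF A(1) B(1)]) (auto intro!: sum.neutral zero)
  qed
  show "(A * B) $$ (i, i) = A $$ (i, i) * B $$ (i, i)" if "i < n"
  proof -
    have "(A * B) $$ (i, i) = (\<Sum>k<n. A $$ (i, k) * B $$ (k, i))"
      using A B that by (intro mat_mult_entry) auto
    also have "\<dots> = (\<Sum>k\<in>{i}. A $$ (i, k) * B $$ (k, i))"
      using that by (intro sum.mono_neutral_right) (auto intro!: zero)
    finally show ?thesis by simp
  qed
qed

lemma upper_triangular_pow:
  fixes A :: "'a::comm_ring_1 mat"
  assumes A: "A \<in> carrier_mat n n" "upper_triangular A"
  shows "upper_triangular (A ^\<^sub>m k) \<and> (\<forall>i<n. (A ^\<^sub>m k) $$ (i, i) = (A $$ (i, i)) ^ k)"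
proof (induction k)
  case 0
  then show ?case using A by auto
next
  case (Suc k)
  then show ?case
    using upper_triangular_mult[of "A ^\<^sub>m k" n A] A by auto
qed

lemma trace_mult_commute:
  fixes A :: "'a::comm_ring_1 mat"
  assumes "A \<in> carrier_mat n n" "B \<in> carrier_mat n n"
  shows "(\<Sum>i<n. (A * B) $$ (i, i)) = (\<Sum>i<n. (B * A) $$ (i, i))"
proof -
  have "(\<Sum>i<n. (A * B) $$ (i, i)) = (\<Sum>i<n. \<Sum>j<n. A $$ (i, j) * B $$ (j, i))"
    by (intro sum.cong refl mat_mult_entry[OF assms]) auto
  also have "\<dots> = (\<Sum>j<n. \<Sum>i<n. B $$ (j, i) * A $$ (i, j))"
    by (subst sum.swap) (simp add: mult.commute)
  also have "\<dots> = (\<Sum>j<n. (B * A) $$ (j, j))"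
    by (intro sum.cong refl mat_mult_entry[OF assms(2,1), symmetric]) auto
  finally show ?thesis .
qed

lemma trace_similar:
  fixes T :: "'a::comm_ring_1 mat"
  assumes "P \<in> carrier_mat n n" "T \<in> carrier_mat n n" "Q \<in> carrier_mat n n" "Q * P = 1\<^sub>m n"
  shows "(\<Sum>i<n. (P * T * Q) $$ (i, i)) = (\<Sum>i<n. T $$ (i, i))"
proof -
  have "(\<Sum>i<n. (P * T * Q) $$ (i, i)) = (\<Sum>i<n. (Q * (P * T)) $$ (i, i))"
    using assms by (intro trace_mult_commute) auto
  also have "Q * (P * T) = (Q * P) * T"
    using assms by (intro assoc_mult_mat[of _ n n _ n _ n, symmetric]) auto
  also have "\<dots> = T" unfolding assms(4) using assms(2) by simp
  finally show ?thesis .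
qed

text \<open>Entries of matrix powers over an arbitrary index set, so that half-edges can index the
  operator and matrices over \<open>{..<n}\<close> stay confined to this section.\<close>

fun walk_sum :: "'a set \<Rightarrow> ('a \<Rightarrow> 'a \<Rightarrow> 'b::semiring_1) \<Rightarrow> nat \<Rightarrow> 'a \<Rightarrow> 'a \<Rightarrow> 'b" where
  "walk_sum I M 0 x y = (if x = y then 1 else 0)"
| "walk_sum I M (Suc k) x y = (\<Sum>z\<in>I. M x z * walk_sum I M k z y)"

lemma pow_mat_Suc_left:
  assumes "A \<in> carrier_mat n n"
  shows "A ^\<^sub>m Suc k = A * A ^\<^sub>m k"
proof (induction k)
  case 0
  then show ?case using assms by auto
next
  case (Suc k)
  have "A ^\<^sub>m Suc (Suc k) = (A * A ^\<^sub>m k) * A" using Suc by simp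
  also have "\<dots> = A * (A ^\<^sub>m k * A)"
    using assms by (intro assoc_mult_mat[of _ n n _ n _ n]) auto
  finally show ?case by simp
qed

lemma walk_sum_mat:
  fixes M :: "'a \<Rightarrow> 'a \<Rightarrow> 'b::comm_ring_1"
  assumes h: "bij_betw h {..<n} I" and "i < n" "j < n"
  shows "(mat n n (\<lambda>(i, j). M (h i) (h j)) ^\<^sub>m k) $$ (i, j) = walk_sum I M k (h i) (h j)"
  using assms(2,3)
proof (induction k arbitrary: i j)
  case 0
  then show ?case using h by (auto simp: bij_betw_def inj_on_def)
next
  case (Suc k)
  let ?B = "mat n n (\<lambda>(i, j). M (h i) (h j))"
  have pw: "?B ^\<^sub>m Suc k = ?B * ?B ^\<^sub>m k"
    by (rule pow_mat_Suc_left[of _ n]) simp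
  have "(?B ^\<^sub>m Suc k) $$ (i, j) = (\<Sum>l<n. ?B $$ (i, l) * (?B ^\<^sub>m k) $$ (l, j))"
    unfolding pw using Suc.prems by (intro mat_mult_entry) auto
  also have "\<dots> = (\<Sum>l<n. M (h i) (h l) * walk_sum I M k (h l) (h j))"
    using Suc by (intro sum.cong refl) auto
  also have "\<dots> = (\<Sum>z\<in>I. M (h i) z * walk_sum I M k z (h j))"
    using sum.reindex_bij_betw[OF h] by fast
  finally show ?case by simp
qed

text \<open>The sequence \<open>e\<close> is the diagonal of a Schur form; two independent eigenvectors of a triangular
  matrix cannot share the same last nonzero coordinate once their eigenvalues agree.\<close>

lemma trace_powers_eigenvalues:
  fixes M :: "'a \<Rightarrow> 'a \<Rightarrow> complex"
  assumes "finite I"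
  shows "\<exists>e :: nat \<Rightarrow> complex.
    (\<forall>k. (\<Sum>x\<in>I. walk_sum I M k x x) = (\<Sum>i<card I. e i ^ k)) \<and>
    (\<forall>i<card I. \<exists>b. (\<exists>x\<in>I. b x \<noteq> 0) \<and> (\<forall>x\<in>I. (\<Sum>y\<in>I. M x y * b y) = e i * b x)) \<and>
    (\<forall>b t. (\<exists>x\<in>I. b x \<noteq> 0) \<longrightarrow> (\<forall>x\<in>I. (\<Sum>y\<in>I. M x y * b y) = t * b x) \<longrightarrow>
      (\<exists>i<card I. e i = t)) \<and>
    (\<forall>b b' t t'. (\<forall>c c'. (\<forall>x\<in>I. c * b x + c' * b' x = 0) \<longrightarrow> c = 0 \<and> c' = 0) \<longrightarrow>
      (\<forall>x\<in>I. (\<Sum>y\<in>I. M x y * b y) = t * b x) \<longrightarrow> (\<forall>x\<in>I. (\<Sum>y\<in>I. M x y * b' y) = t' * b' x) \<longrightarrow>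
      (\<exists>i<card I. \<exists>j<card I. i \<noteq> j \<and> e i = t \<and> e j = t'))"
proof -
  define n where "n = card I"
  obtain h where h: "bij_betw h {..<n} I"
    using ex_bij_betw_nat_finite[OF assms] unfolding n_def by (metis lessThan_atLeast0)
  define B where "B = mat n n (\<lambda>(i, j). M (h i) (h j))"
  have B: "B \<in> carrier_mat n n" by (simp add: B_def)
  obtain es where es: "char_poly B = (\<Prod>a\<leftarrow>es. [:- a, 1:])"
    using char_poly_factorized[OF B] by auto
  obtain T P Q where S: "schur_decomposition B es = (T, P, Q)"
    by (cases "schur_decomposition B es") auto
  from schur_decomposition[OF B es S] have sim: "similar_mat_wit B T P Q"
    and T: "upper_triangular T" by auto
  from similar_mat_witD2[OF B sim] have PQ: "P * Q = 1\<^sub>m n" "Q * P = 1\<^sub>m n" "B = P * T * Q"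
    "T \<in> carrier_mat n n" "P \<in> carrier_mat n n" "Q \<in> carrier_mat n n" by auto
  define e where "e i = T $$ (i, i)" for i
  have inI: "h i \<in> I" if "i < n" for i using h that by (auto simp: bij_betw_def)
  have sumI: "(\<Sum>y\<in>I. g y) = (\<Sum>i<n. g (h i))" for g :: "'a \<Rightarrow> complex"
    using sum.reindex_bij_betw[OF h, of g] by simp
  have c1: "(\<Sum>x\<in>I. walk_sum I M k x x) = (\<Sum>i<n. e i ^ k)" for k
  proof -
    have "(\<Sum>x\<in>I. walk_sum I M k x x) = (\<Sum>i<n. (B ^\<^sub>m k) $$ (i, i))"
      unfolding sumI B_def by (intro sum.cong refl) (simp add: walk_sum_mat[OF h])
    also have "B ^\<^sub>m k = P * T ^\<^sub>m k * Q" by (rule similar_mat_wit_pow_id[OF sim])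
    also have "(\<Sum>i<n. (P * T ^\<^sub>m k * Q) $$ (i, i)) = (\<Sum>i<n. (T ^\<^sub>m k) $$ (i, i))"
      using PQ by (intro trace_similar) auto
    also have "\<dots> = (\<Sum>i<n. e i ^ k)"
      using upper_triangular_pow[OF PQ(4) T, of k] by (intro sum.cong refl) (auto simp: e_def)
    finally show ?thesis .
  qed
  have c2: "\<exists>b. (\<exists>x\<in>I. b x \<noteq> 0) \<and> (\<forall>x\<in>I. (\<Sum>y\<in>I. M x y * b y) = e i * b x)" if i: "i < n" for i
  proof -
    have "poly (char_poly B) (e i) = 0"
    proof -
      have "char_poly B = char_poly T" using sim by (intro char_poly_similar) (auto simp: similar_mat_def)
      also have "\<dots> = (\<Prod>a\<leftarrow>diag_mat T. [:- a, 1:])" by (rule char_poly_upper_triangular[OF PQ(4) T])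
      moreover have "e i \<in> set (diag_mat T)" using i PQ(4) by (auto simp: diag_mat_def e_def)
      ultimately show ?thesis by (auto simp: poly_prod_list prod_list_zero_iff)
    qed
    then have "eigenvalue B (e i)" using eigenvalue_root_char_poly[OF B] by simp
    then obtain v where v: "v \<in> carrier_vec n" "v \<noteq> 0\<^sub>v n" "B *\<^sub>v v = e i \<cdot>\<^sub>v v"
      using B by (auto simp: eigenvalue_def eigenvector_def)
    define b where "b x = vec_index v (the_inv_into {..<n} h x)" for x
    have bh: "b (h j) = vec_index v j" if "j < n" for j
      using h that by (auto simp: b_def bij_betw_def the_inv_into_f_f)
    have "\<exists>j<n. vec_index v j \<noteq> 0"
    proof (rule ccontr)
      assume "\<not> (\<exists>j<n. vec_index v j \<noteq> 0)"
      then have "v = 0\<^sub>v n" using v(1) by (intro eq_vecI) auto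
      then show False using v(2) by simp
    qed
    then have "\<exists>x\<in>I. b x \<noteq> 0" using bh inI by metis
    moreover have "(\<Sum>y\<in>I. M x y * b y) = e i * b x" if "x \<in> I" for x
    proof -
      have "x \<in> h ` {..<n}" using h \<open>x \<in> I\<close> by (simp add: bij_betw_def)
      then obtain j where j: "j < n" "x = h j" by auto
      have "(\<Sum>y\<in>I. M x y * b y) = (\<Sum>l<n. B $$ (j, l) * vec_index v l)"
        unfolding sumI using j by (intro sum.cong refl) (auto simp: B_def bh)
      also have "\<dots> = vec_index (B *\<^sub>v v) j" using B v j by (intro mat_mult_vec_entry[symmetric])
      also have "\<dots> = e i * b x" using v j bh by simp
      finally show ?thesis .
    qed
    ultimately show ?thesis by blast
  qed
  text \<open>Eigenvectors are transported to eigenvectors of \<open>T\<close>.\<close>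
  define w where "w b = Q *\<^sub>v vec n (\<lambda>i. b (h i))" for b :: "'a \<Rightarrow> complex"
  have w[simp]: "w b \<in> carrier_vec n" for b using PQ(6) by (simp add: w_def)
  have Pw: "P *\<^sub>v w b = vec n (\<lambda>i. b (h i))" for b
  proof -
    have "P *\<^sub>v w b = (P * Q) *\<^sub>v vec n (\<lambda>i. b (h i))"
      unfolding w_def using PQ(5,6) by (intro assoc_mult_mat_vec[symmetric]) auto
    then show ?thesis unfolding PQ(1) by simp
  qed
  have w_zero: "\<forall>x\<in>I. b x = 0" if "w b = 0\<^sub>v n" for b
  proof -
    have "vec n (\<lambda>i. b (h i)) = P *\<^sub>v 0\<^sub>v n" using Pw[of b] that by simp
    then have "vec n (\<lambda>i. b (h i)) = 0\<^sub>v n" using PQ(5) by auto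
    then have "vec_index (vec n (\<lambda>i. b (h i))) i = vec_index (0\<^sub>v n) i" for i by simp
    then have "b (h i) = 0" if "i < n" for i using that by (metis index_vec index_zero_vec(1))
    then show ?thesis using h by (auto simp: bij_betw_def)
  qed
  have w_lin: "w (\<lambda>x. c * b x + c' * b' x) = c \<cdot>\<^sub>v w b + c' \<cdot>\<^sub>v w b'" for b b' c c'
  proof -
    have "vec n (\<lambda>i. c * b (h i) + c' * b' (h i))
        = c \<cdot>\<^sub>v vec n (\<lambda>i. b (h i)) + c' \<cdot>\<^sub>v vec n (\<lambda>i. b' (h i))" by auto
    then show ?thesis unfolding w_def using PQ(6)
      by (simp add: mult_add_distrib_mat_vec[of _ n n] mult_mat_vec[of _ n n])
  qed
  have Tw: "T *\<^sub>v w b = t \<cdot>\<^sub>v w b" if "\<forall>x\<in>I. (\<Sum>y\<in>I. M x y * b y) = t * b x" for b t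
  proof -
    let ?v = "vec n (\<lambda>i. b (h i))"
    have "B *\<^sub>v ?v = t \<cdot>\<^sub>v ?v"
    proof (rule eq_vecI)
      fix i assume "i < dim_vec (t \<cdot>\<^sub>v ?v)"
      then have i: "i < n" by simp
      have "vec_index (B *\<^sub>v ?v) i = (\<Sum>l<n. B $$ (i, l) * vec_index ?v l)"
        using B i by (intro mat_mult_vec_entry) auto
      also have "\<dots> = (\<Sum>l<n. M (h i) (h l) * b (h l))" using i by (auto simp: B_def)
      also have "\<dots> = (\<Sum>y\<in>I. M (h i) y * b y)" by (rule sumI[symmetric])
      finally show "vec_index (B *\<^sub>v ?v) i = vec_index (t \<cdot>\<^sub>v ?v) i" using that inI[OF i] i by simp
    qed (use B in auto)
    then have "Q *\<^sub>v (B *\<^sub>v ?v) = t \<cdot>\<^sub>v w b"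
      unfolding w_def using PQ(6) by (simp add: mult_mat_vec[of _ n n])
    moreover have "Q *\<^sub>v (B *\<^sub>v ?v) = T *\<^sub>v w b"
    proof -
      have "Q *\<^sub>v (B *\<^sub>v ?v) = (Q * B) *\<^sub>v ?v" using PQ B by (intro assoc_mult_mat_vec[symmetric]) auto
      also have "Q * B = (Q * P) * (T * Q)"
        unfolding PQ(3) using PQ(4-6) by (simp add: assoc_mult_mat[of _ n n _ n _ n])
      also have "\<dots> = T * Q" unfolding PQ(2) using PQ(4-6) by simp
      finally show ?thesis unfolding w_def using PQ(4-6) by (simp add: assoc_mult_mat_vec[of _ n n _ n])
    qed
    ultimately show ?thesis by simp
  qed
  \<comment> \<open>At the last nonzero coordinate \<open>i\<close> of \<open>u\<close>, row
    \<open>i\<close> of \<open>T u = t u\<close> only retains the diagonal term, because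
    \<open>T\<close> is upper triangular. So \<open>t\<close> is the diagonal entry at that
    place.\<close>
  have last: "\<exists>i<n. vec_index u i \<noteq> 0 \<and> (\<forall>j<n. i < j \<longrightarrow> vec_index u j = 0) \<and> e i = t"
    if u: "u \<in> carrier_vec n" "u \<noteq> 0\<^sub>v n" "T *\<^sub>v u = t \<cdot>\<^sub>v u" for u t
  proof -
    define J where "J = {i. i < n \<and> vec_index u i \<noteq> 0}"
    have "J \<noteq> {}"
    proof
      assume "J = {}"
      then have "u = 0\<^sub>v n" using u(1) by (intro eq_vecI) (auto simp: J_def)
      then show False using u(2) by simp
    qed
    moreover have "finite J" by (simp add: J_def)
    ultimately have m: "Max J \<in> J" by simp
    define i where "i = Max J"
    have i: "i < n" "vec_index u i \<noteq> 0" using m by (auto simp: i_def J_def)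
    have z: "vec_index u j = 0" if "j < n" "i < j" for j
      using Max_ge[OF \<open>finite J\<close>, of j] that by (fastforce simp: i_def J_def)
    have "t * vec_index u i = vec_index (T *\<^sub>v u) i" using u i by simp
    also have "\<dots> = (\<Sum>l<n. T $$ (i, l) * vec_index u l)" using PQ(4) u i by (intro mat_mult_vec_entry)
    also have "\<dots> = (\<Sum>l\<in>{i}. T $$ (i, l) * vec_index u l)"
    proof (intro sum.mono_neutral_right ballI)
      fix l assume "l \<in> {..<n} - {i}"
      then show "T $$ (i, l) * vec_index u l = 0"
        using T z[of l] i PQ(4) by (cases "l < i") (auto simp: upper_triangular_def)
    qed (use i in auto)
    finally have "e i = t" using i by (simp add: e_def)
    then show ?thesis using i z by blast
  qed
  have c4: "\<exists>i<n. \<exists>j<n. i \<noteq> j \<and> e i = t \<and> e j = t'"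
    if ind: "\<forall>c c'. (\<forall>x\<in>I. c * b x + c' * b' x = 0) \<longrightarrow> c = 0 \<and> c' = 0"
      and eb: "\<forall>x\<in>I. (\<Sum>y\<in>I. M x y * b y) = t * b x"
      and eb': "\<forall>x\<in>I. (\<Sum>y\<in>I. M x y * b' y) = t' * b' x" for b b' t t'
  proof -
    have nz: "w b \<noteq> 0\<^sub>v n" "w b' \<noteq> 0\<^sub>v n"
    proof -
      show "w b \<noteq> 0\<^sub>v n"
      proof
        assume "w b = 0\<^sub>v n"
        from w_zero[OF this] have "\<forall>x\<in>I. 1 * b x + 0 * b' x = 0" by simp
        from ind[THEN spec, THEN spec, THEN mp, OF this] show False by simp
      qed
      show "w b' \<noteq> 0\<^sub>v n"
      proof
        assume "w b' = 0\<^sub>v n"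
        from w_zero[OF this] have *: "\<forall>x\<in>I. 0 * b x + 1 * b' x = 0" by simp
        from ind[THEN spec, THEN spec, THEN mp, OF *] show False by simp
      qed
    qed
    obtain i where i: "i < n" "vec_index (w b) i \<noteq> 0" "\<forall>j<n. i < j \<longrightarrow> vec_index (w b) j = 0" "e i = t"
      using last[OF w nz(1) Tw[OF eb]] by blast
    obtain j where j: "j < n" "vec_index (w b') j \<noteq> 0" "\<forall>k<n. j < k \<longrightarrow> vec_index (w b') k = 0" "e j = t'"
      using last[OF w nz(2) Tw[OF eb']] by blast
    show ?thesis
    proof (cases "i = j")
      case False
      then show ?thesis using i j by blast
    next
      case True
      then have tt: "t = t'" using i j by simp
      \<comment> \<open>These coefficients cancel coordinate \<open>i\<close>. The combination is
        nonzero by independence and still an eigenvector for the common eigenvalue, so its last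
        nonzero coordinate is a second index.\<close>
      define c where "c = vec_index (w b') i"
      define c' where "c' = - vec_index (w b) i"
      define b'' where "b'' x = c * b x + c' * b' x" for x
      have wb: "w b'' = c \<cdot>\<^sub>v w b + c' \<cdot>\<^sub>v w b'" unfolding b''_def by (rule w_lin)
      have "c' \<noteq> 0" using i by (simp add: c'_def)
      then have "\<not> (\<forall>x\<in>I. b'' x = 0)" using ind[THEN spec, THEN spec, of c c'] unfolding b''_def by blast
      then have nz': "w b'' \<noteq> 0\<^sub>v n" using w_zero by blast
      have "(\<Sum>y\<in>I. M x y * b'' y) = t * b'' x" if "x \<in> I" for x
      proof -
        have "(\<Sum>y\<in>I. M x y * b'' y) = (\<Sum>y\<in>I. c * (M x y * b y) + c' * (M x y * b' y))"
          unfolding b''_def by (intro sum.cong refl) (simp add: algebra_simps)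
        also have "\<dots> = c * (\<Sum>y\<in>I. M x y * b y) + c' * (\<Sum>y\<in>I. M x y * b' y)"
          by (simp add: sum_distrib_left sum.distrib)
        also have "\<dots> = t * b'' x"
          using eb[rule_format, OF that] eb'[rule_format, OF that] tt by (simp add: b''_def algebra_simps)
        finally show ?thesis .
      qed
      then have "T *\<^sub>v w b'' = t \<cdot>\<^sub>v w b''" by (intro Tw) blast
      from last[OF w nz' this] obtain k where k: "k < n" "vec_index (w b'') k \<noteq> 0" "e k = t" by blast
      have dims: "dim_vec (w b) = n" "dim_vec (w b') = n"
        using w[of b] w[of b'] unfolding carrier_vec_def by blast+
      have "k \<noteq> i"
      proof
        assume "k = i"
        then have "vec_index (w b'') k = c * vec_index (w b) i + c' * vec_index (w b') i"
          unfolding wb using i(1) by (simp add: dims)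
        then show False using k by (simp add: c_def c'_def)
      qed
      then show ?thesis using k i tt by blast
    qed
  qed
  have c3: "\<exists>i<n. e i = t" if bt: "\<exists>x\<in>I. b x \<noteq> 0" "\<forall>x\<in>I. (\<Sum>y\<in>I. M x y * b y) = t * b x" for b t
  proof -
    have "w b \<noteq> 0\<^sub>v n" using w_zero[of b] bt(1) by blast
    from last[OF w this Tw[OF bt(2)]] show ?thesis by blast
  qed
  show ?thesis
    unfolding n_def[symmetric]
  proof (intro exI[of _ e] conjI)
    show "\<forall>k. (\<Sum>x\<in>I. walk_sum I M k x x) = (\<Sum>i<n. e i ^ k)" using c1 by blast
  next
    show "\<forall>i<n. \<exists>b. (\<exists>x\<in>I. b x \<noteq> 0) \<and> (\<forall>x\<in>I. (\<Sum>y\<in>I. M x y * b y) = e i * b x)"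
      by (intro allI impI c2)
  next
    show "\<forall>b t. (\<exists>x\<in>I. b x \<noteq> 0) \<longrightarrow> (\<forall>x\<in>I. (\<Sum>y\<in>I. M x y * b y) = t * b x) \<longrightarrow>
      (\<exists>i<n. e i = t)"
    proof (intro allI impI)
      fix b t assume bt: "\<exists>x\<in>I. b x \<noteq> 0" "\<forall>x\<in>I. (\<Sum>y\<in>I. M x y * b y) = t * b x"
      show "\<exists>i<n. e i = t" by (rule c3[OF bt])
    qed
  next
    show "\<forall>b b' t t'. (\<forall>c c'. (\<forall>x\<in>I. c * b x + c' * b' x = 0) \<longrightarrow> c = 0 \<and> c' = 0) \<longrightarrow>
      (\<forall>x\<in>I. (\<Sum>y\<in>I. M x y * b y) = t * b x) \<longrightarrow> (\<forall>x\<in>I. (\<Sum>y\<in>I. M x y * b' y) = t' * b' x) \<longrightarrow>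
      (\<exists>i<n. \<exists>j<n. i \<noteq> j \<and> e i = t \<and> e j = t')"
    proof (intro allI impI)
      fix b b' t t'
      assume bt: "\<forall>c c'. (\<forall>x\<in>I. c * b x + c' * b' x = 0) \<longrightarrow> c = 0 \<and> c' = 0"
        "\<forall>x\<in>I. (\<Sum>y\<in>I. M x y * b y) = t * b x" "\<forall>x\<in>I. (\<Sum>y\<in>I. M x y * b' y) = t' * b' x"
      show "\<exists>i<n. \<exists>j<n. i \<noteq> j \<and> e i = t \<and> e j = t'" by (rule c4[OF bt])
    qed
  qed
qed

section \<open>The quadratic forms of the Bethe Hessian\<close>

text \<open>Functions on a possibly infinite type carry the product topology, so compactness comes
  from Tychonoff. With \<open>lo = hi = 0\<close> outside a finite set this is a box in a
  finite-dimensional space.\<close>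

lemma compact_box_functions:
  fixes lo hi :: "'v \<Rightarrow> real"
  shows "compact {f. \<forall>v. lo v \<le> f v \<and> f v \<le> hi v}"
proof -
  have "{f. \<forall>v. lo v \<le> f v \<and> f v \<le> hi v} = PiE UNIV (\<lambda>v. {lo v..hi v})"
    by (auto simp: PiE_def Pi_def)
  moreover have "compactin (product_topology (\<lambda>v::'v. euclidean :: real topology) UNIV) (PiE UNIV (\<lambda>v. {lo v..hi v}))"
    unfolding compactin_PiE by simp
  ultimately show ?thesis
    by (simp add: euclidean_product_topology)
qed

text \<open>The first variation of a quadratic form at a minimiser: a linear term would win over the
  quadratic one for small \<open>e\<close> of the right sign.\<close>

lemma linear_term_zero:
  fixes b q :: real
  assumes "\<And>e. 0 \<le> 2 * e * b + e\<^sup>2 * q"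
  shows "b = 0"
proof (rule ccontr)
  assume "b \<noteq> 0"
  define e where "e = - b / (\<bar>q\<bar> + 1)"
  have eb: "e * (\<bar>q\<bar> + 1) = - b" by (simp add: e_def)
  have "e\<^sup>2 * q \<le> e\<^sup>2 * (\<bar>q\<bar> + 1)" by (intro mult_left_mono) auto
  also have "\<dots> = e * (e * (\<bar>q\<bar> + 1))" by (simp add: power2_eq_square)
  also have "\<dots> = - (e * b)" unfolding eb by simp
  finally have "e\<^sup>2 * q \<le> - (e * b)" .
  moreover have "e * b < 0"
  proof -
    have "e * b = - (b * b / (\<bar>q\<bar> + 1))" by (simp add: e_def)
    moreover have "0 < b * b / (\<bar>q\<bar> + 1)" using \<open>b \<noteq> 0\<close> by (intro divide_pos_pos) (auto simp: zero_less_mult_iff)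
    ultimately show ?thesis by simp
  qed
  moreover have "0 \<le> 2 * (e * b) + e\<^sup>2 * q" using assms[of e] by (simp add: mult_ac)
  ultimately show False by simp
qed

lemma negative_right_of:
  fixes \<phi> :: "real \<Rightarrow> real"
  assumes "isCont \<phi> s" "\<phi> s < 0" "s < T"
  shows "\<exists>x. s < x \<and> x < T \<and> \<phi> x < 0"
proof -
  obtain e where e: "0 < e" "\<And>x. \<bar>x - s\<bar> < e \<Longrightarrow> \<bar>\<phi> x - \<phi> s\<bar> < - \<phi> s"
    using assms(1)[unfolded continuous_at_eps_delta dist_real_def, rule_format, of "- \<phi> s"] assms(2)
    by auto
  define x where "x = s + min (e / 2) ((T - s) / 2)"
  have "s < x" "x < T" "\<bar>x - s\<bar> < e" using e assms by (auto simp: x_def min_def field_simps)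
  then show ?thesis using e(2)[of x] by (intro exI[of _ x]) auto
qed

locale weighted_graph =
  fixes V :: "'v set" and a :: "'v \<Rightarrow> 'v \<Rightarrow> real" and dd :: real
  assumes finV: "finite V"
    and a_sym: "\<And>u v. u \<in> V \<Longrightarrow> v \<in> V \<Longrightarrow> a u v = a v u"
    and a_nonneg: "\<And>u v. u \<in> V \<Longrightarrow> v \<in> V \<Longrightarrow> 0 \<le> a u v"
    and deg_le: "\<And>u. u \<in> V \<Longrightarrow> (\<Sum>v\<in>V. a u v) \<le> dd"
    and dd_gt: "2 < dd"
begin

definition dg :: "'v \<Rightarrow> real" where "dg u = (\<Sum>v\<in>V. a u v)"

text \<open>The bilinear form of the deformed Laplacian \<open>t^2 - t A + (D - I)\<close>, a
  quadratic pencil in \<open>t\<close>; its degenerate parameters are the ones that Ihara-Bass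
  relates to nonbacktracking eigenvalues.\<close>

definition Q :: "real \<Rightarrow> ('v \<Rightarrow> real) \<Rightarrow> ('v \<Rightarrow> real) \<Rightarrow> real" where
  "Q t f g = (\<Sum>u\<in>V. (t\<^sup>2 + dg u - 1) * f u * g u) - t * (\<Sum>u\<in>V. \<Sum>v\<in>V. a u v * f u * g v)"

definition in_kernel :: "real \<Rightarrow> ('v \<Rightarrow> real) \<Rightarrow> bool" where
  "in_kernel t f \<longleftrightarrow> (\<forall>u\<in>V. t\<^sup>2 * f u - t * (\<Sum>v\<in>V. a u v * f v) + (dg u - 1) * f u = 0)"

lemma dg_bounds: "u \<in> V \<Longrightarrow> 0 \<le> dg u \<and> dg u \<le> dd"
  unfolding dg_def using a_nonneg deg_le by (auto intro!: sum_nonneg)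

lemma Q_comm: "Q t f g = Q t g f"
proof -
  have "(\<Sum>u\<in>V. \<Sum>v\<in>V. a u v * f u * g v) = (\<Sum>v\<in>V. \<Sum>u\<in>V. a u v * f u * g v)"
    by (rule sum.swap)
  also have "\<dots> = (\<Sum>v\<in>V. \<Sum>u\<in>V. a v u * g v * f u)"
    by (intro sum.cong refl) (simp add: a_sym)
  finally show ?thesis unfolding Q_def by (simp add: mult_ac)
qed

lemma Q_add: "Q t (\<lambda>v. x * f v + y * g v) h = x * Q t f h + y * Q t g h"
  unfolding Q_def
  by (simp add: algebra_simps sum.distrib sum_distrib_left sum_subtractf)

lemma Q_cong: "(\<And>v. v \<in> V \<Longrightarrow> f v = f' v) \<Longrightarrow> (\<And>v. v \<in> V \<Longrightarrow> g v = g' v) \<Longrightarrow> Q t f g = Q t f' g'"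
  unfolding Q_def by (auto intro!: arg_cong2[where f="(-)"] sum.cong)

lemma Q_expand: "Q t (\<lambda>v. x * f v + y * g v) (\<lambda>v. x * f v + y * g v)
    = x\<^sup>2 * Q t f f + 2 * x * y * Q t f g + y\<^sup>2 * Q t g g"
  by (simp add: Q_add Q_comm[of t _ "\<lambda>v. x * f v + y * g v"] Q_comm[of t g f] power2_eq_square algebra_simps)

lemma Q_alt: "Q t f g = (\<Sum>u\<in>V. g u * (t\<^sup>2 * f u - t * (\<Sum>v\<in>V. a u v * f v) + (dg u - 1) * f u))"
  unfolding Q_comm[of t f g] unfolding Q_def
  by (simp add: algebra_simps sum.distrib sum_distrib_left sum_subtractf)

lemma Q_kernel: "in_kernel t f \<Longrightarrow> Q t f g = 0"
  unfolding Q_alt in_kernel_def by simp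

lemma kernelI:
  assumes "\<And>g. Q t f g = 0"
  shows "in_kernel t f"
  unfolding in_kernel_def
proof
  fix u assume "u \<in> V"
  let ?r = "\<lambda>u. t\<^sup>2 * f u - t * (\<Sum>v\<in>V. a u v * f v) + (dg u - 1) * f u"
  have "0 = (\<Sum>w\<in>V. (if w = u then 1 else 0) * ?r w)" using assms unfolding Q_alt by simp
  also have "\<dots> = ?r u" using finV \<open>u \<in> V\<close> by (simp add: if_distrib[of "\<lambda>x. x * _"] cong: if_cong)
  finally show "?r u = 0" by simp
qed

text \<open>Positivity of the Laplacian \<open>D - A\<close>, by the arithmetic-geometric mean
  inequality on every edge.\<close>

lemma adjacency_form_le: "(\<Sum>u\<in>V. \<Sum>v\<in>V. a u v * f u * f v) \<le> (\<Sum>u\<in>V. dg u * (f u)\<^sup>2)"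
proof -
  have "(\<Sum>u\<in>V. \<Sum>v\<in>V. a u v * f u * f v) \<le> (\<Sum>u\<in>V. \<Sum>v\<in>V. a u v * ((f u)\<^sup>2 / 2) + a u v * ((f v)\<^sup>2 / 2))"
  proof (intro sum_mono)
    fix u v assume "u \<in> V" "v \<in> V"
    have "0 \<le> (f u - f v)\<^sup>2" by simp
    then have "f u * f v \<le> (f u)\<^sup>2 / 2 + (f v)\<^sup>2 / 2" by (simp add: power2_eq_square algebra_simps)
    then have "a u v * (f u * f v) \<le> a u v * ((f u)\<^sup>2 / 2 + (f v)\<^sup>2 / 2)"
      using a_nonneg \<open>u \<in> V\<close> \<open>v \<in> V\<close> by (intro mult_left_mono)
    then show "a u v * f u * f v \<le> a u v * ((f u)\<^sup>2 / 2) + a u v * ((f v)\<^sup>2 / 2)" by (simp add: algebra_simps)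
  qed
  also have "\<dots> = (\<Sum>u\<in>V. dg u * ((f u)\<^sup>2 / 2)) + (\<Sum>u\<in>V. \<Sum>v\<in>V. a u v * ((f v)\<^sup>2 / 2))"
    unfolding dg_def sum.distrib sum_distrib_right ..
  also have "(\<Sum>u\<in>V. \<Sum>v\<in>V. a u v * ((f v)\<^sup>2 / 2)) = (\<Sum>v\<in>V. \<Sum>u\<in>V. a v u * ((f v)\<^sup>2 / 2))"
    by (subst sum.swap) (auto intro!: sum.cong simp: a_sym)
  also have "\<dots> = (\<Sum>u\<in>V. dg u * ((f u)\<^sup>2 / 2))"
    unfolding dg_def sum_distrib_right ..
  also have "(\<Sum>u\<in>V. dg u * ((f u)\<^sup>2 / 2)) + (\<Sum>u\<in>V. dg u * ((f u)\<^sup>2 / 2)) = (\<Sum>u\<in>V. dg u * (f u)\<^sup>2)"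
    by (simp add: sum.distrib[symmetric])
  finally show ?thesis .
qed

text \<open>Replacing \<open>A\<close> by the larger \<open>D\<close> leaves the diagonal form with
  entries \<open>(t - 1) * (t + 1 - dg u)\<close>. This gives a parameter from which to descend
  until positivity first fails.\<close>

lemma Q_pos_large:
  assumes "dd - 1 < t" "\<exists>v\<in>V. f v \<noteq> 0"
  shows "0 < Q t f f"
proof -
  have t: "1 < t" using assms dd_gt by simp
  have "0 < (\<Sum>u\<in>V. (t - 1) * (t + 1 - dg u) * (f u)\<^sup>2)"
  proof -
    from assms obtain w where w: "w \<in> V" "f w \<noteq> 0" by blast
    have pos: "0 < (t - 1) * (t + 1 - dg u)" if "u \<in> V" for u
      using t dg_bounds[OF that] assms by (intro mult_pos_pos) auto
    have "0 < (t - 1) * (t + 1 - dg w) * (f w)\<^sup>2" using pos[OF w(1)] w by simp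
    moreover have "0 \<le> (t - 1) * (t + 1 - dg u) * (f u)\<^sup>2" if "u \<in> V" for u
      using pos[OF that] by simp
    ultimately show ?thesis using finV w by (intro sum_pos2[of _ w]) auto
  qed
  also have "\<dots> = (\<Sum>u\<in>V. (t\<^sup>2 + dg u - 1) * f u * f u) - t * (\<Sum>u\<in>V. dg u * (f u)\<^sup>2)"
    by (simp add: sum_distrib_left sum_subtractf[symmetric] power2_eq_square algebra_simps)
  also have "\<dots> \<le> Q t f f"
    unfolding Q_def using adjacency_form_le[of f] t by simp
  finally show ?thesis .
qed

lemma Q_scale: "Q t (\<lambda>v. c * f v) (\<lambda>v. c * f v) = c\<^sup>2 * Q t f f"
  using Q_expand[of t c f 0 f] by simp

text \<open>The pairs of a parameter and a unit vector violating positivity form a compact set, so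
  there is a largest such parameter. The constraint is a hyperplane moving affinely with the
  parameter: trivial when the top kernel is sought, an orthogonality relation when the second one
  is.\<close>

lemma last_crossing:
  fixes \<alpha> \<beta> :: "'v \<Rightarrow> real"
  assumes "t \<le> T" "\<exists>v\<in>V. f v \<noteq> 0" "Q t f f \<le> 0" "(\<Sum>v\<in>V. (t * \<alpha> v + \<beta> v) * f v) = 0"
  shows "\<exists>s f. t \<le> s \<and> s \<le> T \<and> (\<exists>v\<in>V. f v \<noteq> 0) \<and> Q s f f \<le> 0 \<and> (\<Sum>v\<in>V. (s * \<alpha> v + \<beta> v) * f v) = 0
    \<and> (\<forall>s' g. s < s' \<longrightarrow> s' \<le> T \<longrightarrow> (\<exists>v\<in>V. g v \<noteq> 0) \<longrightarrow> (\<Sum>v\<in>V. (s' * \<alpha> v + \<beta> v) * g v) = 0 \<longrightarrow> 0 < Q s' g g)"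
proof -
  define K where "K = {f :: 'v \<Rightarrow> real. \<forall>v. (if v \<in> V then -1 else 0) \<le> f v \<and> f v \<le> (if v \<in> V then 1 else 0)}"
  define C where "C = {z :: real \<times> ('v \<Rightarrow> real). (\<Sum>v\<in>V. (snd z v)\<^sup>2) = 1 \<and> Q (fst z) (snd z) (snd z) \<le> 0
    \<and> (\<Sum>v\<in>V. (fst z * \<alpha> v + \<beta> v) * snd z v) = 0}"
  have cf: "continuous_on UNIV (\<lambda>z :: real \<times> ('v \<Rightarrow> real). snd z v)" for v
    by (rule continuous_on_product_then_coordinatewise) (intro continuous_intros)
  have "closed C"
    unfolding C_def Q_def
    by (intro closed_Collect_conj closed_Collect_eq closed_Collect_le continuous_intros cf)
  moreover have "compact K" unfolding K_def by (rule compact_box_functions)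
  ultimately have comp: "compact (({t..T} \<times> K) \<inter> C)"
    by (intro compact_Int_closed compact_Times) auto
  \<comment> \<open>Scaling to norm 1 and cutting off outside \<open>V\<close> moves any violating
    vector into the compact box \<open>K\<close>.\<close>
  have norm: "\<exists>g. g \<in> K \<and> (s, g) \<in> C" if "\<exists>v\<in>V. f v \<noteq> 0" "Q s f f \<le> 0" "(\<Sum>v\<in>V. (s * \<alpha> v + \<beta> v) * f v) = 0" for s f
  proof -
    define S where "S = (\<Sum>v\<in>V. (f v)\<^sup>2)"
    have S: "0 < S" unfolding S_def using that(1) finV by (auto intro!: sum_pos2)
    define c where "c = 1 / sqrt S"
    define g where "g v = (if v \<in> V then c * f v else 0)" for v
    have c2: "c\<^sup>2 = 1 / S" using S by (simp add: c_def power_divide)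
    have g1: "(\<Sum>v\<in>V. (g v)\<^sup>2) = 1"
    proof -
      have "(\<Sum>v\<in>V. (g v)\<^sup>2) = c\<^sup>2 * S"
        unfolding S_def sum_distrib_left by (simp add: g_def power_mult_distrib)
      then show ?thesis using S by (simp add: c2)
    qed
    have "Q s g g = Q s (\<lambda>v. c * f v) (\<lambda>v. c * f v)" by (intro Q_cong) (auto simp: g_def)
    also have "\<dots> = c\<^sup>2 * Q s f f" by (rule Q_scale)
    also have "\<dots> \<le> 0" using that(2) by (simp add: mult_nonneg_nonpos)
    finally have g2: "Q s g g \<le> 0" .
    have "(\<Sum>v\<in>V. (s * \<alpha> v + \<beta> v) * g v) = c * (\<Sum>v\<in>V. (s * \<alpha> v + \<beta> v) * f v)"
      by (simp add: sum_distrib_left g_def mult_ac)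
    then have g3: "(\<Sum>v\<in>V. (s * \<alpha> v + \<beta> v) * g v) = 0" using that(3) by simp
    have "\<bar>g v\<bar> \<le> 1" if "v \<in> V" for v
    proof -
      have "(g v)\<^sup>2 \<le> (\<Sum>v\<in>V. (g v)\<^sup>2)" using finV that by (intro member_le_sum) auto
      then show ?thesis using g1 by (simp add: abs_square_le_1)
    qed
    then have "g \<in> K" by (fastforce simp: K_def g_def abs_le_iff)
    then show ?thesis using g1 g2 g3 by (auto simp: C_def)
  qed
  from norm[OF assms(2-4)] obtain g where "g \<in> K" "(t, g) \<in> C" by blast
  then have "(t, g) \<in> ({t..T} \<times> K) \<inter> C" using assms(1) by auto
  then have "({t..T} \<times> K) \<inter> C \<noteq> {}" by blast
  moreover have "compact (fst ` (({t..T} \<times> K) \<inter> C))"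
    using comp by (intro compact_continuous_image continuous_intros)
  ultimately obtain s where s: "s \<in> fst ` (({t..T} \<times> K) \<inter> C)"
    "\<forall>s'\<in>fst ` (({t..T} \<times> K) \<inter> C). s' \<le> s"
    using compact_attains_sup[of "fst ` (({t..T} \<times> K) \<inter> C)"] by blast
  from s(1) obtain f where f: "t \<le> s" "s \<le> T" "f \<in> K" "(s, f) \<in> C" by auto
  have "\<exists>v\<in>V. f v \<noteq> 0" using f(4) by (auto simp: C_def intro: ccontr)
  moreover have "0 < Q s' g g" if "s < s'" "s' \<le> T" "\<exists>v\<in>V. g v \<noteq> 0" "(\<Sum>v\<in>V. (s' * \<alpha> v + \<beta> v) * g v) = 0" for s' g
  proof (rule ccontr)
    assume "\<not> 0 < Q s' g g"
    then have "Q s' g g \<le> 0" by simp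
    from norm[OF that(3) this that(4)] obtain h where "h \<in> K" "(s', h) \<in> C" by blast
    then have "(s', h) \<in> ({t..T} \<times> K) \<inter> C" using f that by auto
    then have "s' \<in> fst ` (({t..T} \<times> K) \<inter> C)" by force
    then show False using s(2) that by force
  qed
  ultimately show ?thesis using f by (intro exI[of _ s] exI[of _ f]) (auto simp: C_def)
qed

text \<open>At the last parameter \<open>s\<close> where strict positivity fails, continuity from
  the right makes the form positive semidefinite, so the violating vector is a minimiser and lies in
  the kernel.\<close>

lemma top_kernel:
  assumes "t < dd" "\<exists>v\<in>V. f v \<noteq> 0" "Q t f f < 0"
  shows "\<exists>s f. t < s \<and> (\<exists>v\<in>V. f v \<noteq> 0) \<and> in_kernel s f \<and> (\<forall>g. 0 \<le> Q s g g)"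
proof -
  have "t \<le> dd" using assms by simp
  \<comment> \<open>The right end \<open>dd\<close> lies beyond \<open>dd - 1\<close>, after which
    the form is positive, so there is room to the right of \<open>s\<close> for the continuity
    argument.\<close>
  have "\<exists>s f. t \<le> s \<and> s \<le> dd \<and> (\<exists>v\<in>V. f v \<noteq> 0) \<and> Q s f f \<le> 0
    \<and> (\<forall>s' g. s < s' \<longrightarrow> s' \<le> dd \<longrightarrow> (\<exists>v\<in>V. g v \<noteq> 0) \<longrightarrow> 0 < Q s' g g)"
    using last_crossing[of t dd f "\<lambda>_. 0" "\<lambda>_. 0", OF \<open>t \<le> dd\<close> assms(2)] assms(3) by simp
  then obtain s f where s: "t \<le> s" "s \<le> dd" "\<exists>v\<in>V. f v \<noteq> 0" "Q s f f \<le> 0"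
    "\<And>s' g. s < s' \<Longrightarrow> s' \<le> dd \<Longrightarrow> \<exists>v\<in>V. g v \<noteq> 0 \<Longrightarrow> 0 < Q s' g g" by blast
  have sd: "s \<le> dd - 1" using Q_pos_large[of s f] s by (smt (verit))
  have nonneg: "0 \<le> Q s g g" for g
  proof (rule ccontr)
    assume "\<not> 0 \<le> Q s g g"
    moreover have "isCont (\<lambda>x. Q x g g) s" unfolding Q_def by (intro continuous_intros)
    ultimately obtain x where x: "Q x g g < 0" "s < x" "x < dd"
      using negative_right_of[where \<phi> = "\<lambda>x. Q x g g" and s = s and T = dd] sd by auto
    have "\<exists>v\<in>V. g v \<noteq> 0"
    proof (rule ccontr)
      assume "\<not> ?thesis"
      then have "Q x g g = 0" unfolding Q_def by simp
      then show False using x by simp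
    qed
    then show False using s(5)[of x g] x by simp
  qed
  have "in_kernel s f"
  proof (rule kernelI)
    fix g
    have "0 \<le> 2 * e * Q s f g + e\<^sup>2 * Q s g g" for e
      using nonneg[of "\<lambda>v. 1 * f v + e * g v"] nonneg[of f] s(4) unfolding Q_expand by simp
    then show "Q s f g = 0" by (rule linear_term_zero)
  qed
  moreover have "t \<noteq> s" using nonneg assms(3) by (auto simp: not_le[symmetric])
  ultimately show ?thesis using s nonneg by (intro exI[of _ s] exI[of _ f]) auto
qed

text \<open>Deflation for a quadratic pencil. The forms at different parameters share no eigenbasis,
  so plain orthogonality to the first kernel vector \<open>f1\<close> would not persist as the
  parameter moves. The pairing \<open>H s\<close> repairs this: by \<open>Qf1\<close>,
  \<open>H s h = 0\<close> makes \<open>h\<close> orthogonal to \<open>f1\<close> with respect to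
  \<open>Q s\<close> at every \<open>s\<close>, and the crossing argument can be repeated on these
  moving hyperplanes.\<close>

lemma two_kernels:
  assumes t: "sqrt (dd - 1) < t" "t < dd"
    and neg: "\<And>x y. x \<noteq> 0 \<or> y \<noteq> 0 \<Longrightarrow> Q t (\<lambda>v. x * f v + y * g v) (\<lambda>v. x * f v + y * g v) < 0"
  shows "\<exists>t1 t2 f1 f2. t \<le> t1 \<and> t \<le> t2 \<and> in_kernel t1 f1 \<and> in_kernel t2 f2
    \<and> (\<forall>c c'. (\<forall>v\<in>V. c * f1 v + c' * f2 v = 0) \<longrightarrow> c = 0 \<and> c' = 0)"
proof -
  have t0: "0 < t" using t(1) dd_gt by (smt (verit) real_sqrt_ge_zero)
  have nz: "\<exists>v\<in>V. h v \<noteq> 0" if "Q s h h \<noteq> 0" for s h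
  proof (rule ccontr)
    assume "\<not> ?thesis"
    then have "Q s h h = 0" unfolding Q_def by simp
    then show False using that by simp
  qed
  have "Q t f f < 0" using neg[of 1 0] by simp
  then have "\<exists>v\<in>V. f v \<noteq> 0" using nz[of t f] by simp
  from top_kernel[OF t(2) this \<open>Q t f f < 0\<close>] obtain t1 f1 where
    t1: "t < t1" "\<exists>v\<in>V. f1 v \<noteq> 0" "in_kernel t1 f1" "\<And>g. 0 \<le> Q t1 g g" by blast
  text \<open>The form at \<open>s\<close> pairs \<open>f1\<close> with \<open>h\<close> through the weight \<open>s * t1 + 1 - dg\<close>, which is
    positive in the range considered.\<close>
  define H where "H s h = (\<Sum>v\<in>V. (s * (t1 * f1 v) + (1 - dg v) * f1 v) * h v)" for s h
  \<comment> \<open>The factor \<open>t1\<close> lets the kernel equation of \<open>f1\<close>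
    eliminate the adjacency term; what remains factors as
    \<open>(s - t1) * (s * t1 + 1 - dg u)\<close>.\<close>
  have Qf1: "t1 * Q s f1 h = (s - t1) * H s h" for s h
  proof -
    have ker: "t1 * (\<Sum>v\<in>V. a u v * f1 v) = t1\<^sup>2 * f1 u + (dg u - 1) * f1 u" if "u \<in> V" for u
      using t1(3) that unfolding in_kernel_def by (simp add: algebra_simps)
    have "t1 * Q s f1 h = (\<Sum>u\<in>V. h u * (t1 * s\<^sup>2 * f1 u - s * (t1 * (\<Sum>v\<in>V. a u v * f1 v)) + t1 * (dg u - 1) * f1 u))"
      unfolding Q_alt by (subst sum_distrib_left) (intro sum.cong refl, simp add: algebra_simps)
    also have "\<dots> = (\<Sum>u\<in>V. h u * (t1 * s\<^sup>2 * f1 u - s * (t1\<^sup>2 * f1 u + (dg u - 1) * f1 u) + t1 * (dg u - 1) * f1 u))"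
      using ker by simp
    also have "\<dots> = (s - t1) * H s h"
      unfolding H_def sum_distrib_left by (intro sum.cong refl) (simp add: algebra_simps power2_eq_square)
    finally show ?thesis .
  qed
  have Hpos: "0 < H s f1" if "t \<le> s" for s
  proof -
    have "dd - 1 = sqrt (dd - 1) * sqrt (dd - 1)" using dd_gt by simp
    also have "\<dots> < s * t1" using t t1(1) that dd_gt t0 by (intro mult_strict_mono) auto
    finally have pos: "0 < s * t1 + (1 - dg v)" if "v \<in> V" for v using dg_bounds[OF that] by simp
    from t1(2) obtain w where w: "w \<in> V" "f1 w \<noteq> 0" by blast
    have "H s f1 = (\<Sum>v\<in>V. (s * t1 + (1 - dg v)) * (f1 v)\<^sup>2)"
      unfolding H_def by (intro sum.cong refl) (simp add: algebra_simps power2_eq_square)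
    also have "\<dots> > 0"
      using finV w pos[OF w(1)] by (intro sum_pos2[of _ w]) (auto dest: pos)
    finally show ?thesis .
  qed
  have Hlin: "H s (\<lambda>v. x * h v + y * h' v) = x * H s h + y * H s h'" for s x y h h'
    unfolding H_def sum_distrib_left sum.distrib[symmetric]
    by (intro sum.cong refl) (simp add: algebra_simps)
  \<comment> \<open>One linear condition on the negative plane leaves a nonzero vector on which the
    constrained crossing can start.\<close>
  obtain x y where xy: "x \<noteq> 0 \<or> y \<noteq> 0" "x * H t f + y * H t g = 0"
  proof (cases "H t f = 0")
    case True
    then show ?thesis using that[of 1 0] by simp
  next
    case False
    then show ?thesis using that[of "H t g" "- H t f"] by simp
  qed
  define h0 where "h0 v = x * f v + y * g v" for v
  have h0: "Q t h0 h0 < 0" "H t h0 = 0"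
    using neg[OF xy(1)] xy(2) Hlin[of t x f y g] by (simp_all add: h0_def[abs_def])
  have "\<exists>v\<in>V. h0 v \<noteq> 0" using nz[of t h0] h0 by simp
  from last_crossing[of t t1 h0 "\<lambda>v. t1 * f1 v" "\<lambda>v. (1 - dg v) * f1 v", OF _ this] h0 t1(1)
  have "\<exists>s f. t \<le> s \<and> s \<le> t1 \<and> (\<exists>v\<in>V. f v \<noteq> 0) \<and> Q s f f \<le> 0 \<and> H s f = 0
    \<and> (\<forall>s' g. s < s' \<longrightarrow> s' \<le> t1 \<longrightarrow> (\<exists>v\<in>V. g v \<noteq> 0) \<longrightarrow> H s' g = 0 \<longrightarrow> 0 < Q s' g g)"
    unfolding H_def by simp
  then obtain t2 f2 where t2: "t \<le> t2" "t2 \<le> t1" "\<exists>v\<in>V. f2 v \<noteq> 0" "Q t2 f2 f2 \<le> 0" "H t2 f2 = 0"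
    "\<And>s' g. t2 < s' \<Longrightarrow> s' \<le> t1 \<Longrightarrow> \<exists>v\<in>V. g v \<noteq> 0 \<Longrightarrow> H s' g = 0 \<Longrightarrow> 0 < Q s' g g"
    by blast
  have nonneg: "0 \<le> Q t2 h h" if Hh: "H t2 h = 0" for h
  proof (cases "t2 = t1")
    case True
    then show ?thesis using t1(4) by simp
  next
    case False
    then have lt: "t2 < t1" using t2 by simp
    show ?thesis
    proof (rule ccontr)
      assume n: "\<not> 0 \<le> Q t2 h h"
      \<comment> \<open>The projection of \<open>h\<close> along \<open>f1\<close> to the hyperplane
        at \<open>s\<close>. It equals \<open>h\<close> at \<open>t2\<close> and depends
        continuously on \<open>s\<close>, so negativity at \<open>t2\<close> would persist slightly
        beyond \<open>t2\<close>, where the constrained form is positive.\<close>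
      define hs where "hs s v = 1 * h v + (- (H s h / H s f1)) * f1 v" for s v
      define \<phi> where "\<phi> s = Q s h h + 2 * (- (H s h / H s f1)) * Q s h f1 + (- (H s h / H s f1))\<^sup>2 * Q s f1 f1" for s
      have \<phi>: "\<phi> s = Q s (hs s) (hs s)" for s
        unfolding hs_def[abs_def] Q_expand \<phi>_def by simp
      have "H t2 f1 \<noteq> 0" using Hpos[OF t2(1)] by simp
      then have "isCont \<phi> t2"
        unfolding \<phi>_def Q_def H_def by (intro continuous_intros) auto
      moreover have "\<phi> t2 < 0" using n Hh by (simp add: \<phi>_def)
      ultimately obtain s where s: "t2 < s" "s < t1" "\<phi> s < 0" using negative_right_of lt by blast
      have "H s (hs s) = 0"
        using Hpos[of s] s(1) t2(1) unfolding hs_def[abs_def] Hlin by simp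
      moreover have "\<exists>v\<in>V. hs s v \<noteq> 0" using nz[of s "hs s"] s(3) \<phi>[of s] by simp
      ultimately have "0 < Q s (hs s) (hs s)" using t2(6)[of s "hs s"] s by simp
      then show False using s(3) \<phi>[of s] by simp
    qed
  qed
  have orth: "Q t2 f2 h = 0" if "H t2 h = 0" for h
  proof (rule linear_term_zero[of _ "Q t2 h h"])
    fix e :: real
    have "0 \<le> Q t2 (\<lambda>v. 1 * f2 v + e * h v) (\<lambda>v. 1 * f2 v + e * h v)"
      using t2(5) that by (intro nonneg) (simp only: Hlin mult_zero_right add_0)
    then show "0 \<le> 2 * e * Q t2 f2 h + e\<^sup>2 * Q t2 h h"
      using t2(4) unfolding Q_expand by simp
  qed
  \<comment> \<open>\<open>Q t2 f2\<close> vanishes on the hyperplane by \<open>orth\<close> and on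
    \<open>f1\<close> by this identity, and together they span everything.\<close>
  have "t1 * Q t2 f1 f2 = 0" unfolding Qf1 t2(5) by simp
  then have f12: "Q t2 f2 f1 = 0" using t0 t1(1) by (simp add: Q_comm[of t2 f2 f1])
  have "in_kernel t2 f2"
  proof (rule kernelI)
    fix h
    define c where "c = H t2 h / H t2 f1"
    have "H t2 (\<lambda>v. 1 * h v + (- c) * f1 v) = 0"
      using Hpos[OF t2(1)] unfolding Hlin by (simp add: c_def)
    then have "Q t2 f2 (\<lambda>v. 1 * h v + (- c) * f1 v) = 0" by (rule orth)
    then have "Q t2 (\<lambda>v. 1 * h v + (- c) * f1 v) f2 = 0" unfolding Q_comm[of t2 f2] .
    then have "Q t2 h f2 = 0" unfolding Q_add Q_comm[of t2 f1 f2] f12 by simp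
    then show "Q t2 f2 h = 0" unfolding Q_comm[of t2 f2 h] .
  qed
  \<comment> \<open>\<open>H t2\<close> kills \<open>f2\<close> but not \<open>f1\<close>, which
    also covers \<open>t1 = t2\<close>.\<close>
  moreover have "c = 0 \<and> c' = 0" if lin: "\<forall>v\<in>V. c * f1 v + c' * f2 v = 0" for c c'
  proof -
    have "H t2 (\<lambda>v. c * f1 v + c' * f2 v) = 0" unfolding H_def using lin by simp
    then have "c * H t2 f1 = 0" unfolding Hlin t2(5) by simp
    then have c: "c = 0" using Hpos[OF t2(1)] by simp
    then have "c' = 0" using lin t2(3) by auto
    then show ?thesis using c by simp
  qed
  ultimately show ?thesis using less_imp_le[OF t1(1)] t1(3) t2(1) by blast
qed

end

section \<open>Reduction of the infinite graph to the finite one\<close>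

locale tree_extended = weighted_graph "verts G" "\<lambda>u v. real (edge_mult G u v)" "real d"
  for G :: "'v multigraph" and d :: nat
begin

abbreviation "W \<equiv> verts (tree_extension d G)"

definition nch :: "'v \<times> nat list \<Rightarrow> nat" where
  "nch u = (if snd u = [] then d - vdegree G (fst u) else d - 1)"

definition child :: "('v \<times> nat list) \<times> nat \<Rightarrow> 'v \<times> nat list" where
  "child = (\<lambda>(u, k). (fst u, snd u @ [k]))"

definition parent :: "'v \<times> nat list \<Rightarrow> 'v \<times> nat list" where
  "parent u = (fst u, butlast (snd u))"

text \<open>A vertex outside the finite graph stands for the edge to its parent, so sums over tree
  edges are written as sums over \<open>R\<close>.\<close>

definition R :: "('v \<times> nat list) set" where "R = {w \<in> W. snd w \<noteq> []}"

definition roots :: "('v \<times> nat list) set" where "roots = (\<lambda>v. (v, [])) ` verts G"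

definition form :: "('v \<times> nat list \<Rightarrow> real) \<Rightarrow> real" where
  "form f = l2_inner W f (adj_op (tree_extension d G) f)"

definition sq :: "('v \<times> nat list \<Rightarrow> real) \<Rightarrow> real" where
  "sq f = (\<Sum>\<^sub>\<infinity>w\<in>W. (f w)\<^sup>2)"

lemma in_W: "(v, p) \<in> W \<longleftrightarrow> v \<in> verts G \<and>
    (case p of [] \<Rightarrow> True | x # xs \<Rightarrow> x < d - vdegree G v \<and> set xs \<subseteq> {..<d - 1})"
  by (simp add: tree_extension_def)

lemma parent_child[simp]: "parent (child (u, k)) = u"
  by (simp add: parent_def child_def)

lemma child_in_R: "u \<in> W \<Longrightarrow> k < nch u \<Longrightarrow> child (u, k) \<in> R"
  by (cases u) (auto simp: R_def child_def nch_def in_W split: list.splits if_splits)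

lemma R_cases: "w \<in> R \<Longrightarrow> \<exists>u k. u \<in> W \<and> k < nch u \<and> w = child (u, k)"
proof -
  assume w: "w \<in> R"
  obtain v p where vp: "w = (v, p)" by (cases w)
  have p: "p \<noteq> []" "(v, p) \<in> W" using w vp by (auto simp: R_def)
  then obtain q k where q: "p = q @ [k]" by (metis rev_exhaust)
  have "(v, q) \<in> W \<and> k < nch (v, q)" using p unfolding q
    by (cases q) (auto simp: in_W nch_def)
  then show ?thesis using vp q by (intro exI[of _ "(v, q)"] exI[of _ k]) (auto simp: child_def)
qed

lemma bij_child: "bij_betw child (Sigma W (\<lambda>u. {..<nch u})) R"
proof (rule bij_betwI')
  fix x y assume "x \<in> Sigma W (\<lambda>u. {..<nch u})" "y \<in> Sigma W (\<lambda>u. {..<nch u})"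
  show "(child x = child y) = (x = y)" by (auto simp: child_def prod_eq_iff split: prod.splits)
next
  fix x assume "x \<in> Sigma W (\<lambda>u. {..<nch u})" then show "child x \<in> R" using child_in_R by auto
next
  fix w assume "w \<in> R" then show "\<exists>x\<in>Sigma W (\<lambda>u. {..<nch u}). w = child x" using R_cases by fastforce
qed

lemma W_split: "W = roots \<union> R" "roots \<inter> R = {}"
  by (auto simp: roots_def R_def in_W)

lemma finite_roots: "finite roots" using finV by (simp add: roots_def)

lemma sum_roots: "(\<Sum>w\<in>roots. g w) = (\<Sum>v\<in>verts G. g (v, []))" for g :: "_ \<Rightarrow> real"
  unfolding roots_def by (subst sum.reindex) (auto simp: inj_on_def)

lemma vdegree_real: "real (vdegree G v) = dg v"
  by (simp add: vdegree_def dg_def)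

lemma vdegree_le: "v \<in> verts G \<Longrightarrow> vdegree G v \<le> d"
  using dg_bounds[of v] vdegree_real[of v] by simp

lemma nch_le: "nch u \<le> d" by (simp add: nch_def)

lemma child_nonroot: "snd (child (u, k)) \<noteq> []" by (simp add: child_def)

lemma adj_op_root:
  assumes "v \<in> verts G"
  shows "adj_op (tree_extension d G) f (v, [])
    = (\<Sum>w\<in>verts G. real (edge_mult G v w) * f (w, [])) + (\<Sum>k<nch (v, []). f (child ((v, []), k)))"
proof -
  let ?u = "(v, []) :: 'v \<times> nat list"
  let ?m = "edge_mult (tree_extension d G) ?u"
  let ?C = "(\<lambda>k. child (?u, k)) ` {..<nch ?u}"
  have u: "?u \<in> W" using assms by (simp add: in_W)
  have CW: "?C \<subseteq> R" using child_in_R[OF u] by auto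
  have "(\<Sum>\<^sub>\<infinity>w\<in>W. real (?m w) * f w) = (\<Sum>\<^sub>\<infinity>w\<in>roots \<union> ?C. real (?m w) * f w)"
  proof (rule infsum_cong_neutral)
    fix w assume "w \<in> W - (roots \<union> ?C)"
    then have w: "w \<in> R" "w \<notin> ?C" using W_split by auto
    from R_cases[OF w(1)] obtain u' k where k: "u' \<in> W" "k < nch u'" "w = child (u', k)" by blast
    then have "u' \<noteq> ?u" using w(2) by auto
    then have "?m w = 0" using k by (cases w; cases u') (auto simp: tree_extension_def child_def)
    then show "real (?m w) * f w = 0" by simp
  next
    fix w assume "w \<in> roots \<union> ?C - W" then show "real (?m w) * f w = 0" using CW W_split by auto
  qed auto
  also have "\<dots> = (\<Sum>w\<in>roots \<union> ?C. real (?m w) * f w)" using finite_roots by simp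
  also have "\<dots> = (\<Sum>w\<in>roots. real (?m w) * f w) + (\<Sum>w\<in>?C. real (?m w) * f w)"
    using finite_roots W_split(2) CW by (intro sum.union_disjoint) auto
  also have "(\<Sum>w\<in>roots. real (?m w) * f w) = (\<Sum>w\<in>verts G. real (edge_mult G v w) * f (w, []))"
    unfolding sum_roots by (intro sum.cong refl) (simp add: tree_extension_def)
  also have "(\<Sum>w\<in>?C. real (?m w) * f w) = (\<Sum>k<nch ?u. f (child (?u, k)))"
    by (subst sum.reindex) (auto simp: inj_on_def child_def tree_extension_def intro!: sum.cong)
  finally show ?thesis using u by (simp add: adj_op_def)
qed

lemma adj_op_nonroot:
  assumes "u \<in> R"
  shows "adj_op (tree_extension d G) f u = f (parent u) + (\<Sum>k<nch u. f (child (u, k)))"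
proof -
  let ?m = "edge_mult (tree_extension d G) u"
  let ?C = "(\<lambda>k. child (u, k)) ` {..<nch u}"
  have u: "u \<in> W" "snd u \<noteq> []" using assms by (auto simp: R_def)
  have CW: "?C \<subseteq> R" using child_in_R[OF u(1)] by auto
  from R_cases[OF assms] obtain u' k' where p: "u' \<in> W" "u = child (u', k')" by blast
  then have pW: "parent u \<in> W" by simp
  have pC: "parent u \<notin> ?C"
  proof
    assume "parent u \<in> ?C"
    then obtain k where "parent u = child (u, k)" by auto
    then have "length (snd (parent u)) = length (snd (child (u, k)))" by simp
    then show False by (simp add: parent_def child_def)
  qed
  have m: "?m (child (u, k)) = 1" for k by (cases u) (auto simp: tree_extension_def child_def)
  have mp: "?m (parent u) = 1" using p u by (cases u) (auto simp: tree_extension_def parent_def child_def)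
  have "(\<Sum>\<^sub>\<infinity>w\<in>W. real (?m w) * f w) = (\<Sum>\<^sub>\<infinity>w\<in>insert (parent u) ?C. real (?m w) * f w)"
  proof (rule infsum_cong_neutral)
    fix w assume w: "w \<in> W - insert (parent u) ?C"
    have "?m w = 0"
    proof (rule ccontr)
      assume "?m w \<noteq> 0"
      then have c: "fst u = fst w" "(\<exists>k. snd w = snd u @ [k]) \<or> (\<exists>k. snd u = snd w @ [k])"
        using u by (auto simp: tree_extension_def split: prod.splits if_splits)
      from c(2) show False
      proof
        assume "\<exists>k. snd w = snd u @ [k]"
        then obtain k where k: "snd w = snd u @ [k]" by blast
        then have wk: "w = child (u, k)" using c by (simp add: child_def prod_eq_iff)
        have "w \<in> R" using w k by (auto simp: R_def)
        from R_cases[OF this] obtain u2 k2 where "k2 < nch u2" "w = child (u2, k2)" by blast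
        moreover from this have "u2 = u" "k2 = k" using wk by (auto simp: child_def prod_eq_iff)
        ultimately have "k < nch u" by simp
        then show False using w wk by auto
      next
        assume "\<exists>k. snd u = snd w @ [k]"
        then have "w = parent u" using c by (auto simp: parent_def prod_eq_iff)
        then show False using w by simp
      qed
    qed
    then show "real (?m w) * f w = 0" by simp
  next
    fix w assume "w \<in> insert (parent u) ?C - W"
    then show "real (?m w) * f w = 0" using pW CW W_split by auto
  qed auto
  also have "\<dots> = (\<Sum>w\<in>insert (parent u) ?C. real (?m w) * f w)" by simp
  also have "\<dots> = f (parent u) + (\<Sum>w\<in>?C. real (?m w) * f w)" using pC mp by simp
  also have "(\<Sum>w\<in>?C. real (?m w) * f w) = (\<Sum>k<nch u. f (child (u, k)))"
    by (subst sum.reindex) (auto simp: inj_on_def child_def m[unfolded child_def, simplified] intro!: sum.cong)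
  finally show ?thesis using u by (simp add: adj_op_def)
qed

text \<open>Counting tree edges at their upper ends: \<open>bij_child\<close> gives each vertex the
  multiplicity \<open>nch u\<close>, and nonnegativity justifies the rearrangement.\<close>

lemma sum_over_edges:
  fixes g :: "'v \<times> nat list \<Rightarrow> real"
  assumes "g summable_on W" "\<And>w. w \<in> W \<Longrightarrow> 0 \<le> g w"
  shows "(\<lambda>w. g (parent w)) summable_on R"
    and "(\<Sum>\<^sub>\<infinity>w\<in>R. g (parent w)) = (\<Sum>\<^sub>\<infinity>u\<in>W. real (nch u) * g u)"
    and "(\<lambda>u. real (nch u) * g u) summable_on W"
proof -
  show 3: "(\<lambda>u. real (nch u) * g u) summable_on W"
  proof (rule summable_on_comparison_test)
    show "(\<lambda>u. real d * g u) summable_on W" by (intro summable_on_cmult_right assms)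
  qed (use assms nch_le in \<open>auto intro!: mult_right_mono\<close>)
  have S: "(\<lambda>(u, k). g u) summable_on Sigma W (\<lambda>u. {..<nch u})"
  proof (rule summable_on_SigmaI[OF _ 3])
    fix u assume "u \<in> W"
    show "((\<lambda>k. case (u, k) of (u, k) \<Rightarrow> g u) has_sum real (nch u) * g u) {..<nch u}"
      by (rule has_sum_finiteI) auto
  qed (use assms in auto)
  have eq: "(\<lambda>(u, k). g u) = (\<lambda>x. g (parent (child x)))" by auto
  show "(\<lambda>w. g (parent w)) summable_on R"
    using S unfolding eq by (subst (asm) summable_on_reindex_bij_betw[OF bij_child])
  have "(\<Sum>\<^sub>\<infinity>w\<in>R. g (parent w)) = infsum (\<lambda>(u, k). g u) (Sigma W (\<lambda>u. {..<nch u}))"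
    unfolding eq by (rule infsum_reindex_bij_betw[OF bij_child, symmetric])
  also have "\<dots> = (\<Sum>\<^sub>\<infinity>u\<in>W. \<Sum>\<^sub>\<infinity>k\<in>{..<nch u}. g u)"
    using infsum_Sigma_banach[OF S] by simp
  also have "\<dots> = (\<Sum>\<^sub>\<infinity>u\<in>W. real (nch u) * g u)" by simp
  finally show "(\<Sum>\<^sub>\<infinity>w\<in>R. g (parent w)) = (\<Sum>\<^sub>\<infinity>u\<in>W. real (nch u) * g u)" .
qed

text \<open>Every tree edge is met from both its ends, which gives the factor 2. The cross terms are
  absolutely summable since \<open>2 * \<bar>a * b\<bar>\<close> is at most the sum of the squares,
  so the order of summation is immaterial.\<close>

lemma form_eq:
  assumes f: "(\<lambda>w. (f w)\<^sup>2) summable_on W"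
  shows "(\<lambda>w. f w * f (parent w)) summable_on R"
    and "form f = (\<Sum>u\<in>verts G. \<Sum>v\<in>verts G. real (edge_mult G u v) * f (u, []) * f (v, []))
      + 2 * (\<Sum>\<^sub>\<infinity>w\<in>R. f w * f (parent w))"
proof -
  have fR: "(\<lambda>w. (f w)\<^sup>2) summable_on R" using f by (rule summable_on_subset_banach) (auto simp: R_def)
  note par = sum_over_edges(1)[OF f]
  have abs: "(\<lambda>w. norm (f w * f (parent w))) summable_on R"
  proof (rule summable_on_comparison_test[where f = "\<lambda>w. (f w)\<^sup>2 + (f (parent w))\<^sup>2"])
    show "(\<lambda>w. (f w)\<^sup>2 + (f (parent w))\<^sup>2) summable_on R"
      using fR par by (intro summable_on_add) auto
    fix w assume "w \<in> R"
    have "2 * (\<bar>f w\<bar> * \<bar>f (parent w)\<bar>) \<le> (f w)\<^sup>2 + (f (parent w))\<^sup>2"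
      using sum_squares_bound[of "\<bar>f w\<bar>" "\<bar>f (parent w)\<bar>"] by (simp add: mult_ac)
    moreover have "0 \<le> \<bar>f w\<bar> * \<bar>f (parent w)\<bar>" by simp
    ultimately show "norm (f w * f (parent w)) \<le> (f w)\<^sup>2 + (f (parent w))\<^sup>2"
      unfolding real_norm_def abs_mult by linarith
  qed simp
  then show sum1: "(\<lambda>w. f w * f (parent w)) summable_on R" by (rule Infinite_Sum.abs_summable_summable)
  let ?h = "\<lambda>x. f (child x) * f (fst x)"
  have eq: "(\<lambda>x. f (child x) * f (parent (child x))) = ?h" by (auto simp: fun_eq_iff)
  have S: "?h summable_on Sigma W (\<lambda>u. {..<nch u})"
    using sum1 unfolding eq[symmetric] by (subst summable_on_reindex_bij_betw[OF bij_child])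
  have S2: "(\<lambda>u. \<Sum>k<nch u. f (child (u, k)) * f u) summable_on W"
    using summable_on_Sigma_banach[where f = "\<lambda>u k. f (child (u, k)) * f u" and A = W and B = "\<lambda>u. {..<nch u}"] S
    by (simp add: case_prod_unfold)
  have E: "(\<Sum>\<^sub>\<infinity>w\<in>R. f w * f (parent w)) = (\<Sum>\<^sub>\<infinity>u\<in>W. \<Sum>k<nch u. f (child (u, k)) * f u)"
  proof -
    have "(\<Sum>\<^sub>\<infinity>w\<in>R. f w * f (parent w)) = infsum ?h (Sigma W (\<lambda>u. {..<nch u}))"
      unfolding eq[symmetric] by (rule infsum_reindex_bij_betw[OF bij_child, symmetric])
    also have "\<dots> = (\<Sum>\<^sub>\<infinity>u\<in>W. \<Sum>\<^sub>\<infinity>k\<in>{..<nch u}. ?h (u, k))"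
      using infsum_Sigma_banach[OF S] by simp
    finally show ?thesis by simp
  qed
  define a0 where "a0 w = (if w \<in> roots then f w * (\<Sum>v\<in>verts G. real (edge_mult G (fst w) v) * f (v, [])) else 0)" for w
  define r where "r w = (if w \<in> R then f w * f (parent w) else 0)" for w
  have pt: "f w * adj_op (tree_extension d G) f w = a0 w + r w + (\<Sum>k<nch w. f (child (w, k)) * f w)" if "w \<in> W" for w
  proof (cases "w \<in> R")
    case True
    then have "w \<notin> roots" using W_split by auto
    then show ?thesis using True adj_op_nonroot[OF True, of f]
      by (simp add: a0_def r_def algebra_simps sum_distrib_left)
  next
    case False
    then have w: "w \<in> roots" using W_split that by auto
    then obtain v where v: "v \<in> verts G" "w = (v, [])" by (auto simp: roots_def)
    show ?thesis using False w adj_op_root[OF v(1), of f] unfolding v(2)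
      by (simp add: a0_def r_def algebra_simps sum_distrib_left)
  qed
  have sa: "a0 summable_on W"
    using finite_roots by (intro finite_nonzero_values_imp_summable_on) (auto simp: a0_def elim: finite_subset[rotated])
  have sr: "r summable_on W"
    using sum1 by (subst summable_on_cong_neutral[where S = W and T = R and g = "\<lambda>w. f w * f (parent w)"])
      (auto simp: r_def R_def)
  have "form f = (\<Sum>\<^sub>\<infinity>w\<in>W. a0 w + r w + (\<Sum>k<nch w. f (child (w, k)) * f w))"
    unfolding form_def l2_inner_def by (intro infsum_cong pt)
  also have "\<dots> = (\<Sum>\<^sub>\<infinity>w\<in>W. a0 w) + (\<Sum>\<^sub>\<infinity>w\<in>W. r w) + (\<Sum>\<^sub>\<infinity>w\<in>W. \<Sum>k<nch w. f (child (w, k)) * f w)"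
    using sa sr S2 by (simp add: infsum_add summable_on_add)
  also have "(\<Sum>\<^sub>\<infinity>w\<in>W. r w) = (\<Sum>\<^sub>\<infinity>w\<in>R. f w * f (parent w))"
    by (rule infsum_cong_neutral) (auto simp: r_def R_def)
  also have "(\<Sum>\<^sub>\<infinity>w\<in>W. a0 w) = (\<Sum>\<^sub>\<infinity>w\<in>roots. a0 w)"
    by (rule infsum_cong_neutral) (auto simp: a0_def W_split)
  also have "\<dots> = (\<Sum>w\<in>roots. a0 w)" using finite_roots by simp
  also have "\<dots> = (\<Sum>u\<in>verts G. f (u, []) * (\<Sum>v\<in>verts G. real (edge_mult G u v) * f (v, [])))"
    unfolding sum_roots by (intro sum.cong refl) (auto simp: a0_def roots_def)
  also have "\<dots> = (\<Sum>u\<in>verts G. \<Sum>v\<in>verts G. real (edge_mult G u v) * f (u, []) * f (v, []))"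
    by (simp add: sum_distrib_left mult_ac)
  finally show "form f = (\<Sum>u\<in>verts G. \<Sum>v\<in>verts G. real (edge_mult G u v) * f (u, []) * f (v, []))
      + 2 * (\<Sum>\<^sub>\<infinity>w\<in>R. f w * f (parent w))" using E by simp
qed

text \<open>Completing the square along every tree edge, with weight \<open>t\<close> at the child and \<open>1 / t\<close> at the
  parent, leaves exactly \<open>t + (d - 1) / t\<close> at each tree vertex.\<close>

lemma form_bound:
  assumes f: "(\<lambda>w. (f w)\<^sup>2) summable_on W" and t: "0 < t"
  shows "Q t (\<lambda>v. f (v, [])) (\<lambda>v. f (v, [])) / t \<le> (t + (real d - 1) / t) * sq f - form f"
    and "(\<And>w. w \<in> R \<Longrightarrow> f w = f (parent w) / t) \<Longrightarrow>
      Q t (\<lambda>v. f (v, [])) (\<lambda>v. f (v, [])) / t = (t + (real d - 1) / t) * sq f - form f"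
    and "- (real (3 * d) + 1) * sq f \<le> form f"
proof -
  let ?f0 = "\<lambda>v. f (v, [])"
  let ?A = "\<Sum>u\<in>verts G. \<Sum>v\<in>verts G. real (edge_mult G u v) * f (u, []) * f (v, [])"
  define s0 where "s0 = (\<Sum>v\<in>verts G. (?f0 v)\<^sup>2)"
  define sR where "sR = (\<Sum>\<^sub>\<infinity>w\<in>R. (f w)\<^sup>2)"
  define D where "D = (\<Sum>v\<in>verts G. dg v * (?f0 v)\<^sup>2)"
  have fR: "(\<lambda>w. (f w)\<^sup>2) summable_on R" using f by (rule summable_on_subset_banach) (auto simp: R_def)
  have d1: "1 \<le> d" using dd_gt by simp
  have sq: "sq f = s0 + sR"
  proof -
    have "sq f = infsum (\<lambda>w. (f w)\<^sup>2) roots + infsum (\<lambda>w. (f w)\<^sup>2) R"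
      unfolding sq_def W_split(1)
      using fR finite_roots W_split(2) by (intro infsum_Un_disjoint) auto
    then show ?thesis using finite_roots by (simp add: sR_def s0_def sum_roots)
  qed
  have par: "(\<lambda>w. (f (parent w))\<^sup>2) summable_on R" using sum_over_edges(1)[OF f] by simp
  have parS: "(\<Sum>\<^sub>\<infinity>w\<in>R. (f (parent w))\<^sup>2) = (real d * s0 - D) + (real d - 1) * sR"
  proof -
    have "(\<Sum>\<^sub>\<infinity>w\<in>R. (f (parent w))\<^sup>2) = (\<Sum>\<^sub>\<infinity>u\<in>W. real (nch u) * (f u)\<^sup>2)"
      using sum_over_edges(2)[OF f] by simp
    also have "\<dots> = infsum (\<lambda>u. real (nch u) * (f u)\<^sup>2) roots + infsum (\<lambda>u. real (nch u) * (f u)\<^sup>2) R"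
      unfolding W_split(1) using sum_over_edges(3)[OF f] finite_roots W_split
      by (intro infsum_Un_disjoint) (auto intro: summable_on_subset_banach)
    also have "infsum (\<lambda>u. real (nch u) * (f u)\<^sup>2) R = infsum (\<lambda>u. (real d - 1) * (f u)\<^sup>2) R"
      using d1 by (intro infsum_cong) (auto simp: R_def nch_def of_nat_diff)
    also have "\<dots> = (real d - 1) * sR" unfolding sR_def by (rule infsum_cmult_right) (use fR in simp)
    also have "infsum (\<lambda>u. real (nch u) * (f u)\<^sup>2) roots = (\<Sum>v\<in>verts G. (real d - dg v) * (?f0 v)\<^sup>2)"
      using finite_roots vdegree_le by (simp add: sum_roots nch_def of_nat_diff vdegree_real)
    also have "\<dots> = real d * s0 - D"
      by (simp add: s0_def D_def sum_distrib_left sum_subtractf algebra_simps)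
    finally show ?thesis .
  qed
  have Qe: "Q t ?f0 ?f0 = (t\<^sup>2 - 1) * s0 + D - t * ?A"
    unfolding Q_def s0_def D_def
    by (simp add: sum_distrib_left sum.distrib sum_subtractf algebra_simps power2_eq_square)
  note fe = form_eq[OF f]
  have tot: "(\<Sum>\<^sub>\<infinity>w\<in>R. t * (f w)\<^sup>2 + (f (parent w))\<^sup>2 / t)
      = t * sR + ((real d * s0 - D) + (real d - 1) * sR) / t"
  proof -
    have "(\<Sum>\<^sub>\<infinity>w\<in>R. t * (f w)\<^sup>2 + (f (parent w))\<^sup>2 / t)
        = (\<Sum>\<^sub>\<infinity>w\<in>R. t * (f w)\<^sup>2) + (\<Sum>\<^sub>\<infinity>w\<in>R. (f (parent w))\<^sup>2 * (1 / t))"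
      using fR par by (subst infsum_add[symmetric])
        (auto intro!: summable_on_cmult_right summable_on_cmult_left simp del: times_divide_eq_right, simp)
    then show ?thesis
      using fR par by (simp add: infsum_cmult_right infsum_cmult_left sR_def parS del: times_divide_eq_right) simp
  qed
  have stot: "(\<lambda>w. t * (f w)\<^sup>2 + (f (parent w))\<^sup>2 / t) summable_on R"
    using fR par unfolding divide_inverse by (intro summable_on_add summable_on_cmult_right summable_on_cmult_left)
  \<comment> \<open>A finite vertex has only \<open>d - dg v\<close> tree edges, contributing
    \<open>(d - dg v) / t\<close>. The deficit against \<open>t + (d - 1) / t\<close> is
    \<open>(t^2 + dg v - 1) / t\<close>, which is the diagonal of \<open>Q t\<close> divided by
    \<open>t\<close>.\<close>
  have id: "Q t ?f0 ?f0 / t = (t + (real d - 1) / t) * sq f - (?A + (\<Sum>\<^sub>\<infinity>w\<in>R. t * (f w)\<^sup>2 + (f (parent w))\<^sup>2 / t))"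
    unfolding tot Qe sq using t by (simp add: field_simps power2_eq_square)
  have pw: "2 * (f w * f (parent w)) \<le> t * (f w)\<^sup>2 + (f (parent w))\<^sup>2 / t" for w
  proof -
    have "0 \<le> (t * f w - f (parent w))\<^sup>2" by simp
    then have "2 * (f w * f (parent w)) * t \<le> t\<^sup>2 * (f w)\<^sup>2 + (f (parent w))\<^sup>2"
      by (simp add: power2_eq_square algebra_simps)
    then show ?thesis using t by (simp add: field_simps power2_eq_square)
  qed
  have m2: "2 * (\<Sum>\<^sub>\<infinity>w\<in>R. f w * f (parent w)) = (\<Sum>\<^sub>\<infinity>w\<in>R. 2 * (f w * f (parent w)))"
    using fe(1) by (simp add: infsum_cmult_right)
  have s2: "(\<lambda>w. 2 * (f w * f (parent w))) summable_on R" using fe(1) by (rule summable_on_cmult_right)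
  have "(\<Sum>\<^sub>\<infinity>w\<in>R. 2 * (f w * f (parent w))) \<le> (\<Sum>\<^sub>\<infinity>w\<in>R. t * (f w)\<^sup>2 + (f (parent w))\<^sup>2 / t)"
    using s2 stot pw by (intro infsum_mono) auto
  then show "Q t ?f0 ?f0 / t \<le> (t + (real d - 1) / t) * sq f - form f"
    unfolding id fe(2) m2 by simp
  show "Q t ?f0 ?f0 / t = (t + (real d - 1) / t) * sq f - form f"
    if eq: "\<And>w. w \<in> R \<Longrightarrow> f w = f (parent w) / t"
  proof -
    have "(\<Sum>\<^sub>\<infinity>w\<in>R. 2 * (f w * f (parent w))) = (\<Sum>\<^sub>\<infinity>w\<in>R. t * (f w)\<^sup>2 + (f (parent w))\<^sup>2 / t)"
    proof (rule infsum_cong)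
      fix w assume "w \<in> R"
      then have "f (parent w) = t * f w" using eq[of w] t by simp
      then show "2 * (f w * f (parent w)) = t * (f w)\<^sup>2 + (f (parent w))\<^sup>2 / t"
        using t by (simp add: power2_eq_square)
    qed
    then show ?thesis unfolding id fe(2) m2 by simp
  qed
  \<comment> \<open>A crude bound from below; it serves to make the real-valued infima over unit
    spheres genuine.\<close>
  show "- (real (3 * d) + 1) * sq f \<le> form f"
  proof -
    have "- (\<Sum>\<^sub>\<infinity>w\<in>R. 1 * (f w)\<^sup>2 + (f (parent w))\<^sup>2) = (\<Sum>\<^sub>\<infinity>w\<in>R. - ((f w)\<^sup>2 + (f (parent w))\<^sup>2))"
      by (simp add: infsum_uminus[symmetric])
    also have "\<dots> \<le> (\<Sum>\<^sub>\<infinity>w\<in>R. 2 * (f w * f (parent w)))"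
    proof (rule infsum_mono)
      show "(\<lambda>w. - ((f w)\<^sup>2 + (f (parent w))\<^sup>2)) summable_on R"
        using fR par by (intro summable_on_uminus[THEN iffD2] summable_on_add) auto
      fix w show "- ((f w)\<^sup>2 + (f (parent w))\<^sup>2) \<le> 2 * (f w * f (parent w))"
        using zero_le_power2[of "f w + f (parent w)"] by (simp add: power2_eq_square algebra_simps)
    qed (rule s2)
    finally have 1: "- (sR + ((real d * s0 - D) + (real d - 1) * sR)) \<le> 2 * (\<Sum>\<^sub>\<infinity>w\<in>R. f w * f (parent w))"
      using fR par by (simp add: infsum_add m2 sR_def parS)
    have 2: "- D \<le> ?A"
    proof -
      have "(\<Sum>u\<in>verts G. \<Sum>v\<in>verts G. - (real (edge_mult G u v) * f (u, []) * f (v, []))) \<le> D"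
      proof -
        have "(\<Sum>u\<in>verts G. \<Sum>v\<in>verts G. - (real (edge_mult G u v) * f (u, []) * f (v, [])))
           \<le> (\<Sum>u\<in>verts G. \<Sum>v\<in>verts G. real (edge_mult G u v) * \<bar>f (u, [])\<bar> * \<bar>f (v, [])\<bar>)"
        proof (intro sum_mono)
          fix u v
          have "- (f (u, []) * f (v, [])) \<le> \<bar>f (u, [])\<bar> * \<bar>f (v, [])\<bar>" unfolding abs_mult[symmetric] by simp
          then have "real (edge_mult G u v) * - (f (u, []) * f (v, [])) \<le> real (edge_mult G u v) * (\<bar>f (u, [])\<bar> * \<bar>f (v, [])\<bar>)"
            by (intro mult_left_mono) auto
          then show "- (real (edge_mult G u v) * f (u, []) * f (v, [])) \<le> real (edge_mult G u v) * \<bar>f (u, [])\<bar> * \<bar>f (v, [])\<bar>"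
            by (simp add: mult_ac)
        qed
        also have "\<dots> \<le> D" unfolding D_def using adjacency_form_le[of "\<lambda>v. \<bar>f (v, [])\<bar>"] by simp
        finally show ?thesis .
      qed
      then show ?thesis by (simp add: sum_negf)
    qed
    have D: "0 \<le> D" "D \<le> real d * s0" unfolding D_def s0_def sum_distrib_left
      using dg_bounds by (auto intro!: sum_nonneg sum_mono mult_right_mono)
    have s: "0 \<le> s0" "0 \<le> sR" unfolding s0_def sR_def by (auto intro!: sum_nonneg infsum_nonneg)
    have p: "0 \<le> real d * s0" "0 \<le> real d * sR" using s by simp_all
    have "- (real (3 * d) + 1) * sq f = - (3 * (real d * s0)) - 3 * (real d * sR) - s0 - sR"
      unfolding sq by (simp add: algebra_simps)
    moreover have "form f = ?A + 2 * (\<Sum>\<^sub>\<infinity>w\<in>R. f w * f (parent w))" by (rule fe(2))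
    moreover have "sR + ((real d * s0 - D) + (real d - 1) * sR) = real d * s0 - D + real d * sR"
      by (simp add: algebra_simps)
    ultimately show ?thesis using 1 2 D s p by linarith
  qed
qed

text \<open>The previous bound at a parameter beyond \<open>d - 1\<close>, where the finite form is
  nonnegative. It keeps the supremum over subspaces bounded.\<close>

lemma form_bounded:
  assumes f: "(\<lambda>w. (f w)\<^sup>2) summable_on W"
  shows "form f \<le> (real d + 1 + (real d - 1) / (real d + 1)) * sq f"
proof -
  have "0 \<le> Q (real d + 1) (\<lambda>v. f (v, [])) (\<lambda>v. f (v, []))"
  proof (cases "\<exists>v\<in>verts G. f (v, []) \<noteq> 0")
    case True
    then show ?thesis using Q_pos_large[of "real d + 1" "\<lambda>v. f (v, [])"] by simp
  next
    case False
    then show ?thesis by (simp add: Q_def)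
  qed
  then have "0 \<le> Q (real d + 1) (\<lambda>v. f (v, [])) (\<lambda>v. f (v, [])) / (real d + 1)" by simp
  then show ?thesis using form_bound(1)[OF f, of "real d + 1"] by simp
qed

section \<open>Min-max values of the infinite graph\<close>

lemma l2_norm_sq: "l2_norm W f = sqrt (sq f)"
  by (simp add: l2_norm_def l2_inner_def sq_def power2_eq_square)

lemma sq_scale: "sq (c *\<^sub>R f) = c\<^sup>2 * sq f"
  unfolding sq_def by (simp add: scaleR_fun_def power_mult_distrib infsum_cmult_right')

lemma form_scale: "form (c *\<^sub>R f) = c\<^sup>2 * form f"
proof -
  have "adj_op (tree_extension d G) (c *\<^sub>R f) u = c * adj_op (tree_extension d G) f u" for u
    unfolding adj_op_def by (simp add: scaleR_fun_def infsum_cmult_right'[symmetric] mult_ac)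
  then show ?thesis
    unfolding form_def l2_inner_def
    by (simp add: scaleR_fun_def infsum_cmult_right'[symmetric] power2_eq_square mult_ac)
qed

lemma sq_pos:
  assumes "f \<in> l2 W" "f \<noteq> 0"
  shows "0 < sq f"
proof -
  obtain w where w: "f w \<noteq> 0" using assms(2) by (auto simp: fun_eq_iff)
  then have wW: "w \<in> W" using assms(1) unfolding l2_def by blast
  have "(f w)\<^sup>2 = infsum (\<lambda>w. (f w)\<^sup>2) {w}" by simp
  also have "\<dots> \<le> sq f"
    unfolding sq_def using assms(1) wW by (intro infsum_mono2) (auto simp: l2_def)
  finally show ?thesis using w by (smt (verit) zero_less_power2)
qed

lemma eigenvalue_set_bounded:
  assumes "Real_Vector_Spaces.subspace S" "S \<subseteq> l2 W"
  shows "bdd_below ((\<lambda>f. l2_inner W f (adj_op (tree_extension d G) f)) ` {f \<in> S. l2_norm W f = 1})"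
    and "f \<in> S \<Longrightarrow> l2_norm W f = 1 \<Longrightarrow> (INF f \<in> {f \<in> S. l2_norm W f = 1}. l2_inner W f (adj_op (tree_extension d G) f)) \<le> form f"
proof -
  have "- (real (3 * d) + 1) \<le> form f" if "f \<in> S" "l2_norm W f = 1" for f
    using form_bound(3)[of f 1] assms(2) that by (auto simp: l2_def l2_norm_sq)
  then show "bdd_below ((\<lambda>f. l2_inner W f (adj_op (tree_extension d G) f)) ` {f \<in> S. l2_norm W f = 1})"
    by (auto simp: bdd_below_def form_def)
  then show "f \<in> S \<Longrightarrow> l2_norm W f = 1 \<Longrightarrow> (INF f \<in> {f \<in> S. l2_norm W f = 1}. l2_inner W f (adj_op (tree_extension d G) f)) \<le> form f"
    unfolding form_def by (intro cINF_lower) auto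
qed

lemma unit_vector:
  assumes "Real_Vector_Spaces.subspace S" "S \<subseteq> l2 W" "f \<in> S" "f \<noteq> 0"
  shows "(1 / sqrt (sq f)) *\<^sub>R f \<in> S" "l2_norm W ((1 / sqrt (sq f)) *\<^sub>R f) = 1"
    "form ((1 / sqrt (sq f)) *\<^sub>R f) = form f / sq f"
proof -
  have p: "0 < sq f" using sq_pos assms by auto
  show "(1 / sqrt (sq f)) *\<^sub>R f \<in> S" using assms by (intro subspace_scale)
  show "l2_norm W ((1 / sqrt (sq f)) *\<^sub>R f) = 1" "form ((1 / sqrt (sq f)) *\<^sub>R f) = form f / sq f"
    using p by (simp_all add: l2_norm_sq sq_scale form_scale power_divide)
qed

lemma inf_bounded:
  assumes S: "Real_Vector_Spaces.subspace S" "S \<subseteq> l2 W" "f \<in> S" "f \<noteq> 0"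
  shows "(INF f \<in> {f \<in> S. l2_norm W f = 1}. l2_inner W f (adj_op (tree_extension d G) f)) \<le> form f / sq f"
  using eigenvalue_set_bounded(2)[OF S(1,2) unit_vector(1,2)[OF S]] unit_vector(3)[OF S] by simp

lemma exists_nonzero:
  assumes "Real_Vector_Spaces.subspace S" "0 < dim (S :: ('a \<Rightarrow> real) set)"
  shows "\<exists>f\<in>S. f \<noteq> 0"
proof (rule ccontr)
  assume "\<not> ?thesis"
  then have "S \<subseteq> {0}" by auto
  then have "S \<subseteq> span {}" by simp
  then have "dim S \<le> card ({} :: ('a \<Rightarrow> real) set)" by (intro dim_le_card) auto
  then show False using assms by simp
qed

text \<open>One vector per subspace bounds the infimum there. The second assumption keeps the
  real-valued supremum away from the empty set.\<close>

lemma eigenvalue_le: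
  assumes "1 \<le> i" and "\<exists>S. Real_Vector_Spaces.subspace S \<and> dim S = i \<and> S \<subseteq> l2 W"
    and "\<And>S. Real_Vector_Spaces.subspace S \<Longrightarrow> dim S = i \<Longrightarrow> S \<subseteq> l2 W \<Longrightarrow> \<exists>f\<in>S. f \<noteq> 0 \<and> form f \<le> c * sq f"
  shows "graph_eigenvalue i (tree_extension d G) \<le> c"
  unfolding graph_eigenvalue_def
proof (rule cSUP_least)
  show "{S. Real_Vector_Spaces.subspace S \<and> dim S = i \<and> S \<subseteq> l2 W} \<noteq> {}" using assms(2) by blast
  fix S assume "S \<in> {S. Real_Vector_Spaces.subspace S \<and> dim S = i \<and> S \<subseteq> l2 W}"
  then have S: "Real_Vector_Spaces.subspace S" "dim S = i" "S \<subseteq> l2 W" by auto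
  from assms(3)[OF S] obtain f where f: "f \<in> S" "f \<noteq> 0" "form f \<le> c * sq f" by blast
  have "0 < sq f" using sq_pos f S by blast
  then have "form f / sq f \<le> c" using f(3) by (simp add: divide_le_eq)
  then show "(INF f \<in> {f \<in> S. l2_norm W f = 1}. l2_inner W f (adj_op (tree_extension d G) f)) \<le> c"
    using inf_bounded[OF S(1,3) f(1,2)] by simp
qed

lemma eigenvalue1_ge:
  assumes "f \<in> l2 W" "f \<noteq> 0" "c * sq f \<le> form f"
  shows "c \<le> graph_eigenvalue 1 (tree_extension d G)"
proof -
  have p: "0 < sq f" using sq_pos assms by blast
  define S where "S = span {f}"
  have "independent {f}" using assms(2) by (simp add: dependent_single)
  then have S: "Real_Vector_Spaces.subspace S" "dim S = 1" unfolding S_def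
    by (simp_all add: dim_eq_card_independent)
  have Sf: "S = range (\<lambda>c. c *\<^sub>R f)" unfolding S_def by (rule span_singleton)
  have Sl: "S \<subseteq> l2 W"
    unfolding Sf using assms(1)
    by (auto simp: l2_def scaleR_fun_def power_mult_distrib intro!: summable_on_cmult_right)
  have fS: "f \<in> S" unfolding S_def by (intro span_base) simp
  have "c \<le> (INF f \<in> {f \<in> S. l2_norm W f = 1}. l2_inner W f (adj_op (tree_extension d G) f))"
  proof (rule cINF_greatest)
    show "{f \<in> S. l2_norm W f = 1} \<noteq> {}" using unit_vector[OF S(1) Sl fS assms(2)] by blast
    fix g assume "g \<in> {f \<in> S. l2_norm W f = 1}"
    then obtain x where x: "g = x *\<^sub>R f" "sqrt (sq g) = 1" by (auto simp: Sf l2_norm_sq)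
    have "x\<^sup>2 * sq f = 1" using x by (simp add: sq_scale)
    then have "c = c * (x\<^sup>2 * sq f)" by simp
    also have "\<dots> = x\<^sup>2 * (c * sq f)" by simp
    also have "\<dots> \<le> x\<^sup>2 * form f" using assms(3) by (intro mult_left_mono) auto
    finally show "c \<le> l2_inner W g (adj_op (tree_extension d G) g)"
      using x form_scale[of x f] by (simp add: form_def)
  qed
  also have "\<dots> \<le> graph_eigenvalue 1 (tree_extension d G)"
    unfolding graph_eigenvalue_def
  proof (rule cSUP_upper)
    show "S \<in> {S. Real_Vector_Spaces.subspace S \<and> dim S = 1 \<and> S \<subseteq> l2 W}" using S Sl by simp
    show "bdd_above ((\<lambda>S. INF f \<in> {f \<in> S. l2_norm W f = 1}. l2_inner W f (adj_op (tree_extension d G) f))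
        ` {S. Real_Vector_Spaces.subspace S \<and> dim S = 1 \<and> S \<subseteq> l2 W})"
    proof (rule bdd_aboveI2)
      fix S :: "('v \<times> nat list \<Rightarrow> real) set" assume "S \<in> {S. Real_Vector_Spaces.subspace S \<and> dim S = 1 \<and> S \<subseteq> l2 W}"
      then have S: "Real_Vector_Spaces.subspace S" "dim S = 1" "S \<subseteq> l2 W" by auto
      then obtain h where h: "h \<in> S" "h \<noteq> 0" using exists_nonzero[of S] by auto
      have "form h / sq h \<le> real d + 1 + (real d - 1) / (real d + 1)"
        using form_bounded[of h] h S(3) sq_pos[of h] by (auto simp: l2_def divide_le_eq)
      then show "(INF f \<in> {f \<in> S. l2_norm W f = 1}. l2_inner W f (adj_op (tree_extension d G) f))
          \<le> real d + 1 + (real d - 1) / (real d + 1)"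
        using inf_bounded[OF S(1,3) h] by simp
    qed
  qed
  finally show ?thesis .
qed

text \<open>For this function all the squares completed in \<open>form_bound\<close> vanish.\<close>

definition extend :: "real \<Rightarrow> ('v \<Rightarrow> real) \<Rightarrow> 'v \<times> nat list \<Rightarrow> real" where
  "extend t g w = (if w \<in> W then g (fst w) / t ^ length (snd w) else 0)"

lemma extend_parent:
  assumes "w \<in> R" "t \<noteq> 0"
  shows "extend t g w = extend t g (parent w) / t"
proof -
  from R_cases[OF assms(1)] obtain u k where u: "u \<in> W" "k < nch u" "w = child (u, k)" by blast
  then have "w \<in> W" using assms by (auto simp: R_def)
  then show ?thesis using u assms(2) by (simp add: extend_def) (simp add: child_def)
qed

text \<open>Going one level down a tree multiplies the squared mass by
  \<open>(d - 1) / t\<^sup>2\<close>, which is below 1 exactly because \<open>t\<close> exceeds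
  \<open>sqrt (d - 1)\<close>; the masses up to depth \<open>m\<close> are therefore bounded
  uniformly in \<open>m\<close>.\<close>

lemma extend_l2:
  assumes "sqrt (real d - 1) < t"
  shows "extend t g \<in> l2 W"
proof -
  let ?e = "\<lambda>w. (extend t g w)\<^sup>2"
  have t: "0 < t" using assms dd_gt by (smt (verit) real_sqrt_ge_zero)
  have "real d - 1 < t\<^sup>2"
    using assms dd_gt t by (smt (verit) real_sqrt_le_iff real_sqrt_unique)
  then have q: "(real d - 1) / t\<^sup>2 < 1" using t by (simp add: divide_less_eq)
  define q where "q = (real d - 1) / t\<^sup>2"
  have q01: "0 \<le> q" "q < 1" using q dd_gt by (auto simp: q_def)
  define s0 where "s0 = (\<Sum>w\<in>roots. ?e w)"
  have s0: "0 \<le> s0" by (auto simp: s0_def intro: sum_nonneg)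
  \<comment> \<open>The fixed point of the recursion that bounds the mass up to depth
    \<open>m + 1\<close> by that up to depth \<open>m\<close>. Vertices of the finite graph may have
    up to \<open>d\<close> children instead of \<open>d - 1\<close>, whence the separate
    term.\<close>
  define B where "B = (s0 + real d / t\<^sup>2 * s0) / (1 - q)"
  define Wm where "Wm m = {w \<in> W. length (snd w) \<le> m}" for m
  have B: "s0 + real d / t\<^sup>2 * s0 + q * B = B" 
  proof -
    have "B * (1 - q) = s0 + real d / t\<^sup>2 * s0" using q01 by (simp add: B_def)
    then show ?thesis by (simp add: algebra_simps)
  qed
  have W0: "Wm 0 = roots" by (auto simp: Wm_def roots_def in_W)
  have fin: "finite (Wm m) \<and> sum ?e (Wm m) \<le> B" for m
  proof (induction m)
    case 0
    have "s0 \<le> B"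
    proof -
      have "s0 * (1 - q) \<le> s0 * 1" using s0 q01 by (intro mult_left_mono) auto
      also have "\<dots> \<le> s0 + real d / t\<^sup>2 * s0" using s0 by simp
      finally show ?thesis unfolding B_def using q01 by (simp add: le_divide_eq)
    qed
    then show ?case unfolding W0 using finite_roots by (simp add: s0_def)
  next
    case (Suc m)
    then have fm: "finite (Wm m)" and sm: "sum ?e (Wm m) \<le> B" by auto
    let ?S = "Sigma (Wm m) (\<lambda>u. {..<nch u})"
    have sub: "Wm (Suc m) = roots \<union> child ` ?S"
    proof (intro equalityI subsetI)
      fix w assume w: "w \<in> Wm (Suc m)"
      show "w \<in> roots \<union> child ` ?S"
      proof (cases "w \<in> roots")
        case False
        then have "w \<in> R" using w W_split by (auto simp: Wm_def)
        from R_cases[OF this] obtain u k where u: "u \<in> W" "k < nch u" "w = child (u, k)" by blast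
        then have "u \<in> Wm m" using w by (auto simp: Wm_def child_def)
        then show ?thesis using u by auto
      qed simp
    next
      fix w assume "w \<in> roots \<union> child ` ?S"
      then consider "w \<in> roots" | u k where "u \<in> Wm m" "k < nch u" "w = child (u, k)" by auto
      then show "w \<in> Wm (Suc m)"
      proof cases
        case 1
        then show ?thesis by (auto simp: Wm_def roots_def in_W)
      next
        case 2
        then have "w \<in> R" using child_in_R by (auto simp: Wm_def)
        then show ?thesis using 2 by (auto simp: Wm_def R_def child_def)
      qed
    qed
    have inj: "inj_on child ?S" by (auto simp: inj_on_def child_def prod_eq_iff)
    have finS: "finite ?S" using fm by auto
    have "sum ?e (Wm (Suc m)) = s0 + sum ?e (child ` ?S)"
      unfolding sub s0_def using finite_roots finS child_nonroot
      by (intro sum.union_disjoint) (auto simp: roots_def child_def)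
    also have "sum ?e (child ` ?S) = (\<Sum>x\<in>?S. ?e (child x))" by (rule sum.reindex[OF inj, unfolded o_def])
    also have "\<dots> = (\<Sum>u\<in>Wm m. \<Sum>k<nch u. ?e (child (u, k)))" using fm by (subst sum.Sigma) auto
    also have "\<dots> = (\<Sum>u\<in>Wm m. real (nch u) * (?e u / t\<^sup>2))"
    proof (intro sum.cong refl)
      fix u assume u: "u \<in> Wm m"
      have "?e (child (u, k)) = ?e u / t\<^sup>2" if "k < nch u" for k
        using extend_parent[of "child (u, k)" t g] child_in_R[of u k] u that t by (simp add: Wm_def power_divide)
      then show "(\<Sum>k<nch u. ?e (child (u, k))) = real (nch u) * (?e u / t\<^sup>2)" by simp
    qed
    also have "\<dots> \<le> (\<Sum>u\<in>Wm m. (if u \<in> roots then real d / t\<^sup>2 * ?e u else 0) + q * ?e u)"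
    proof (intro sum_mono)
      fix u assume u: "u \<in> Wm m"
      show "real (nch u) * (?e u / t\<^sup>2) \<le> (if u \<in> roots then real d / t\<^sup>2 * ?e u else 0) + q * ?e u"
      proof (cases "u \<in> roots")
        case True
        have "real (nch u) * (?e u / t\<^sup>2) \<le> real d * (?e u / t\<^sup>2)"
          using nch_le[of u] by (intro mult_right_mono) auto
        then show ?thesis using True q01 by (simp add: add_increasing2)
      next
        case False
        then have "snd u \<noteq> []" using u by (cases u) (auto simp: Wm_def roots_def in_W)
        then have "real (nch u) = real d - 1" using dd_gt by (simp add: nch_def of_nat_diff)
        then show ?thesis using False by (simp add: q_def)
      qed
    qed
    also have "\<dots> = (\<Sum>u\<in>Wm m. if u \<in> roots then real d / t\<^sup>2 * ?e u else 0) + q * sum ?e (Wm m)"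
      by (simp add: sum.distrib sum_distrib_left)
    also have "(\<Sum>u\<in>Wm m. if u \<in> roots then real d / t\<^sup>2 * ?e u else 0) = (\<Sum>u\<in>roots. real d / t\<^sup>2 * ?e u)"
      using fm by (intro sum.mono_neutral_cong_right) (auto simp: Wm_def roots_def in_W)
    also have "\<dots> = real d / t\<^sup>2 * s0" by (simp add: s0_def sum_distrib_left)
    finally have "sum ?e (Wm (Suc m)) \<le> s0 + (real d / t\<^sup>2 * s0 + q * sum ?e (Wm m))" by simp
    also have "\<dots> \<le> s0 + (real d / t\<^sup>2 * s0 + q * B)" using sm q01 by (intro add_left_mono mult_left_mono)
    also have "\<dots> = B" using B by simp
    finally have "sum ?e (Wm (Suc m)) \<le> B" .
    moreover have "finite (Wm (Suc m))" unfolding sub using finite_roots finS by simp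
    ultimately show ?case by simp
  qed
  have "?e summable_on W"
  proof (rule nonneg_bdd_above_summable_on)
    show "bdd_above (sum ?e ` {F. F \<subseteq> W \<and> finite F})"
    proof (rule bdd_aboveI2)
      fix F assume "F \<in> {F. F \<subseteq> W \<and> finite F}"
      then have F: "F \<subseteq> W" "finite F" by auto
      define m where "m = Max (insert 0 ((\<lambda>w. length (snd w)) ` F))"
      have "F \<subseteq> Wm m" using F by (auto simp: Wm_def m_def intro!: Max_ge)
      then have "sum ?e F \<le> sum ?e (Wm m)" using fin[of m] by (intro sum_mono2) auto
      then show "sum ?e F \<le> B" using fin[of m] by simp
    qed
  qed simp
  then show ?thesis by (auto simp: l2_def extend_def)
qed

text \<open>The decaying extension \<open>extend t g\<close> is the test vector: it attains equality
  in \<open>form_bound\<close>, so the sign of the finite form decides.\<close>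

lemma eigenvalue1_lower:
  assumes t: "sqrt (real d - 1) < t" and g: "\<exists>v\<in>verts G. g v \<noteq> 0" "Q t g g \<le> 0"
  shows "t + (real d - 1) / t \<le> graph_eigenvalue 1 (tree_extension d G)"
proof (rule eigenvalue1_ge)
  have t0: "0 < t" using assms dd_gt by (smt (verit) real_sqrt_ge_zero)
  show l: "extend t g \<in> l2 W" by (rule extend_l2[OF t])
  have ex: "extend t g (v, []) = g v" if "v \<in> verts G" for v using that by (simp add: extend_def in_W)
  show "extend t g \<noteq> 0" 
  proof
    assume z: "extend t g = 0"
    from g(1) obtain v where v: "v \<in> verts G" "g v \<noteq> 0" by blast
    have "g v = extend t g (v, [])" using ex[OF v(1)] by (rule sym)
    also have "\<dots> = 0" unfolding z by simp
    finally show False using v(2) by simp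
  qed
  have "Q t (\<lambda>v. extend t g (v, [])) (\<lambda>v. extend t g (v, [])) / t
      = (t + (real d - 1) / t) * sq (extend t g) - form (extend t g)"
    using form_bound(2)[of "extend t g" t] l t0 extend_parent[of _ t g] by (auto simp: l2_def)
  moreover have "Q t (\<lambda>v. extend t g (v, [])) (\<lambda>v. extend t g (v, [])) = Q t g g"
    using ex by (intro Q_cong) auto
  moreover have "Q t g g / t \<le> 0" using g(2) t0 by (simp add: divide_nonpos_pos)
  ultimately show "(t + (real d - 1) / t) * sq (extend t g) \<le> form (extend t g)" by simp
qed

lemma eigenvalue1_upper:
  assumes t: "sqrt (real d - 1) < t" and V: "verts G \<noteq> {}"
    and nonneg: "\<And>g. 0 \<le> Q t g g"
  shows "graph_eigenvalue 1 (tree_extension d G) \<le> t + (real d - 1) / t"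
proof (rule eigenvalue_le)
  have t0: "0 < t" using assms dd_gt by (smt (verit) real_sqrt_ge_zero)
  show "\<exists>f\<in>S. f \<noteq> 0 \<and> form f \<le> (t + (real d - 1) / t) * sq f"
    if S: "Real_Vector_Spaces.subspace S" "dim S = 1" "S \<subseteq> l2 W" for S
  proof -
    obtain f where f: "f \<in> S" "f \<noteq> 0" using exists_nonzero[of S] S by auto
    have "0 \<le> Q t (\<lambda>v. f (v, [])) (\<lambda>v. f (v, [])) / t" using nonneg t0 by simp
    then show ?thesis using f form_bound(1)[of f t] S(3) t0 by (intro bexI[of _ f]) (auto simp: l2_def)
  qed
  obtain v where v: "v \<in> verts G" using V by blast
  let ?f = "\<lambda>w :: 'v \<times> nat list. if w = (v, []) then 1 else 0 :: real"
  have nz: "?f \<noteq> 0" by (auto simp: fun_eq_iff)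
  have "span {?f} \<subseteq> l2 W"
    unfolding span_singleton using v
    by (auto simp: l2_def scaleR_fun_def in_W intro!: finite_nonzero_values_imp_summable_on)
  moreover have "dim (span {?f}) = 1"
  proof -
    have "independent {?f}" using nz by (simp add: dependent_single)
    then show ?thesis by (simp add: dim_eq_card_independent)
  qed
  ultimately show "\<exists>S. Real_Vector_Spaces.subspace S \<and> dim S = 1 \<and> S \<subseteq> l2 W" by (intro exI[of _ "span {?f}"]) auto
qed simp

text \<open>A plane in \<open>l2 W\<close> is restricted to the finite graph. The restrictions of
  two independent vectors may be dependent or zero, which is why the assumption speaks of nontrivial
  coefficients \<open>x\<close>, \<open>y\<close> for arbitrary \<open>f\<close>, \<open>g\<close>
  and not of a nonzero combination.\<close>

lemma eigenvalue2_upper: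
  assumes t: "sqrt (real d - 1) < t" and V: "v \<in> verts G" "v' \<in> verts G" "v \<noteq> v'"
    and nonneg: "\<And>f g. \<exists>x y. (x \<noteq> 0 \<or> y \<noteq> 0) \<and> 0 \<le> Q t (\<lambda>v. x * f v + y * g v) (\<lambda>v. x * f v + y * g v)"
  shows "graph_eigenvalue 2 (tree_extension d G) \<le> t + (real d - 1) / t"
proof (rule eigenvalue_le)
  have t0: "0 < t" using assms dd_gt by (smt (verit) real_sqrt_ge_zero)
  show "\<exists>f\<in>S. f \<noteq> 0 \<and> form f \<le> (t + (real d - 1) / t) * sq f"
    if S: "Real_Vector_Spaces.subspace S" "dim S = 2" "S \<subseteq> l2 W" for S
  proof -
    obtain B where B: "B \<subseteq> S" "independent B" "S \<subseteq> span B" "card B = dim S"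
      using basis_exists[of S] by blast
    then obtain f g where fg: "B = {f, g}" "f \<noteq> g" using S(2) by (auto simp: card_2_iff)
    obtain x y where xy: "x \<noteq> 0 \<or> y \<noteq> 0"
      "0 \<le> Q t (\<lambda>v. x * f (v, []) + y * g (v, [])) (\<lambda>v. x * f (v, []) + y * g (v, []))"
      using nonneg[of "\<lambda>v. f (v, [])" "\<lambda>v. g (v, [])"] by blast
    define h where "h = x *\<^sub>R f + y *\<^sub>R g"
    have hS: "h \<in> S" unfolding h_def using B(1) fg S(1) by (intro subspace_add subspace_scale) auto
    have "h \<noteq> 0"
    proof
      assume h0: "h = 0"
      have ind: "f \<notin> span {g}" "g \<noteq> 0"
        using B(2) fg unfolding fg(1) by (auto simp only: independent_insert dependent_single split: if_splits)
      show False
      proof (cases "x = 0")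
        case True
        then show False using h0 xy(1) ind(2) by (simp add: h_def)
      next
        case False
        have "x *\<^sub>R f = (- y) *\<^sub>R g" using h0 by (simp add: h_def add_eq_0_iff2)
        then have "(1 / x) *\<^sub>R (x *\<^sub>R f) = (1 / x) *\<^sub>R ((- y) *\<^sub>R g)" by (rule arg_cong)
        then have "f = (- y / x) *\<^sub>R g" using False by simp
        then show False using ind(1) unfolding span_singleton by blast
      qed
    qed
    moreover have "0 \<le> Q t (\<lambda>v. h (v, [])) (\<lambda>v. h (v, [])) / t"
      using xy(2) t0 by (simp add: h_def scaleR_fun_def)
    ultimately show ?thesis using hS form_bound(1)[of h t] S(3) t0 by (intro bexI[of _ h]) (auto simp: l2_def)
  qed
  let ?f = "\<lambda>v. \<lambda>w :: 'v \<times> nat list. if w = (v, []) then 1 else 0 :: real"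
  have ne: "?f v \<noteq> ?f v'" using V(3) by (auto simp: fun_eq_iff)
  have "independent {?f v, ?f v'}"
  proof -
    have "?f v \<notin> span {?f v'}"
    proof
      assume "?f v \<in> span {?f v'}"
      then obtain c where "?f v = c *\<^sub>R ?f v'" unfolding span_singleton by auto
      then have "?f v (v, []) = (c *\<^sub>R ?f v') (v, [])" by (rule arg_cong[where f = "\<lambda>h. h (v, [])"])
      then show False using V(3) by (simp add: scaleR_fun_def)
    qed
    moreover have "?f v' \<noteq> 0" by (auto simp: fun_eq_iff)
    ultimately show ?thesis using ne by (simp add: independent_insert)
  qed
  from dim_span_eq_card_independent[OF this] have "dim (span {?f v, ?f v'}) = 2"
    using ne by (simp only: card_2_iff) blast
  moreover have "span {?f v, ?f v'} \<subseteq> l2 W"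
  proof
    fix h assume "h \<in> span {?f v, ?f v'}"
    then obtain x where "h - x *\<^sub>R ?f v \<in> span {?f v'}" unfolding span_insert by blast
    then obtain y where "h - x *\<^sub>R ?f v = y *\<^sub>R ?f v'" unfolding span_singleton by blast
    then have "h = x *\<^sub>R ?f v + y *\<^sub>R ?f v'" by (metis add.commute diff_add_cancel)
    then have "\<forall>w. w \<notin> {(v, []), (v', [])} \<longrightarrow> h w = 0" by (auto simp: scaleR_fun_def)
    moreover have "{(v, []), (v', [])} \<subseteq> W" using V by (auto simp: in_W)
    moreover have "finite {w \<in> W. (h w)\<^sup>2 \<noteq> 0}"
      by (rule finite_subset[of _ "{(v, []), (v', [])}"]) (use calculation(1) in force)+
    ultimately have "\<forall>w. w \<notin> W \<longrightarrow> h w = 0" "finite {w \<in> W. (h w)\<^sup>2 \<noteq> 0}" by blast+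
    then show "h \<in> l2 W" by (auto simp: l2_def intro!: finite_nonzero_values_imp_summable_on)
  qed
  ultimately show "\<exists>S. Real_Vector_Spaces.subspace S \<and> dim S = 2 \<and> S \<subseteq> l2 W"
    by (intro exI[of _ "span {?f v, ?f v'}"]) auto
qed simp

end

section \<open>The nonbacktracking operator\<close>

definition partial_matching :: "'a set \<Rightarrow> 'a set set \<Rightarrow> bool" where
  "partial_matching X E \<longleftrightarrow> (\<forall>e\<in>E. e \<subseteq> X \<and> card e = 2) \<and> pairwise disjnt E"

lemma partial_matching_subset:
  assumes "partial_matching X E" "F \<subseteq> E"
  shows "partial_matching X F"
proof -
  have "pairwise disjnt F"
    using assms unfolding partial_matching_def by (intro pairwise_subset[of disjnt E F]) auto
  then show ?thesis using assms unfolding partial_matching_def by auto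
qed

lemma partial_matching_finite:
  assumes "partial_matching X E" "finite X"
  shows "finite E"
proof (rule finite_subset)
  show "E \<subseteq> Pow X" using assms unfolding partial_matching_def by auto
  show "finite (Pow X)" using assms by simp
qed

lemma partial_matching_unique:
  assumes "partial_matching X E" "{x, y} \<in> E" "{x, y'} \<in> E"
  shows "y = y'"
proof -
  have "pairwise disjnt E" using assms(1) by (simp add: partial_matching_def)
  then have "{x, y} \<noteq> {x, y'} \<Longrightarrow> disjnt {x, y} {x, y'}"
    using assms(2,3) by (rule pairwiseD)
  then have "{x, y} = {x, y'}" by (auto simp: disjnt_def)
  moreover have "card {x, y} = 2" using assms(1,2) by (simp add: partial_matching_def)
  ultimately show ?thesis by (auto simp: doubleton_eq_iff)
qed

lemma partial_matching_edge:
  assumes "partial_matching X E" "{x, y} \<in> E"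
  shows "x \<noteq> y" "x \<in> X" "y \<in> X" "{y, x} \<in> E"
proof -
  have "{x, y} \<subseteq> X \<and> card {x, y} = 2"
    by (rule bspec[OF _ assms(2)]) (use assms(1) in \<open>simp add: partial_matching_def\<close>)
  then show "x \<noteq> y" "x \<in> X" "y \<in> X" by (auto simp: card_insert_if)
  show "{y, x} \<in> E" using assms(2) by (simp add: insert_commute)
qed

lemma partial_matching_obtain:
  assumes "partial_matching X E" "x \<in> \<Union>E"
  obtains y where "{x, y} \<in> E"
proof -
  from assms(2) obtain e where e: "e \<in> E" "x \<in> e" by blast
  then have "card e = 2" using assms(1) by (simp add: partial_matching_def)
  then obtain a b where "e = {a, b}" by (auto simp: card_2_iff)
  then show ?thesis using e that by (auto simp: insert_commute)
qed

definition mate :: "'a set set \<Rightarrow> 'a \<Rightarrow> 'a" where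
  "mate E x = (THE y. {x, y} \<in> E)"

lemma mate_eq: "partial_matching X E \<Longrightarrow> {x, y} \<in> E \<Longrightarrow> mate E x = y"
  unfolding mate_def by (rule the_equality) (auto dest: partial_matching_unique)

lemma mate_edge:
  assumes "partial_matching X E" "x \<in> \<Union>E"
  shows "{x, mate E x} \<in> E"
proof -
  obtain y where y: "{x, y} \<in> E" using partial_matching_obtain[OF assms] .
  then show ?thesis using mate_eq[OF assms(1) y] by simp
qed

lemma mate_mate:
  assumes "partial_matching X E" "x \<in> \<Union>E"
  shows "mate E (mate E x) = x"
  using mate_edge[OF assms] by (intro mate_eq[OF assms(1)]) (simp add: insert_commute)

type_synonym half = "nat \<times> nat"
type_synonym step = "half \<times> half"

definition step_edge :: "step \<Rightarrow> half set" where "step_edge s = {fst s, snd s}"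

text \<open>A step \<open>(x, y)\<close> traverses the edge \<open>{x, y}\<close> from \<open>x\<close> to \<open>y\<close>; a nonbacktracking walk may
  continue with any other half-edge at the vertex of \<open>y\<close>.\<close>

definition follows :: "step \<Rightarrow> half \<Rightarrow> bool" where
  "follows s x \<longleftrightarrow> fst (snd s) = fst x \<and> snd s \<noteq> x"

fun start :: "step list \<Rightarrow> half \<Rightarrow> half" where
  "start [] z = z"
| "start (s # \<gamma>) z = fst s"

text \<open>The half-edge \<open>z\<close> is the one by which the walk is to be continued, so the
  condition on the last step already forbids backtracking into what follows.\<close>

fun nb_walk :: "half set set \<Rightarrow> step list \<Rightarrow> half \<Rightarrow> bool" where
  "nb_walk E [] z \<longleftrightarrow> True"
| "nb_walk E (s # \<gamma>) z \<longleftrightarrow> step_edge s \<in> E \<and> follows s (start \<gamma> z) \<and> nb_walk E \<gamma> z"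

text \<open>Continuing with its own first half-edge means that the walk does not backtrack at the
  closing point either; this is what the trace of a power of \<open>B\<close> counts.\<close>

definition closed_walks :: "half set set \<Rightarrow> nat \<Rightarrow> step list set" where
  "closed_walks E k = {\<gamma>. length \<gamma> = k \<and> \<gamma> \<noteq> [] \<and> nb_walk E \<gamma> (fst (hd \<gamma>))}"

lemma start_hd: "\<gamma> \<noteq> [] \<Longrightarrow> start \<gamma> z = fst (hd \<gamma>)"
  by (cases \<gamma>) auto

lemma nb_walk_edges: "nb_walk E \<gamma> z \<Longrightarrow> step_edge ` set \<gamma> \<subseteq> E"
  by (induction \<gamma>) auto

lemma nb_walk_mono: "nb_walk E \<gamma> z \<Longrightarrow> step_edge ` set \<gamma> \<subseteq> F \<Longrightarrow> nb_walk F \<gamma> z"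
  by (induction \<gamma>) auto

locale half_edge_graph =
  fixes N d :: nat and E :: "half set set"
  assumes pm: "partial_matching (half_edges N d) E" and d3: "3 \<le> d"
begin

abbreviation "H \<equiv> half_edges N d"
abbreviation "G \<equiv> paired_multigraph N E"

text \<open>A half-edge stands for the directed edge that leaves through it. Unmatched half-edges
  stay in the index set with zero rows, so the dimension is \<open>N * d\<close> for every
  \<open>E\<close>.\<close>

definition B :: "half \<Rightarrow> half \<Rightarrow> complex" where
  "B x x' = (if x \<in> \<Union>E \<and> follows (x, mate E x) x' then 1 else 0)"

lemma finH: "finite H" by (simp add: half_edges_def)

lemma finE: "finite E" using partial_matching_finite[OF pm finH] .

lemma UE: "\<Union>E \<subseteq> H" using pm by (auto simp: partial_matching_def)

lemma finite_walks: "finite {\<gamma>. length \<gamma> = k \<and> nb_walk E \<gamma> z}"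
proof (rule finite_subset)
  show "{\<gamma>. length \<gamma> = k \<and> nb_walk E \<gamma> z} \<subseteq> {\<gamma>. set \<gamma> \<subseteq> H \<times> H \<and> length \<gamma> = k}"
  proof
    fix \<gamma> assume "\<gamma> \<in> {\<gamma>. length \<gamma> = k \<and> nb_walk E \<gamma> z}"
    then have "length \<gamma> = k" "step_edge ` set \<gamma> \<subseteq> E" using nb_walk_edges[of E \<gamma> z] by blast+
    moreover have "s \<in> H \<times> H" if "step_edge s \<in> E" for s
      using partial_matching_edge[OF pm] that by (cases s) (auto simp: step_edge_def)
    ultimately show "\<gamma> \<in> {\<gamma>. set \<gamma> \<subseteq> H \<times> H \<and> length \<gamma> = k}" by blast
  qed
  show "finite {\<gamma>. set \<gamma> \<subseteq> H \<times> H \<and> length \<gamma> = k}"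
    using finite_lists_length_eq[of "H \<times> H" k] finH by simp
qed

lemma start_in_H: "nb_walk E \<gamma> z \<Longrightarrow> z \<in> H \<Longrightarrow> start \<gamma> z \<in> H"
  using partial_matching_edge[OF pm] by (cases \<gamma>) (auto simp: step_edge_def)

lemma walk_sum_card:
  assumes "z \<in> H" "x \<in> H"
  shows "walk_sum H B k x z = of_nat (card {\<gamma>. length \<gamma> = k \<and> nb_walk E \<gamma> z \<and> start \<gamma> z = x})"
  using assms(2)
proof (induction k arbitrary: x)
  case 0
  have "{\<gamma>. length \<gamma> = 0 \<and> nb_walk E \<gamma> z \<and> start \<gamma> z = x} = (if x = z then {[]} else {})" by auto
  then show ?case by simp
next
  case (Suc k)
  define S where "S x = {\<gamma>. length \<gamma> = k \<and> nb_walk E \<gamma> z \<and> start \<gamma> z = x}" for x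
  have fS: "finite (S x)" for x unfolding S_def by (rule finite_subset[OF _ finite_walks[of k z]]) auto
  show ?case
  proof (cases "x \<in> \<Union>E")
    case False
    then have "\<not> step_edge s \<in> E" if "fst s = x" for s using that by (auto simp: step_edge_def)
    then have e: "{\<gamma>. length \<gamma> = Suc k \<and> nb_walk E \<gamma> z \<and> start \<gamma> z = x} = {}"
      by (auto simp: length_Suc_conv)
    have "walk_sum H B (Suc k) x z = 0" using False by (simp add: B_def)
    then show ?thesis unfolding e by simp
  next
    case True
    let ?s = "(x, mate E x)"
    define X where "X = {x' \<in> H. follows ?s x'}"
    have "{\<gamma>. length \<gamma> = Suc k \<and> nb_walk E \<gamma> z \<and> start \<gamma> z = x} = (\<lambda>\<gamma>. ?s # \<gamma>) ` (\<Union>x'\<in>X. S x')"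
    proof (intro equalityI subsetI)
      fix \<gamma> assume g: "\<gamma> \<in> {\<gamma>. length \<gamma> = Suc k \<and> nb_walk E \<gamma> z \<and> start \<gamma> z = x}"
      then obtain s \<gamma>' where s: "\<gamma> = s # \<gamma>'" by (auto simp: length_Suc_conv)
      have "{x, snd s} \<in> E" "fst s = x" using g s by (auto simp: step_edge_def)
      then have "s = ?s" using mate_eq[OF pm, of x "snd s"] by (simp add: prod_eq_iff)
      then show "\<gamma> \<in> (\<lambda>\<gamma>. ?s # \<gamma>) ` (\<Union>x'\<in>X. S x')"
        using g s start_in_H[of \<gamma>' z] assms(1) by (auto simp: X_def S_def)
    next
      fix \<gamma> assume "\<gamma> \<in> (\<lambda>\<gamma>. ?s # \<gamma>) ` (\<Union>x'\<in>X. S x')"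
      then show "\<gamma> \<in> {\<gamma>. length \<gamma> = Suc k \<and> nb_walk E \<gamma> z \<and> start \<gamma> z = x}"
        using mate_edge[OF pm True] by (auto simp: X_def S_def step_edge_def)
    qed
    then have "card {\<gamma>. length \<gamma> = Suc k \<and> nb_walk E \<gamma> z \<and> start \<gamma> z = x} = card (\<Union>x'\<in>X. S x')"
      by (simp add: card_image)
    also have "\<dots> = (\<Sum>x'\<in>X. card (S x'))"
      using fS finH by (intro card_UN_disjoint) (auto simp: X_def S_def)
    finally have c: "card {\<gamma>. length \<gamma> = Suc k \<and> nb_walk E \<gamma> z \<and> start \<gamma> z = x} = (\<Sum>x'\<in>X. card (S x'))" .
    have "walk_sum H B (Suc k) x z = (\<Sum>x'\<in>H. B x x' * of_nat (card (S x')))"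
      using Suc.IH by (simp add: S_def)
    also have "\<dots> = (\<Sum>x'\<in>X. of_nat (card (S x')))"
      using finH True unfolding X_def by (intro sum.mono_neutral_cong_right) (auto simp: B_def)
    finally show ?thesis unfolding c by simp
  qed
qed

lemma trace_closed_walks:
  assumes "0 < k"
  shows "(\<Sum>x\<in>H. walk_sum H B k x x) = of_nat (card (closed_walks E k))"
proof -
  define S where "S x = {\<gamma>. length \<gamma> = k \<and> nb_walk E \<gamma> x \<and> start \<gamma> x = x}" for x
  have "closed_walks E k = (\<Union>x\<in>H. S x)"
  proof (intro equalityI subsetI)
    fix \<gamma> assume g: "\<gamma> \<in> closed_walks E k"
    then have "step_edge (hd \<gamma>) \<in> E" using nb_walk_edges[of E \<gamma> "fst (hd \<gamma>)"] by (auto simp: closed_walks_def)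
    then have "fst (hd \<gamma>) \<in> H" using partial_matching_edge[OF pm] by (auto simp: step_edge_def)
    then show "\<gamma> \<in> (\<Union>x\<in>H. S x)" using g by (auto simp: closed_walks_def S_def start_hd)
  next
    fix \<gamma> assume "\<gamma> \<in> (\<Union>x\<in>H. S x)"
    then show "\<gamma> \<in> closed_walks E k" using assms by (cases \<gamma>) (auto simp: closed_walks_def S_def)
  qed
  moreover have "card (\<Union>x\<in>H. S x) = (\<Sum>x\<in>H. card (S x))"
  proof (rule card_UN_disjoint[OF finH])
    show "\<forall>x\<in>H. finite (S x)"
    proof
      fix x
      show "finite (S x)"
        unfolding S_def by (rule finite_subset[OF _ finite_walks[of k x]]) auto
    qed
    show "\<forall>x\<in>H. \<forall>y\<in>H. x \<noteq> y \<longrightarrow> S x \<inter> S y = {}"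
    proof (intro ballI impI)
      fix x y :: half assume "x \<noteq> y"
      then show "S x \<inter> S y = {}" using assms by (auto simp: S_def start_hd)
    qed
  qed
  ultimately show ?thesis by (simp add: walk_sum_card S_def)
qed

lemma mem_verts: "v \<in> verts G \<longleftrightarrow> v < N" by (simp add: paired_multigraph_def)

lemma finite_verts: "finite (verts G)" by (simp add: paired_multigraph_def)

lemma adjacency_sum:
  fixes g :: "nat \<Rightarrow> 'b::real_algebra_1"
  assumes "u \<in> verts G"
  shows "(\<Sum>v\<in>verts G. of_nat (edge_mult G u v) * g v) = (\<Sum>x\<in>{x \<in> \<Union>E. fst x = u}. g (fst (mate E x)))"
proof -
  define S where "S v = {x \<in> \<Union>E. fst x = u \<and> fst (mate E x) = v}" for v
  have finU: "finite (\<Union>E)" using UE finH by (rule finite_subset)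
  have mN: "fst (mate E x) \<in> verts G" if "x \<in> \<Union>E" for x
    using mate_edge[OF pm that] partial_matching_edge(3)[OF pm, of x "mate E x"] by (auto simp: half_edges_def mem_verts)
  have "edge_mult G u v = card (S v)" for v
  proof -
    have "bij_betw (\<lambda>(j, k). (u, j)) {(j, k). {(u, j), (v, k)} \<in> E} (S v)"
    proof (rule bij_betwI')
      fix p q assume pq: "p \<in> {(j, k). {(u, j), (v, k)} \<in> E}" "q \<in> {(j, k). {(u, j), (v, k)} \<in> E}"
      obtain j k where p: "p = (j, k)" by (cases p)
      obtain j' k' where q: "q = (j', k')" by (cases q)
      show "((case p of (j, k) \<Rightarrow> (u, j)) = (case q of (j, k) \<Rightarrow> (u, j))) = (p = q)"
      proof
        assume "(case p of (j, k) \<Rightarrow> (u, j)) = (case q of (j, k) \<Rightarrow> (u, j))"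
        then have "j = j'" using p q by simp
        then show "p = q" using partial_matching_unique[OF pm, of "(u, j)" "(v, k)" "(v, k')"] pq p q by simp
      qed simp
    next
      fix p assume "p \<in> {(j, k). {(u, j), (v, k)} \<in> E}"
      then show "(case p of (j, k) \<Rightarrow> (u, j)) \<in> S v"
        using mate_eq[OF pm] by (auto simp: S_def)
    next
      fix x assume x: "x \<in> S v"
      then have "{x, mate E x} \<in> E" using mate_edge[OF pm] by (auto simp: S_def)
      then have "{(u, snd x), (v, snd (mate E x))} \<in> E" using x by (auto simp: S_def)
      then show "\<exists>p\<in>{(j, k). {(u, j), (v, k)} \<in> E}. x = (case p of (j, k) \<Rightarrow> (u, j))"
        using x by (intro bexI[of _ "(snd x, snd (mate E x))"]) (auto simp: S_def)
    qed
    then show ?thesis using bij_betw_same_card by (fastforce simp: paired_multigraph_def)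
  qed
  then have "(\<Sum>v\<in>verts G. of_nat (edge_mult G u v) * g v) = (\<Sum>v\<in>verts G. \<Sum>x\<in>S v. g (fst (mate E x)))"
    by (intro sum.cong refl) (simp add: S_def)
  also have "\<dots> = (\<Sum>x\<in>(\<Union>v\<in>verts G. S v). g (fst (mate E x)))"
  proof (rule sum.UNION_disjoint[symmetric])
    show "\<forall>v\<in>verts G. finite (S v)"
      unfolding S_def by (intro ballI finite_subset[OF _ finU]) blast
  qed (auto simp: S_def finite_verts)
  also have "(\<Union>v\<in>verts G. S v) = {x \<in> \<Union>E. fst x = u}" using mN by (auto simp: S_def)
  finally show ?thesis .
qed

lemma card_half_edges_at: "card {x \<in> H. fst x = u} \<le> d"
proof -
  have "{x \<in> H. fst x = u} \<subseteq> Pair u ` {..<d}" by (auto simp: half_edges_def mem_verts)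
  then have "card {x \<in> H. fst x = u} \<le> card (Pair u ` {..<d})" by (intro card_mono) auto
  also have "\<dots> \<le> d" using card_image_le[of "{..<d}" "Pair u"] by simp
  finally show ?thesis .
qed

lemma edge_mult_sym: "edge_mult G u v = edge_mult G v u"
proof -
  have "{(j, k). {(u, j), (v, k)} \<in> E} = prod.swap ` {(j, k). {(v, j), (u, k)} \<in> E}"
    by (auto simp: image_iff insert_commute)
  moreover have "card (prod.swap ` {(j, k). {(v, j), (u, k)} \<in> E}) = card {(j, k). {(v, j), (u, k)} \<in> E}"
    by (rule card_image) (rule inj_on_subset[OF inj_swap subset_UNIV])
  ultimately show ?thesis by (simp add: paired_multigraph_def)
qed

lemma covered_at_le: "real (card {x \<in> \<Union>E. fst x = u}) \<le> real d"
proof -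
  have "card {x \<in> \<Union>E. fst x = u} \<le> card {x \<in> H. fst x = u}"
    using UE finH by (intro card_mono) auto
  then show ?thesis using card_half_edges_at[of u] by simp
qed

sublocale tree_extended G d
proof unfold_locales
  show "finite (verts G)" by (rule finite_verts)
  show "real (edge_mult G u v) = real (edge_mult G v u)" for u v using edge_mult_sym by simp
  show "(\<Sum>v\<in>verts G. real (edge_mult G u v)) \<le> real d" if "u \<in> verts G" for u
    using adjacency_sum[of u "\<lambda>_. 1 :: real"] covered_at_le[of u] that by simp
  show "2 < real d" using d3 by simp
qed simp

lemma dg_card: "u \<in> verts G \<Longrightarrow> dg u = real (card {x \<in> \<Union>E. fst x = u})"
  unfolding dg_def using adjacency_sum[of u "\<lambda>_. 1 :: real"] by simp

lemma B_apply:
  assumes "x \<in> \<Union>E" "\<And>x. x \<in> H - \<Union>E \<Longrightarrow> b x = 0"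
  shows "(\<Sum>x'\<in>H. B x x' * b x') = (\<Sum>x'\<in>{x' \<in> \<Union>E. fst x' = fst (mate E x)}. b x') - b (mate E x)"
proof -
  let ?y = "mate E x"
  let ?S = "{x' \<in> \<Union>E. fst x' = fst ?y}"
  have finU: "finite (\<Union>E)" using UE finH by (rule finite_subset)
  have y: "?y \<in> ?S" using mate_edge[OF pm assms(1)] by auto
  have "(\<Sum>x'\<in>H. B x x' * b x') = (\<Sum>x'\<in>?S - {?y}. b x')"
  proof (rule sum.mono_neutral_cong_right[OF finH])
    show "?S - {?y} \<subseteq> H" using UE by blast
    show "\<forall>x'\<in>H - (?S - {?y}). B x x' * b x' = 0"
    proof
      fix x' assume x': "x' \<in> H - (?S - {?y})"
      show "B x x' * b x' = 0"
      proof (cases "x' \<in> \<Union>E")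
        case True
        then have "\<not> follows (x, ?y) x'" using x' by (auto simp: follows_def)
        then show ?thesis by (simp add: B_def)
      next
        case False
        then show ?thesis using assms(2)[of x'] x' by simp
      qed
    qed
    fix x' assume "x' \<in> ?S - {?y}"
    then have "follows (x, ?y) x'" by (auto simp: follows_def)
    then show "B x x' * b x' = b x'" using assms(1) by (simp add: B_def)
  qed
  also have "\<dots> = (\<Sum>x'\<in>?S. b x') - b ?y"
  proof -
    have "finite ?S" by (rule finite_subset[OF _ finU]) blast
    then show ?thesis using y by (simp add: sum_diff1)
  qed
  finally show ?thesis .
qed

text \<open>Ihara-Bass on vectors. The directed edge function is \<open>t\<close> times the value at
  the head minus the value at the tail. Summed over the edges leaving a vertex, it becomes
  \<open>(t\<^sup>2 - 1) * f v\<close> by the kernel equation; removing the reversed edge leaves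
  \<open>t\<close> times the value at the incoming one.\<close>

lemma kernel_to_eigenvector:
  fixes t :: real
  assumes f: "in_kernel t f"
  defines "b \<equiv> \<lambda>x. if x \<in> \<Union>E then complex_of_real (t * f (fst (mate E x)) - f (fst x)) else 0"
  shows "\<forall>x\<in>H. (\<Sum>x'\<in>H. B x x' * b x') = of_real t * b x"
proof
  fix x assume x: "x \<in> H"
  show "(\<Sum>x'\<in>H. B x x' * b x') = of_real t * b x"
  proof (cases "x \<in> \<Union>E")
    case False
    then show ?thesis by (simp add: B_def b_def)
  next
    case True
    let ?y = "mate E x"
    define v where "v = fst ?y"
    let ?S = "{x' \<in> \<Union>E. fst x' = v}"
    have yU: "?y \<in> \<Union>E" using mate_edge[OF pm True] by auto
    have vN: "v \<in> verts G" using yU UE by (auto simp: v_def half_edges_def mem_verts)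
    have "(\<Sum>x'\<in>H. B x x' * b x') = (\<Sum>x'\<in>?S. b x') - b ?y"
      unfolding v_def by (rule B_apply[OF True]) (simp add: b_def)
    also have "(\<Sum>x'\<in>?S. b x') = of_real (\<Sum>x'\<in>?S. t * f (fst (mate E x')) - f v)"
      unfolding of_real_sum by (intro sum.cong refl) (simp add: b_def)
    also have "(\<Sum>x'\<in>?S. t * f (fst (mate E x')) - f v) = t * (\<Sum>w\<in>verts G. real (edge_mult G v w) * f w) - dg v * f v"
      using adjacency_sum[OF vN, of f] dg_card[OF vN]
      by (simp add: sum_subtractf sum_distrib_left[symmetric])
    also have "\<dots> = t\<^sup>2 * f v - f v"
    proof -
      have "t\<^sup>2 * f v - t * (\<Sum>w\<in>verts G. real (edge_mult G v w) * f w) + (dg v - 1) * f v = 0"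
        using f vN unfolding in_kernel_def by simp
      then show ?thesis by (simp add: algebra_simps)
    qed
    also have "b ?y = of_real (t * f (fst x) - f v)"
      using yU mate_mate[OF pm True] by (simp add: b_def v_def)
    finally show ?thesis using True
      by (simp add: b_def v_def[symmetric] power2_eq_square algebra_simps)
  qed
qed

text \<open>If the edge function vanishes in both orientations of an edge, then
  \<open>t\<^sup>2 * f u = f u\<close>. At a vertex without edges the kernel equation says the same,
  the degree being 0.\<close>

lemma kernel_eigenvector_nonzero:
  fixes t :: real
  assumes f: "in_kernel t f" and t: "1 < t"
    and z: "\<And>x. x \<in> \<Union>E \<Longrightarrow> t * f (fst (mate E x)) - f (fst x) = 0"
    and u: "u \<in> verts G"
  shows "f u = 0"
proof (cases "\<exists>x\<in>\<Union>E. fst x = u")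
  case True
  then obtain x where x: "x \<in> \<Union>E" "fst x = u" by blast
  let ?y = "mate E x"
  have yU: "?y \<in> \<Union>E" using mate_edge[OF pm x(1)] by auto
  have "t * f (fst ?y) = f u" using z[OF x(1)] x by simp
  moreover have "t * f u = f (fst ?y)" using z[OF yU] mate_mate[OF pm x(1)] x by simp
  ultimately have "(t * t - 1) * f u = 0" by (simp add: algebra_simps)
  moreover have "1 < t * t" using t by (simp add: less_1_mult)
  ultimately show ?thesis by simp
next
  case False
  then have e: "{x \<in> \<Union>E. fst x = u} = {}" by blast
  have dg0: "dg u = 0" unfolding dg_card[OF u] e by simp
  have "(\<Sum>w\<in>verts G. real (edge_mult G u w) * f w) = 0"
    unfolding adjacency_sum[OF u, of f] e by simp
  then have "t\<^sup>2 * f u - f u = 0" using bspec[OF f[unfolded in_kernel_def] u] dg0 by simp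
  then have "(t * t - 1) * f u = 0" by (simp add: algebra_simps power2_eq_square)
  moreover have "1 < t * t" using t by (simp add: less_1_mult)
  ultimately show ?thesis by simp
qed

text \<open>The converse: \<open>f u\<close> sums \<open>b\<close> over the edges leaving
  \<open>u\<close>, and \<open>b\<close> is recovered from \<open>f\<close> since
  \<open>\<beta>\<^sup>2\<close> differs from 1. Pairing the kernel equation with the conjugate of
  \<open>f\<close> gives \<open>S * \<beta>^2 - a * \<beta> + q = 0\<close> with real coefficients;
  a nonreal root would have squared modulus \<open>q / S\<close>, at most
  \<open>d - 1\<close>.\<close>

lemma eigenvector_to_kernel:
  assumes b: "\<exists>x\<in>H. b x \<noteq> 0" "\<forall>x\<in>H. (\<Sum>x'\<in>H. B x x' * b x') = \<beta> * b x"
    and \<beta>: "sqrt (real d - 1) < norm \<beta>"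
  shows "Im \<beta> = 0 \<and> (\<exists>f. (\<exists>u\<in>verts G. f u \<noteq> 0) \<and> in_kernel (Re \<beta>) f)"
proof -
  have finU: "finite (\<Union>E)" using UE finH by (rule finite_subset)
  have "1 \<le> sqrt (real d - 1)" using d3 by simp
  then have n1: "1 < norm \<beta>" using \<beta> by linarith
  then have b0: "\<beta> \<noteq> 0" "\<beta>\<^sup>2 \<noteq> 1"
    by (auto simp: norm_power[symmetric] power2_eq_1_iff)
  have off: "b x = 0" if "x \<in> H - \<Union>E" for x
  proof -
    have "\<beta> * b x = (\<Sum>x'\<in>H. B x x' * b x')" using b(2) that by simp
    also have "\<dots> = 0" using that by (simp add: B_def)
    finally show ?thesis using b0 by simp
  qed
  define f where "f u = (\<Sum>x\<in>{x \<in> \<Union>E. fst x = u}. b x)" for u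
  have key: "(\<beta>\<^sup>2 - 1) * b x = \<beta> * f (fst (mate E x)) - f (fst x)" if x: "x \<in> \<Union>E" for x
  proof -
    let ?y = "mate E x"
    have yU: "?y \<in> \<Union>E" using mate_edge[OF pm x] by auto
    have app: "\<beta> * b w = f (fst (mate E w)) - b (mate E w)" if w: "w \<in> \<Union>E" for w
    proof -
      have "w \<in> H" using w UE by blast
      then have "\<beta> * b w = (\<Sum>x'\<in>H. B w x' * b x')" using b(2) by simp
      also have "\<dots> = f (fst (mate E w)) - b (mate E w)"
        unfolding f_def by (rule B_apply[OF w]) (rule off)
      finally show ?thesis .
    qed
    have 1: "\<beta> * b x = f (fst ?y) - b ?y" by (rule app[OF x])
    have 2: "\<beta> * b ?y = f (fst x) - b x"
      using app[OF yU] unfolding mate_mate[OF pm x] .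
    have "\<beta>\<^sup>2 * b x = \<beta> * (\<beta> * b x)" by (simp add: power2_eq_square)
    also have "\<dots> = \<beta> * f (fst ?y) - \<beta> * b ?y" unfolding 1 by (simp add: algebra_simps)
    finally show ?thesis unfolding 2 by (simp add: algebra_simps)
  qed
  have ker: "\<beta>\<^sup>2 * f u - \<beta> * (\<Sum>v\<in>verts G. of_nat (edge_mult G u v) * f v) + of_real (dg u - 1) * f u = 0"
    if u: "u \<in> verts G" for u
  proof -
    have "(\<beta>\<^sup>2 - 1) * f u = (\<Sum>x\<in>{x \<in> \<Union>E. fst x = u}. (\<beta>\<^sup>2 - 1) * b x)"
      unfolding f_def by (rule sum_distrib_left)
    also have "\<dots> = (\<Sum>x\<in>{x \<in> \<Union>E. fst x = u}. \<beta> * f (fst (mate E x)) - f u)"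
      by (intro sum.cong refl) (use key in auto)
    also have "\<dots> = \<beta> * (\<Sum>v\<in>verts G. of_nat (edge_mult G u v) * f v) - of_real (dg u) * f u"
      unfolding adjacency_sum[OF u, of f] dg_card[OF u]
      by (simp add: sum_subtractf sum_distrib_left[symmetric])
    finally show ?thesis by (simp add: algebra_simps)
  qed
  have fnz: "\<exists>u\<in>verts G. f u \<noteq> 0"
  proof (rule ccontr)
    assume "\<not> ?thesis"
    then have z: "f u = 0" if "u \<in> verts G" for u using that by blast
    from b(1) obtain x where x: "x \<in> H" "b x \<noteq> 0" by blast
    then have xU: "x \<in> \<Union>E" using off by blast
    then have "mate E x \<in> H" using mate_edge[OF pm xU] UE by auto
    then have "(\<beta>\<^sup>2 - 1) * b x = 0" using key[OF xU] z x by (auto simp: half_edges_def mem_verts)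
    then show False using x b0 by simp
  qed
  define S where "S = (\<Sum>u\<in>verts G. (norm (f u))\<^sup>2)"
  define q where "q = (\<Sum>u\<in>verts G. (dg u - 1) * (norm (f u))\<^sup>2)"
  define a where "a = (\<Sum>u\<in>verts G. \<Sum>v\<in>verts G. of_nat (edge_mult G u v) * (cnj (f u) * f v))"
  have S: "0 < S" unfolding S_def using fnz finite_verts by (auto intro!: sum_pos2)
  have q: "q \<le> (real d - 1) * S" unfolding q_def S_def sum_distrib_left
    using dg_bounds by (intro sum_mono mult_right_mono) auto
  have Ia: "Im a = 0"
  proof -
    have "cnj a = (\<Sum>u\<in>verts G. \<Sum>v\<in>verts G. of_nat (edge_mult G u v) * (f u * cnj (f v)))"
      by (simp add: a_def)
    also have "\<dots> = (\<Sum>v\<in>verts G. \<Sum>u\<in>verts G. of_nat (edge_mult G v u) * (cnj (f v) * f u))"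
      by (subst sum.swap) (simp add: edge_mult_sym mult_ac)
    finally have "cnj a = a" by (simp add: a_def)
    then show ?thesis by (simp add: complex_eq_iff)
  qed
  have main: "\<beta>\<^sup>2 * of_real S - \<beta> * a + of_real q = 0"
  proof -
    have "0 = (\<Sum>u\<in>verts G. cnj (f u) * (\<beta>\<^sup>2 * f u - \<beta> * (\<Sum>v\<in>verts G. of_nat (edge_mult G u v) * f v) + of_real (dg u - 1) * f u))"
      using ker by simp
    also have "\<dots> = (\<Sum>u\<in>verts G. \<beta>\<^sup>2 * of_real ((norm (f u))\<^sup>2) - \<beta> * (\<Sum>v\<in>verts G. of_nat (edge_mult G u v) * (cnj (f u) * f v))
        + of_real ((dg u - 1) * (norm (f u))\<^sup>2))"
    proof (intro sum.cong refl)
      fix u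
      have n: "of_real ((norm (f u))\<^sup>2) = cnj (f u) * f u"
        by (simp only: complex_norm_square mult.commute)
      have "cnj (f u) * (\<Sum>v\<in>verts G. of_nat (edge_mult G u v) * f v) = (\<Sum>v\<in>verts G. of_nat (edge_mult G u v) * (cnj (f u) * f v))"
        by (simp add: sum_distrib_left mult_ac)
      then have e: "\<beta> * (\<Sum>v\<in>verts G. of_nat (edge_mult G u v) * (cnj (f u) * f v)) = cnj (f u) * (\<beta> * (\<Sum>v\<in>verts G. of_nat (edge_mult G u v) * f v))"
        by (simp add: mult_ac)
      show "cnj (f u) * (\<beta>\<^sup>2 * f u - \<beta> * (\<Sum>v\<in>verts G. of_nat (edge_mult G u v) * f v) + of_real (dg u - 1) * f u)
        = \<beta>\<^sup>2 * of_real ((norm (f u))\<^sup>2) - \<beta> * (\<Sum>v\<in>verts G. of_nat (edge_mult G u v) * (cnj (f u) * f v))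
        + of_real ((dg u - 1) * (norm (f u))\<^sup>2)"
        unfolding of_real_mult n e by (simp add: algebra_simps)
    qed
    also have "\<dots> = \<beta>\<^sup>2 * of_real S - \<beta> * a + of_real q"
      unfolding S_def q_def a_def of_real_sum sum_distrib_left sum.distrib sum_subtractf ..
    finally show ?thesis by simp
  qed
  have real: "Im \<beta> = 0"
  proof (rule ccontr)
    assume im: "Im \<beta> \<noteq> 0"
    define x y where "x = Re \<beta>" and "y = Im \<beta>"
    have R: "(x\<^sup>2 - y\<^sup>2) * S - x * Re a + q = 0"
      using arg_cong[OF main, of Re] Ia by (simp add: x_def y_def power2_eq_square)
    have I: "2 * x * y * S - y * Re a = 0"
      using arg_cong[OF main, of Im] Ia by (simp add: x_def y_def power2_eq_square)
    have "y * (2 * x * S - Re a) = 0" using I by (simp add: algebra_simps)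
    then have Ra: "Re a = 2 * x * S" using im by (simp add: y_def)
    have "q = (x\<^sup>2 + y\<^sup>2) * S" using R unfolding Ra by (simp add: algebra_simps power2_eq_square)
    then have "(x\<^sup>2 + y\<^sup>2) * S \<le> (real d - 1) * S" using q by simp
    then have "x\<^sup>2 + y\<^sup>2 \<le> real d - 1" using S by simp
    then have "norm \<beta> \<le> sqrt (real d - 1)" by (simp add: cmod_def x_def y_def)
    then show False using \<beta> by simp
  qed
  define t where "t = Re \<beta>"
  have \<beta>t: "\<beta> = of_real t" using real by (simp add: t_def complex_eq_iff)
  have kRe: "in_kernel t (\<lambda>u. Re (f u))" and kIm: "in_kernel t (\<lambda>u. Im (f u))"
    unfolding in_kernel_def
  proof (safe)
    fix u assume u: "u \<in> verts G"
    note k = ker[OF u, unfolded \<beta>t]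
    show "t\<^sup>2 * Re (f u) - t * (\<Sum>v\<in>verts G. real (edge_mult G u v) * Re (f v)) + (dg u - 1) * Re (f u) = 0"
      using arg_cong[OF k, of Re] by (simp add: of_real_power[symmetric] del: of_real_power of_real_diff)
    show "t\<^sup>2 * Im (f u) - t * (\<Sum>v\<in>verts G. real (edge_mult G u v) * Im (f v)) + (dg u - 1) * Im (f u) = 0"
      using arg_cong[OF k, of Im] by (simp add: of_real_power[symmetric] del: of_real_power of_real_diff)
  qed
  from fnz obtain u where u: "u \<in> verts G" "f u \<noteq> 0" by blast
  then have "Re (f u) \<noteq> 0 \<or> Im (f u) \<noteq> 0" by (auto simp: complex_eq_iff)
  then have "\<exists>g. (\<exists>u\<in>verts G. g u \<noteq> 0) \<and> in_kernel t g"
  proof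
    assume "Re (f u) \<noteq> 0"
    then show ?thesis by (intro exI[of _ "\<lambda>u. Re (f u)"] conjI bexI[of _ u] kRe u(1))
  next
    assume "Im (f u) \<noteq> 0"
    then show ?thesis by (intro exI[of _ "\<lambda>u. Im (f u)"] conjI bexI[of _ u] kIm u(1))
  qed
  then show ?thesis using real by (simp add: t_def)
qed

end

text \<open>Beyond \<open>sqrt c\<close> the map \<open>t + c / t\<close> is increasing and
  1-Lipschitz, so errors in nonbacktracking eigenvalues carry over to adjacency eigenvalues
  unchanged.\<close>

lemma joukowski_mono:
  fixes c s t :: real
  assumes "0 < s" "s \<le> t" "c \<le> s * s" "0 \<le> c"
  shows "s + c / s \<le> t + c / t" "t + c / t \<le> s + c / s + (t - s)"
proof -
  have t: "0 < t" using assms by simp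
  have st: "c \<le> s * t" using assms by (smt (verit) mult_left_mono)
  have id: "(t + c / t) - (s + c / s) = (t - s) * (1 - c / (s * t))"
    using assms t by (simp add: field_simps)
  have q: "0 \<le> c / (s * t)" "c / (s * t) \<le> 1" using assms t st by (auto simp: divide_le_eq)
  have "0 \<le> (t - s) * (1 - c / (s * t))" using assms q by (intro mult_nonneg_nonneg) auto
  then show "s + c / s \<le> t + c / t" using id by simp
  have "(t - s) * (1 - c / (s * t)) \<le> (t - s) * 1" using assms q by (intro mult_left_mono) auto
  then show "t + c / t \<le> s + c / s + (t - s)" using id by simp
qed

section \<open>From two traces to the two largest min-max values\<close>

context half_edge_graph
begin

text \<open>Traces of even powers do not see signs. A kernel vector at \<open>- t\<close> still
  yields, through its absolute value, a test vector at \<open>t\<close>.\<close>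

lemma Q_abs_le:
  assumes "0 \<le> t"
  shows "Q t (\<lambda>v. \<bar>f v\<bar>) (\<lambda>v. \<bar>f v\<bar>) \<le> Q t f f" "Q t (\<lambda>v. \<bar>f v\<bar>) (\<lambda>v. \<bar>f v\<bar>) \<le> Q (- t) f f"
proof -
  let ?a = "\<lambda>u v. real (edge_mult G u v)"
  have bound: "\<bar>\<Sum>u\<in>verts G. \<Sum>v\<in>verts G. ?a u v * f u * f v\<bar> \<le> (\<Sum>u\<in>verts G. \<Sum>v\<in>verts G. ?a u v * \<bar>f u\<bar> * \<bar>f v\<bar>)"
  proof -
    have "\<bar>\<Sum>u\<in>verts G. \<Sum>v\<in>verts G. ?a u v * f u * f v\<bar> \<le> (\<Sum>u\<in>verts G. \<bar>\<Sum>v\<in>verts G. ?a u v * f u * f v\<bar>)"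
      by (rule sum_abs)
    also have "\<dots> \<le> (\<Sum>u\<in>verts G. \<Sum>v\<in>verts G. \<bar>?a u v * f u * f v\<bar>)"
      by (intro sum_mono sum_abs)
    finally show ?thesis by (simp add: abs_mult)
  qed
  have eq: "(\<Sum>u\<in>verts G. (t\<^sup>2 + dg u - 1) * \<bar>f u\<bar> * \<bar>f u\<bar>) = (\<Sum>u\<in>verts G. (t\<^sup>2 + dg u - 1) * f u * f u)"
    by (intro sum.cong refl) (simp add: mult.assoc)
  let ?S = "\<Sum>u\<in>verts G. \<Sum>v\<in>verts G. ?a u v * f u * f v"
  let ?T = "\<Sum>u\<in>verts G. \<Sum>v\<in>verts G. ?a u v * \<bar>f u\<bar> * \<bar>f v\<bar>"
  have "?S \<le> ?T" "- ?S \<le> ?T" using bound by (auto simp: abs_le_iff)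
  then have "t * ?S \<le> t * ?T" "t * (- ?S) \<le> t * ?T" using assms by (blast intro: mult_left_mono)+
  then show "Q t (\<lambda>v. \<bar>f v\<bar>) (\<lambda>v. \<bar>f v\<bar>) \<le> Q t f f" "Q t (\<lambda>v. \<bar>f v\<bar>) (\<lambda>v. \<bar>f v\<bar>) \<le> Q (- t) f f"
    unfolding Q_def eq by simp_all
qed

lemma kernel_eigenvalue:
  assumes "in_kernel t f" "\<exists>v\<in>verts G. f v \<noteq> 0" "1 < t"
  shows "\<exists>b. (\<exists>x\<in>H. b x \<noteq> 0) \<and> (\<forall>x\<in>H. (\<Sum>y\<in>H. B x y * b y) = of_real t * b x)"
proof -
  let ?b = "\<lambda>x. if x \<in> \<Union>E then complex_of_real (t * f (fst (mate E x)) - f (fst x)) else 0"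
  from assms(2) obtain v where v: "v \<in> verts G" "f v \<noteq> 0" by blast
  have "\<exists>x\<in>\<Union>E. t * f (fst (mate E x)) - f (fst x) \<noteq> 0"
    using kernel_eigenvector_nonzero[OF assms(1,3) _ v(1)] v(2) by blast
  then obtain x where x: "x \<in> \<Union>E" "t * f (fst (mate E x)) - f (fst x) \<noteq> 0" by blast
  then have "?b x \<noteq> 0" by (simp del: of_real_diff of_real_mult)
  then have "\<exists>x\<in>H. ?b x \<noteq> 0" using x(1) UE by blast
  then show ?thesis using kernel_to_eigenvector[OF assms(1)] by (intro exI[of _ ?b] conjI)
qed

lemma in_kernel_lin:
  assumes "in_kernel t f" "in_kernel t g"
  shows "in_kernel t (\<lambda>v. x * f v + y * g v)"
  using assms by (intro kernelI) (simp add: Q_add Q_kernel)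

text \<open>Nonreal eigenvalues of \<open>B\<close> and real ones below \<open>sqrt (d - 1)\<close> contribute little to the trace
  of \<open>B ^ k\<close>, while all others contribute positively for even \<open>k\<close>. The traces of \<open>B ^ k\<close> and
  \<open>B ^ (2 * k)\<close> together then determine the largest of these and separate it from the rest.\<close>

lemma eigenvalues_from_closed_walks:
  fixes \<theta> \<epsilon> :: real
  assumes N: "2 \<le> N" and \<theta>: "sqrt (real d - 1) < \<theta>" "\<theta> < real d - 1"
    and k: "even k" "0 < k" and \<epsilon>: "0 < \<epsilon>" "\<epsilon> \<le> 1 / 10"
    and c1: "\<bar>real (card (closed_walks E k)) / \<theta> ^ k - 1\<bar> \<le> \<epsilon>"
    and c2: "\<bar>real (card (closed_walks E (2 * k))) / \<theta> ^ (2 * k) - 1\<bar> \<le> \<epsilon>"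
    and noise: "real (N * d) * (sqrt (real d - 1) / \<theta>) ^ k \<le> \<epsilon>"
  shows "\<bar>graph_eigenvalue 1 (tree_extension d G) - (\<theta> + (real d - 1) / \<theta>)\<bar> \<le> 4 * \<epsilon> * \<theta>"
    and "\<And>t. sqrt (real d - 1) < t \<Longrightarrow> t < \<theta> \<Longrightarrow> 6 * \<epsilon> < (t / \<theta>) ^ k \<Longrightarrow>
      graph_eigenvalue 2 (tree_extension d G) \<le> t + (real d - 1) / t"
proof -
  define L where "L = sqrt (real d - 1)"
  have L: "1 < L" "L * L = real d - 1" "L < \<theta>" using d3 \<theta> by (auto simp: L_def)
  have \<theta>0: "0 < \<theta>" using L by simp
  define n where "n = card H"
  have n: "n = N * d" by (simp add: n_def half_edges_def)
  from trace_powers_eigenvalues[OF finH, of B] obtain e where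
    e1: "\<And>k. (\<Sum>x\<in>H. walk_sum H B k x x) = (\<Sum>i<n. e i ^ k)"
    and e2: "\<And>i. i < n \<Longrightarrow> \<exists>b. (\<exists>x\<in>H. b x \<noteq> 0) \<and> (\<forall>x\<in>H. (\<Sum>y\<in>H. B x y * b y) = e i * b x)"
    and e3: "\<And>b t. \<exists>x\<in>H. b x \<noteq> 0 \<Longrightarrow> \<forall>x\<in>H. (\<Sum>y\<in>H. B x y * b y) = t * b x \<Longrightarrow> \<exists>i<n. e i = t"
    and e4: "\<And>b b' t t'. \<forall>c c'. (\<forall>x\<in>H. c * b x + c' * b' x = 0) \<longrightarrow> c = 0 \<and> c' = 0 \<Longrightarrow>
      \<forall>x\<in>H. (\<Sum>y\<in>H. B x y * b y) = t * b x \<Longrightarrow> \<forall>x\<in>H. (\<Sum>y\<in>H. B x y * b' y) = t' * b' x \<Longrightarrow>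
      \<exists>i<n. \<exists>j<n. i \<noteq> j \<and> e i = t \<and> e j = t'"
    unfolding n_def[symmetric] by (elim exE conjE) blast
  define R where "R = {i. i < n \<and> L < norm (e i)}"
  have finR: "finite R" by (simp add: R_def)
  define x where "x i = (norm (e i) / \<theta>) ^ k" for i
  have x0: "0 \<le> x i" for i unfolding x_def using \<theta>0 by simp
  have kernelR: "Im (e i) = 0 \<and> (\<exists>f. (\<exists>u\<in>verts G. f u \<noteq> 0) \<and> in_kernel (Re (e i)) f)" if "i \<in> R" for i
  proof -
    from that have i: "i < n" "L < norm (e i)" by (auto simp: R_def)
    from e2[OF i(1)] obtain b where b: "\<exists>x\<in>H. b x \<noteq> 0" "\<forall>x\<in>H. (\<Sum>y\<in>H. B x y * b y) = e i * b x" by blast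
    show ?thesis by (rule eigenvector_to_kernel[OF b i(2)[unfolded L_def]])
  qed
  \<comment> \<open>The noise hypothesis is stated for \<open>k\<close> and serves for every larger
    even \<open>m\<close>, since \<open>L / \<theta>\<close> is below 1; it is applied at
    \<open>k\<close> and \<open>2 * k\<close>.\<close>
  have trace: "\<bar>real (card (closed_walks E m)) / \<theta> ^ m - (\<Sum>i\<in>R. (norm (e i) / \<theta>) ^ m)\<bar> \<le> \<epsilon>"
    if m: "even m" "k \<le> m" for m
  proof -
    have m0: "0 < m" using m k by simp
    have "of_nat (card (closed_walks E m)) = (\<Sum>i<n. e i ^ m)"
      using e1[of m] trace_closed_walks[OF m0] by simp
    then have "Re (of_nat (card (closed_walks E m))) = Re (\<Sum>i<n. e i ^ m)" by (rule arg_cong)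
    then have "real (card (closed_walks E m)) = (\<Sum>i<n. Re (e i ^ m))" by simp
    also have "\<dots> = (\<Sum>i\<in>R. Re (e i ^ m)) + (\<Sum>i\<in>{..<n} - R. Re (e i ^ m))"
    proof -
      have "R \<subseteq> {..<n}" by (auto simp: R_def)
      then show ?thesis using sum.subset_diff[of R "{..<n}" "\<lambda>i. Re (e i ^ m)"] by simp
    qed
    also have "(\<Sum>i\<in>R. Re (e i ^ m)) = (\<Sum>i\<in>R. norm (e i) ^ m)"
    proof (intro sum.cong refl)
      fix i assume "i \<in> R"
      then have "e i = of_real (Re (e i))" using kernelR[of i] by (simp add: complex_eq_iff)
      then obtain r where r: "e i = of_real r" by blast
      have "Re (e i ^ m) = r ^ m" unfolding r by (simp flip: of_real_power)
      also have "\<dots> = \<bar>r\<bar> ^ m" using m(1) by (simp add: power_even_abs)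
      finally show "Re (e i ^ m) = norm (e i) ^ m" unfolding r by simp
    qed
    finally have "real (card (closed_walks E m)) - (\<Sum>i\<in>R. norm (e i) ^ m) = (\<Sum>i\<in>{..<n} - R. Re (e i ^ m))" by simp
    also have "\<bar>\<dots>\<bar> \<le> (\<Sum>i\<in>{..<n} - R. L ^ m)"
    proof (rule order.trans[OF sum_abs], rule sum_mono)
      fix i assume "i \<in> {..<n} - R"
      then have "norm (e i) \<le> L" by (auto simp: R_def)
      have "\<bar>Re (e i ^ m)\<bar> \<le> norm (e i ^ m)" by (rule abs_Re_le_cmod)
      also have "\<dots> \<le> L ^ m" unfolding norm_power using \<open>norm (e i) \<le> L\<close> by (intro power_mono) auto
      finally show "\<bar>Re (e i ^ m)\<bar> \<le> L ^ m" .
    qed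
    also have "\<dots> \<le> real n * L ^ m"
    proof -
      have "card ({..<n} - R) \<le> n" using card_mono[of "{..<n}" "{..<n} - R"] by simp
      then show ?thesis using L by (simp add: mult_right_mono)
    qed
    finally have "\<bar>real (card (closed_walks E m)) - (\<Sum>i\<in>R. norm (e i) ^ m)\<bar> / \<theta> ^ m \<le> real n * L ^ m / \<theta> ^ m"
      using \<theta>0 by (intro divide_right_mono) auto
    also have "\<dots> = real n * (L / \<theta>) ^ m" by (simp add: power_divide)
    also have "\<dots> \<le> real n * (L / \<theta>) ^ k"
      using L \<theta>0 m(2) by (intro mult_left_mono power_decreasing) auto
    also have "\<dots> \<le> \<epsilon>" using noise by (simp add: n L_def)
    finally have "\<bar>real (card (closed_walks E m)) - (\<Sum>i\<in>R. norm (e i) ^ m)\<bar> / \<theta> ^ m \<le> \<epsilon>" .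
    moreover have "\<bar>real (card (closed_walks E m)) - (\<Sum>i\<in>R. norm (e i) ^ m)\<bar> / \<theta> ^ m
        = \<bar>real (card (closed_walks E m)) / \<theta> ^ m - (\<Sum>i\<in>R. (norm (e i) / \<theta>) ^ m)\<bar>"
      using \<theta>0 by (simp add: power_divide sum_divide_distrib[symmetric] diff_divide_distrib[symmetric] abs_divide)
    ultimately show ?thesis by simp
  qed
  have s1: "\<bar>(\<Sum>i\<in>R. x i) - 1\<bar> \<le> 2 * \<epsilon>"
    using trace[of k] k c1 unfolding x_def by linarith
  have x2: "(norm (e i) / \<theta>) ^ (2 * k) = (x i)\<^sup>2" for i
    by (simp add: x_def power_mult[symmetric] mult.commute)
  have s2: "\<bar>(\<Sum>i\<in>R. (x i)\<^sup>2) - 1\<bar> \<le> 2 * \<epsilon>"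
  proof -
    have "even (2 * k)" "k \<le> 2 * k" by auto
    from trace[OF this] show ?thesis using c2 unfolding x2 by linarith
  qed
  have xle: "x i \<le> 1 + 2 * \<epsilon>" if "i \<in> R" for i
    using member_le_sum[OF that, of x] x0 finR s1 by (simp add: abs_le_iff)
  \<comment> \<open>If all terms were smaller, the sum of squares would be at most
    \<open>(1 - 4 * \<epsilon>) * (1 + 2 * \<epsilon>)\<close>, which is below
    \<open>1 - 2 * \<epsilon>\<close>. Two power sums close to 1 force one dominant term.\<close>
  have "\<exists>i\<in>R. 1 - 4 * \<epsilon> \<le> x i"
  proof (rule ccontr)
    assume "\<not> ?thesis"
    then have lt: "x i \<le> 1 - 4 * \<epsilon>" if "i \<in> R" for i using that by force
    have "(\<Sum>i\<in>R. (x i)\<^sup>2) \<le> (\<Sum>i\<in>R. (1 - 4 * \<epsilon>) * x i)"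
      unfolding power2_eq_square using lt x0 by (intro sum_mono mult_right_mono) auto
    also have "\<dots> = (1 - 4 * \<epsilon>) * (\<Sum>i\<in>R. x i)" by (rule sum_distrib_left[symmetric])
    also have "\<dots> \<le> (1 - 4 * \<epsilon>) * (1 + 2 * \<epsilon>)" using s1 \<epsilon> by (intro mult_left_mono) (auto simp: abs_le_iff)
    also have "\<dots> = 1 - 2 * \<epsilon> - 8 * \<epsilon>\<^sup>2" by (simp add: power2_eq_square algebra_simps)
    finally have "8 * \<epsilon>\<^sup>2 \<le> 0" using s2 by linarith
    then show False using \<epsilon> by simp
  qed
  then obtain i0 where i0: "i0 \<in> R" "1 - 4 * \<epsilon> \<le> x i0" by blast
  show "\<bar>graph_eigenvalue 1 (tree_extension d G) - (\<theta> + (real d - 1) / \<theta>)\<bar> \<le> 4 * \<epsilon> * \<theta>"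
  proof -
    have "\<theta> + (real d - 1) / \<theta> - 4 * \<epsilon> * \<theta> \<le> graph_eigenvalue 1 (tree_extension d G)"
    proof -
      define t where "t = norm (e i0)"
      have t: "L < t" using i0 by (simp add: t_def R_def)
      from kernelR[OF i0(1)] obtain f where f: "\<exists>u\<in>verts G. f u \<noteq> 0" "in_kernel (Re (e i0)) f" and im: "Im (e i0) = 0" by blast
      have "t = \<bar>Re (e i0)\<bar>" using im by (simp add: t_def cmod_def)
      then have "Re (e i0) = t \<or> Re (e i0) = - t" by linarith
      then have "Q t (\<lambda>v. \<bar>f v\<bar>) (\<lambda>v. \<bar>f v\<bar>) \<le> 0"
        using Q_abs_le[of t f] Q_kernel[OF f(2), of f] t L by (elim disjE) auto
      moreover have "\<exists>v\<in>verts G. \<bar>f v\<bar> \<noteq> 0" using f(1) by simp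
      ultimately have low: "t + (real d - 1) / t \<le> graph_eigenvalue 1 (tree_extension d G)"
        using t unfolding L_def by (intro eigenvalue1_lower)
      \<comment> \<open>Among numbers in \<open>[0, 1]\<close> taking a root increases, so the lower
        bound on \<open>x i0\<close> passes to the ratio \<open>t / \<theta>\<close> itself.\<close>
      have "(1 - 4 * \<epsilon>) ^ k \<le> (1 - 4 * \<epsilon>) ^ 1" using \<epsilon> k by (intro power_decreasing) auto
      also have "\<dots> \<le> (t / \<theta>) ^ k" using i0(2) by (simp add: x_def t_def)
      finally have "1 - 4 * \<epsilon> \<le> t / \<theta>"
        using power_mono_iff[of "1 - 4 * \<epsilon>" "t / \<theta>" k] \<epsilon> k \<theta>0 L t by simp
      then have te: "(1 - 4 * \<epsilon>) * \<theta> \<le> t" using \<theta>0 by (simp add: le_divide_eq)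
      have LL: "real d - 1 \<le> t * t" "real d - 1 \<le> \<theta> * \<theta>"
        using mult_mono[of L t L t] mult_mono[of L \<theta> L \<theta>] L t by auto
      have "\<theta> + (real d - 1) / \<theta> - 4 * \<epsilon> * \<theta> \<le> t + (real d - 1) / t"
      proof (cases "\<theta> \<le> t")
        case True
        have "0 \<le> 4 * \<epsilon> * \<theta>" using \<epsilon> \<theta>0 by simp
        then show ?thesis using joukowski_mono(1)[of \<theta> t "real d - 1"] True \<theta>0 LL d3 by simp
      next
        case False
        have "\<theta> - t \<le> 4 * \<epsilon> * \<theta>" using te by (simp add: algebra_simps)
        moreover have "\<theta> + (real d - 1) / \<theta> \<le> t + (real d - 1) / t + (\<theta> - t)"
          by (rule joukowski_mono(2)) (use False t L LL d3 in auto)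
        ultimately show ?thesis by linarith
      qed
      then show ?thesis using low by simp
    qed
    moreover have "graph_eigenvalue 1 (tree_extension d G) \<le> \<theta> + (real d - 1) / \<theta> + 4 * \<epsilon> * \<theta>"
    proof -
      \<comment> \<open>\<open>1 + 2 * \<epsilon>\<close> is the bound \<open>xle\<close> on all
        terms. A negative direction at \<open>s\<close> would produce an eigenvalue beyond
        \<open>s\<close>, and the power of its ratio to \<open>\<theta>\<close> would exceed that
        bound.\<close>
      define s where "s = (1 + 2 * \<epsilon>) * \<theta>"
      have s: "\<theta> \<le> s" "s - \<theta> \<le> 4 * \<epsilon> * \<theta>" using \<epsilon> \<theta>0 by (auto simp: s_def algebra_simps)
      have nonneg: "0 \<le> Q s g g" for g
      proof (rule ccontr)
        assume neg: "\<not> 0 \<le> Q s g g"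
        have gz: "\<exists>v\<in>verts G. g v \<noteq> 0"
        proof (rule ccontr)
          assume "\<not> ?thesis"
          then have "Q s g g = 0" unfolding Q_def by simp
          then show False using neg by simp
        qed
        have sd: "s < real d"
        proof (rule ccontr)
          assume "\<not> s < real d"
          then have "0 < Q s g g" using gz by (intro Q_pos_large) auto
          then show False using neg by simp
        qed
        have "Q s g g < 0" using neg by simp
        from top_kernel[OF sd gz this] obtain s' f where
          f: "s < s'" "\<exists>v\<in>verts G. f v \<noteq> 0" "in_kernel s' f" by blast
        have s': "L < s'" using f(1) s L by simp
        from kernel_eigenvalue[OF f(3,2)] obtain b where
          "\<exists>x\<in>H. b x \<noteq> 0" "\<forall>x\<in>H. (\<Sum>y\<in>H. B x y * b y) = of_real s' * b x" using s' L by auto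
        from e3[OF this] obtain i where i: "i < n" "e i = of_real s'" by blast
        have nm: "norm (e i) = s'" using i s' L by simp
        then have iR: "i \<in> R" using i s' by (simp add: R_def)
        have "1 + 2 * \<epsilon> < s' / \<theta>" using f(1) \<theta>0 by (simp add: s_def less_divide_eq)
        also have "\<dots> = (s' / \<theta>) ^ 1" by simp
        also have "\<dots> \<le> (s' / \<theta>) ^ k"
          using f(1) s(1) k \<theta>0 by (intro power_increasing) (auto simp: le_divide_eq)
        also have "\<dots> = x i" by (simp add: x_def nm)
        finally show False using xle[OF iR] by simp
      qed
      have "verts G \<noteq> {}" using N mem_verts[of 0] by auto
      then have "graph_eigenvalue 1 (tree_extension d G) \<le> s + (real d - 1) / s"
        using nonneg s(1) \<theta> by (intro eigenvalue1_upper) auto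
      also have "\<dots> \<le> \<theta> + (real d - 1) / \<theta> + (s - \<theta>)"
        using \<theta>0 s(1) d3 L mult_mono[of L \<theta> L \<theta>] by (intro joukowski_mono(2)) auto
      finally show ?thesis using s(2) by simp
    qed
    ultimately show ?thesis by (simp add: abs_le_iff)
  qed
  show "graph_eigenvalue 2 (tree_extension d G) \<le> t + (real d - 1) / t"
    if t: "sqrt (real d - 1) < t" "t < \<theta>" "6 * \<epsilon> < (t / \<theta>) ^ k" for t
  proof (rule eigenvalue2_upper[OF t(1)])
    show "0 \<in> verts G" "1 \<in> verts G" "(0::nat) \<noteq> 1" using N mem_verts by auto
    fix f g
    show "\<exists>x y. (x \<noteq> 0 \<or> y \<noteq> 0) \<and> 0 \<le> Q t (\<lambda>v. x * f v + y * g v) (\<lambda>v. x * f v + y * g v)"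
    proof (rule ccontr)
      assume neg: "\<not> ?thesis"
      have td: "t < real d" using t \<theta> by simp
      have "\<exists>t1 t2 f1 f2. t \<le> t1 \<and> t \<le> t2 \<and> in_kernel t1 f1 \<and> in_kernel t2 f2
        \<and> (\<forall>c c'. (\<forall>v\<in>verts G. c * f1 v + c' * f2 v = 0) \<longrightarrow> c = 0 \<and> c' = 0)"
      proof (rule two_kernels[OF t(1) td])
        fix x y :: real assume xy: "x \<noteq> 0 \<or> y \<noteq> 0"
        show "Q t (\<lambda>v. x * f v + y * g v) (\<lambda>v. x * f v + y * g v) < 0"
        proof (rule ccontr)
          assume "\<not> Q t (\<lambda>v. x * f v + y * g v) (\<lambda>v. x * f v + y * g v) < 0"
          then have q: "0 \<le> Q t (\<lambda>v. x * f v + y * g v) (\<lambda>v. x * f v + y * g v)" by (rule leI)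
          from neg show False
            by (rule notE) (rule exI[of _ x], rule exI[of _ y], rule conjI[OF xy q])
        qed
      qed
      then obtain t1 t2 f1 f2 where k12: "t \<le> t1" "t \<le> t2" "in_kernel t1 f1" "in_kernel t2 f2"
        and ind: "\<And>c c'. \<forall>v\<in>verts G. c * f1 v + c' * f2 v = 0 \<Longrightarrow> c = 0 \<and> c' = 0" by blast
      have t1: "L < t1" "L < t2" using t(1) k12 by (auto simp: L_def)
      have nz: "\<exists>v\<in>verts G. f1 v \<noteq> 0" "\<exists>v\<in>verts G. f2 v \<noteq> 0"
        using ind[of 1 0] ind[of 0 1] by auto
      have "\<exists>i<n. \<exists>j<n. i \<noteq> j \<and> e i = of_real t1 \<and> e j = of_real t2"
      proof (cases "t1 = t2")
        case False
        from kernel_eigenvalue[OF k12(3) nz(1)] obtain b where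
          "\<exists>x\<in>H. b x \<noteq> 0" "\<forall>x\<in>H. (\<Sum>y\<in>H. B x y * b y) = of_real t1 * b x" using t1 L by auto
        from e3[OF this] obtain i where i: "i < n" "e i = of_real t1" by blast
        from kernel_eigenvalue[OF k12(4) nz(2)] obtain b where
          "\<exists>x\<in>H. b x \<noteq> 0" "\<forall>x\<in>H. (\<Sum>y\<in>H. B x y * b y) = of_real t2 * b x" using t1 L by auto
        from e3[OF this] obtain j where j: "j < n" "e j = of_real t2" by blast
        have "i \<noteq> j" using i j False by auto
        then show ?thesis using i j by blast
      next
        \<comment> \<open>With equal parameters a single eigenvalue has to be found twice. The edge
          functions of independent kernel vectors stay independent, also over complex coefficients,
          whose real and imaginary parts are treated separately.\<close>
        case True
        define b where "b f x = (if x \<in> \<Union>E then complex_of_real (t1 * f (fst (mate E x)) - f (fst x)) else 0)"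
          for f :: "nat \<Rightarrow> real" and x
        have real_ind: "r = 0 \<and> r' = 0"
          if r: "\<forall>x\<in>\<Union>E. r * (t1 * f1 (fst (mate E x)) - f1 (fst x)) + r' * (t1 * f2 (fst (mate E x)) - f2 (fst x)) = 0"
          for r r' :: real
        proof (rule ind, rule ballI)
          fix v assume v: "v \<in> verts G"
          have ker: "in_kernel t1 (\<lambda>v. r * f1 v + r' * f2 v)"
            using k12(3,4) True by (intro in_kernel_lin) auto
          show "r * f1 v + r' * f2 v = 0"
          proof (rule kernel_eigenvector_nonzero[OF ker _ _ v])
            show "1 < t1" using t1 L by simp
            show "t1 * (r * f1 (fst (mate E x)) + r' * f2 (fst (mate E x))) - (r * f1 (fst x) + r' * f2 (fst x)) = 0"
              if "x \<in> \<Union>E" for x using bspec[OF r that] by (simp add: algebra_simps)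
          qed
        qed
        have cind: "\<forall>c c'. (\<forall>x\<in>H. c * b f1 x + c' * b f2 x = 0) \<longrightarrow> c = 0 \<and> c' = 0"
        proof (intro allI impI)
          fix c c' assume z: "\<forall>x\<in>H. c * b f1 x + c' * b f2 x = 0"
          have z': "c * complex_of_real (t1 * f1 (fst (mate E x)) - f1 (fst x)) + c' * complex_of_real (t1 * f2 (fst (mate E x)) - f2 (fst x)) = 0"
            if "x \<in> \<Union>E" for x
            using bspec[OF z subsetD[OF UE that]] that by (simp add: b_def)
          have "Re c = 0 \<and> Re c' = 0"
          proof (rule real_ind, rule ballI)
            fix x assume "x \<in> \<Union>E"
            from arg_cong[OF z'[OF this], of Re]
            show "Re c * (t1 * f1 (fst (mate E x)) - f1 (fst x)) + Re c' * (t1 * f2 (fst (mate E x)) - f2 (fst x)) = 0"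
              by (simp del: of_real_diff of_real_mult)
          qed
          moreover have "Im c = 0 \<and> Im c' = 0"
          proof (rule real_ind, rule ballI)
            fix x assume "x \<in> \<Union>E"
            from arg_cong[OF z'[OF this], of Im]
            show "Im c * (t1 * f1 (fst (mate E x)) - f1 (fst x)) + Im c' * (t1 * f2 (fst (mate E x)) - f2 (fst x)) = 0"
              by (simp del: of_real_diff of_real_mult)
          qed
          ultimately show "c = 0 \<and> c' = 0" by (simp add: complex_eq_iff)
        qed
        show ?thesis
        proof (rule e4[OF cind])
          show "\<forall>x\<in>H. (\<Sum>y\<in>H. B x y * b f1 y) = of_real t1 * b f1 x"
            using kernel_to_eigenvector[OF k12(3)] unfolding b_def .
          show "\<forall>x\<in>H. (\<Sum>y\<in>H. B x y * b f2 y) = of_real t2 * b f2 x"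
            using kernel_to_eigenvector[OF k12(4)] unfolding b_def True .
        qed
      qed
      then obtain i j where ij: "i < n" "j < n" "i \<noteq> j" "e i = of_real t1" "e j = of_real t2" by blast
      have nm: "norm (e i) = t1" "norm (e j) = t2" using ij t1 L by simp_all
      then have iR: "i \<in> R" "j \<in> R" using ij t1 by (simp_all add: R_def)
      have big: "6 * \<epsilon> < x i" "6 * \<epsilon> < x j"
      proof -
        have tp: "0 < t" using t(1) L(1) unfolding L_def by linarith
        have "(t / \<theta>) ^ k \<le> (t1 / \<theta>) ^ k" "(t / \<theta>) ^ k \<le> (t2 / \<theta>) ^ k"
          using k12 tp \<theta>0 by (auto intro!: power_mono divide_right_mono)
        then show "6 * \<epsilon> < x i" "6 * \<epsilon> < x j" using t(3) by (simp_all add: x_def nm)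
      qed
      \<comment> \<open>Together with \<open>x i0\<close>, at least
        \<open>1 - 4 * \<epsilon>\<close>, any second term above \<open>6 * \<epsilon>\<close> would
        push the sum past \<open>1 + 2 * \<epsilon>\<close>; this is the origin of the constant
        6.\<close>
      have two: "x a + x b \<le> 1 + 2 * \<epsilon>" if "a \<in> R" "b \<in> R" "a \<noteq> b" for a b
      proof -
        have "x a + x b = (\<Sum>i\<in>{a, b}. x i)" using that by simp
        also have "\<dots> \<le> (\<Sum>i\<in>R. x i)" using that finR x0 by (intro sum_mono2) auto
        finally show ?thesis using s1 by (simp add: abs_le_iff)
      qed
      show False
      proof (cases "i = i0")
        case True
        then have "j \<noteq> i0" using ij by simp
        then show False using two[OF i0(1) iR(2)] i0(2) big(2) by simp
      next
        case False
        then show False using two[OF i0(1) iR(1)] i0(2) big(1) by simp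
      qed
    qed
  qed
qed

end

section \<open>The configuration model\<close>

lemma partial_matchingD:
  assumes "partial_matching X E"
  shows "e \<in> E \<Longrightarrow> e \<subseteq> X" "e \<in> E \<Longrightarrow> card e = 2" "pairwise disjnt E"
  using assms by (simp_all add: partial_matching_def)

lemma perfect_matching_partial: "M \<in> perfect_matchings X \<Longrightarrow> partial_matching X M"
  by (auto simp: perfect_matchings_def partial_matching_def partition_on_def)

lemma perfect_matching_iff: "M \<in> perfect_matchings X \<longleftrightarrow> partial_matching X M \<and> \<Union>M = X"
  by (auto simp: perfect_matchings_def partial_matching_def partition_on_def)

lemma finite_perfect_matchings: "finite X \<Longrightarrow> finite (perfect_matchings X)"
  by (rule finite_subset[of _ "Pow (Pow X)"]) (auto simp: perfect_matchings_def partition_on_def)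

text \<open>The remaining pairs form a perfect matching of the uncovered points, so the probability
  that given pairs are matched becomes a ratio of two counts.\<close>

lemma perfect_matchings_containing:
  assumes F: "partial_matching X F"
  shows "{M \<in> perfect_matchings X. F \<subseteq> M} = (\<lambda>M. F \<union> M) ` perfect_matchings (X - \<Union>F)"
    and "inj_on (\<lambda>M. F \<union> M) (perfect_matchings (X - \<Union>F))"
proof -
  have ne: "e \<noteq> {}" if "partial_matching Y M" "e \<in> M" for e Y and M :: "'a set set"
    using that by (auto simp: partial_matching_def)
  have int: "M \<inter> F = {}" if M: "M \<in> perfect_matchings (X - \<Union>F)" for M
  proof (rule ccontr)
    assume "M \<inter> F \<noteq> {}"
    then obtain e where e: "e \<in> M" "e \<in> F" by blast
    then have "e \<subseteq> X - \<Union>F" using M by (auto simp: perfect_matching_iff)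
    then have "e = {}" using e(2) by blast
    then show False using ne[OF F e(2)] by simp
  qed
  show "inj_on (\<lambda>M. F \<union> M) (perfect_matchings (X - \<Union>F))"
  proof (rule inj_onI)
    fix M M' assume "M \<in> perfect_matchings (X - \<Union>F)" "M' \<in> perfect_matchings (X - \<Union>F)" "F \<union> M = F \<union> M'"
    then show "M = M'" using int[of M] int[of M'] by blast
  qed
  show "{M \<in> perfect_matchings X. F \<subseteq> M} = (\<lambda>M. F \<union> M) ` perfect_matchings (X - \<Union>F)"
  proof (intro equalityI subsetI)
    fix M assume "M \<in> {M \<in> perfect_matchings X. F \<subseteq> M}"
    then have M: "partial_matching X M" "\<Union>M = X" "F \<subseteq> M" by (auto simp: perfect_matching_iff)
    have dj: "e \<inter> \<Union>F = {}" if e: "e \<in> M - F" for e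
    proof -
      have "disjnt e f" if "f \<in> F" for f
        using M(1) e that M(3) unfolding partial_matching_def by (intro pairwiseD[of disjnt M e f]) auto
      then show ?thesis by (auto simp: disjnt_def)
    qed
    have "partial_matching (X - \<Union>F) (M - F)"
      unfolding partial_matching_def
    proof (intro conjI ballI)
      fix e assume e: "e \<in> M - F"
      then show "card e = 2" using M(1) by (simp add: partial_matching_def)
      have "e \<subseteq> X" using M(1) e by (simp add: partial_matching_def)
      then show "e \<subseteq> X - \<Union>F" using dj[OF e] by blast
    next
      have "pairwise disjnt M" using M(1) by (simp add: partial_matching_def)
      then show "pairwise disjnt (M - F)" by (rule pairwise_subset) blast
    qed
    moreover have "\<Union>(M - F) = X - \<Union>F"
    proof (intro equalityI subsetI)
      fix x assume "x \<in> \<Union>(M - F)"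
      then obtain e where "e \<in> M - F" "x \<in> e" by blast
      then show "x \<in> X - \<Union>F" using dj[of e] M(2) by blast
    next
      fix x assume "x \<in> X - \<Union>F"
      then show "x \<in> \<Union>(M - F)" using M(2) by blast
    qed
    ultimately have "M - F \<in> perfect_matchings (X - \<Union>F)" by (simp add: perfect_matching_iff)
    moreover have "M = F \<union> (M - F)" using M(3) by blast
    ultimately show "M \<in> (\<lambda>M. F \<union> M) ` perfect_matchings (X - \<Union>F)"
      by (intro image_eqI[of M _ "M - F"])
  next
    fix M assume "M \<in> (\<lambda>M. F \<union> M) ` perfect_matchings (X - \<Union>F)"
    then obtain M' where MM: "M = F \<union> M'" "M' \<in> perfect_matchings (X - \<Union>F)" by (rule imageE)
    then have M': "M = F \<union> M'" "partial_matching (X - \<Union>F) M'" "\<Union>M' = X - \<Union>F"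
      unfolding perfect_matching_iff by blast+
    have FX: "\<Union>F \<subseteq> X" using F by (auto simp: partial_matching_def)
    have dj: "disjnt e f" if "e \<in> M'" "f \<in> F" for e f
      using that M'(3) by (auto simp: disjnt_def)
    have "partial_matching X M"
      unfolding partial_matching_def
    proof (intro conjI ballI)
      fix e assume "e \<in> M"
      then have "e \<in> F \<or> e \<in> M'" using M'(1) by blast
      then have "e \<subseteq> X \<and> card e = 2"
        using partial_matchingD(1,2)[OF F, of e] partial_matchingD(1,2)[OF M'(2), of e] by blast
      then show "e \<subseteq> X" "card e = 2" by simp_all
    next
      show "pairwise disjnt M"
      proof (rule pairwiseI)
        fix e f assume ef: "e \<in> M" "f \<in> M" "e \<noteq> f"
        have pF: "pairwise disjnt F" and pM: "pairwise disjnt M'"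
          using F M'(2) by (simp_all add: partial_matching_def)
        from ef consider "e \<in> F" "f \<in> F" | "e \<in> F" "f \<in> M'" | "e \<in> M'" "f \<in> F" | "e \<in> M'" "f \<in> M'"
          unfolding M'(1) by blast
        then show "disjnt e f"
        proof cases
          case 1 then show ?thesis using pairwiseD[OF pF] ef by blast
        next
          case 2 then show ?thesis using dj[of f e] by (simp add: disjnt_sym)
        next
          case 3 then show ?thesis using dj by blast
        next
          case 4 then show ?thesis using pairwiseD[OF pM] ef by blast
        qed
      qed
    qed
    moreover have "\<Union>M = X" using M'(1,3) FX by blast
    ultimately show "M \<in> {M \<in> perfect_matchings X. F \<subseteq> M}" using M'(1) by (simp add: perfect_matching_iff)
  qed
qed

text \<open>For even \<open>n\<close> this is \<open>(n - 1)!!\<close>, for odd \<open>n\<close> it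
  is 0: the number of perfect matchings of \<open>n\<close> points, not \<open>n!!\<close>.\<close>

fun double_fact :: "nat \<Rightarrow> nat" where
  "double_fact 0 = 1"
| "double_fact (Suc 0) = 0"
| "double_fact (Suc (Suc n)) = Suc n * double_fact n"

lemma card_perfect_matchings:
  assumes "finite X"
  shows "card (perfect_matchings X) = double_fact (card X)"
  using assms
proof (induction "card X" arbitrary: X rule: double_fact.induct)
  case 1
  then have "X = {}" by simp
  have "M = {}" if "M \<in> perfect_matchings X" for M
  proof (rule ccontr)
    assume "M \<noteq> {}"
    then obtain e where e: "e \<in> M" by blast
    have pm: "partial_matching X M" using that by (rule perfect_matching_partial)
    have "e = {}" using partial_matchingD(1)[OF pm e] \<open>X = {}\<close> by simp
    then show False using partial_matchingD(2)[OF pm e] by simp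
  qed
  moreover have "{} \<in> perfect_matchings X"
    using \<open>X = {}\<close> by (simp add: perfect_matching_iff partial_matching_def)
  ultimately have "perfect_matchings X = {{}}" by blast
  then show ?case using \<open>X = {}\<close> by simp
next
  case 2
  then obtain x where x: "X = {x}" using card_1_singletonE[of X] by auto
  have "perfect_matchings X = {}"
  proof (rule ccontr)
    assume "perfect_matchings X \<noteq> {}"
    then obtain M where M: "M \<in> perfect_matchings X" by blast
    then have pm: "partial_matching X M" and "\<Union>M = X" unfolding perfect_matching_iff by blast+
    then obtain e where "e \<in> M" using x by blast
    then have e: "e \<subseteq> {x}" "card e = 2" using partial_matchingD[OF pm] x by blast+
    have "card e \<le> card {x}" using e(1) by (intro card_mono) auto
    then show False using e(2) by simp
  qed
  then show ?case using x by simp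
next
  case (3 n)
  then have "X \<noteq> {}" by auto
  then obtain x where x: "x \<in> X" by blast
  define A where "A y = {M \<in> perfect_matchings X. {{x, y}} \<subseteq> M}" for y
  have pm1: "partial_matching X {{x, y}}" if "y \<in> X - {x}" for y
    using that x by (auto simp: partial_matching_def)
  have eq: "perfect_matchings X = (\<Union>y\<in>X - {x}. A y)"
  proof (intro equalityI subsetI)
    fix M assume M: "M \<in> perfect_matchings X"
    then have M': "partial_matching X M" "x \<in> \<Union>M" using x by (auto simp: perfect_matching_iff)
    obtain y where y: "{x, y} \<in> M" using partial_matching_obtain[OF M'] .
    then show "M \<in> (\<Union>y\<in>X - {x}. A y)"
      using M partial_matching_edge[OF M'(1) y] by (auto simp: A_def)
  qed (auto simp: A_def)
  have cA: "card (A y) = double_fact n" if y: "y \<in> X - {x}" for y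
  proof -
    have c: "card (X - \<Union>{{x, y}}) = n"
    proof -
      have "card {x, y} = 2" using y by auto
      moreover have "card (X - {x, y}) = card X - card {x, y}"
        using x y by (intro card_Diff_subset) auto
      ultimately show ?thesis using 3(2) by simp
    qed
    have "card (A y) = card (perfect_matchings (X - \<Union>{{x, y}}))"
      unfolding A_def perfect_matchings_containing(1)[OF pm1[OF y]]
      by (rule card_image[OF perfect_matchings_containing(2)[OF pm1[OF y]]])
    also have "\<dots> = double_fact n" using 3(1)[of "X - \<Union>{{x, y}}"] c 3(3) by simp
    finally show ?thesis .
  qed
  have "card (perfect_matchings X) = (\<Sum>y\<in>X - {x}. card (A y))"
    unfolding eq
  proof (rule card_UN_disjoint)
    show "finite (X - {x})" using 3 by simp
    show "\<forall>y\<in>X - {x}. finite (A y)"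
      unfolding A_def using finite_perfect_matchings[OF 3(3)] by simp
    show "\<forall>y\<in>X - {x}. \<forall>y'\<in>X - {x}. y \<noteq> y' \<longrightarrow> A y \<inter> A y' = {}"
    proof (intro ballI impI)
      fix y y' :: 'a assume ne: "y \<noteq> y'"
      have False if M: "M \<in> A y \<inter> A y'" for M
      proof -
        have "partial_matching X M" "{x, y} \<in> M" "{x, y'} \<in> M"
          using M perfect_matching_partial[of M X] by (auto simp: A_def)
        from partial_matching_unique[OF this] show False using ne by simp
      qed
      then show "A y \<inter> A y' = {}" by blast
    qed
  qed
  also have "\<dots> = (card X - 1) * double_fact n" using cA x 3(3) by simp
  also have "card X = Suc (Suc n)" using 3 by simp
  finally show ?case by (simp add: 3(2)[symmetric])
qed

lemma double_fact_pos: "even n \<Longrightarrow> 0 < double_fact n"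
  by (induction n rule: double_fact.induct) auto

lemma double_fact_ratio:
  assumes "even n" "2 * m \<le> n"
  shows "real (double_fact (n - 2 * m)) / real (double_fact n) = (\<Prod>j<m. 1 / (real n - 1 - 2 * real j))"
  using assms
proof (induction m)
  case 0
  then show ?case using double_fact_pos[of n] by simp
next
  case (Suc m)
  define r where "r = n - 2 * Suc m"
  have r: "n - 2 * m = Suc (Suc r)" using Suc.prems by (simp add: r_def)
  have r': "real n - 1 - 2 * real m = real (Suc r)" using Suc.prems by (simp add: r_def of_nat_diff)
  have "real (double_fact (n - 2 * m)) = real (Suc r) * real (double_fact r)"
    unfolding r by (simp only: double_fact.simps of_nat_mult)
  then have "real (double_fact r) / real (double_fact n)
      = real (double_fact (n - 2 * m)) / real (double_fact n) * (1 / real (Suc r))" by simp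
  also have "\<dots> = (\<Prod>j<m. 1 / (real n - 1 - 2 * real j)) * (1 / (real n - 1 - 2 * real m))"
    using Suc by (simp add: r')
  finally show ?case by (simp add: r_def)
qed

lemma card_Union_partial_matching:
  assumes "partial_matching X F" "finite X"
  shows "card (\<Union>F) = 2 * card F"
proof -
  have "card (\<Union>F) = (\<Sum>e\<in>F. card e)"
    using assms by (intro card_Union_disjoint) (auto simp: partial_matching_def finite_subset)
  also have "\<dots> = 2 * card F" using assms by (simp add: partial_matching_def)
  finally show ?thesis .
qed

text \<open>The probability that \<open>m\<close> given disjoint pairs out of \<open>n\<close> half-edges are matched and retained.\<close>

definition wt :: "real \<Rightarrow> nat \<Rightarrow> nat \<Rightarrow> real" where
  "wt p n m = p ^ m * (\<Prod>j<m. 1 / (real n - 1 - 2 * real j))"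

lemma prob_percolation_superset:
  assumes "finite M" "F \<subseteq> M" "0 \<le> p" "p \<le> 1"
  shows "measure_pmf.prob (percolation p M) {E. F \<subseteq> E} = p ^ card F"
proof -
  have "measure_pmf.prob (percolation p M) {E. F \<subseteq> E}
      = measure_pmf.prob (Pi_pmf M False (\<lambda>_. bernoulli_pmf p)) {b. F \<subseteq> {e \<in> M. b e}}"
    unfolding percolation_def by (simp add: vimage_def)
  also have "{b. F \<subseteq> {e \<in> M. b e}} = Pi M (\<lambda>e. if e \<in> F then {True} else UNIV)"
    using assms(2) by (auto simp: Pi_def split: if_splits)
  also have "measure_pmf.prob (Pi_pmf M False (\<lambda>_. bernoulli_pmf p)) \<dots>
      = (\<Prod>e\<in>M. measure_pmf.prob (bernoulli_pmf p) (if e \<in> F then {True} else UNIV))"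
    by (rule measure_Pi_pmf_Pi[OF assms(1)])
  also have "\<dots> = (\<Prod>e\<in>M. if e \<in> F then p else 1)"
    using assms(3,4) by (intro prod.cong refl) (auto simp: measure_pmf_single)
  also have "\<dots> = (\<Prod>e\<in>F. p)"
    using assms(1,2) by (intro prod.mono_neutral_cong_right) auto
  finally show ?thesis by simp
qed

definition edge_model :: "nat \<Rightarrow> nat \<Rightarrow> real \<Rightarrow> half set set pmf" where
  "edge_model N d p = config_model N d \<bind> percolation p"

lemma card_half_edges: "card (half_edges N d) = N * d" "finite (half_edges N d)"
  by (simp_all add: half_edges_def)

lemma config_model_nonempty:
  assumes "even (N * d)"
  shows "perfect_matchings (half_edges N d) \<noteq> {}" "finite (perfect_matchings (half_edges N d))"
proof -
  have "card (perfect_matchings (half_edges N d)) = double_fact (N * d)"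
    using card_perfect_matchings[of "half_edges N d"] card_half_edges by simp
  then show "perfect_matchings (half_edges N d) \<noteq> {}" using double_fact_pos[OF assms] by auto
  show "finite (perfect_matchings (half_edges N d))" by (intro finite_perfect_matchings card_half_edges)
qed

lemma set_percolation: "finite M \<Longrightarrow> set_pmf (percolation p M) \<subseteq> Pow M"
  by (auto simp: percolation_def)

lemma set_edge_model:
  assumes "even (N * d)" "E \<in> set_pmf (edge_model N d p)"
  shows "partial_matching (half_edges N d) E"
proof -
  from assms(2) obtain M where M: "M \<in> set_pmf (config_model N d)" "E \<in> set_pmf (percolation p M)"
    by (auto simp: edge_model_def)
  then have "M \<in> perfect_matchings (half_edges N d)"
    unfolding config_model_def using config_model_nonempty[OF assms(1)] by simp
  then have pm: "partial_matching (half_edges N d) M" by (rule perfect_matching_partial)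
  then have "finite M" using partial_matching_finite card_half_edges by blast
  then have "E \<subseteq> M" using set_percolation[of M p] M(2) by blast
  then show ?thesis using pm partial_matching_subset by blast
qed

lemma finite_edge_model:
  assumes "even (N * d)"
  shows "finite (set_pmf (edge_model N d p))"
proof (rule finite_subset)
  show "set_pmf (edge_model N d p) \<subseteq> Pow (Pow (half_edges N d))"
    using set_edge_model[OF assms] by (auto simp: partial_matching_def)
  show "finite (Pow (Pow (half_edges N d)))" using card_half_edges by simp
qed

text \<open>Given the matching, retention is independent, so the matching probability of the pairs
  is multiplied by a power of \<open>p\<close>. The later moment and union bounds all go back to
  this formula.\<close>

lemma prob_edges_present:
  assumes ev: "even (N * d)" and F: "partial_matching (half_edges N d) F" and p: "0 \<le> p" "p \<le> 1"
  shows "measure_pmf.prob (edge_model N d p) {E. F \<subseteq> E} = wt p (N * d) (card F)"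
proof -
  let ?H = "half_edges N d"
  let ?PM = "perfect_matchings ?H"
  note PM = config_model_nonempty[OF ev]
  have finM: "finite M" if "M \<in> ?PM" for M
    using partial_matching_finite[OF perfect_matching_partial[OF that]] card_half_edges by blast
  have fin: "finite (set_pmf (percolation p M))" if "M \<in> ?PM" for M
    using finite_subset[OF set_percolation[OF finM[OF that]]] finM[OF that] by simp
  have UF: "card (\<Union>F) = 2 * card F" using card_Union_partial_matching[OF F] card_half_edges by blast
  have FH: "\<Union>F \<subseteq> ?H" using F by (auto simp: partial_matching_def)
  have le: "2 * card F \<le> N * d"
    using card_mono[OF _ FH] UF card_half_edges by simp
  have "measure_pmf.prob (edge_model N d p) {E. F \<subseteq> E} = measure_pmf.expectation (edge_model N d p) (indicator {E. F \<subseteq> E})"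
    by simp
  also have "\<dots> = (\<Sum>M\<in>?PM. measure_pmf.expectation (percolation p M) (indicator {E. F \<subseteq> E}) /\<^sub>R real (card ?PM))"
    unfolding edge_model_def config_model_def using PM fin by (intro pmf_expectation_bind_pmf_of_set)
  also have "\<dots> = (\<Sum>M\<in>?PM. (if F \<subseteq> M then p ^ card F else 0) / real (card ?PM))"
  proof (intro sum.cong refl)
    fix M assume M: "M \<in> ?PM"
    have "measure_pmf.prob (percolation p M) {E. F \<subseteq> E} = (if F \<subseteq> M then p ^ card F else 0)"
    proof (cases "F \<subseteq> M")
      case True
      then show ?thesis using prob_percolation_superset[OF finM[OF M] True p] by simp
    next
      case False
      have "measure_pmf.prob (percolation p M) {E. F \<subseteq> E} = 0"
        using set_percolation[OF finM[OF M], of p] False by (subst measure_pmf_zero_iff) auto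
      then show ?thesis using False by simp
    qed
    then show "measure_pmf.expectation (percolation p M) (indicator {E. F \<subseteq> E}) /\<^sub>R real (card ?PM)
        = (if F \<subseteq> M then p ^ card F else 0) / real (card ?PM)"
      by (simp add: divide_inverse mult.commute)
  qed
  also have "\<dots> = (\<Sum>M\<in>{M \<in> ?PM. F \<subseteq> M}. p ^ card F / real (card ?PM))"
    using PM(2) by (intro sum.mono_neutral_cong_right) auto
  also have "\<dots> = p ^ card F * (real (card {M \<in> ?PM. F \<subseteq> M}) / real (card ?PM))" by simp
  also have "card {M \<in> ?PM. F \<subseteq> M} = card (perfect_matchings (?H - \<Union>F))"
    unfolding perfect_matchings_containing(1)[OF F]
    by (rule card_image[OF perfect_matchings_containing(2)[OF F]])
  also have "\<dots> = double_fact (N * d - 2 * card F)"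
  proof -
    have "card (?H - \<Union>F) = N * d - 2 * card F"
      using card_Diff_subset[OF finite_subset[OF FH card_half_edges(2)] FH] UF card_half_edges by simp
    then show ?thesis using card_perfect_matchings[of "?H - \<Union>F"] card_half_edges(2) by simp
  qed
  also have "card ?PM = double_fact (N * d)"
    using card_perfect_matchings[OF card_half_edges(2)] card_half_edges(1) by simp
  also have "real (double_fact (N * d - 2 * card F)) / real (double_fact (N * d)) = (\<Prod>j<card F. 1 / (real (N * d) - 1 - 2 * real j))"
    by (rule double_fact_ratio[OF ev le])
  finally show ?thesis by (simp add: wt_def)
qed

lemma prob_edges_present_le:
  assumes ev: "even (N * d)" and p: "0 \<le> p" "p \<le> 1"
  shows "measure_pmf.prob (edge_model N d p) {E. F \<subseteq> E}
    = (if partial_matching (half_edges N d) F then wt p (N * d) (card F) else 0)"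
proof (cases "partial_matching (half_edges N d) F")
  case True
  then show ?thesis using prob_edges_present[OF ev True p] by simp
next
  case False
  have "measure_pmf.prob (edge_model N d p) {E. F \<subseteq> E} = 0"
    using set_edge_model[OF ev, of _ p] False partial_matching_subset by (subst measure_pmf_zero_iff) blast
  then show ?thesis using False by simp
qed

section \<open>Tangles\<close>

text \<open>In contrast to \<open>nb_walk\<close> the end is only a vertex and nothing is required
  of a continuation, so paths can be cut into pieces and counted by their ends.\<close>

fun nb_path :: "half set set \<Rightarrow> step list \<Rightarrow> nat \<Rightarrow> bool" where
  "nb_path \<Gamma> [] v \<longleftrightarrow> True"
| "nb_path \<Gamma> [s] v \<longleftrightarrow> step_edge s \<in> \<Gamma> \<and> fst (snd s) = v"
| "nb_path \<Gamma> (s # t # \<gamma>) v \<longleftrightarrow> step_edge s \<in> \<Gamma> \<and> follows s (fst t) \<and> nb_path \<Gamma> (t # \<gamma>) v"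

fun origin :: "step list \<Rightarrow> nat \<Rightarrow> nat" where
  "origin [] v = v"
| "origin (s # \<gamma>) v = fst (fst s)"

definition paths :: "half set set \<Rightarrow> nat \<Rightarrow> nat \<Rightarrow> nat \<Rightarrow> step list set" where
  "paths \<Gamma> n u v = {\<gamma>. length \<gamma> = n \<and> nb_path \<Gamma> \<gamma> v \<and> origin \<gamma> v = u}"

text \<open>In terms of components: each contains at most one cycle, loops and double edges counting
  as cycles.\<close>

definition hereditarily_sparse :: "half set set \<Rightarrow> bool" where
  "hereditarily_sparse \<Gamma> \<longleftrightarrow> (\<forall>F\<subseteq>\<Gamma>. card F \<le> card (fst ` \<Union>F))"

lemma nb_path_edges: "nb_path \<Gamma> \<gamma> v \<Longrightarrow> s \<in> set \<gamma> \<Longrightarrow> step_edge s \<in> \<Gamma>"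
  by (induction \<Gamma> \<gamma> v rule: nb_path.induct) auto

lemma nb_path_mono: "nb_path \<Gamma> \<gamma> v \<Longrightarrow> (\<And>s. s \<in> set \<gamma> \<Longrightarrow> step_edge s \<in> \<Gamma>') \<Longrightarrow> nb_path \<Gamma>' \<gamma> v"
  by (induction \<Gamma> \<gamma> v rule: nb_path.induct) auto

lemma nb_path_Cons: "nb_path \<Gamma> (s # \<gamma>) v \<longleftrightarrow> step_edge s \<in> \<Gamma> \<and> fst (snd s) = origin \<gamma> v \<and>
    (\<gamma> \<noteq> [] \<longrightarrow> snd s \<noteq> fst (hd \<gamma>)) \<and> nb_path \<Gamma> \<gamma> v"
  by (cases \<gamma>) (auto simp: follows_def)

lemma nb_path_append: "nb_path \<Gamma> (\<gamma> @ \<gamma>') v \<Longrightarrow> nb_path \<Gamma> \<gamma> (origin \<gamma>' v) \<and> nb_path \<Gamma> \<gamma>' v"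
proof (induction \<gamma>)
  case (Cons s \<gamma>)
  then show ?case by (cases \<gamma>) (auto simp: nb_path_Cons)
qed auto

lemma origin_append: "origin (\<gamma> @ \<gamma>') v = origin \<gamma> (origin \<gamma>' v)"
  by (cases \<gamma>) auto

lemma nb_walk_path: "nb_walk \<Gamma> \<gamma> z \<Longrightarrow> nb_path \<Gamma> \<gamma> (fst z)"
proof (induction \<gamma>)
  case (Cons s \<gamma>)
  then show ?case by (cases \<gamma>) (auto simp: nb_path_Cons follows_def)
qed auto

lemma step_half_edges:
  assumes "partial_matching X \<Gamma>" "step_edge s \<in> \<Gamma>"
  shows "fst s \<in> \<Union>\<Gamma>" "snd s \<in> \<Union>\<Gamma>" "s = (fst s, mate \<Gamma> (fst s))" "fst s \<noteq> snd s" "fst s \<in> X" "snd s \<in> X"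
proof -
  have e: "{fst s, snd s} \<in> \<Gamma>" using assms(2) by (simp add: step_edge_def)
  then show "fst s \<in> \<Union>\<Gamma>" "snd s \<in> \<Union>\<Gamma>" by auto
  show "s = (fst s, mate \<Gamma> (fst s))" using mate_eq[OF assms(1) e] by (simp add: prod_eq_iff)
  show "fst s \<noteq> snd s" "fst s \<in> X" "snd s \<in> X" using partial_matching_edge[OF assms(1) e] by auto
qed

lemma finite_nb_paths:
  assumes "partial_matching X \<Gamma>" "finite X"
  shows "finite {\<gamma>. length \<gamma> = n \<and> nb_path \<Gamma> \<gamma> v}"
proof (rule finite_subset)
  show "{\<gamma>. length \<gamma> = n \<and> nb_path \<Gamma> \<gamma> v} \<subseteq> {\<gamma>. set \<gamma> \<subseteq> X \<times> X \<and> length \<gamma> = n}"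
  proof
    fix \<gamma> assume "\<gamma> \<in> {\<gamma>. length \<gamma> = n \<and> nb_path \<Gamma> \<gamma> v}"
    then have g: "length \<gamma> = n" "nb_path \<Gamma> \<gamma> v" by simp_all
    have "s \<in> X \<times> X" if "s \<in> set \<gamma>" for s
      using step_half_edges(5,6)[OF assms(1) nb_path_edges[OF g(2) that]] by (simp add: mem_Times_iff)
    then show "\<gamma> \<in> {\<gamma>. set \<gamma> \<subseteq> X \<times> X \<and> length \<gamma> = n}" using g(1) by blast
  qed
  show "finite {\<gamma>. set \<gamma> \<subseteq> X \<times> X \<and> length \<gamma> = n}"
    using finite_lists_length_eq[of "X \<times> X" n] assms(2) by simp
qed

lemma finite_paths:
  assumes "partial_matching X \<Gamma>" "finite X"
  shows "finite (paths \<Gamma> n u v)"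
  by (rule finite_subset[OF _ finite_nb_paths[OF assms, of n v]]) (auto simp: paths_def)

lemma sum_card_fibres:
  assumes "finite A"
  shows "card A = (\<Sum>v\<in>f ` A. card {x \<in> A. f x = v})"
  using card_eq_sum[of A] sum.image_gen[OF assms, of "\<lambda>_. 1::nat" f] by simp

text \<open>At a vertex with two half-edges, a walk that has arrived through one must leave through
  the other, so the first half-edge and the length fix everything.\<close>

lemma two_regular_deterministic:
  assumes pm: "partial_matching X \<Gamma>" and fin: "finite X"
    and deg: "\<And>w. w \<in> fst ` \<Union>\<Gamma> \<Longrightarrow> card {x \<in> \<Union>\<Gamma>. fst x = w} = 2"
    and "nb_path \<Gamma> \<gamma> v" "nb_path \<Gamma> \<gamma>' v" "length \<gamma> = length \<gamma>'" "\<gamma> \<noteq> []" "fst (hd \<gamma>) = fst (hd \<gamma>')"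
  shows "\<gamma> = \<gamma>'"
  using assms(4-)
proof (induction \<gamma> arbitrary: \<gamma>')
  case Nil
  then show ?case by simp
next
  case (Cons s \<gamma>)
  then obtain s' \<delta> where g': "\<gamma>' = s' # \<delta>" by (cases \<gamma>') auto
  have e: "step_edge s \<in> \<Gamma>" "step_edge s' \<in> \<Gamma>" using Cons.prems g' by (auto simp: nb_path_Cons)
  have ss: "s = s'"
    using step_half_edges(3)[OF pm e(1)] step_half_edges(3)[OF pm e(2)] Cons.prems(5) g' by simp
  show ?case
  proof (cases "\<gamma> = []")
    case True
    then show ?thesis using Cons.prems(3) g' ss by simp
  next
    case False
    then have "\<delta> \<noteq> []" using Cons.prems(3) g' by auto
    define A where "A = {x \<in> \<Union>\<Gamma>. fst x = fst (snd s)}"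
    have sA: "snd s \<in> A" using step_half_edges(2)[OF pm e(1)] by (simp add: A_def)
    then have "fst (snd s) \<in> fst ` \<Union>\<Gamma>" unfolding A_def by blast
    then have "card A = 2" using deg unfolding A_def by simp
    have h1: "fst (hd \<gamma>) \<in> A" "fst (hd \<gamma>) \<noteq> snd s"
    proof -
      obtain t \<gamma>2 where t: "\<gamma> = t # \<gamma>2" using False by (cases \<gamma>) auto
      have "step_edge t \<in> \<Gamma>" "fst (snd s) = fst (fst t)" "snd s \<noteq> fst t"
        using Cons.prems(1) unfolding t nb_path_Cons by auto
      then show "fst (hd \<gamma>) \<in> A" "fst (hd \<gamma>) \<noteq> snd s"
        using step_half_edges(1)[OF pm] t by (simp_all add: A_def)
    qed
    have h2: "fst (hd \<delta>) \<in> A" "fst (hd \<delta>) \<noteq> snd s"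
    proof -
      obtain t \<gamma>2 where t: "\<delta> = t # \<gamma>2" using \<open>\<delta> \<noteq> []\<close> by (cases \<delta>) auto
      have "step_edge t \<in> \<Gamma>" "fst (snd s) = fst (fst t)" "snd s \<noteq> fst t"
        using Cons.prems(2) unfolding g' t nb_path_Cons ss by auto
      then show "fst (hd \<delta>) \<in> A" "fst (hd \<delta>) \<noteq> snd s"
        using step_half_edges(1)[OF pm] t by (simp_all add: A_def)
    qed
    have "fst (hd \<gamma>) = fst (hd \<delta>)"
    proof (rule ccontr)
      assume ne: "fst (hd \<gamma>) \<noteq> fst (hd \<delta>)"
      have "finite A" using \<open>card A = 2\<close> by (simp add: card_ge_0_finite)
      then have "card {snd s, fst (hd \<gamma>), fst (hd \<delta>)} \<le> card A"
        using sA h1 h2 by (intro card_mono) auto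
      moreover have "card {snd s, fst (hd \<gamma>), fst (hd \<delta>)} = 3" using ne h1(2) h2(2) by auto
      ultimately show False using \<open>card A = 2\<close> by simp
    qed
    moreover have "nb_path \<Gamma> \<gamma> v" "nb_path \<Gamma> \<delta> v" using Cons.prems(1,2) g' by (simp_all add: nb_path_Cons)
    ultimately have "\<gamma> = \<delta>" using Cons.IH[of \<delta>] False Cons.prems(3) g' by simp
    then show ?thesis using g' ss by simp
  qed
qed

lemma hereditarily_sparse_subset: "hereditarily_sparse \<Gamma> \<Longrightarrow> \<Gamma>' \<subseteq> \<Gamma> \<Longrightarrow> hereditarily_sparse \<Gamma>'"
  unfolding hereditarily_sparse_def by simp

text \<open>Handshaking: the degrees sum to \<open>2 * card \<Gamma>\<close>, at most twice the
  number of vertices, so minimal degree 2 leaves no slack.\<close>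

lemma two_regular_of_count:
  assumes pm: "partial_matching X \<Gamma>" and fin: "finite X"
    and count: "card \<Gamma> \<le> card (fst ` \<Union>\<Gamma>)"
    and ge: "\<And>v. v \<in> fst ` \<Union>\<Gamma> \<Longrightarrow> 2 \<le> card {x \<in> \<Union>\<Gamma>. fst x = v}"
    and w: "w \<in> fst ` \<Union>\<Gamma>"
  shows "card {x \<in> \<Union>\<Gamma>. fst x = w} = 2"
proof (rule ccontr)
  let ?h = "\<lambda>v. card {x \<in> \<Union>\<Gamma>. fst x = v}"
  have finU: "finite (\<Union>\<Gamma>)" using partial_matchingD(1)[OF pm] by (intro finite_subset[OF _ fin]) blast
  have "(\<Sum>v\<in>fst ` \<Union>\<Gamma>. ?h v) = 2 * card \<Gamma>"
    using sum_card_fibres[OF finU, of fst] card_Union_partial_matching[OF pm fin] by simp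
  also have "\<dots> \<le> (\<Sum>v\<in>fst ` \<Union>\<Gamma>. 2)" using count by simp
  finally have le: "(\<Sum>v\<in>fst ` \<Union>\<Gamma>. ?h v) \<le> (\<Sum>v\<in>fst ` \<Union>\<Gamma>. 2)" .
  assume "?h w \<noteq> 2"
  then have "2 < ?h w" using ge[OF w] by simp
  then have "(\<Sum>v\<in>fst ` \<Union>\<Gamma>. 2) < (\<Sum>v\<in>fst ` \<Union>\<Gamma>. ?h v)"
  proof (intro sum_strict_mono_ex1)
    show "finite (fst ` \<Union>\<Gamma>)" using finU by (rule finite_imageI)
    show "\<forall>x\<in>fst ` \<Union>\<Gamma>. 2 \<le> ?h x" using ge by (rule ballI)
    show "\<exists>x\<in>fst ` \<Union>\<Gamma>. 2 < ?h x" using w \<open>2 < ?h w\<close> by (rule bexI[rotated])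
  qed
  then show False using le by simp
qed

text \<open>Vertices of degree one can only be visited at the ends of a nonbacktracking walk, so they can be
  stripped; what remains is two-regular, and there a walk is determined by its first half-edge.\<close>

lemma card_paths_le_2:
  assumes "partial_matching X \<Gamma>" "finite X" "hereditarily_sparse \<Gamma>"
  shows "card (paths \<Gamma> n u v) \<le> 2"
  using assms
proof (induction "card \<Gamma>" arbitrary: \<Gamma> n u v rule: less_induct)
  case less
  note pm = less.prems(1) and fin = less.prems(2) and sparse = less.prems(3)
  have finG: "finite \<Gamma>" using partial_matching_finite[OF pm fin] .
  have UX: "\<Union>\<Gamma> \<subseteq> X" using partial_matchingD(1)[OF pm] by blast
  have finU: "finite (\<Union>\<Gamma>)" using UX fin by (rule finite_subset)
  define half where "half w = {x \<in> \<Union>\<Gamma>. fst x = w}" for w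
  have finh: "finite (half w)" for w unfolding half_def by (rule finite_subset[OF _ finU]) blast
  show ?case
  proof (cases "\<exists>w\<in>fst ` \<Union>\<Gamma>. card (half w) = 1")
    case True
    then obtain w where w: "card (half w) = 1" by blast
    then obtain h where h: "half w = {h}" using card_1_singletonE by blast
    then have hU: "h \<in> \<Union>\<Gamma>" "fst h = w" by (auto simp: half_def)
    define h' where "h' = mate \<Gamma> h"
    define e where "e = {h, h'}"
    define \<Gamma>' where "\<Gamma>' = \<Gamma> - {e}"
    have e: "e \<in> \<Gamma>" unfolding e_def h'_def by (rule mate_edge[OF pm hU(1)])
    have only_h: "x = h" if "x \<in> \<Union>\<Gamma>" "fst x = w" for x
    proof -
      have "x \<in> half w" using that by (simp add: half_def)
      then show ?thesis using h by simp
    qed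
    have h'w: "fst h' \<noteq> w"
    proof
      assume "fst h' = w"
      then have "h' = h" using only_h[of h'] e by (auto simp: e_def)
      then show False using partial_matching_edge(1)[OF pm, of h h'] e by (simp add: e_def)
    qed
    have e_step: "s = (h, h') \<or> s = (h', h)" if "step_edge s = e" for s
      using that by (cases s) (auto simp: step_edge_def e_def doubleton_eq_iff)
    have c\<Gamma>': "card \<Gamma>' < card \<Gamma>" unfolding \<Gamma>'_def using e finG by (intro psubset_card_mono) auto
    have IH: "card (paths \<Gamma>' n u v) \<le> 2" for n u v
      using less.hyps[OF c\<Gamma>'] partial_matching_subset[OF pm] fin hereditarily_sparse_subset[OF sparse]
      by (simp add: \<Gamma>'_def)
    have pm': "partial_matching X \<Gamma>'" unfolding \<Gamma>'_def by (rule partial_matching_subset[OF pm]) blast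
    \<comment> \<open>To leave \<open>w\<close> through \<open>h\<close> after the first step, the
      walk must have arrived at \<open>w\<close>, hence through its only half-edge \<open>h\<close>,
      and that is a backtrack.\<close>
    have tail: "\<forall>t\<in>set \<gamma>. fst t \<noteq> h" if "nb_path \<Gamma> (s # \<gamma>) v" for s \<gamma> v
      using that
    proof (induction \<gamma> arbitrary: s)
      case (Cons t \<gamma>)
      have st: "step_edge s \<in> \<Gamma>" "fst (snd s) = fst (fst t)" "snd s \<noteq> fst t" "nb_path \<Gamma> (t # \<gamma>) v"
        using Cons.prems by (auto simp: nb_path_Cons)
      have "fst t \<noteq> h"
      proof
        assume th: "fst t = h"
        then have "snd s = h" using only_h[OF step_half_edges(2)[OF pm st(1)]] st(2) hU(2) by simp
        then show False using st(3) th by simp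
      qed
      then show ?case using Cons.IH[OF st(4)] by simp
    qed simp
    \<comment> \<open>Symmetrically, entering \<open>w\<close> through \<open>h\<close> is possible
      in the last step only, since every continuation would leave through \<open>h\<close>
      again.\<close>
    have front: "snd s \<noteq> h" if sg: "nb_path \<Gamma> (s # \<gamma>) v" "\<gamma> \<noteq> []" for s \<gamma> v
    proof
      assume sh: "snd s = h"
      obtain t \<delta> where t: "\<gamma> = t # \<delta>" using sg(2) by (cases \<gamma>) auto
      have st: "step_edge t \<in> \<Gamma>" "fst (snd s) = fst (fst t)" "snd s \<noteq> fst t"
        using sg(1) unfolding t nb_path_Cons by auto
      then have "fst t = h" using only_h[OF step_half_edges(1)[OF pm st(1)]] sh hU(2) by simp
      then show False using st(3) sh by simp
    qed
    have no_enter: "\<forall>t\<in>set \<gamma>. snd t \<noteq> h" if "nb_path \<Gamma> \<gamma> v" "v \<noteq> w" for \<gamma> v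
      using that(1)
    proof (induction \<gamma>)
      case (Cons s \<gamma>)
      have p: "nb_path \<Gamma> \<gamma> v" "fst (snd s) = origin \<gamma> v" using Cons.prems by (auto simp: nb_path_Cons)
      have "snd s \<noteq> h"
      proof (cases "\<gamma> = []")
        case True
        then show ?thesis using p(2) that(2) hU(2) by auto
      next
        case False
        then show ?thesis using front[OF Cons.prems] by simp
      qed
      then show ?case using Cons.IH p(1) by simp
    qed simp
    have no_leave: "\<forall>t\<in>set \<gamma>. fst t \<noteq> h" if "nb_path \<Gamma> \<gamma> v" "origin \<gamma> v \<noteq> w" for \<gamma> v
      using that tail hU(2) by (cases \<gamma>) auto
    have clean: "nb_path \<Gamma>' \<gamma> v" if p: "nb_path \<Gamma> \<gamma> v" and a: "\<forall>t\<in>set \<gamma>. fst t \<noteq> h" and b: "\<forall>t\<in>set \<gamma>. snd t \<noteq> h" for \<gamma> v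
    proof (rule nb_path_mono[OF p])
      fix s assume s: "s \<in> set \<gamma>"
      have "step_edge s \<noteq> e" using e_step[of s] bspec[OF a s] bspec[OF b s] by auto
      then show "step_edge s \<in> \<Gamma>'" using nb_path_edges[OF p s] by (simp add: \<Gamma>'_def)
    qed
    have A: "card (paths \<Gamma> n u v) \<le> 2" if "u \<noteq> w" "v \<noteq> w" for n u v
    proof -
      have "paths \<Gamma> n u v \<subseteq> paths \<Gamma>' n u v"
        unfolding paths_def using clean no_leave no_enter that by blast
      then have "card (paths \<Gamma> n u v) \<le> card (paths \<Gamma>' n u v)"
        using finite_paths[OF pm' fin] by (rule card_mono[rotated])
      then show ?thesis using IH[of n u v] by simp
    qed
    \<comment> \<open>A path that ends at \<open>w\<close> has the forced last step
      \<open>(h', h)\<close>; without it, it avoids the stripped edge.\<close>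
    have D: "card (paths \<Gamma> n u w) \<le> 2" if uw: "u \<noteq> w" for n u
    proof (cases n)
      case 0
      then have "paths \<Gamma> n u w = {}" using uw by (auto simp: paths_def)
      then show ?thesis by simp
    next
      case (Suc m)
      have "paths \<Gamma> n u w \<subseteq> (\<lambda>\<gamma>. \<gamma> @ [(h', h)]) ` paths \<Gamma>' m u (fst h')"
      proof
        fix \<gamma> assume "\<gamma> \<in> paths \<Gamma> n u w"
        then have g: "length \<gamma> = Suc m" "nb_path \<Gamma> \<gamma> w" "origin \<gamma> w = u" using Suc by (simp_all add: paths_def)
        then obtain \<delta> s where \<delta>: "\<gamma> = \<delta> @ [s]" by (cases \<gamma> rule: rev_cases) auto
        have ps: "nb_path \<Gamma> \<delta> (fst (fst s))" "step_edge s \<in> \<Gamma>" "fst (snd s) = w"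
          using nb_path_append[of \<Gamma> \<delta> "[s]" w] g(2) \<delta> by auto
        have "snd s = h" using only_h[OF step_half_edges(2)[OF pm ps(2)] ps(3)] .
        then have "{fst s, h} \<in> \<Gamma>" using ps(2) by (simp add: step_edge_def)
        then have "{h, fst s} \<in> \<Gamma>" by (simp add: insert_commute)
        then have fs: "fst s = h'" unfolding h'_def using mate_eq[OF pm] by simp
        have s: "s = (h', h)" using fs \<open>snd s = h\<close> by (simp add: prod_eq_iff)
        have nl: "\<forall>t\<in>set \<gamma>. fst t \<noteq> h" using no_leave[OF g(2)] g(3) uw by simp
        have p\<delta>: "nb_path \<Gamma> \<delta> (fst h')" using ps(1) fs by simp
        have "\<forall>t\<in>set \<delta>. snd t \<noteq> h" using no_enter[OF p\<delta> h'w] .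
        then have "nb_path \<Gamma>' \<delta> (fst h')" using clean[OF p\<delta>] nl \<delta> by simp
        moreover have "origin \<delta> (fst h') = u" using g(3) unfolding \<delta> origin_append s by simp
        moreover have "length \<delta> = m" using g(1) \<delta> by simp
        ultimately show "\<gamma> \<in> (\<lambda>\<gamma>. \<gamma> @ [(h', h)]) ` paths \<Gamma>' m u (fst h')"
          unfolding \<delta> s by (intro imageI) (simp add: paths_def)
      qed
      then have "card (paths \<Gamma> n u w) \<le> card (paths \<Gamma>' m u (fst h'))"
        by (rule surj_card_le[OF finite_paths[OF pm' fin]])
      then show ?thesis using IH[of m u "fst h'"] by simp
    qed
    have AD: "card (paths \<Gamma> n u v) \<le> 2" if "u \<noteq> w" for n u v
      using A[OF that, of v] D[OF that] by (cases "v = w") auto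
    show ?thesis
    proof (cases "u = w")
      case False
      then show ?thesis by (rule AD)
    next
      case True
      show ?thesis
      proof (cases n)
        case 0
        then have "paths \<Gamma> n u v \<subseteq> {[]}" by (auto simp: paths_def)
        then have "card (paths \<Gamma> n u v) \<le> card {[] :: step list}" by (intro card_mono) auto
        then show ?thesis by simp
      next
        case (Suc m)
        \<comment> \<open>A path that starts at \<open>w\<close> has the forced first step
          \<open>(h, h')\<close>. The rest begins away from \<open>w\<close> but may return to end
          there, so it is counted in \<open>\<Gamma>\<close> through \<open>AD\<close> and not in
          \<open>\<Gamma>'\<close>.\<close>
        have "paths \<Gamma> n u v \<subseteq> (\<lambda>\<gamma>. (h, h') # \<gamma>) ` paths \<Gamma> m (fst h') v"
        proof
          fix \<gamma> assume "\<gamma> \<in> paths \<Gamma> n u v"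
          then have g: "length \<gamma> = Suc m" "nb_path \<Gamma> \<gamma> v" "origin \<gamma> v = w" using Suc True by (simp_all add: paths_def)
          then obtain s \<delta> where \<delta>: "\<gamma> = s # \<delta>" by (cases \<gamma>) auto
          have ps: "nb_path \<Gamma> \<delta> v" "step_edge s \<in> \<Gamma>" "fst (snd s) = origin \<delta> v" "fst (fst s) = w"
            using g(2,3) unfolding \<delta> by (auto simp: nb_path_Cons)
          have "fst s = h" using only_h[OF step_half_edges(1)[OF pm ps(2)] ps(4)] .
          then have s: "s = (h, h')" using step_half_edges(3)[OF pm ps(2)] by (simp add: h'_def)
          have "\<delta> \<in> paths \<Gamma> m (fst h') v" using ps g(1) \<delta> s by (simp add: paths_def)
          then show "\<gamma> \<in> (\<lambda>\<gamma>. (h, h') # \<gamma>) ` paths \<Gamma> m (fst h') v" unfolding \<delta> s by (rule imageI)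
        qed
        then have "card (paths \<Gamma> n u v) \<le> card (paths \<Gamma> m (fst h') v)"
          by (rule surj_card_le[OF finite_paths[OF pm fin]])
        then show ?thesis using AD[OF h'w, of m v] by simp
      qed
    qed
  next
    case False
    have "card (half w) = 2" if wV: "w \<in> fst ` \<Union>\<Gamma>" for w
    proof -
      have ge: "2 \<le> card (half x)" if xV: "x \<in> fst ` \<Union>\<Gamma>" for x
      proof -
        obtain y where "x = fst y" "y \<in> \<Union>\<Gamma>" using xV by (rule imageE)
        then have "y \<in> half x" unfolding half_def by simp
        then have "half x \<noteq> {}" by blast
        then have "card (half x) \<noteq> 0" using finh by simp
        moreover have "card (half x) \<noteq> 1" using False xV by blast
        ultimately show ?thesis by linarith
      qed
      have "card \<Gamma> \<le> card (fst ` \<Union>\<Gamma>)" using sparse unfolding hereditarily_sparse_def by simp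
      then show ?thesis unfolding half_def
        by (rule two_regular_of_count[OF pm fin _ _ wV]) (rule ge[unfolded half_def])
    qed
    then have deg: "card {x \<in> \<Union>\<Gamma>. fst x = w} = 2" if "w \<in> fst ` \<Union>\<Gamma>" for w
      using that by (simp add: half_def)
    show ?thesis
    proof (cases "n = 0")
      case True
      then have "paths \<Gamma> n u v \<subseteq> {[]}" by (auto simp: paths_def)
      then have "card (paths \<Gamma> n u v) \<le> card {[] :: step list}" by (intro card_mono) auto
      then show ?thesis by simp
    next
      case n: False
      \<comment> \<open>The bound 2 is the number of half-edges at \<open>u\<close>: in the stripped
        graph each determines at most one path of length \<open>n\<close>.\<close>
      have "inj_on (\<lambda>\<gamma>. fst (hd \<gamma>)) (paths \<Gamma> n u v)"
      proof (rule inj_onI)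
        fix \<gamma> \<gamma>' assume "\<gamma> \<in> paths \<Gamma> n u v" "\<gamma>' \<in> paths \<Gamma> n u v" "fst (hd \<gamma>) = fst (hd \<gamma>')"
        then show "\<gamma> = \<gamma>'" using n
          by (intro two_regular_deterministic[OF pm fin deg, of \<gamma> v \<gamma>']) (auto simp: paths_def)
      qed
      moreover have img: "(\<lambda>\<gamma>. fst (hd \<gamma>)) ` paths \<Gamma> n u v \<subseteq> half u"
      proof
        fix x assume "x \<in> (\<lambda>\<gamma>. fst (hd \<gamma>)) ` paths \<Gamma> n u v"
        then obtain \<gamma> where g: "\<gamma> \<in> paths \<Gamma> n u v" "x = fst (hd \<gamma>)" by blast
        then obtain s \<delta> where s: "\<gamma> = s # \<delta>" using n by (cases \<gamma>) (auto simp: paths_def)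
        have "step_edge s \<in> \<Gamma>" "fst (fst s) = u" using g s by (auto simp: paths_def nb_path_Cons)
        then show "x \<in> half u" using g(2) s step_half_edges(1)[OF pm] by (simp add: half_def)
      qed
      ultimately have "card (paths \<Gamma> n u v) \<le> card (half u)"
        using finh by (intro card_inj_on_le)
      also have "\<dots> \<le> 2"
      proof (cases "half u = {}")
        case True
        then show ?thesis by simp
      next
        case False
        then obtain y where "y \<in> half u" by blast
        then have "y \<in> \<Union>\<Gamma>" "u = fst y" unfolding half_def by simp_all
        then have "u \<in> fst ` \<Union>\<Gamma>" by (intro image_eqI)
        then show ?thesis using deg by (simp add: half_def)
      qed
      finally show ?thesis .
    qed
  qed
qed

text \<open>The local form of \<open>hereditarily_sparse\<close>. Only small vertex sets are
  constrained, because \<open>prob_tangle\<close> gives a useful bound only as long as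
  \<open>m\<close> is at most a small multiple of \<open>ln N\<close>.\<close>

definition tangle_free :: "nat \<Rightarrow> half set set \<Rightarrow> bool" where
  "tangle_free m E \<longleftrightarrow> (\<forall>S. finite S \<longrightarrow> S \<noteq> {} \<longrightarrow> card S \<le> m \<longrightarrow> card {e \<in> E. fst ` e \<subseteq> S} \<le> card S)"

lemma tangle_free_subset:
  assumes "tangle_free m E" "F \<subseteq> E" "finite E"
  shows "tangle_free m F"
  unfolding tangle_free_def
proof (intro allI impI)
  fix S :: "nat set" assume S: "finite S" "S \<noteq> {}" "card S \<le> m"
  have "card {e \<in> F. fst ` e \<subseteq> S} \<le> card {e \<in> E. fst ` e \<subseteq> S}"
  proof (rule card_mono)
    show "finite {e \<in> E. fst ` e \<subseteq> S}" using assms(3) by simp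
    show "{e \<in> F. fst ` e \<subseteq> S} \<subseteq> {e \<in> E. fst ` e \<subseteq> S}" using assms(2) by blast
  qed
  also have "\<dots> \<le> card S" using assms(1) S by (simp add: tangle_free_def)
  finally show "card {e \<in> F. fst ` e \<subseteq> S} \<le> card S" .
qed

lemma path_vertices:
  assumes "nb_path \<Gamma> \<gamma> v"
  shows "fst ` \<Union>(step_edge ` set \<gamma>) \<subseteq> insert (origin \<gamma> v) ((\<lambda>s. fst (snd s)) ` set \<gamma>)"
  using assms
proof (induction \<gamma>)
  case (Cons s \<gamma>)
  have "fst (snd s) = origin \<gamma> v" "nb_path \<Gamma> \<gamma> v" using Cons.prems by (auto simp: nb_path_Cons)
  then show ?case using Cons.IH by (auto simp: step_edge_def)
qed simp

text \<open>Three paths with common ends would live on at most \<open>3 * (n + 1)\<close> vertices,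
  so their union would be hereditarily sparse and yet carry three paths.\<close>

lemma tangle_free_paths:
  assumes tf: "tangle_free m E" and pm: "partial_matching X E" "finite X" and n: "3 * (n + 1) \<le> m"
  shows "card (paths E n u v) \<le> 2"
proof (rule ccontr)
  assume "\<not> ?thesis"
  then have "3 \<le> card (paths E n u v)" by simp
  then obtain P where P: "P \<subseteq> paths E n u v" "card P = 3" using obtain_subset_with_card_n by metis
  have finP: "finite P" using P(2) by (simp add: card_ge_0_finite)
  define F where "F = (\<Union>\<gamma>\<in>P. step_edge ` set \<gamma>)"
  have FE: "F \<subseteq> E" using P(1) nb_path_edges unfolding F_def paths_def by blast
  have finE: "finite E" using partial_matching_finite[OF pm] .
  have vert: "card (fst ` \<Union>(step_edge ` set \<gamma>)) \<le> n + 1" if "\<gamma> \<in> P" for \<gamma>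
  proof -
    have g: "nb_path E \<gamma> v" "length \<gamma> = n" using P(1) that by (auto simp: paths_def)
    have "card (fst ` \<Union>(step_edge ` set \<gamma>)) \<le> card (insert (origin \<gamma> v) ((\<lambda>s. fst (snd s)) ` set \<gamma>))"
      using path_vertices[OF g(1)] by (intro card_mono) auto
    also have "\<dots> \<le> Suc (card ((\<lambda>s. fst (snd s)) ` set \<gamma>))" by (rule card_insert_le_m1) auto
    also have "card ((\<lambda>s. fst (snd s)) ` set \<gamma>) \<le> length \<gamma>"
      using card_image_le[of "set \<gamma>" "\<lambda>s. fst (snd s)"] card_length[of \<gamma>] by simp
    finally show ?thesis using g(2) by simp
  qed
  have small: "card (fst ` \<Union>F) \<le> m"
  proof -
    have "fst ` \<Union>F = (\<Union>\<gamma>\<in>P. fst ` \<Union>(step_edge ` set \<gamma>))" unfolding F_def by blast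
    then have "card (fst ` \<Union>F) \<le> (\<Sum>\<gamma>\<in>P. card (fst ` \<Union>(step_edge ` set \<gamma>)))"
      using card_UN_le[OF finP, of "\<lambda>\<gamma>. fst ` \<Union>(step_edge ` set \<gamma>)"] by simp
    also have "\<dots> \<le> (\<Sum>\<gamma>\<in>P. n + 1)" using vert by (rule sum_mono)
    also have "\<dots> \<le> m" using P(2) n by simp
    finally show ?thesis .
  qed
  have finF: "finite F" using FE finE by (rule finite_subset)
  have fin2: "finite (\<Union>F)"
    using partial_matchingD(1)[OF pm(1)] FE pm(2) by (intro finite_subset[of "\<Union>F" X]) auto
  have "hereditarily_sparse F"
    unfolding hereditarily_sparse_def
  proof (intro allI impI)
    fix F' assume F': "F' \<subseteq> F"
    show "card F' \<le> card (fst ` \<Union>F')"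
    proof (cases "F' = {}")
      case True
      then show ?thesis by simp
    next
      case False
      let ?S = "fst ` \<Union>F'"
      have "?S \<subseteq> fst ` \<Union>F" using F' by blast
      then have S: "finite ?S" "card ?S \<le> m"
        using fin2 small card_mono[of "fst ` \<Union>F" ?S] finite_subset[of ?S "fst ` \<Union>F"] by auto
      have "?S \<noteq> {}"
      proof -
        from False obtain f where f: "f \<in> F'" by blast
        then have "card f = 2" using partial_matchingD(2)[OF pm(1), of f] F' FE by blast
        then have "f \<noteq> {}" by auto
        then show ?thesis using f by blast
      qed
      have "card F' \<le> card {e \<in> E. fst ` e \<subseteq> ?S}"
        using F' FE finE by (intro card_mono) auto
      also have "\<dots> \<le> card ?S" using tf S \<open>?S \<noteq> {}\<close> unfolding tangle_free_def by simp
      finally show ?thesis .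
    qed
  qed
  then have "card (paths F n u v) \<le> 2"
    using partial_matching_subset[OF pm(1) FE] pm(2) by (intro card_paths_le_2)
  moreover have "P \<subseteq> paths F n u v"
  proof
    fix \<gamma> assume g: "\<gamma> \<in> P"
    then have g': "length \<gamma> = n" "nb_path E \<gamma> v" "origin \<gamma> v = u" using P(1) by (auto simp: paths_def)
    have "nb_path F \<gamma> v" by (rule nb_path_mono[OF g'(2)]) (use g in \<open>auto simp: F_def\<close>)
    then show "\<gamma> \<in> paths F n u v" using g' by (simp add: paths_def)
  qed
  ultimately have "card P \<le> 2"
    using card_mono[OF finite_paths[OF partial_matching_subset[OF pm(1) FE] pm(2)]] by (meson le_trans)
  then show False using P(2) by simp
qed

text \<open>There are at most \<open>2 * card E\<close> possible origins, each with at most two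
  paths; the \<open>+ 1\<close> allows for the empty path.\<close>

lemma card_nb_paths_short:
  assumes tf: "tangle_free m E" and pm: "partial_matching X E" "finite X" and n: "3 * (n + 1) \<le> m"
  shows "card {\<gamma>. length \<gamma> = n \<and> nb_path E \<gamma> v} \<le> 4 * card E + 1"
proof (cases n)
  case 0
  then have "{\<gamma>. length \<gamma> = n \<and> nb_path E \<gamma> v} = {[]}" by auto
  then show ?thesis by simp
next
  case (Suc n')
  have UX: "\<Union>E \<subseteq> X" using partial_matchingD(1)[OF pm(1)] by blast
  then have finU: "finite (\<Union>E)" using pm(2) by (rule finite_subset)
  have "{\<gamma>. length \<gamma> = n \<and> nb_path E \<gamma> v} \<subseteq> (\<Union>u\<in>fst ` \<Union>E. paths E n u v)"
  proof
    fix \<gamma> assume "\<gamma> \<in> {\<gamma>. length \<gamma> = n \<and> nb_path E \<gamma> v}"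
    then have g: "length \<gamma> = n" "nb_path E \<gamma> v" by simp_all
    then obtain s \<delta> where s: "\<gamma> = s # \<delta>" using Suc by (cases \<gamma>) auto
    then have "step_edge s \<in> E" using g by (simp add: nb_path_Cons)
    then have "fst s \<in> \<Union>E" by (rule step_half_edges(1)[OF pm(1)])
    then have "origin \<gamma> v \<in> fst ` \<Union>E" using s by simp
    moreover have "\<gamma> \<in> paths E n (origin \<gamma> v) v" using g by (simp add: paths_def)
    ultimately show "\<gamma> \<in> (\<Union>u\<in>fst ` \<Union>E. paths E n u v)" by (rule UN_I)
  qed
  then have "card {\<gamma>. length \<gamma> = n \<and> nb_path E \<gamma> v} \<le> card (\<Union>u\<in>fst ` \<Union>E. paths E n u v)"
    by (rule card_mono[rotated]) (intro finite_UN_I finite_imageI finU finite_paths[OF pm])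
  also have "\<dots> \<le> (\<Sum>u\<in>fst ` \<Union>E. card (paths E n u v))" by (intro card_UN_le finite_imageI finU)
  also have "\<dots> \<le> (\<Sum>u\<in>fst ` \<Union>E. 2)" using tangle_free_paths[OF tf pm n] by (intro sum_mono)
  also have "\<dots> = 2 * card (fst ` \<Union>E)" by simp
  also have "\<dots> \<le> 2 * card (\<Union>E)" using card_image_le[OF finU] by simp
  also have "\<dots> = 4 * card E" using card_Union_partial_matching[OF pm] by simp
  finally show ?thesis by simp
qed

text \<open>Tangle-freeness controls paths of length \<open>l\<close> only, so longer ones are cut
  into blocks, each with at most \<open>4 * card E + 1\<close> choices once its end is
  known.\<close>

lemma card_nb_paths:
  assumes tf: "tangle_free m E" and pm: "partial_matching X E" "finite X" and l: "3 * (l + 1) \<le> m" "0 < l"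
  shows "card {\<gamma>. length \<gamma> = n \<and> nb_path E \<gamma> v} \<le> (4 * card E + 1) ^ (n div l + 1)"
proof (induction n arbitrary: v rule: less_induct)
  case (less n)
  let ?P = "\<lambda>n v. {\<gamma>. length \<gamma> = n \<and> nb_path E \<gamma> v}"
  show ?case
  proof (cases "n < l")
    case True
    then show ?thesis using card_nb_paths_short[OF tf pm, of n v] l by simp
  next
    case False
    have fin: "finite (?P n v)" for n v by (rule finite_nb_paths[OF pm])
    have "?P n v \<subseteq> (\<lambda>(\<delta>, \<gamma>). \<gamma> @ \<delta>) ` (Sigma (?P l v) (\<lambda>\<delta>. ?P (n - l) (origin \<delta> v)))"
    proof
      fix \<gamma> assume "\<gamma> \<in> ?P n v"
      then have g: "length \<gamma> = n" "nb_path E \<gamma> v" by simp_all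
      define \<gamma>1 \<delta> where "\<gamma>1 = take (n - l) \<gamma>" and "\<delta> = drop (n - l) \<gamma>"
      have eq: "\<gamma> = \<gamma>1 @ \<delta>" by (simp add: \<gamma>1_def \<delta>_def)
      have "nb_path E \<gamma>1 (origin \<delta> v)" "nb_path E \<delta> v" using nb_path_append[of E \<gamma>1 \<delta> v] g(2) eq by auto
      moreover have "length \<gamma>1 = n - l" "length \<delta> = l" using g(1) False by (auto simp: \<gamma>1_def \<delta>_def)
      ultimately have "(\<delta>, \<gamma>1) \<in> Sigma (?P l v) (\<lambda>\<delta>. ?P (n - l) (origin \<delta> v))" by simp
      then show "\<gamma> \<in> (\<lambda>(\<delta>, \<gamma>). \<gamma> @ \<delta>) ` (Sigma (?P l v) (\<lambda>\<delta>. ?P (n - l) (origin \<delta> v)))"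
        unfolding eq by (rule image_eqI[rotated]) simp
    qed
    moreover have finS: "finite (Sigma (?P l v) (\<lambda>\<delta>. ?P (n - l) (origin \<delta> v)))"
      using fin by (intro finite_SigmaI)
    ultimately have "card (?P n v) \<le> card (Sigma (?P l v) (\<lambda>\<delta>. ?P (n - l) (origin \<delta> v)))"
      by (intro surj_card_le)
    also have "\<dots> = (\<Sum>\<delta>\<in>?P l v. card (?P (n - l) (origin \<delta> v)))"
      using fin by (intro card_SigmaI) auto
    also have "\<dots> \<le> (\<Sum>\<delta>\<in>?P l v. (4 * card E + 1) ^ ((n - l) div l + 1))"
      using less.IH[of "n - l"] False l by (intro sum_mono) auto
    also have "\<dots> = card (?P l v) * (4 * card E + 1) ^ ((n - l) div l + 1)" by simp
    also have "\<dots> \<le> (4 * card E + 1) * (4 * card E + 1) ^ ((n - l) div l + 1)"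
      using card_nb_paths_short[OF tf pm l(1)] by (rule mult_right_mono) simp
    also have "\<dots> = (4 * card E + 1) ^ (n div l + 1)"
      using False l by (simp add: le_div_geq)
    finally show ?thesis .
  qed
qed

section \<open>Edge probabilities and the union bound over tangles\<close>

lemma wt_0[simp]: "wt p n 0 = 1" by (simp add: wt_def)

lemma wt_Suc: "wt p n (Suc m) = wt p n m * (p / (real n - 1 - 2 * real m))"
  by (simp add: wt_def)

lemma wt_nonneg: "0 \<le> p \<Longrightarrow> 2 * m \<le> n \<Longrightarrow> 0 \<le> wt p n m"
proof (induction m)
  case (Suc m)
  then have "0 \<le> p / (real n - 1 - 2 * real m)" by (intro divide_nonneg_nonneg) auto
  then show ?case using Suc by (simp add: wt_Suc)
qed simp

lemma wt_le:
  assumes "0 \<le> p" "m \<le> K" "2 * K < n"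
  shows "wt p n m \<le> (p / (real n - 2 * real K)) ^ m"
  using assms(2)
proof (induction m)
  case (Suc m)
  have "p / (real n - 1 - 2 * real m) \<le> p / (real n - 2 * real K)"
    using assms Suc.prems by (intro divide_left_mono mult_pos_pos) auto
  moreover have "0 \<le> p / (real n - 1 - 2 * real m)" using assms Suc.prems by (intro divide_nonneg_nonneg) auto
  moreover have "0 \<le> wt p n m" using assms Suc.prems by (intro wt_nonneg) auto
  moreover have "wt p n m \<le> (p / (real n - 2 * real K)) ^ m" using Suc by simp
  moreover have "0 \<le> (p / (real n - 2 * real K)) ^ m" using assms by (intro zero_le_power divide_nonneg_nonneg) auto
  ultimately have "wt p n m * (p / (real n - 1 - 2 * real m)) \<le> (p / (real n - 2 * real K)) ^ m * (p / (real n - 2 * real K))"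
    by (intro mult_mono)
  then show ?case by (simp add: wt_Suc mult.commute)
qed simp

lemma wt_ge:
  assumes "0 \<le> p" "2 * m \<le> n"
  shows "(p / real n) ^ m \<le> wt p n m"
  using assms(2)
proof (induction m)
  case (Suc m)
  have "p / real n \<le> p / (real n - 1 - 2 * real m)"
    using assms Suc.prems by (intro divide_left_mono mult_pos_pos) auto
  then have "(p / real n) ^ m * (p / real n) \<le> wt p n m * (p / (real n - 1 - 2 * real m))"
    using Suc assms by (intro mult_mono wt_nonneg) auto
  then show ?case by (simp add: wt_Suc mult.commute)
qed simp

lemma power_le_exp_fact: "real s ^ s \<le> exp (real s) * fact s"
proof -
  have "(\<lambda>i. real s ^ i / fact i) sums exp (real s)"
    using exp_converges[of "real s"] by (simp add: divide_inverse mult.commute scaleR_conv_of_real)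
  then have "(\<Sum>i\<in>{s}. real s ^ i / fact i) \<le> exp (real s)"
    using sum_le_suminf[of "\<lambda>i. real s ^ i / fact i" "{s}"] by (auto simp: sums_iff)
  then show ?thesis by (simp add: divide_le_eq)
qed

text \<open>Restricting a bad vertex set to \<open>{..<N}\<close> and thinning its edges to exactly
  one in excess prepares a union bound over pairs of prescribed sizes.\<close>

lemma not_tangle_free:
  assumes pm: "partial_matching (half_edges N d) E" and "\<not> tangle_free m E"
  shows "\<exists>S F. S \<subseteq> {..<N} \<and> 1 \<le> card S \<and> card S \<le> m \<and> F \<subseteq> E \<and> card F = card S + 1
    \<and> F \<subseteq> {e. e \<subseteq> S \<times> {..<d} \<and> card e = 2}"
proof -
  from assms(2) obtain S where S: "finite S" "S \<noteq> {}" "card S \<le> m" "card S < card {e \<in> E. fst ` e \<subseteq> S}"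
    unfolding tangle_free_def by (auto simp: not_le)
  define S' where "S' = S \<inter> {..<N}"
  have eH: "e \<subseteq> half_edges N d" "card e = 2" if "e \<in> E" for e
    using partial_matchingD(1,2)[OF pm that] by simp_all
  have sub: "e \<subseteq> S' \<times> {..<d}" if e: "e \<in> E" "fst ` e \<subseteq> S" for e
    using eH(1)[OF e(1)] e(2) by (force simp: S'_def half_edges_def)
  have le: "card S' \<le> card S" unfolding S'_def using S(1) by (intro card_mono) auto
  then have "card S' + 1 \<le> card {e \<in> E. fst ` e \<subseteq> S}" using S(4) by simp
  then obtain F where F: "F \<subseteq> {e \<in> E. fst ` e \<subseteq> S}" "card F = card S' + 1"
    by (rule obtain_subset_with_card_n) blast
  then have "F \<noteq> {}" by auto
  then obtain e where e: "e \<in> F" by blast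
  then have "e \<in> E" "fst ` e \<subseteq> S" using F(1) by auto
  then have "e \<subseteq> S' \<times> {..<d}" "card e = 2" using sub eH by auto
  then have "S' \<noteq> {}" by auto
  then have "1 \<le> card S'" using S(1) by (simp add: S'_def Suc_le_eq card_gt_0_iff)
  moreover have "F \<subseteq> {e. e \<subseteq> S' \<times> {..<d} \<and> card e = 2}" using F(1) sub eH(2) by blast
  ultimately show ?thesis using F le S(3) by (intro exI[of _ S'] exI[of _ F]) (auto simp: S'_def)
qed

text \<open>Vertex sets of size \<open>s\<close> number at most \<open>N ^ s / s!\<close>, while the
  \<open>s + 1\<close> edges cost \<open>N ^ (s + 1)\<close>: the excess edge leaves one factor
  \<open>1 / N\<close>. The factorials turn the powers of \<open>s\<close> into
  \<open>exp (2 * s)\<close>.\<close>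

lemma prob_tangle:
  assumes ev: "even (N * d)" and p: "0 \<le> p" "p \<le> 1" and Nd: "4 * (m + 1) \<le> N * d" "0 < N" "0 < d"
  shows "measure_pmf.prob (edge_model N d p) {E. \<not> tangle_free m E}
    \<le> real m ^ 3 * (2 * real d * exp 2) ^ (m + 1) / real N"
proof -
  let ?n = "N * d"
  define Fs where "Fs S = {F. F \<subseteq> {e. e \<subseteq> S \<times> {..<d} \<and> card e = 2} \<and> card F = card S + 1}" for S :: "nat set"
  define Ss where "Ss s = {S. S \<subseteq> {..<N} \<and> card S = s}" for s
  define I where "I = Sigma {1..m} (\<lambda>s. Sigma (Ss s) Fs)"
  have finS: "finite S" if "S \<in> Ss s" for S s using that by (auto simp: Ss_def intro: finite_subset)
  have finSs: "finite (Ss s)" for s by (rule finite_subset[of _ "Pow {..<N}"]) (auto simp: Ss_def)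
  have fin2: "finite {e. e \<subseteq> S \<times> {..<d} \<and> card e = 2}" if "finite S" for S :: "nat set"
    by (rule finite_subset[of _ "Pow (S \<times> {..<d})"]) (use that in auto)
  have finFs: "finite (Fs S)" if "finite S" for S
    by (rule finite_subset[of _ "Pow {e. e \<subseteq> S \<times> {..<d} \<and> card e = 2}"]) (use fin2[OF that] in \<open>auto simp: Fs_def\<close>)
  have finI: "finite I" unfolding I_def using finSs finS finFs by (intro finite_SigmaI) auto
  have cSs: "real (card (Ss s)) * fact s \<le> real N ^ s" for s
  proof -
    have "card (Ss s) = N choose s" unfolding Ss_def using n_subsets[of "{..<N}" s] by simp
    then have "real (card (Ss s) * fact s) \<le> real (N ^ s)" using binomial_fact_pow[of N s] by (intro of_nat_mono) simp
    then show ?thesis by simp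
  qed
  have cFs: "real (card (Fs S)) * fact (s + 1) \<le> (real s * real d) ^ (2 * (s + 1))" if S: "S \<in> Ss s" for S s
  proof -
    have cS: "card S = s" "finite S" using S finS[OF S] by (simp_all add: Ss_def)
    define P where "P = {e. e \<subseteq> S \<times> {..<d} \<and> card e = 2}"
    have "card P = (s * d) choose 2"
      unfolding P_def using n_subsets[of "S \<times> {..<d}" 2] cS by simp
    also have "\<dots> \<le> (s * d)\<^sup>2"
      using binomial_fact_pow[of "s * d" 2] by (simp add: fact_2)
    finally have cP: "card P \<le> (s * d)\<^sup>2" .
    have "card (Fs S) = card P choose (s + 1)"
      unfolding Fs_def P_def[symmetric] using n_subsets[of P "s + 1"] fin2[OF cS(2)] cS by (simp add: P_def)
    then have "card (Fs S) * fact (s + 1) \<le> card P ^ (s + 1)" using binomial_fact_pow[of "card P" "s + 1"] by simp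
    also have "\<dots> \<le> ((s * d)\<^sup>2) ^ (s + 1)" using cP by (rule power_mono) simp
    also have "\<dots> = (s * d) ^ (2 * (s + 1))" by (rule power_mult[symmetric])
    finally have "real (card (Fs S) * fact (s + 1)) \<le> real ((s * d) ^ (2 * (s + 1)))" by (rule of_nat_mono)
    then show ?thesis by (simp only: of_nat_mult of_nat_power of_nat_fact)
  qed
  \<comment> \<open>The assumption \<open>4 * (m + 1) \<le> N * d\<close> keeps the denominators in
    \<open>wt\<close> above half of \<open>N * d\<close>, whence the 2.\<close>
  have pF: "measure_pmf.prob (edge_model N d p) {E. F \<subseteq> E} \<le> (2 / real ?n) ^ (s + 1)" if "card F = s + 1" "s \<le> m" for F s
  proof -
    have "measure_pmf.prob (edge_model N d p) {E. F \<subseteq> E} \<le> wt p ?n (s + 1)"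
      unfolding prob_edges_present_le[OF ev p] using that wt_nonneg[OF p(1), of "s + 1" ?n] Nd by auto
    also have "\<dots> \<le> (p / (real ?n - 2 * real (m + 1))) ^ (s + 1)"
      using p that Nd by (intro wt_le) auto
    also have "\<dots> \<le> (2 / real ?n) ^ (s + 1)"
    proof (rule power_mono)
      have n4: "4 * (real m + 1) \<le> real ?n" using of_nat_mono[OF Nd(1), where ?'a = real] by simp
      then have pos: "0 < real ?n - 2 * real (m + 1)" by simp
      have "p / (real ?n - 2 * real (m + 1)) \<le> 1 / (real ?n - 2 * real (m + 1))"
        using p pos by (intro divide_right_mono) auto
      also have "\<dots> \<le> 2 / real ?n" using pos n4 by (simp add: field_simps)
      finally show "p / (real ?n - 2 * real (m + 1)) \<le> 2 / real ?n" .
      show "0 \<le> p / (real ?n - 2 * real (m + 1))" using p pos by (intro divide_nonneg_pos)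
    qed
    finally show ?thesis .
  qed
  have "measure_pmf.prob (edge_model N d p) {E. \<not> tangle_free m E}
     = measure_pmf.prob (edge_model N d p) ({E. \<not> tangle_free m E} \<inter> set_pmf (edge_model N d p))"
    by (rule measure_Int_set_pmf[symmetric])
  also have "\<dots> \<le> measure_pmf.prob (edge_model N d p) (\<Union>i\<in>I. {E. snd (snd i) \<subseteq> E})"
  proof (rule measure_pmf.finite_measure_mono)
    show "{E. \<not> tangle_free m E} \<inter> set_pmf (edge_model N d p) \<subseteq> (\<Union>i\<in>I. {E. snd (snd i) \<subseteq> E})"
    proof
      fix E assume E: "E \<in> {E. \<not> tangle_free m E} \<inter> set_pmf (edge_model N d p)"
      then have "partial_matching (half_edges N d) E" "\<not> tangle_free m E" using set_edge_model[OF ev] by auto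
      from not_tangle_free[OF this] obtain S F where SF: "S \<subseteq> {..<N}" "1 \<le> card S" "card S \<le> m" "F \<subseteq> E"
        "card F = card S + 1" "F \<subseteq> {e. e \<subseteq> S \<times> {..<d} \<and> card e = 2}" by blast
      have "(card S, S, F) \<in> I" using SF by (simp add: I_def Ss_def Fs_def)
      then show "E \<in> (\<Union>i\<in>I. {E. snd (snd i) \<subseteq> E})" using SF(4) by force
    qed
  qed simp
  also have "\<dots> \<le> (\<Sum>i\<in>I. measure_pmf.prob (edge_model N d p) {E. snd (snd i) \<subseteq> E})"
    using finI by (intro measure_pmf.finite_measure_subadditive_finite) auto
  also have "\<dots> \<le> (\<Sum>i\<in>I. (2 / real ?n) ^ (fst i + 1))"
    by (intro sum_mono pF) (auto simp: I_def Ss_def Fs_def)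
  also have "\<dots> = (\<Sum>s\<in>{1..m}. \<Sum>S\<in>Ss s. \<Sum>F\<in>Fs S. (2 / real ?n) ^ (s + 1))"
  proof -
    have "(\<Sum>i\<in>I. (2 / real ?n) ^ (fst i + 1)) = (\<Sum>s\<in>{1..m}. \<Sum>z\<in>Sigma (Ss s) Fs. (2 / real ?n) ^ (s + 1))"
      unfolding I_def using finSs finS finFs
      by (subst sum.Sigma) (auto intro!: sum.cong)
    also have "\<dots> = (\<Sum>s\<in>{1..m}. \<Sum>S\<in>Ss s. \<Sum>F\<in>Fs S. (2 / real ?n) ^ (s + 1))"
      using finSs finS finFs by (intro sum.cong refl) (subst sum.Sigma, auto)
    finally show ?thesis .
  qed
  also have "\<dots> \<le> (\<Sum>s\<in>{1..m}. real m ^ 2 * (2 * real d * exp 2) ^ (m + 1) / real N)"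
  proof (rule sum_mono)
    fix s assume s: "s \<in> {1..m}"
    let ?b = "(2 / real ?n) ^ (s + 1)"
    have f1: "(fact s :: real) \<le> fact (s + 1)" by (rule fact_mono) simp
    have "(\<Sum>S\<in>Ss s. \<Sum>F\<in>Fs S. ?b) \<le> (\<Sum>S\<in>Ss s. (real s * real d) ^ (2 * (s + 1)) / fact s * ?b)"
    proof (rule sum_mono)
      fix S assume S: "S \<in> Ss s"
      have "real (card (Fs S)) * fact s \<le> real (card (Fs S)) * fact (s + 1)" using f1 by (intro mult_left_mono) auto
      also have "\<dots> \<le> (real s * real d) ^ (2 * (s + 1))" by (rule cFs[OF S])
      finally have "real (card (Fs S)) \<le> (real s * real d) ^ (2 * (s + 1)) / fact s" by (simp add: le_divide_eq)
      then have "real (card (Fs S)) * ?b \<le> (real s * real d) ^ (2 * (s + 1)) / fact s * ?b"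
        by (intro mult_right_mono) auto
      then show "(\<Sum>F\<in>Fs S. ?b) \<le> (real s * real d) ^ (2 * (s + 1)) / fact s * ?b" by simp
    qed
    also have "\<dots> = real (card (Ss s)) * ((real s * real d) ^ (2 * (s + 1)) / fact s * ?b)" by simp
    also have "\<dots> \<le> (real N ^ s / fact s) * ((real s * real d) ^ (2 * (s + 1)) / fact s * ?b)"
    proof (rule mult_right_mono)
      show "real (card (Ss s)) \<le> real N ^ s / fact s" using cSs[of s] by (simp add: le_divide_eq)
      show "0 \<le> (real s * real d) ^ (2 * (s + 1)) / fact s * ?b"
        by (intro mult_nonneg_nonneg divide_nonneg_nonneg zero_le_power) auto
    qed
    \<comment> \<open>Here \<open>N ^ s\<close> and one of the two powers of \<open>d\<close>
      cancel, and a single \<open>N\<close> stays in the denominator.\<close>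
    also have "\<dots> = (real s ^ s / fact s)\<^sup>2 * (real s)\<^sup>2 * (2 * real d) ^ (s + 1) / real N"
    proof -
      have s2: "real s ^ (2 * (s + 1)) = (real s ^ s)\<^sup>2 * (real s)\<^sup>2"
      proof -
        have e: "2 * (s + 1) = s + s + 2" by simp
        show ?thesis unfolding e power_add power2_eq_square[of "real s ^ s"] ..
      qed
      have d2: "real d ^ (2 * (s + 1)) = real d ^ (s + 1) * real d ^ (s + 1)"
        unfolding mult_2 by (rule power_add)
      have b: "?b = 2 ^ (s + 1) / (real N ^ s * real N * real d ^ (s + 1))"
        by (simp add: power_divide power_mult_distrib mult_ac)
      have dd: "real d ^ (s + 1) \<noteq> 0" and NN: "real N ^ s \<noteq> 0" "real N \<noteq> 0" using Nd by auto
      have "(real N ^ s / fact s) * ((real s * real d) ^ (2 * (s + 1)) / fact s * ?b)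
        = (real N ^ s / real N ^ s) * (real d ^ (s + 1) / real d ^ (s + 1)) *
          ((real s ^ s)\<^sup>2 / (fact s * fact s) * (real s)\<^sup>2 * (2 ^ (s + 1) * real d ^ (s + 1)) / real N)"
        unfolding power_mult_distrib s2 d2 b times_divide_times_eq times_divide_eq_left times_divide_eq_right
          divide_divide_eq_left by (simp only: mult_ac)
      also have "\<dots> = (real s ^ s)\<^sup>2 / (fact s * fact s) * (real s)\<^sup>2 * (2 ^ (s + 1) * real d ^ (s + 1)) / real N"
        using dd NN by simp
      finally show ?thesis by (simp only: power_divide power_mult_distrib power2_eq_square[of "fact s :: real"])
    qed
    also have "\<dots> \<le> (exp (real s))\<^sup>2 * (real m)\<^sup>2 * (2 * real d) ^ (s + 1) / real N"
    proof -
      have "real s ^ s / fact s \<le> exp (real s)" using power_le_exp_fact[of s] by (simp add: divide_le_eq)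
      then have "(real s ^ s / fact s)\<^sup>2 \<le> (exp (real s))\<^sup>2" by (intro power_mono) auto
      moreover have "(real s)\<^sup>2 \<le> (real m)\<^sup>2" using s by (intro power_mono) auto
      ultimately show ?thesis by (intro divide_right_mono mult_right_mono mult_mono) auto
    qed
    also have "\<dots> \<le> real m ^ 2 * (2 * real d * exp 2) ^ (m + 1) / real N"
    proof -
      have "(exp (real s))\<^sup>2 = exp 2 ^ s" by (simp add: exp_of_nat_mult[symmetric] power2_eq_square exp_add[symmetric] mult.commute)
      also have "\<dots> \<le> exp 2 ^ (s + 1)" by (intro power_increasing) auto
      finally have "(exp (real s))\<^sup>2 * (2 * real d) ^ (s + 1) \<le> exp 2 ^ (s + 1) * (2 * real d) ^ (s + 1)"
        by (rule mult_right_mono) simp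
      also have "\<dots> = (2 * real d * exp 2) ^ (s + 1)"
        unfolding power_mult_distrib[symmetric] by (simp only: mult_ac)
      also have "\<dots> \<le> (2 * real d * exp 2) ^ (m + 1)"
      proof (rule power_increasing)
        have "1 * 1 \<le> (2 * real d) * exp 2" using Nd(3) by (intro mult_mono) auto
        then show "1 \<le> 2 * real d * exp 2" by simp
      qed (use s in auto)
      finally have "(exp (real s))\<^sup>2 * (2 * real d) ^ (s + 1) \<le> (2 * real d * exp 2) ^ (m + 1)" .
      then have "(real m)\<^sup>2 * ((exp (real s))\<^sup>2 * (2 * real d) ^ (s + 1)) \<le> (real m)\<^sup>2 * (2 * real d * exp 2) ^ (m + 1)"
        by (intro mult_left_mono) auto
      then show ?thesis by (intro divide_right_mono) (auto simp: mult_ac)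
    qed
    finally show "(\<Sum>S\<in>Ss s. \<Sum>F\<in>Fs S. ?b) \<le> real m ^ 2 * (2 * real d * exp 2) ^ (m + 1) / real N" .
  qed
  also have "\<dots> = real m ^ 3 * (2 * real d * exp 2) ^ (m + 1) / real N" by (simp add: power3_eq_cube power2_eq_square)
  finally show ?thesis .
qed

section \<open>Exploration of a walk\<close>

text \<open>Walks ending at the half-edge \<open>z\<close> are explored backwards, by prepending steps; the edges in
  \<open>\<Gamma>0\<close> count as explored from the outset.\<close>

locale exploration_base =
  fixes N d :: nat and p :: real and \<Gamma>0 :: "half set set" and z :: half and allowed :: "step list \<Rightarrow> bool"
begin

abbreviation "H \<equiv> half_edges N d"
abbreviation "n \<equiv> N * d"

definition edges :: "step list \<Rightarrow> half set set" where
  "edges \<gamma> = \<Gamma>0 \<union> step_edge ` set \<gamma>"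

definition visited :: "step list \<Rightarrow> nat set" where
  "visited \<gamma> = insert (fst z) (fst ` \<Union>(edges \<gamma>))"

text \<open>No sample enters: a candidate walk must only be realisable, its edges together with
  \<open>\<Gamma>0\<close> forming a partial matching. Probability comes in through
  \<open>wt\<close> alone.\<close>

definition valid :: "step list \<Rightarrow> bool" where
  "valid \<gamma> \<longleftrightarrow> allowed \<gamma> \<and> partial_matching H (edges \<gamma>) \<and> nb_walk UNIV \<gamma> z"

text \<open>Since steps are prepended, \<open>snd s\<close> sits at the vertex already reached and
  \<open>fst s\<close> is the end that is being revealed.\<close>

definition collides :: "step list \<Rightarrow> step \<Rightarrow> bool" where
  "collides \<gamma> s \<longleftrightarrow> step_edge s \<notin> edges \<gamma> \<and> fst (fst s) \<in> visited \<gamma>"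

fun coll :: "step list \<Rightarrow> nat" where
  "coll [] = 0"
| "coll (s # \<gamma>) = coll \<gamma> + (if collides \<gamma> s then 1 else 0)"

text \<open>Such runs reveal nothing and so gain no factor of order \<open>1 / N\<close> that would
  pay for the choices; their number has to be bounded by other means.\<close>

definition old_runs :: "nat \<Rightarrow> step list \<Rightarrow> step list set" where
  "old_runs m \<gamma> = {\<delta>. length \<delta> = m \<and> valid (\<delta> @ \<gamma>) \<and> step_edge ` set \<delta> \<subseteq> edges \<gamma>}"

lemma edges_Cons: "edges (s # \<gamma>) = insert (step_edge s) (edges \<gamma>)"
  by (auto simp: edges_def)

lemma start_visited: "fst (start \<gamma> z) \<in> visited \<gamma>"
  by (cases \<gamma>) (auto simp: visited_def edges_Cons step_edge_def)

lemma finite_edges: "valid \<gamma> \<Longrightarrow> finite (edges \<gamma>)"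
  unfolding valid_def using partial_matching_finite[of H "edges \<gamma>"] card_half_edges(2)[of N d] by blast

text \<open>A new edge brings exactly one new vertex unless it collides, and an old edge changes
  neither count. Collisions thus measure the excess of edges over vertices relative to the
  start.\<close>

lemma euler_count:
  assumes "valid \<gamma>" "\<And>s \<delta>. allowed (s # \<delta>) \<Longrightarrow> allowed \<delta>"
  shows "card (edges \<gamma>) + card (visited []) = card (visited \<gamma>) + card (edges []) + coll \<gamma>"
  using assms(1)
proof (induction \<gamma>)
  case (Cons s \<gamma>)
  have v: "valid \<gamma>"
    using Cons.prems assms(2)[of s \<gamma>] partial_matching_subset[of H "edges (s # \<gamma>)" "edges \<gamma>"]
    unfolding valid_def by (auto simp: edges_Cons)
  have fe: "finite (edges \<gamma>)" by (rule finite_edges[OF v])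
  have fs: "follows s (start \<gamma> z)" using Cons.prems by (simp add: valid_def)
  have sv: "fst (snd s) \<in> visited \<gamma>" using fs start_visited[of \<gamma>] by (simp add: follows_def)
  have vis: "visited (s # \<gamma>) = insert (fst (fst s)) (visited \<gamma>)"
    using sv by (auto simp: visited_def edges_Cons step_edge_def)
  have "\<Union>(edges \<gamma>) \<subseteq> H" using v partial_matchingD(1) unfolding valid_def by blast
  then have fv: "finite (visited \<gamma>)"
    unfolding visited_def using finite_subset[OF _ card_half_edges(2)] by simp
  show ?case
  proof (cases "step_edge s \<in> edges \<gamma>")
    case True
    then have "fst s \<in> \<Union>(edges \<gamma>)" by (auto simp: step_edge_def)
    then have "fst (fst s) \<in> visited \<gamma>" by (simp add: visited_def)
    then show ?thesis using Cons.IH[OF v] True vis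
      by (simp add: edges_Cons insert_absorb collides_def)
  next
    case False
    then show ?thesis using Cons.IH[OF v] vis fe fv
      by (cases "fst (fst s) \<in> visited \<gamma>") (simp_all add: edges_Cons insert_absorb collides_def)
  qed
qed simp

end

text \<open>The parameters: \<open>\<theta>'\<close> is the growth per new step, from
  \<open>d - 1\<close> choices of the near half-edge, \<open>n\<close> of the far one and a
  probability of at most \<open>p / (n - 2 * K)\<close>. The ratio of possible far half-edges at
  visited vertices to all of them is at most \<open>\<eta>\<close>. The constant
  \<open>\<kappa>\<close> controls runs over old edges, and \<open>\<zeta>\<close> is the reward per
  collision, so small that \<open>k\<close> steps accumulate at most a factor 2.\<close>

locale exploration = exploration_base +
  fixes k K :: nat and \<kappa> \<zeta> \<theta>' \<eta> :: real
  assumes d2: "2 \<le> d" and p0: "0 \<le> p" and zH: "z \<in> H"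
    and allowed_tl: "\<And>s \<gamma>. allowed (s # \<gamma>) \<Longrightarrow> allowed \<gamma>"
    and K: "card \<Gamma>0 + k \<le> K" "2 * K < n"
    and \<theta>': "\<theta>' = (real d - 1) * real n * (p / (real n - 2 * real K))"
    and \<eta>: "\<eta> = real d * (2 * real K + 1) / real n"
    and \<kappa>: "1 \<le> \<kappa>"
    and old: "\<And>\<gamma> m. valid \<gamma> \<Longrightarrow> length \<gamma> + m \<le> k \<Longrightarrow> real (card (old_runs m \<gamma>)) \<le> \<kappa> * \<theta>' ^ m"
    and \<zeta>: "0 \<le> \<zeta>" "\<zeta> * \<eta> * (2 * \<kappa> * (real k + 1)) * real k \<le> 1"
begin

definition w :: "step list \<Rightarrow> real" where "w \<gamma> = wt p n (card (edges \<gamma>))"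

definition ext :: "step list \<Rightarrow> step set" where "ext \<gamma> = {s. valid (s # \<gamma>)}"

text \<open>Every collision is rewarded by a factor \<open>\<zeta>\<close> of order \<open>N\<close> up to logarithms. As the sum still grows
  by \<open>\<theta>'\<close> per step only, walks with \<open>c\<close> collisions contribute a fraction of order \<open>\<zeta> powr (- c)\<close>.\<close>

fun \<Psi> :: "nat \<Rightarrow> step list \<Rightarrow> real" where
  "\<Psi> 0 \<gamma> = w \<gamma>"
| "\<Psi> (Suc r) \<gamma> = (\<Sum>s\<in>ext \<gamma>. (if collides \<gamma> s then \<zeta> else 1) * \<Psi> r (s # \<gamma>))"

lemma K_real: "2 * real K < real n"
  using of_nat_less_iff[of "2 * K" n, where ?'a = real] K(2) by simp

lemma valid_tl: "valid (s # \<gamma>) \<Longrightarrow> valid \<gamma>"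
  using allowed_tl[of s \<gamma>] partial_matching_subset[of H "edges (s # \<gamma>)" "edges \<gamma>"]
  unfolding valid_def by (auto simp: edges_Cons)

lemma valid_suffix: "valid (\<delta> @ \<gamma>) \<Longrightarrow> valid \<gamma>"
  by (induction \<delta>) (auto dest: valid_tl)

lemma ext_step:
  assumes "s \<in> ext \<gamma>"
  shows "follows s (start \<gamma> z)" "fst s \<in> H" "snd s \<in> H"
proof -
  have v: "valid (s # \<gamma>)" using assms by (simp add: ext_def)
  then show "follows s (start \<gamma> z)" by (simp add: valid_def)
  have "step_edge s \<subseteq> H" using v partial_matchingD(1)[of H "edges (s # \<gamma>)" "step_edge s"]
    by (simp add: valid_def edges_Cons)
  then show "fst s \<in> H" "snd s \<in> H" by (auto simp: step_edge_def)
qed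

lemma finite_ext: "finite (ext \<gamma>)"
proof (rule finite_subset)
  show "ext \<gamma> \<subseteq> H \<times> H" using ext_step(2,3) by (force simp: mem_Times_iff)
  show "finite (H \<times> H)" using card_half_edges(2)[of N d] by simp
qed

lemma finite_extensions: "finite {\<delta>. length \<delta> = m \<and> valid (\<delta> @ \<gamma>)}"
proof (induction m arbitrary: \<gamma>)
  case 0
  have "{\<delta>. length \<delta> = 0 \<and> valid (\<delta> @ \<gamma>)} \<subseteq> {[]}" by auto
  then show ?case by (rule finite_subset) simp
next
  case (Suc m)
  have "{\<delta>. length \<delta> = Suc m \<and> valid (\<delta> @ \<gamma>)} \<subseteq> (\<Union>s\<in>ext \<gamma>. (\<lambda>\<delta>. \<delta> @ [s]) ` {\<delta>. length \<delta> = m \<and> valid (\<delta> @ s # \<gamma>)})"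
  proof
    fix \<delta> assume "\<delta> \<in> {\<delta>. length \<delta> = Suc m \<and> valid (\<delta> @ \<gamma>)}"
    then have l: "length \<delta> = Suc m" and v: "valid (\<delta> @ \<gamma>)" by simp_all
    then obtain \<delta>' s where e: "\<delta> = \<delta>' @ [s]" by (cases \<delta> rule: rev_cases) auto
    have v': "valid (\<delta>' @ s # \<gamma>)" using v e by simp
    then have "s \<in> ext \<gamma>" using valid_suffix[OF v'] by (simp add: ext_def)
    moreover have "\<delta>' \<in> {\<delta>. length \<delta> = m \<and> valid (\<delta> @ s # \<gamma>)}" using v' l e by simp
    ultimately show "\<delta> \<in> (\<Union>s\<in>ext \<gamma>. (\<lambda>\<delta>. \<delta> @ [s]) ` {\<delta>. length \<delta> = m \<and> valid (\<delta> @ s # \<gamma>)})"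
      unfolding e by (intro UN_I[of s] image_eqI[of _ _ \<delta>'] refl)
  qed
  then show ?case by (rule finite_subset) (intro finite_UN_I finite_ext finite_imageI Suc.IH)
qed

lemma \<Psi>_sum:
  assumes "valid \<gamma>"
  shows "(\<Sum>\<delta>\<in>{\<delta>. length \<delta> = r \<and> valid (\<delta> @ \<gamma>)}. w (\<delta> @ \<gamma>) * \<zeta> ^ coll (\<delta> @ \<gamma>)) = \<zeta> ^ coll \<gamma> * \<Psi> r \<gamma>"
  using assms
proof (induction r arbitrary: \<gamma>)
  case 0
  then have "{\<delta>. length \<delta> = 0 \<and> valid (\<delta> @ \<gamma>)} = {[]}" by auto
  then show ?case by (simp only: sum.insert sum.empty finite.emptyI empty_iff not_False_eq_True append_Nil \<Psi>.simps mult.commute add_0_right)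
next
  case (Suc r)
  let ?A = "\<lambda>s. {\<delta>. length \<delta> = r \<and> valid (\<delta> @ s # \<gamma>)}"
  let ?g = "\<lambda>\<delta>. w (\<delta> @ \<gamma>) * \<zeta> ^ coll (\<delta> @ \<gamma>)"
  have eq: "{\<delta>. length \<delta> = Suc r \<and> valid (\<delta> @ \<gamma>)} = (\<Union>s\<in>ext \<gamma>. (\<lambda>\<delta>. \<delta> @ [s]) ` ?A s)"
  proof (intro equalityI subsetI)
    fix \<delta> assume "\<delta> \<in> {\<delta>. length \<delta> = Suc r \<and> valid (\<delta> @ \<gamma>)}"
    then have l: "length \<delta> = Suc r" and v: "valid (\<delta> @ \<gamma>)" by simp_all
    then obtain \<delta>' s where e: "\<delta> = \<delta>' @ [s]" by (cases \<delta> rule: rev_cases) auto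
    have v': "valid (\<delta>' @ s # \<gamma>)" using v e by simp
    then have "s \<in> ext \<gamma>" using valid_suffix[OF v'] by (simp add: ext_def)
    moreover have "\<delta>' \<in> ?A s" using v' l e by simp
    ultimately show "\<delta> \<in> (\<Union>s\<in>ext \<gamma>. (\<lambda>\<delta>. \<delta> @ [s]) ` ?A s)"
      unfolding e by (intro UN_I[of s] image_eqI[of _ _ \<delta>'] refl)
  next
    fix \<delta> assume "\<delta> \<in> (\<Union>s\<in>ext \<gamma>. (\<lambda>\<delta>. \<delta> @ [s]) ` ?A s)"
    then show "\<delta> \<in> {\<delta>. length \<delta> = Suc r \<and> valid (\<delta> @ \<gamma>)}" by auto
  qed
  have "(\<Sum>\<delta>\<in>{\<delta>. length \<delta> = Suc r \<and> valid (\<delta> @ \<gamma>)}. ?g \<delta>) = (\<Sum>s\<in>ext \<gamma>. \<Sum>\<delta>\<in>(\<lambda>\<delta>. \<delta> @ [s]) ` ?A s. ?g \<delta>)"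
    unfolding eq using finite_ext finite_extensions by (intro sum.UNION_disjoint) auto
  also have "\<dots> = (\<Sum>s\<in>ext \<gamma>. \<Sum>\<delta>\<in>?A s. w (\<delta> @ s # \<gamma>) * \<zeta> ^ coll (\<delta> @ s # \<gamma>))"
  proof (rule sum.cong[OF refl])
    fix s
    have "(\<Sum>\<delta>\<in>(\<lambda>\<delta>. \<delta> @ [s]) ` ?A s. ?g \<delta>) = (\<Sum>\<delta>\<in>?A s. ?g (\<delta> @ [s]))"
      by (rule sum.reindex[unfolded o_def]) (simp add: inj_on_def)
    then show "(\<Sum>\<delta>\<in>(\<lambda>\<delta>. \<delta> @ [s]) ` ?A s. ?g \<delta>) = (\<Sum>\<delta>\<in>?A s. w (\<delta> @ s # \<gamma>) * \<zeta> ^ coll (\<delta> @ s # \<gamma>))"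
      by simp
  qed
  also have "\<dots> = (\<Sum>s\<in>ext \<gamma>. \<zeta> ^ coll (s # \<gamma>) * \<Psi> r (s # \<gamma>))"
    by (intro sum.cong refl Suc.IH) (simp add: ext_def)
  also have "\<dots> = \<zeta> ^ coll \<gamma> * \<Psi> (Suc r) \<gamma>"
    unfolding \<Psi>.simps sum_distrib_left by (intro sum.cong refl) (auto simp: mult_ac)
  finally show ?case .
qed

lemma card_edges_le:
  assumes "valid \<gamma>" "length \<gamma> \<le> k"
  shows "card (edges \<gamma>) \<le> K"
proof -
  have "card (edges \<gamma>) \<le> card \<Gamma>0 + card (step_edge ` set \<gamma>)" unfolding edges_def by (rule card_Un_le)
  also have "card (step_edge ` set \<gamma>) \<le> length \<gamma>"
    using card_image_le[of "set \<gamma>" step_edge] card_length[of \<gamma>] by simp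
  finally show ?thesis using K assms by simp
qed

lemma card_visited_le:
  assumes "valid \<gamma>" "length \<gamma> \<le> k"
  shows "finite (visited \<gamma>)" "card (visited \<gamma>) \<le> 2 * K + 1"
proof -
  have pm: "partial_matching H (edges \<gamma>)" using assms by (simp add: valid_def)
  have fin: "finite (\<Union>(edges \<gamma>))"
    using partial_matchingD(1)[OF pm] by (intro finite_subset[OF _ card_half_edges(2)[of N d]]) blast
  then show "finite (visited \<gamma>)" by (simp add: visited_def)
  have "card (visited \<gamma>) \<le> Suc (card (fst ` \<Union>(edges \<gamma>)))"
    unfolding visited_def by (rule card_insert_le_m1) auto
  also have "card (fst ` \<Union>(edges \<gamma>)) \<le> card (\<Union>(edges \<gamma>))" by (rule card_image_le[OF fin])
  also have "\<dots> = 2 * card (edges \<gamma>)" by (rule card_Union_partial_matching[OF pm card_half_edges(2)])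
  finally show "card (visited \<gamma>) \<le> 2 * K + 1" using card_edges_le[OF assms] by simp
qed

lemma start_H: "valid \<gamma> \<Longrightarrow> start \<gamma> z \<in> H"
proof (cases \<gamma>)
  case Nil
  then show ?thesis using zH by simp
next
  case (Cons s \<delta>)
  assume "valid \<gamma>"
  then have "s \<in> ext \<delta>" using Cons by (simp add: ext_def)
  then show ?thesis using ext_step(2) Cons by simp
qed

lemma card_at_vertex: "card {y \<in> H. fst y = u} \<le> d" "finite {y \<in> H. fst y = u}"
proof -
  have "{y \<in> H. fst y = u} \<subseteq> Pair u ` {..<d}" by (auto simp: half_edges_def)
  then have "card {y \<in> H. fst y = u} \<le> card (Pair u ` {..<d})" by (intro card_mono) auto
  also have "\<dots> \<le> d" using card_image_le[of "{..<d}" "Pair u"] by simp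
  finally show "card {y \<in> H. fst y = u} \<le> d" .
  show "finite {y \<in> H. fst y = u}" using card_half_edges(2)[of N d] by simp
qed

lemma card_steps:
  assumes v: "valid \<gamma>" and X: "finite X" and S: "S \<subseteq> ext \<gamma>" "\<And>s. s \<in> S \<Longrightarrow> fst s \<in> X"
  shows "real (card S) \<le> (real d - 1) * real (card X)"
proof -
  let ?x = "start \<gamma> z"
  let ?Y = "{y \<in> H. fst y = fst ?x} - {?x}"
  have "card ?Y = card {y \<in> H. fst y = fst ?x} - 1"
    using start_H[OF v] by (simp add: card_Diff_singleton)
  then have Y: "card ?Y \<le> d - 1" using card_at_vertex(1)[of "fst ?x"] by simp
  have "S \<subseteq> X \<times> ?Y"
  proof
    fix s assume s: "s \<in> S"
    then have "s \<in> ext \<gamma>" using S(1) by blast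
    from ext_step[OF this] show "s \<in> X \<times> ?Y" using S(2)[OF s]
      by (auto simp: mem_Times_iff follows_def)
  qed
  then have "card S \<le> card (X \<times> ?Y)" using X card_at_vertex(2) by (intro card_mono finite_cartesian_product) auto
  also have "\<dots> = card X * card ?Y" by (rule card_cartesian_product)
  also have "\<dots> \<le> card X * (d - 1)" using Y by (rule mult_left_mono) simp
  finally have "real (card S) \<le> real (card X * (d - 1))" by (rule of_nat_mono)
  then show ?thesis using d2 by (simp add: of_nat_diff mult.commute)
qed

lemma w_nonneg: "valid \<gamma> \<Longrightarrow> length \<gamma> \<le> k \<Longrightarrow> 0 \<le> w \<gamma>"
  unfolding w_def using card_edges_le[of \<gamma>] K p0 by (intro wt_nonneg) auto

lemma w_new:
  assumes v: "valid (s # \<gamma>)" and new: "step_edge s \<notin> edges \<gamma>" and l: "length (s # \<gamma>) \<le> k"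
  shows "w (s # \<gamma>) \<le> w \<gamma> * (p / (real n - 2 * real K))"
proof -
  have fe: "finite (edges \<gamma>)" using finite_edges[OF valid_tl[OF v]] .
  have c: "card (edges (s # \<gamma>)) = Suc (card (edges \<gamma>))" unfolding edges_Cons using new fe by simp
  then have cK: "Suc (card (edges \<gamma>)) \<le> K" using card_edges_le[OF v l] by simp
  have "w (s # \<gamma>) = w \<gamma> * (p / (real n - 1 - 2 * real (card (edges \<gamma>))))"
    unfolding w_def c by (rule wt_Suc)
  also have "\<dots> \<le> w \<gamma> * (p / (real n - 2 * real K))"
  proof -
    have "real n - 2 * real K \<le> real n - 1 - 2 * real (card (edges \<gamma>))" using cK by simp
    then have "p / (real n - 1 - 2 * real (card (edges \<gamma>))) \<le> p / (real n - 2 * real K)"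
      using p0 K_real by (intro divide_left_mono mult_pos_pos) linarith+
    then show ?thesis using w_nonneg[OF valid_tl[OF v]] l by (intro mult_left_mono) auto
  qed
  finally show ?thesis .
qed

text \<open>At a fresh vertex the only explored half-edge is the one just revealed, and using it
  would be a backtrack. Hence an old run begins only at the start or after a collision.\<close>

lemma no_old_after_fresh:
  assumes v: "valid (s # \<gamma>)" and new: "step_edge s \<notin> edges \<gamma>" "fst (fst s) \<notin> visited \<gamma>"
    and t: "t \<in> ext (s # \<gamma>)"
  shows "step_edge t \<notin> edges (s # \<gamma>)"
proof
  assume old: "step_edge t \<in> edges (s # \<gamma>)"
  have ft: "fst (snd t) = fst (fst s)" "snd t \<noteq> fst s" using ext_step(1)[OF t] by (auto simp: follows_def)
  have fs: "fst (snd s) = fst (start \<gamma> z)" using v by (simp add: valid_def follows_def)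
  from old consider "step_edge t = step_edge s" | "step_edge t \<in> edges \<gamma>" by (auto simp: edges_Cons)
  then show False
  proof cases
    case 1
    then have "snd t = snd s" using ft(2) by (auto simp: step_edge_def doubleton_eq_iff)
    then show False using ft(1) fs start_visited[of \<gamma>] new(2) by simp
  next
    case 2
    then have "snd t \<in> \<Union>(edges \<gamma>)" by (auto simp: step_edge_def)
    then have "fst (snd t) \<in> visited \<gamma>" by (simp add: visited_def)
    then show False using ft(1) new(2) by simp
  qed
qed

text \<open>The worst factor by which old edges inflate the sum: \<open>\<kappa>\<close> for one old
  run, \<open>k + 1\<close> for its possible lengths and 2 for all that follows the next new
  edge.\<close>

abbreviation "g \<equiv> 2 * \<kappa> * (real k + 1)"

lemma \<theta>'_nonneg: "0 \<le> \<theta>'"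
  unfolding \<theta>' using d2 p0 K_real by (intro mult_nonneg_nonneg divide_nonneg_nonneg) linarith+

text \<open>Fresh endpoints: at most \<open>(d - 1) * n\<close> choices of the next step give the
  factor \<open>\<theta>'\<close> with the good constant \<open>f\<close>. Colliding endpoints: only
  a share \<open>\<eta>\<close> of these choices, with the reward \<open>\<zeta>\<close> and the
  worst constant \<open>g\<close>.\<close>

lemma new_sum:
  assumes v: "valid \<gamma>" and l: "length \<gamma> + Suc r \<le> k"
    and G: "\<And>s. valid (s # \<gamma>) \<Longrightarrow> \<Psi> r (s # \<gamma>) \<le> w (s # \<gamma>) * \<theta>' ^ r * g"
    and F: "\<And>s. valid (s # \<gamma>) \<Longrightarrow> step_edge s \<notin> edges \<gamma> \<Longrightarrow> fst (fst s) \<notin> visited \<gamma> \<Longrightarrow>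
      \<Psi> r (s # \<gamma>) \<le> w (s # \<gamma>) * \<theta>' ^ r * f" and f: "0 \<le> f"
  shows "(\<Sum>s\<in>{s \<in> ext \<gamma>. step_edge s \<notin> edges \<gamma>}. (if collides \<gamma> s then \<zeta> else 1) * \<Psi> r (s # \<gamma>))
    \<le> w \<gamma> * \<theta>' ^ Suc r * (f + \<zeta> * \<eta> * g)"
proof -
  define q where "q = p / (real n - 2 * real K)"
  have q0: "0 \<le> q" unfolding q_def using p0 K_real by (intro divide_nonneg_nonneg) linarith+
  have w0: "0 \<le> w \<gamma>" using w_nonneg[OF v] l by simp
  have g0: "0 \<le> g" using \<kappa> by simp
  let ?Nw = "{s \<in> ext \<gamma>. step_edge s \<notin> edges \<gamma> \<and> fst (fst s) \<notin> visited \<gamma>}"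
  let ?C = "{s \<in> ext \<gamma>. step_edge s \<notin> edges \<gamma> \<and> fst (fst s) \<in> visited \<gamma>}"
  have wq: "w (s # \<gamma>) * \<theta>' ^ r * c \<le> w \<gamma> * q * \<theta>' ^ r * c" if s: "s \<in> ext \<gamma>" "step_edge s \<notin> edges \<gamma>" "0 \<le> c" for s c
    using w_new[of s \<gamma>] s l \<theta>'_nonneg by (intro mult_right_mono) (auto simp: ext_def q_def)
  have "(\<Sum>s\<in>{s \<in> ext \<gamma>. step_edge s \<notin> edges \<gamma>}. (if collides \<gamma> s then \<zeta> else 1) * \<Psi> r (s # \<gamma>))
      = (\<Sum>s\<in>?Nw \<union> ?C. (if collides \<gamma> s then \<zeta> else 1) * \<Psi> r (s # \<gamma>))"
    by (intro sum.cong) auto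
  also have "\<dots> = (\<Sum>s\<in>?Nw. (if collides \<gamma> s then \<zeta> else 1) * \<Psi> r (s # \<gamma>)) + (\<Sum>s\<in>?C. (if collides \<gamma> s then \<zeta> else 1) * \<Psi> r (s # \<gamma>))"
    using finite_ext by (intro sum.union_disjoint) auto
  also have "(\<Sum>s\<in>?Nw. (if collides \<gamma> s then \<zeta> else 1) * \<Psi> r (s # \<gamma>)) \<le> (\<Sum>s\<in>?Nw. w \<gamma> * q * \<theta>' ^ r * f)"
  proof (rule sum_mono)
    fix s assume s: "s \<in> ?Nw"
    then have "\<Psi> r (s # \<gamma>) \<le> w (s # \<gamma>) * \<theta>' ^ r * f" using F[of s] by (simp add: ext_def)
    also have "\<dots> \<le> w \<gamma> * q * \<theta>' ^ r * f" using wq[of s f] s f by simp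
    finally show "(if collides \<gamma> s then \<zeta> else 1) * \<Psi> r (s # \<gamma>) \<le> w \<gamma> * q * \<theta>' ^ r * f"
      using s by (simp add: collides_def)
  qed
  also have "(\<Sum>s\<in>?C. (if collides \<gamma> s then \<zeta> else 1) * \<Psi> r (s # \<gamma>)) \<le> (\<Sum>s\<in>?C. \<zeta> * (w \<gamma> * q * \<theta>' ^ r * g))"
  proof (rule sum_mono)
    fix s assume s: "s \<in> ?C"
    then have "\<Psi> r (s # \<gamma>) \<le> w (s # \<gamma>) * \<theta>' ^ r * g" using G[of s] by (simp add: ext_def)
    also have "\<dots> \<le> w \<gamma> * q * \<theta>' ^ r * g" using wq[of s g] s g0 by simp
    finally have "\<zeta> * \<Psi> r (s # \<gamma>) \<le> \<zeta> * (w \<gamma> * q * \<theta>' ^ r * g)" using \<zeta>(1) by (rule mult_left_mono)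
    then show "(if collides \<gamma> s then \<zeta> else 1) * \<Psi> r (s # \<gamma>) \<le> \<zeta> * (w \<gamma> * q * \<theta>' ^ r * g)"
      using s by (simp add: collides_def)
  qed
  also have "(\<Sum>s\<in>?Nw. w \<gamma> * q * \<theta>' ^ r * f) = real (card ?Nw) * (w \<gamma> * q * \<theta>' ^ r * f)" by simp
  also have "\<dots> \<le> ((real d - 1) * real n) * (w \<gamma> * q * \<theta>' ^ r * f)"
  proof (rule mult_right_mono)
    show "real (card ?Nw) \<le> (real d - 1) * real n"
    proof -
      have "real (card ?Nw) \<le> (real d - 1) * real (card H)"
      proof (rule card_steps[OF v card_half_edges(2)])
        show "?Nw \<subseteq> ext \<gamma>" by blast
        fix s assume "s \<in> ?Nw"
        then have "s \<in> ext \<gamma>" by blast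
        then show "fst s \<in> H" by (rule ext_step(2))
      qed
      then show ?thesis unfolding card_half_edges(1) .
    qed
    show "0 \<le> w \<gamma> * q * \<theta>' ^ r * f" using w0 q0 \<theta>'_nonneg f by simp
  qed
  also have "(\<Sum>s\<in>?C. \<zeta> * (w \<gamma> * q * \<theta>' ^ r * g)) = real (card ?C) * (\<zeta> * (w \<gamma> * q * \<theta>' ^ r * g))" by simp
  also have "\<dots> \<le> ((real d - 1) * (real d * (2 * real K + 1))) * (\<zeta> * (w \<gamma> * q * \<theta>' ^ r * g))"
  proof (rule mult_right_mono)
    let ?X = "\<Union>u\<in>visited \<gamma>. {y \<in> H. fst y = u}"
    have fin: "finite (visited \<gamma>)" and cv: "card (visited \<gamma>) \<le> 2 * K + 1"
      using card_visited_le[OF v] l by simp_all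
    have X: "finite ?X" using fin card_at_vertex(2) by (intro finite_UN_I)
    have "card ?X \<le> (\<Sum>u\<in>visited \<gamma>. card {y \<in> H. fst y = u})" by (rule card_UN_le[OF fin])
    also have "\<dots> \<le> (\<Sum>u\<in>visited \<gamma>. d)" by (rule sum_mono) (rule card_at_vertex(1))
    also have "\<dots> = card (visited \<gamma>) * d" by simp
    also have "\<dots> \<le> (2 * K + 1) * d" using cv by (rule mult_right_mono) simp
    finally have "real (card ?X) \<le> real ((2 * K + 1) * d)" by (rule of_nat_mono)
    then have cX: "real (card ?X) \<le> real d * (2 * real K + 1)" by (simp add: algebra_simps)
    have "real (card ?C) \<le> (real d - 1) * real (card ?X)"
    proof (rule card_steps[OF v X])
      show "?C \<subseteq> ext \<gamma>" by blast
      fix s assume s: "s \<in> ?C"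
      then have "s \<in> ext \<gamma>" by blast
      then have "fst s \<in> H" by (rule ext_step(2))
      then show "fst s \<in> ?X" using s by (intro UN_I[of "fst (fst s)"]) auto
    qed
    also have "\<dots> \<le> (real d - 1) * (real d * (2 * real K + 1))" using cX d2 by (intro mult_left_mono) auto
    finally show "real (card ?C) \<le> (real d - 1) * (real d * (2 * real K + 1))" .
    show "0 \<le> \<zeta> * (w \<gamma> * q * \<theta>' ^ r * g)" using w0 q0 \<theta>'_nonneg g0 \<zeta>(1) by simp
  qed
  also have "((real d - 1) * real n) * (w \<gamma> * q * \<theta>' ^ r * f) + ((real d - 1) * (real d * (2 * real K + 1))) * (\<zeta> * (w \<gamma> * q * \<theta>' ^ r * g))
      = w \<gamma> * \<theta>' ^ Suc r * (f + \<zeta> * \<eta> * g)"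
  proof -
    have "n \<noteq> 0" using K(2) by linarith
    then have n0: "real n \<noteq> 0" by (simp only: of_nat_eq_0_iff not_False_eq_True)
    have t: "\<theta>' = (real d - 1) * real n * q" by (simp add: \<theta>' q_def)
    have e: "real d * (2 * real K + 1) = \<eta> * real n" using n0 by (simp add: \<eta>)
    have "((real d - 1) * real n) * (w \<gamma> * q * \<theta>' ^ r * f) = w \<gamma> * ((real d - 1) * real n * q) * \<theta>' ^ r * f"
      by (simp only: mult_ac)
    moreover have "((real d - 1) * (\<eta> * real n)) * (\<zeta> * (w \<gamma> * q * \<theta>' ^ r * g)) = w \<gamma> * ((real d - 1) * real n * q) * \<theta>' ^ r * (\<zeta> * \<eta> * g)"
      by (simp only: mult_ac)
    ultimately show ?thesis unfolding e t[symmetric] by (simp add: distrib_left mult_ac)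
  qed
  finally show ?thesis by simp
qed

lemma ext_split: "\<Psi> (Suc r) \<gamma> = (\<Sum>s\<in>{s \<in> ext \<gamma>. step_edge s \<notin> edges \<gamma>}. (if collides \<gamma> s then \<zeta> else 1) * \<Psi> r (s # \<gamma>))
    + (\<Sum>s\<in>{s \<in> ext \<gamma>. step_edge s \<in> edges \<gamma>}. \<Psi> r (s # \<gamma>))"
proof -
  have "ext \<gamma> = {s \<in> ext \<gamma>. step_edge s \<notin> edges \<gamma>} \<union> {s \<in> ext \<gamma>. step_edge s \<in> edges \<gamma>}" by blast
  then have "\<Psi> (Suc r) \<gamma> = (\<Sum>s\<in>{s \<in> ext \<gamma>. step_edge s \<notin> edges \<gamma>} \<union> {s \<in> ext \<gamma>. step_edge s \<in> edges \<gamma>}. (if collides \<gamma> s then \<zeta> else 1) * \<Psi> r (s # \<gamma>))"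
    by simp
  also have "\<dots> = (\<Sum>s\<in>{s \<in> ext \<gamma>. step_edge s \<notin> edges \<gamma>}. (if collides \<gamma> s then \<zeta> else 1) * \<Psi> r (s # \<gamma>))
    + (\<Sum>s\<in>{s \<in> ext \<gamma>. step_edge s \<in> edges \<gamma>}. (if collides \<gamma> s then \<zeta> else 1) * \<Psi> r (s # \<gamma>))"
    using finite_ext by (intro sum.union_disjoint) auto
  also have "(\<Sum>s\<in>{s \<in> ext \<gamma>. step_edge s \<in> edges \<gamma>}. (if collides \<gamma> s then \<zeta> else 1) * \<Psi> r (s # \<gamma>))
    = (\<Sum>s\<in>{s \<in> ext \<gamma>. step_edge s \<in> edges \<gamma>}. \<Psi> r (s # \<gamma>))"
    by (intro sum.cong refl) (simp add: collides_def)
  finally show ?thesis .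
qed

lemma old_runs_Suc:
  "card (old_runs (Suc m) \<gamma>) = (\<Sum>s\<in>{s \<in> ext \<gamma>. step_edge s \<in> edges \<gamma>}. card (old_runs m (s # \<gamma>)))"
proof -
  let ?S = "{s \<in> ext \<gamma>. step_edge s \<in> edges \<gamma>}"
  have fin: "finite (old_runs m \<gamma>)" for m \<gamma>
    by (rule finite_subset[OF _ finite_extensions[of m \<gamma>]]) (auto simp: old_runs_def)
  have eq: "old_runs (Suc m) \<gamma> = (\<Union>s\<in>?S. (\<lambda>\<delta>. \<delta> @ [s]) ` old_runs m (s # \<gamma>))"
  proof (intro equalityI subsetI)
    fix \<delta> assume \<delta>: "\<delta> \<in> old_runs (Suc m) \<gamma>"
    then have l: "length \<delta> = Suc m" and v: "valid (\<delta> @ \<gamma>)" and o: "step_edge ` set \<delta> \<subseteq> edges \<gamma>"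
      by (simp_all add: old_runs_def)
    then obtain \<delta>' s where e: "\<delta> = \<delta>' @ [s]" by (cases \<delta> rule: rev_cases) auto
    have v': "valid (\<delta>' @ s # \<gamma>)" using v e by simp
    have "valid (s # \<gamma>)" by (rule valid_suffix[OF v'])
    then have "s \<in> ?S" using o e by (simp add: ext_def)
    moreover have "\<delta>' \<in> old_runs m (s # \<gamma>)" using v' l o e by (simp add: old_runs_def edges_Cons subset_insertI2)
    ultimately show "\<delta> \<in> (\<Union>s\<in>?S. (\<lambda>\<delta>. \<delta> @ [s]) ` old_runs m (s # \<gamma>))"
      unfolding e by (intro UN_I[of s] image_eqI[of _ _ \<delta>'] refl)
  next
    fix \<delta> assume "\<delta> \<in> (\<Union>s\<in>?S. (\<lambda>\<delta>. \<delta> @ [s]) ` old_runs m (s # \<gamma>))"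
    then obtain s \<delta>' where s: "s \<in> ?S" "\<delta>' \<in> old_runs m (s # \<gamma>)" "\<delta> = \<delta>' @ [s]" by blast
    then show "\<delta> \<in> old_runs (Suc m) \<gamma>" by (simp add: old_runs_def edges_Cons insert_absorb)
  qed
  have "card (old_runs (Suc m) \<gamma>) = (\<Sum>s\<in>?S. card ((\<lambda>\<delta>. \<delta> @ [s]) ` old_runs m (s # \<gamma>)))"
    unfolding eq using finite_ext fin by (intro card_UN_disjoint) auto
  also have "\<dots> = (\<Sum>s\<in>?S. card (old_runs m (s # \<gamma>)))"
    by (intro sum.cong refl card_image) (auto simp: inj_on_def)
  finally show ?thesis .
qed

text \<open>The walks are sorted by the length \<open>m\<close> of the old run that precedes the
  next new edge; old steps leave the weight unchanged.\<close>

lemma unroll_old: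
  assumes "valid \<gamma>" "length \<gamma> + r \<le> k"
    and "\<And>\<gamma> j. valid \<gamma> \<Longrightarrow> j < r \<Longrightarrow> length \<gamma> + Suc j \<le> k \<Longrightarrow>
      (\<Sum>s\<in>{s \<in> ext \<gamma>. step_edge s \<notin> edges \<gamma>}. (if collides \<gamma> s then \<zeta> else 1) * \<Psi> j (s # \<gamma>)) \<le> w \<gamma> * \<theta>' ^ Suc j * 2"
  shows "\<Psi> r \<gamma> \<le> w \<gamma> * (\<Sum>m\<le>r. real (card (old_runs m \<gamma>)) * (2 * \<theta>' ^ (r - m)))"
  using assms
proof (induction r arbitrary: \<gamma>)
  case 0
  then have "old_runs 0 \<gamma> = {[]}" by (auto simp: old_runs_def)
  then show ?case using w_nonneg[of \<gamma>] 0 by simp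
next
  case (Suc r)
  let ?S = "{s \<in> ext \<gamma>. step_edge s \<in> edges \<gamma>}"
  have o0: "card (old_runs 0 \<gamma>) = 1"
  proof -
    have "old_runs 0 \<gamma> = {[]}" using Suc.prems(1) by (auto simp: old_runs_def)
    then show ?thesis by simp
  qed
  have new: "(\<Sum>s\<in>{s \<in> ext \<gamma>. step_edge s \<notin> edges \<gamma>}. (if collides \<gamma> s then \<zeta> else 1) * \<Psi> r (s # \<gamma>)) \<le> w \<gamma> * \<theta>' ^ Suc r * 2"
    using Suc.prems by (intro Suc.prems(3)) auto
  have "(\<Sum>s\<in>?S. \<Psi> r (s # \<gamma>)) \<le> (\<Sum>s\<in>?S. w \<gamma> * (\<Sum>m\<le>r. real (card (old_runs m (s # \<gamma>))) * (2 * \<theta>' ^ (r - m))))"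
  proof (rule sum_mono)
    fix s assume s: "s \<in> ?S"
    have we: "w (s # \<gamma>) = w \<gamma>" using s by (simp add: w_def edges_Cons insert_absorb)
    have "\<Psi> r (s # \<gamma>) \<le> w (s # \<gamma>) * (\<Sum>m\<le>r. real (card (old_runs m (s # \<gamma>))) * (2 * \<theta>' ^ (r - m)))"
    proof (rule Suc.IH)
      show "valid (s # \<gamma>)" using s by (simp add: ext_def)
      show "length (s # \<gamma>) + r \<le> k" using Suc.prems(2) by simp
      fix \<gamma>' j assume "valid \<gamma>'" "j < r" "length \<gamma>' + Suc j \<le> k"
      then show "(\<Sum>s\<in>{s \<in> ext \<gamma>'. step_edge s \<notin> edges \<gamma>'}. (if collides \<gamma>' s then \<zeta> else 1) * \<Psi> j (s # \<gamma>')) \<le> w \<gamma>' * \<theta>' ^ Suc j * 2"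
        by (intro Suc.prems(3)) auto
    qed
    then show "\<Psi> r (s # \<gamma>) \<le> w \<gamma> * (\<Sum>m\<le>r. real (card (old_runs m (s # \<gamma>))) * (2 * \<theta>' ^ (r - m)))"
      unfolding we .
  qed
  also have "\<dots> = w \<gamma> * (\<Sum>m\<le>r. (\<Sum>s\<in>?S. real (card (old_runs m (s # \<gamma>)))) * (2 * \<theta>' ^ (r - m)))"
    unfolding sum_distrib_left[symmetric] sum_distrib_right by (subst sum.swap) (rule refl)
  also have "\<dots> = w \<gamma> * (\<Sum>m\<le>r. real (card (old_runs (Suc m) \<gamma>)) * (2 * \<theta>' ^ (r - m)))"
    unfolding old_runs_Suc by simp
  finally have old: "(\<Sum>s\<in>?S. \<Psi> r (s # \<gamma>)) \<le> w \<gamma> * (\<Sum>m\<le>r. real (card (old_runs (Suc m) \<gamma>)) * (2 * \<theta>' ^ (r - m)))" .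
  have "(\<Sum>m\<le>Suc r. real (card (old_runs m \<gamma>)) * (2 * \<theta>' ^ (Suc r - m)))
      = 2 * \<theta>' ^ Suc r + (\<Sum>m\<le>r. real (card (old_runs (Suc m) \<gamma>)) * (2 * \<theta>' ^ (r - m)))"
    unfolding sum.atMost_Suc_shift o0 by simp
  then have "w \<gamma> * (\<Sum>m\<le>Suc r. real (card (old_runs m \<gamma>)) * (2 * \<theta>' ^ (Suc r - m)))
      = w \<gamma> * \<theta>' ^ Suc r * 2 + w \<gamma> * (\<Sum>m\<le>r. real (card (old_runs (Suc m) \<gamma>)) * (2 * \<theta>' ^ (r - m)))"
    by (simp only: distrib_left mult_ac)
  then show ?case unfolding ext_split using new old by linarith
qed

text \<open>The two estimates need each other. After a fresh step no old run can start, so the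
  constant grows by only \<open>\<zeta> * \<eta> * g\<close> per step and stays at most 2; the full
  constant \<open>g\<close> is incurred only at the start or after a collision, where
  \<open>\<zeta> * \<eta>\<close> compensates for it.\<close>

lemma \<Psi>_bound:
  "valid \<gamma> \<Longrightarrow> length \<gamma> + r \<le> k \<Longrightarrow> \<Psi> r \<gamma> \<le> w \<gamma> * \<theta>' ^ r * g"
  "valid (s # \<gamma>) \<Longrightarrow> length (s # \<gamma>) + r \<le> k \<Longrightarrow> step_edge s \<notin> edges \<gamma> \<Longrightarrow> fst (fst s) \<notin> visited \<gamma> \<Longrightarrow>
    \<Psi> r (s # \<gamma>) \<le> w (s # \<gamma>) * \<theta>' ^ r * (1 + real r * (\<zeta> * \<eta> * g))"
proof (induction r arbitrary: s \<gamma> rule: less_induct)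
  case (less r)
  have c0: "0 \<le> \<zeta> * \<eta> * g" unfolding \<eta> using \<zeta>(1) \<kappa> by simp
  have small: "1 + real j * (\<zeta> * \<eta> * g) + \<zeta> * \<eta> * g \<le> 2" if "Suc j \<le> k" for j
  proof -
    have "real (Suc j) * (\<zeta> * \<eta> * g) \<le> real k * (\<zeta> * \<eta> * g)" using that c0 by (intro mult_right_mono) auto
    also have "\<dots> \<le> 1" using \<zeta>(2) by (simp add: mult_ac)
    finally show ?thesis by (simp add: algebra_simps)
  qed
  have new: "(\<Sum>s\<in>{s \<in> ext \<gamma>. step_edge s \<notin> edges \<gamma>}. (if collides \<gamma> s then \<zeta> else 1) * \<Psi> j (s # \<gamma>))
      \<le> w \<gamma> * \<theta>' ^ Suc j * (1 + real j * (\<zeta> * \<eta> * g) + \<zeta> * \<eta> * g)"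
    if v: "valid \<gamma>" and j: "j < r" "length \<gamma> + Suc j \<le> k" for \<gamma> j
  proof (rule new_sum[OF v j(2)])
    show "\<Psi> j (s # \<gamma>) \<le> w (s # \<gamma>) * \<theta>' ^ j * g" if "valid (s # \<gamma>)" for s
      using less.IH(1)[OF j(1) that] j(2) by simp
    show "\<Psi> j (s # \<gamma>) \<le> w (s # \<gamma>) * \<theta>' ^ j * (1 + real j * (\<zeta> * \<eta> * g))"
      if "valid (s # \<gamma>)" "step_edge s \<notin> edges \<gamma>" "fst (fst s) \<notin> visited \<gamma>" for s
      using less.IH(2)[OF j(1) that(1) _ that(2,3)] j(2) by simp
    show "0 \<le> 1 + real j * (\<zeta> * \<eta> * g)" using c0 by simp
  qed
  show "\<Psi> r \<gamma> \<le> w \<gamma> * \<theta>' ^ r * g" if v: "valid \<gamma>" and l: "length \<gamma> + r \<le> k" for \<gamma>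
  proof -
    have w0: "0 \<le> w \<gamma>" using w_nonneg[OF v] l by simp
    have "\<Psi> r \<gamma> \<le> w \<gamma> * (\<Sum>m\<le>r. real (card (old_runs m \<gamma>)) * (2 * \<theta>' ^ (r - m)))"
    proof (rule unroll_old[OF v l])
      fix \<gamma> j assume v': "valid \<gamma>" and j: "j < r" "length \<gamma> + Suc j \<le> k"
      have w0': "0 \<le> w \<gamma>" using w_nonneg[OF v'] j by simp
      note new[OF v' j]
      also have "w \<gamma> * \<theta>' ^ Suc j * (1 + real j * (\<zeta> * \<eta> * g) + \<zeta> * \<eta> * g) \<le> w \<gamma> * \<theta>' ^ Suc j * 2"
        using small[of j] j w0' \<theta>'_nonneg by (intro mult_left_mono mult_nonneg_nonneg zero_le_power) auto
      finally show "(\<Sum>s\<in>{s \<in> ext \<gamma>. step_edge s \<notin> edges \<gamma>}. (if collides \<gamma> s then \<zeta> else 1) * \<Psi> j (s # \<gamma>)) \<le> w \<gamma> * \<theta>' ^ Suc j * 2" .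
    qed
    also have "\<dots> \<le> w \<gamma> * (\<Sum>m\<le>r. \<theta>' ^ r * (2 * \<kappa>))"
    proof (intro mult_left_mono sum_mono w0)
      fix m assume m: "m \<in> {..r}"
      have "real (card (old_runs m \<gamma>)) * (2 * \<theta>' ^ (r - m)) \<le> (\<kappa> * \<theta>' ^ m) * (2 * \<theta>' ^ (r - m))"
        using old[OF v, of m] m l \<theta>'_nonneg by (intro mult_right_mono) auto
      also have "\<dots> = (\<theta>' ^ m * \<theta>' ^ (r - m)) * (2 * \<kappa>)" by simp
      also have "\<theta>' ^ m * \<theta>' ^ (r - m) = \<theta>' ^ r" using m by (simp add: power_add[symmetric])
      finally show "real (card (old_runs m \<gamma>)) * (2 * \<theta>' ^ (r - m)) \<le> \<theta>' ^ r * (2 * \<kappa>)" .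
    qed
    also have "\<dots> = w \<gamma> * \<theta>' ^ r * (2 * \<kappa> * (real r + 1))" by simp
    also have "\<dots> \<le> w \<gamma> * \<theta>' ^ r * g"
      using l w0 \<theta>'_nonneg \<kappa> by (intro mult_left_mono mult_nonneg_nonneg zero_le_power) auto
    finally show ?thesis .
  qed
  show "\<Psi> r (s # \<gamma>) \<le> w (s # \<gamma>) * \<theta>' ^ r * (1 + real r * (\<zeta> * \<eta> * g))"
    if v: "valid (s # \<gamma>)" and l: "length (s # \<gamma>) + r \<le> k" and s: "step_edge s \<notin> edges \<gamma>" "fst (fst s) \<notin> visited \<gamma>" for s \<gamma>
  proof (cases r)
    case 0
    then show ?thesis by simp
  next
    case (Suc j)
    have none: "{t \<in> ext (s # \<gamma>). step_edge t \<in> edges (s # \<gamma>)} = {}"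
      using no_old_after_fresh[OF v s] by blast
    have "\<Psi> r (s # \<gamma>) \<le> w (s # \<gamma>) * \<theta>' ^ Suc j * (1 + real j * (\<zeta> * \<eta> * g) + \<zeta> * \<eta> * g)"
      unfolding Suc ext_split none using new[OF v, of j] Suc l by simp
    then show ?thesis unfolding Suc by (simp add: algebra_simps)
  qed
qed

lemma exploration_sum:
  assumes "valid []"
  shows "(\<Sum>\<gamma>\<in>{\<gamma>. length \<gamma> = k \<and> valid \<gamma>}. wt p n (card (edges \<gamma>)) * \<zeta> ^ coll \<gamma>)
    \<le> wt p n (card \<Gamma>0) * \<theta>' ^ k * g"
  using \<Psi>_sum[OF assms, of k] \<Psi>_bound(1)[OF assms, of k] by (simp add: w_def edges_def)

text \<open>Markov's inequality for the rewarded sum: at least \<open>c\<close> collisions mean a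
  reward of at least \<open>\<zeta> ^ c\<close>.\<close>

lemma exploration_sum_coll:
  assumes "valid []" "1 \<le> \<zeta>"
  shows "(\<Sum>\<gamma>\<in>{\<gamma>. length \<gamma> = k \<and> valid \<gamma> \<and> c \<le> coll \<gamma>}. wt p n (card (edges \<gamma>)))
    \<le> wt p n (card \<Gamma>0) * \<theta>' ^ k * g / \<zeta> ^ c"
proof -
  have fin: "finite {\<gamma>. length \<gamma> = k \<and> valid \<gamma>}" using finite_extensions[of k "[]"] by simp
  have wp: "0 \<le> wt p n (card (edges \<gamma>))" if "length \<gamma> = k" "valid \<gamma>" for \<gamma>
    using w_nonneg[of \<gamma>] that by (simp add: w_def)
  have "(\<Sum>\<gamma>\<in>{\<gamma>. length \<gamma> = k \<and> valid \<gamma> \<and> c \<le> coll \<gamma>}. wt p n (card (edges \<gamma>))) * \<zeta> ^ c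
      \<le> (\<Sum>\<gamma>\<in>{\<gamma>. length \<gamma> = k \<and> valid \<gamma> \<and> c \<le> coll \<gamma>}. wt p n (card (edges \<gamma>)) * \<zeta> ^ coll \<gamma>)"
    unfolding sum_distrib_right using assms(2) wp by (intro sum_mono mult_left_mono power_increasing) auto
  also have "\<dots> \<le> (\<Sum>\<gamma>\<in>{\<gamma>. length \<gamma> = k \<and> valid \<gamma>}. wt p n (card (edges \<gamma>)) * \<zeta> ^ coll \<gamma>)"
    using fin wp assms(2) by (intro sum_mono2) auto
  also have "\<dots> \<le> wt p n (card \<Gamma>0) * \<theta>' ^ k * g" by (rule exploration_sum[OF assms(1)])
  finally show ?thesis using assms(2) by (simp add: le_divide_eq)
qed

end

section \<open>Closed walks that are not simple\<close>

lemma nb_walk_nth: "nb_walk UNIV \<gamma> z \<longleftrightarrow>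
    (\<forall>i<length \<gamma>. follows (\<gamma> ! i) (if Suc i < length \<gamma> then fst (\<gamma> ! Suc i) else z))"
proof (induction \<gamma>)
  case (Cons s \<gamma>)
  show ?case
  proof (cases \<gamma>)
    case Nil
    then show ?thesis by simp
  next
    case (Cons t \<delta>)
    have "nb_walk UNIV (s # \<gamma>) z \<longleftrightarrow> follows s (fst t) \<and> nb_walk UNIV \<gamma> z" using Cons by simp
    also have "\<dots> \<longleftrightarrow> (\<forall>i<length (s # \<gamma>). follows ((s # \<gamma>) ! i) (if Suc i < length (s # \<gamma>) then fst ((s # \<gamma>) ! Suc i) else z))"
      unfolding Cons.IH using Cons by (simp add: All_less_Suc2)
    finally show ?thesis .
  qed
qed simp

text \<open>A closed nonbacktracking walk that spans at most one cycle runs around that cycle.\<close>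

locale unicyclic_walk =
  fixes X :: "half set" and s :: "nat \<Rightarrow> step" and k :: nat
  assumes k: "0 < k" and period: "\<And>i. s (i + k) = s i"
    and pm: "partial_matching X (step_edge ` range s)" and fin: "finite X"
    and nb: "\<And>i. follows (s i) (fst (s (Suc i)))"
    and count: "card (step_edge ` range s) \<le> card (fst ` \<Union>(step_edge ` range s))"
begin

abbreviation "\<Gamma> \<equiv> step_edge ` range s"
abbreviation "x i \<equiv> fst (s i)"
abbreviation "y i \<equiv> snd (s i)"
abbreviation "u i \<equiv> fst (fst (s i))"

lemma vert: "fst (y i) = u (Suc i)" "y i \<noteq> x (Suc i)"
  using nb[of i] by (simp_all add: follows_def)

lemma mem: "x i \<in> \<Union>\<Gamma>" "y i \<in> \<Union>\<Gamma>"
  by (auto simp: step_edge_def)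

lemma edge: "{x i, y i} \<in> \<Gamma>"
  by (auto simp: step_edge_def)

lemma s_eqI: "x i = x j \<Longrightarrow> s i = s j"
proof -
  assume eq: "x i = x j"
  have "{x i, y j} \<in> \<Gamma>" unfolding eq by (rule edge)
  then have "y i = y j" by (rule partial_matching_unique[OF pm edge])
  then show "s i = s j" using eq by (rule prod_eqI[rotated])
qed

lemma vertices: "fst ` \<Union>\<Gamma> = range u"
proof (intro equalityI subsetI)
  fix v assume "v \<in> fst ` \<Union>\<Gamma>"
  then obtain h i where "v = fst h" "h \<in> step_edge (s i)" by blast
  then have "v = u i \<or> v = u (Suc i)" using vert(1)[of i] by (auto simp: step_edge_def)
  then show "v \<in> range u" by blast
next
  fix v assume "v \<in> range u"
  then obtain i where "v = fst (x i)" by blast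
  then show "v \<in> fst ` \<Union>\<Gamma>" using mem(1)[of i] by (rule image_eqI)
qed

text \<open>Arrival and departure show two half-edges at every visited vertex, and the count of
  edges allows no third.\<close>

lemma half: "{h \<in> \<Union>\<Gamma>. fst h = u (Suc i)} = {x (Suc i), y i}"
proof -
  let ?h = "\<lambda>v. {h \<in> \<Union>\<Gamma>. fst h = v}"
  have finU: "finite (\<Union>\<Gamma>)" using partial_matchingD(1)[OF pm] by (intro finite_subset[OF _ fin]) blast
  have finh: "finite (?h v)" for v by (rule finite_subset[OF _ finU]) blast
  have sub: "{x (Suc i), y i} \<subseteq> ?h (u (Suc i))" for i using mem vert(1) by simp
  have two: "card {x (Suc i), y i} = 2" for i using vert(2)[of i] by auto
  have "2 \<le> card (?h v)" if v: "v \<in> fst ` \<Union>\<Gamma>" for v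
  proof -
    from v obtain i where "v = u i" unfolding vertices by blast
    then have "v = u (Suc (i + k - 1))" using k period[of i] by simp
    then show ?thesis using card_mono[OF finh sub[of "i + k - 1"]] two[of "i + k - 1"] by simp
  qed
  then have "card (?h (u (Suc i))) = 2"
    using two_regular_of_count[OF pm fin count] unfolding vertices by blast
  then show ?thesis using card_subset_eq[OF finh sub[of i]] two[of i] by simp
qed

text \<open>If step \<open>b\<close> retraces step \<open>a\<close> backwards, then by
  \<open>half\<close> step \<open>b - 1\<close> retraces step \<open>a + 1\<close>. The gap shrinks
  by two until the walk would traverse an edge both ways at once or backtrack.\<close>

lemma no_reversal: "a \<le> b \<Longrightarrow> x a \<noteq> y b"
proof (induction "b - a" arbitrary: a b rule: less_induct)
  case less
  show ?case
  proof
    assume eq: "x a = y b"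
    have "{x a, y a} \<in> \<Gamma>" "{x a, x b} \<in> \<Gamma>" using edge[of a] edge[of b] eq by (simp_all add: insert_commute)
    then have yb: "y a = x b" using partial_matching_unique[OF pm] by blast
    consider "a = b" | "b = Suc a" | "Suc a < b" using less.prems by linarith
    then show False
    proof cases
      case 1
      then show False using eq partial_matching_edge(1)[OF pm edge[of a]] by simp
    next
      case 2
      then show False using yb vert(2)[of a] by simp
    next
      case 3
      then obtain c where c: "b = Suc c" "Suc a \<le> c" by (cases b) auto
      have "u (Suc a) = u b" using vert(1)[of a] yb by simp
      then have "x (Suc a) \<in> {h \<in> \<Union>\<Gamma>. fst h = u (Suc c)}" using mem(1)[of "Suc a"] c(1) by simp
      then have "x (Suc a) = x b \<or> x (Suc a) = y c" unfolding half c(1) by simp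
      then have "x (Suc a) = y c" using vert(2)[of a] yb by auto
      moreover have "c - Suc a < b - a" using c by simp
      ultimately show False using less.hyps[of c "Suc a"] c(2) by simp
    qed
  qed
qed

text \<open>Of the two half-edges at a vertex, the departure at one visit cannot be the arrival at
  another by \<open>no_reversal\<close>, so all visits depart alike.\<close>

lemma same_vertex: "u i = u j \<Longrightarrow> s i = s j"
proof -
  have key: "s (Suc i) = s (Suc j)" if "i < j" "u (Suc i) = u (Suc j)" for i j
  proof -
    have "x (Suc i) \<in> {h \<in> \<Union>\<Gamma>. fst h = u (Suc j)}" using mem that by simp
    then have "x (Suc i) = x (Suc j) \<or> x (Suc i) = y j" unfolding half by simp
    then have "x (Suc i) = x (Suc j)" using no_reversal[of "Suc i" j] that by simp
    then show ?thesis by (rule s_eqI)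
  qed
  assume uij: "u i = u j"
  \<comment> \<open>Adding a full period gives every index a predecessor, as \<open>half\<close>
    describes vertices through the arriving step.\<close>
  have p: "s i = s (Suc (i + k - 1))" "s j = s (Suc (j + k - 1))" using k period[of i] period[of j] by simp_all
  consider "i = j" | "i < j" | "j < i" by linarith
  then show ?thesis
  proof cases
    case 2
    then have "i + k - 1 < j + k - 1" using k by simp
    then show ?thesis using key[of "i + k - 1" "j + k - 1"] uij p by simp
  next
    case 3
    then have "j + k - 1 < i + k - 1" using k by simp
    then show ?thesis using key[of "j + k - 1" "i + k - 1"] uij p by simp
  qed simp
qed

lemma shift_up: "s i = s j \<Longrightarrow> s (i + t) = s (j + t)"
proof (induction t)
  case (Suc t)
  then have "u (Suc (i + t)) = u (Suc (j + t))" using vert(1)[of "i + t"] vert(1)[of "j + t"] by simp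
  then show ?case using same_vertex by simp
qed simp

lemma shift_down: "s (i + t) = s (j + t) \<Longrightarrow> s i = s j"
proof -
  assume "s (i + t) = s (j + t)"
  \<comment> \<open>The walk is run forward until the total shift is a multiple of \<open>k\<close>,
    which undoes the shift by \<open>t\<close>.\<close>
  then have "s (i + t + t * (k - 1)) = s (j + t + t * (k - 1))" by (rule shift_up)
  moreover have e: "t + t * (k - 1) = t * k" using k by (cases k) simp_all
  have per: "s (i + m * k) = s i" for i m
  proof (induction m)
    case (Suc m)
    have "s (i + Suc m * k) = s ((i + m * k) + k)" by (simp only: mult_Suc add_ac)
    also have "\<dots> = s (i + m * k)" by (rule period)
    finally show ?case using Suc.IH by (rule trans)
  qed simp
  ultimately show ?thesis unfolding add.assoc e per by simp
qed

lemma period_mult: "s (i + m * q) = s i" if "s q = s 0"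
proof (induction m)
  case (Suc m)
  have "s (q + (i + m * q)) = s (0 + (i + m * q))" by (rule shift_up[OF that])
  moreover have "i + Suc m * q = q + (i + m * q)" by (simp only: mult_Suc add_ac)
  ultimately show ?case using Suc.IH by (simp only: add_0)
qed simp

text \<open>A repeated vertex gives a period below \<open>k\<close>. The least period divides
  \<open>k\<close> and is smaller, hence at most \<open>k / 2\<close>; by minimality no vertex
  repeats within it.\<close>

lemma primitive_period:
  assumes "i < j" "j < k" "u i = u j"
  shows "\<exists>q. 0 < q \<and> 2 * q \<le> k \<and> (\<forall>i. s (i mod q) = s i) \<and> inj_on u {..<q}"
proof -
  have "s (0 + i) = s ((j - i) + i)" using same_vertex[OF assms(3)] assms(1) by simp
  then have "s (j - i) = s 0" using shift_down[of 0 i "j - i"] by simp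
  then have ex: "\<exists>q. 0 < q \<and> s q = s 0" using assms(1) by (intro exI[of _ "j - i"]) simp
  define q where "q = (LEAST q. 0 < q \<and> s q = s 0)"
  have q: "0 < q" "s q = s 0" using LeastI_ex[OF ex] unfolding q_def by blast+
  have least: "q \<le> r" if "0 < r" "s r = s 0" for r unfolding q_def using that by (intro Least_le) simp
  have qk: "q < k" using least[of "j - i"] \<open>s (j - i) = s 0\<close> assms by simp
  have md: "s (i mod q) = s i" for i
    using period_mult[OF q(2), of "i mod q" "i div q"] by simp
  have "s (k mod q) = s 0" using md[of k] period[of 0] by simp
  then have "k mod q = 0" using least[of "k mod q"] q(1) mod_less_divisor[OF q(1), of k] by linarith
  then obtain c where c: "k = q * c" by auto
  then have "2 \<le> c" using qk k by (cases c; cases "c - 1") auto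
  then have "2 * q \<le> k" using c by simp
  moreover have "inj_on u {..<q}"
  proof (rule linorder_inj_onI)
    fix a b assume ab: "a < b" "a \<in> {..<q}" "b \<in> {..<q}"
    show "u a \<noteq> u b"
    proof
      assume "u a = u b"
      then have "s (0 + a) = s ((b - a) + a)" using same_vertex ab(1) by simp
      then have "s (b - a) = s 0" using shift_down[of 0 a "b - a"] by simp
      then have "q \<le> b - a" using ab(1) by (intro least) auto
      then show False using ab by simp
    qed
  qed auto
  ultimately show ?thesis using q(1) md by blast
qed

end

text \<open>The deterministic pool from which a sample \<open>E\<close> selects its closed walks,
  namely those with all edges in \<open>E\<close>.\<close>

definition closed_candidates :: "nat \<Rightarrow> nat \<Rightarrow> nat \<Rightarrow> step list set" where
  "closed_candidates N d k = {\<gamma>. length \<gamma> = k \<and> \<gamma> \<noteq> [] \<and> nb_walk UNIV \<gamma> (fst (hd \<gamma>)) \<and>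
     partial_matching (half_edges N d) (step_edge ` set \<gamma>)}"

definition simple :: "step list \<Rightarrow> bool" where
  "simple \<gamma> \<longleftrightarrow> distinct (map (\<lambda>s. fst (fst s)) \<gamma>)"

definition cycles :: "nat \<Rightarrow> nat \<Rightarrow> nat \<Rightarrow> step list set" where
  "cycles N d k = {\<gamma> \<in> closed_candidates N d k. simple \<gamma>}"

lemma step_edges_half: "step_edge s \<subseteq> X \<Longrightarrow> fst s \<in> X \<and> snd s \<in> X"
  by (simp add: step_edge_def)

lemma finite_closed_candidates: "finite (closed_candidates N d k)"
proof (rule finite_subset)
  let ?H = "half_edges N d"
  show "closed_candidates N d k \<subseteq> {\<gamma>. set \<gamma> \<subseteq> ?H \<times> ?H \<and> length \<gamma> = k}"
  proof
    fix \<gamma> assume g: "\<gamma> \<in> closed_candidates N d k"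
    have "s \<in> ?H \<times> ?H" if "s \<in> set \<gamma>" for s
    proof -
      have "partial_matching ?H (step_edge ` set \<gamma>)" using g by (simp add: closed_candidates_def)
      from partial_matchingD(1)[OF this, of "step_edge s"] have "step_edge s \<subseteq> ?H" using that by simp
      then show ?thesis using step_edges_half by (simp add: mem_Times_iff)
    qed
    then show "\<gamma> \<in> {\<gamma>. set \<gamma> \<subseteq> ?H \<times> ?H \<and> length \<gamma> = k}" using g by (auto simp: closed_candidates_def)
  qed
  show "finite {\<gamma>. set \<gamma> \<subseteq> ?H \<times> ?H \<and> length \<gamma> = k}"
    using finite_lists_length_eq[of "?H \<times> ?H" k] card_half_edges(2)[of N d] by simp
qed

lemma cyclic_follows:
  assumes "\<gamma> \<in> closed_candidates N d k"
  shows "follows (\<gamma> ! (i mod k)) (fst (\<gamma> ! (Suc i mod k)))"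
proof -
  have l: "length \<gamma> = k" "0 < k" and w: "nb_walk UNIV \<gamma> (fst (hd \<gamma>))"
    using assms by (auto simp: closed_candidates_def)
  have im: "i mod k < length \<gamma>" using l by simp
  have f: "follows (\<gamma> ! (i mod k)) (if Suc (i mod k) < length \<gamma> then fst (\<gamma> ! Suc (i mod k)) else fst (hd \<gamma>))"
    using w im unfolding nb_walk_nth by blast
  show ?thesis
  proof (cases "Suc (i mod k) < k")
    case True
    then have "Suc i mod k = Suc (i mod k)" by (simp add: mod_Suc)
    then show ?thesis using f True l by simp
  next
    case False
    then have e: "Suc (i mod k) = k" using mod_less_divisor[OF l(2), of i] by linarith
    then have "Suc i mod k = 0" by (simp add: mod_Suc)
    moreover have "hd \<gamma> = \<gamma> ! 0" using l by (intro hd_conv_nth) auto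
    ultimately show ?thesis using f e l by simp
  qed
qed

lemma range_nth_mod: "length \<gamma> = k \<Longrightarrow> 0 < k \<Longrightarrow> range (\<lambda>i. \<gamma> ! (i mod k)) = set \<gamma>"
proof (intro equalityI subsetI)
  fix s assume "length \<gamma> = k" "0 < k" "s \<in> set \<gamma>"
  then obtain i where "i < k" "s = \<gamma> ! i" by (auto simp: in_set_conv_nth)
  then show "s \<in> range (\<lambda>i. \<gamma> ! (i mod k))" by (intro image_eqI[of _ _ i]) auto
qed auto

text \<open>The edge count puts the walk on a single cycle, where a repeated vertex forces it to
  wind round. The period is at most half the length, and this turns growth
  \<open>\<theta> ^ k\<close> into \<open>\<theta> ^ (k div 2)\<close>.\<close>

lemma one_collision_periodic:
  assumes g: "\<gamma> \<in> closed_candidates N d k" and ns: "\<not> simple \<gamma>"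
    and count: "card (step_edge ` set \<gamma>) \<le> card (fst ` \<Union>(step_edge ` set \<gamma>))"
  shows "\<exists>q\<in>{1..k div 2}. take q \<gamma> \<in> cycles N d q \<and> step_edge ` set \<gamma> = step_edge ` set (take q \<gamma>)
    \<and> (\<forall>i<k. \<gamma> ! i = take q \<gamma> ! (i mod q))"
proof -
  have l: "length \<gamma> = k" "0 < k" and pmg: "partial_matching (half_edges N d) (step_edge ` set \<gamma>)"
    using g by (auto simp: closed_candidates_def)
  define s where "s i = \<gamma> ! (i mod k)" for i
  have rng: "range s = set \<gamma>" unfolding s_def[abs_def] by (rule range_nth_mod[OF l])
  interpret unicyclic_walk "half_edges N d" s k
  proof
    show "follows (s i) (fst (s (Suc i)))" for i unfolding s_def by (rule cyclic_follows[OF g])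
  qed (use l pmg count rng card_half_edges(2)[of N d] in \<open>simp_all add: s_def\<close>)
  have "\<not> distinct (map (\<lambda>s. fst (fst s)) \<gamma>)" using ns by (simp add: simple_def)
  then obtain i j where ij: "i < k" "j < k" "i \<noteq> j" "fst (fst (\<gamma> ! i)) = fst (fst (\<gamma> ! j))"
    using l by (auto simp: distinct_conv_nth)
  have "\<exists>i j. i < j \<and> j < k \<and> fst (fst (s i)) = fst (fst (s j))"
  proof (cases "i < j")
    case True
    then show ?thesis using ij by (intro exI[of _ i] exI[of _ j]) (simp add: s_def)
  next
    case False
    then show ?thesis using ij by (intro exI[of _ j] exI[of _ i]) (simp add: s_def)
  qed
  then obtain i j where "i < j" "j < k" "fst (fst (s i)) = fst (fst (s j))" by blast
  from primitive_period[OF this] obtain q where q: "0 < q" "2 * q \<le> k" "\<And>i. s (i mod q) = s i"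
    "inj_on (\<lambda>i. fst (fst (s i))) {..<q}" by blast
  let ?\<delta> = "take q \<gamma>"
  have ld: "length ?\<delta> = q" using l q by simp
  have dn: "?\<delta> ! i = s i" if "i < q" for i using that q l by (simp add: s_def)
  have gn: "\<gamma> ! i = ?\<delta> ! (i mod q)" if "i < k" for i
    using dn[of "i mod q"] q(1,3) that by (simp add: s_def)
  have setd: "set ?\<delta> = set \<gamma>"
  proof
    show "set ?\<delta> \<subseteq> set \<gamma>" by (rule set_take_subset)
    show "set \<gamma> \<subseteq> set ?\<delta>"
    proof
      fix t assume "t \<in> set \<gamma>"
      then obtain i where "i < k" "t = \<gamma> ! i" using l by (auto simp: in_set_conv_nth)
      then have "t = ?\<delta> ! (i mod q)" using gn by simp
      moreover have "i mod q < length ?\<delta>" using ld q(1) by simp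
      ultimately show "t \<in> set ?\<delta>" by (simp only: nth_mem)
    qed
  qed
  have "simple ?\<delta>"
  proof -
    have "inj_on ((!) (map (\<lambda>s. fst (fst s)) ?\<delta>)) {..<q}"
    proof (rule inj_onI)
      fix a b assume ab: "a \<in> {..<q}" "b \<in> {..<q}" "map (\<lambda>s. fst (fst s)) ?\<delta> ! a = map (\<lambda>s. fst (fst s)) ?\<delta> ! b"
      then have "fst (fst (s a)) = fst (fst (s b))" using ld dn by simp
      then show "a = b" using inj_onD[OF q(4)] ab by blast
    qed
    then show ?thesis unfolding simple_def distinct_conv_nth using ld by (auto simp: inj_on_def simp del: length_take)
  qed
  moreover have "nb_walk UNIV ?\<delta> (fst (hd ?\<delta>))"
    unfolding nb_walk_nth
  proof (intro allI impI)
    fix i assume i: "i < length ?\<delta>"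
    have h: "hd ?\<delta> = s 0" using q(1) l by (cases \<gamma>) (auto simp: s_def take_Cons')
    have fi: "follows (s i) (fst (s (Suc i)))" by (rule nb)
    show "follows (?\<delta> ! i) (if Suc i < length ?\<delta> then fst (?\<delta> ! Suc i) else fst (hd ?\<delta>))"
    proof (cases "Suc i < q")
      case True
      then show ?thesis using fi dn[of i] dn[of "Suc i"] ld by simp
    next
      case False
      then have "Suc i = q" using i ld by simp
      then have "s (Suc i) = s 0" using q(3)[of q] by simp
      then show ?thesis using fi dn[of i] i ld False h by simp
    qed
  qed
  moreover have "?\<delta> \<noteq> []" using ld q(1) by auto
  ultimately have "?\<delta> \<in> cycles N d q" using ld pmg setd by (simp add: cycles_def closed_candidates_def)
  moreover have "q \<in> {1..k div 2}" using q by auto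
  ultimately show ?thesis using setd gn by (intro bexI[of _ q]) auto
qed

lemma sum_UNION_le:
  fixes f :: "'b \<Rightarrow> real"
  assumes "finite I" "\<And>i. i \<in> I \<Longrightarrow> finite (A i)" "\<And>i x. i \<in> I \<Longrightarrow> x \<in> A i \<Longrightarrow> 0 \<le> f x"
  shows "sum f (\<Union>i\<in>I. A i) \<le> (\<Sum>i\<in>I. sum f (A i))"
  using assms
proof (induction I rule: finite_induct)
  case (insert i I)
  have fin: "finite (A i)" "finite (\<Union>i\<in>I. A i)" using insert by auto
  have "0 \<le> sum f (A i \<inter> (\<Union>i\<in>I. A i))" using insert.prems(2)[of i] by (intro sum_nonneg) simp
  then have "sum f (A i \<union> (\<Union>i\<in>I. A i)) \<le> sum f (A i) + sum f (\<Union>i\<in>I. A i)"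
    using sum.union_inter[OF fin, of f] by linarith
  moreover have "sum f (\<Union>i\<in>I. A i) \<le> (\<Sum>i\<in>I. sum f (A i))"
    using insert.prems by (intro insert.IH) auto
  ultimately show ?case using insert.hyps by simp
qed simp

definition cycle_weight :: "real \<Rightarrow> nat \<Rightarrow> nat \<Rightarrow> nat \<Rightarrow> real" where
  "cycle_weight p N d q = (\<Sum>\<delta>\<in>cycles N d q. wt p (N * d) (card (step_edge ` set \<delta>)))"

lemma closed_wt_nonneg:
  assumes "\<gamma> \<in> closed_candidates N d k" "0 \<le> p" "2 * k \<le> N * d"
  shows "0 \<le> wt p (N * d) (card (step_edge ` set \<gamma>))"
proof -
  have "card (step_edge ` set \<gamma>) \<le> k"
    using card_image_le[of "set \<gamma>" step_edge] card_length[of \<gamma>] assms(1) by (simp add: closed_candidates_def)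
  then show ?thesis using assms by (intro wt_nonneg) auto
qed

text \<open>A periodic walk is determined by its first \<open>q\<close> steps and has the edge set,
  hence the weight, of that cycle.\<close>

lemma periodic_sum:
  assumes p: "0 \<le> p" and k: "2 * k \<le> N * d"
  shows "(\<Sum>\<gamma>\<in>{\<gamma> \<in> closed_candidates N d k. \<not> simple \<gamma> \<and> card (step_edge ` set \<gamma>) \<le> card (fst ` \<Union>(step_edge ` set \<gamma>))}.
      wt p (N * d) (card (step_edge ` set \<gamma>))) \<le> (\<Sum>q\<in>{1..k div 2}. cycle_weight p N d q)"
proof -
  let ?w = "\<lambda>\<gamma>. wt p (N * d) (card (step_edge ` set \<gamma>))"
  define P where "P q = {\<gamma> \<in> closed_candidates N d k. take q \<gamma> \<in> cycles N d q \<and> step_edge ` set \<gamma> = step_edge ` set (take q \<gamma>)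
    \<and> (\<forall>i<k. \<gamma> ! i = take q \<gamma> ! (i mod q))}" for q
  have finP: "finite (P q)" for q by (rule finite_subset[OF _ finite_closed_candidates[of N d k]]) (auto simp: P_def)
  have w0: "0 \<le> ?w \<gamma>" if "\<gamma> \<in> closed_candidates N d k" for \<gamma> by (rule closed_wt_nonneg[OF that p k])
  have "(\<Sum>\<gamma>\<in>{\<gamma> \<in> closed_candidates N d k. \<not> simple \<gamma> \<and> card (step_edge ` set \<gamma>) \<le> card (fst ` \<Union>(step_edge ` set \<gamma>))}. ?w \<gamma>)
      \<le> (\<Sum>\<gamma>\<in>(\<Union>q\<in>{1..k div 2}. P q). ?w \<gamma>)"
  proof (rule sum_mono2)
    show "finite (\<Union>q\<in>{1..k div 2}. P q)" using finP by (intro finite_UN_I) auto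
    show "{\<gamma> \<in> closed_candidates N d k. \<not> simple \<gamma> \<and> card (step_edge ` set \<gamma>) \<le> card (fst ` \<Union>(step_edge ` set \<gamma>))} \<subseteq> (\<Union>q\<in>{1..k div 2}. P q)"
    proof
      fix \<gamma> assume "\<gamma> \<in> {\<gamma> \<in> closed_candidates N d k. \<not> simple \<gamma> \<and> card (step_edge ` set \<gamma>) \<le> card (fst ` \<Union>(step_edge ` set \<gamma>))}"
      then have g: "\<gamma> \<in> closed_candidates N d k" "\<not> simple \<gamma>" "card (step_edge ` set \<gamma>) \<le> card (fst ` \<Union>(step_edge ` set \<gamma>))" by simp_all
      from one_collision_periodic[OF g] obtain q where "q \<in> {1..k div 2}" "take q \<gamma> \<in> cycles N d q"
        "step_edge ` set \<gamma> = step_edge ` set (take q \<gamma>)" "\<forall>i<k. \<gamma> ! i = take q \<gamma> ! (i mod q)" by blast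
      then show "\<gamma> \<in> (\<Union>q\<in>{1..k div 2}. P q)" using g(1) by (intro UN_I[of q]) (simp_all add: P_def)
    qed
    show "0 \<le> ?w \<gamma>" if "\<gamma> \<in> (\<Union>q\<in>{1..k div 2}. P q) - {\<gamma> \<in> closed_candidates N d k. \<not> simple \<gamma> \<and> card (step_edge ` set \<gamma>) \<le> card (fst ` \<Union>(step_edge ` set \<gamma>))}" for \<gamma>
      using that by (intro w0) (auto simp: P_def)
  qed
  also have "\<dots> \<le> (\<Sum>q\<in>{1..k div 2}. \<Sum>\<gamma>\<in>P q. ?w \<gamma>)"
  proof (rule sum_UNION_le)
    show "finite {1..k div 2}" by simp
    show "finite (P q)" for q by (rule finP)
    show "0 \<le> ?w \<gamma>" if "\<gamma> \<in> P q" for q \<gamma> using that by (intro w0) (simp add: P_def)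
  qed
  also have "\<dots> \<le> (\<Sum>q\<in>{1..k div 2}. cycle_weight p N d q)"
  proof (rule sum_mono)
    fix q assume q: "q \<in> {1..k div 2}"
    have inj: "inj_on (take q) (P q)"
    proof (rule inj_onI)
      fix \<gamma> \<gamma>' assume a: "\<gamma> \<in> P q" "\<gamma>' \<in> P q" "take q \<gamma> = take q \<gamma>'"
      show "\<gamma> = \<gamma>'"
      proof (rule nth_equalityI)
        show "length \<gamma> = length \<gamma>'" using a by (simp add: P_def closed_candidates_def)
        fix i assume "i < length \<gamma>"
        then have "i < k" using a by (simp add: P_def closed_candidates_def)
        then show "\<gamma> ! i = \<gamma>' ! i" using a unfolding P_def by simp
      qed
    qed
    have "(\<Sum>\<gamma>\<in>P q. ?w \<gamma>) = (\<Sum>\<gamma>\<in>P q. ?w (take q \<gamma>))" by (intro sum.cong refl) (simp add: P_def)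
    also have "\<dots> = (\<Sum>\<delta>\<in>take q ` P q. ?w \<delta>)" using sum.reindex[OF inj, of ?w] by simp
    also have "\<dots> \<le> cycle_weight p N d q"
      unfolding cycle_weight_def
    proof (rule sum_mono2)
      show "finite (cycles N d q)" by (rule finite_subset[OF _ finite_closed_candidates[of N d q]]) (auto simp: cycles_def)
      show "take q ` P q \<subseteq> cycles N d q" by (auto simp: P_def)
      fix \<delta> assume "\<delta> \<in> cycles N d q - take q ` P q"
      then have "\<delta> \<in> closed_candidates N d q" by (simp add: cycles_def)
      then show "0 \<le> ?w \<delta>" using p k q by (intro closed_wt_nonneg[of \<delta> N d q]) auto
    qed
    finally show "(\<Sum>\<gamma>\<in>P q. ?w \<gamma>) \<le> cycle_weight p N d q" .
  qed
  finally show ?thesis .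
qed

section \<open>The total weight of tangle-free closed walks that are not simple\<close>

lemma nb_walk_append: "nb_walk \<Gamma> (\<delta> @ \<gamma>) z \<longleftrightarrow> nb_walk \<Gamma> \<delta> (start \<gamma> z) \<and> nb_walk \<Gamma> \<gamma> z"
proof (induction \<delta>)
  case (Cons s \<delta>)
  have "start (\<delta> @ \<gamma>) z = start \<delta> (start \<gamma> z)" by (cases \<delta>) auto
  then show ?case using Cons by auto
qed simp

context exploration_base
begin

lemma valid_partial_matching: "valid \<gamma> \<Longrightarrow> partial_matching H (edges \<gamma>)"
  by (simp add: valid_def)

lemma old_run_path:
  assumes "\<delta> \<in> old_runs m \<gamma>"
  shows "length \<delta> = m" "nb_path (edges \<gamma>) \<delta> (fst (start \<gamma> z))"
proof -
  have "valid (\<delta> @ \<gamma>)" "step_edge ` set \<delta> \<subseteq> edges \<gamma>" and l: "length \<delta> = m"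
    using assms by (simp_all add: old_runs_def)
  then have "nb_walk (edges \<gamma>) \<delta> (start \<gamma> z)"
    using nb_walk_mono[of UNIV \<delta> "start \<gamma> z" "edges \<gamma>"] by (simp add: valid_def nb_walk_append)
  then show "nb_path (edges \<gamma>) \<delta> (fst (start \<gamma> z))" by (rule nb_walk_path)
  show "length \<delta> = m" by (rule l)
qed

lemma card_edges_valid: "finite \<Gamma>0 \<Longrightarrow> card (edges \<gamma>) \<le> card \<Gamma>0 + length \<gamma>"
proof -
  assume "finite \<Gamma>0"
  then have "card (edges \<gamma>) \<le> card \<Gamma>0 + card (step_edge ` set \<gamma>)" unfolding edges_def by (intro card_Un_le)
  also have "card (step_edge ` set \<gamma>) \<le> length \<gamma>" using card_image_le[of "set \<gamma>" step_edge] card_length[of \<gamma>] by simp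
  finally show ?thesis by simp
qed

end

definition tame_walks :: "nat \<Rightarrow> nat \<Rightarrow> nat \<Rightarrow> nat \<Rightarrow> step list set" where
  "tame_walks N d m k = {\<gamma> \<in> closed_candidates N d k. \<not> simple \<gamma> \<and> tangle_free m (step_edge ` set \<gamma>)}"

lemma closed_candidate_card:
  assumes "\<gamma> \<in> closed_candidates N d k"
  shows "card (step_edge ` set \<gamma>) \<le> k" "fst (hd \<gamma>) \<in> half_edges N d" "fst (fst (hd \<gamma>)) \<in> fst ` \<Union>(step_edge ` set \<gamma>)"
proof -
  have l: "length \<gamma> = k" "\<gamma> \<noteq> []" and pm: "partial_matching (half_edges N d) (step_edge ` set \<gamma>)"
    using assms by (simp_all add: closed_candidates_def)
  show "card (step_edge ` set \<gamma>) \<le> k" using card_image_le[of "set \<gamma>" step_edge] card_length[of \<gamma>] l by simp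
  have h: "step_edge (hd \<gamma>) \<in> step_edge ` set \<gamma>" using l by simp
  show "fst (hd \<gamma>) \<in> half_edges N d" using step_edges_half[OF partial_matchingD(1)[OF pm h]] by simp
  have "fst (hd \<gamma>) \<in> \<Union>(step_edge ` set \<gamma>)" using h by (intro UnionI) (auto simp: step_edge_def)
  then show "fst (fst (hd \<gamma>)) \<in> fst ` \<Union>(step_edge ` set \<gamma>)" by (rule imageI)
qed

text \<open>Walks without an excess edge are periodic. All others, explored from their first
  half-edge with nothing known, collide at least twice; the gain \<open>\<zeta>\<^sup>2\<close>, of
  order \<open>N^2\<close> up to logarithms, outweighs the \<open>N * d\<close> choices of that
  half-edge.\<close>

lemma tame_sum:
  fixes p \<zeta> \<theta>' \<eta> \<kappa> :: real
  assumes d: "2 \<le> d" and p: "0 \<le> p" and K: "k \<le> K" "2 * K < N * d"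
    and \<theta>': "\<theta>' = (real d - 1) * real (N * d) * (p / (real (N * d) - 2 * real K))" "1 \<le> \<theta>'"
    and \<eta>: "\<eta> = real d * (2 * real K + 1) / real (N * d)"
    and l: "3 * (l + 1) \<le> m" "0 < l" "4 * real k + 1 \<le> \<theta>' ^ l"
    and \<kappa>: "4 * real k + 1 \<le> \<kappa>"
    and \<zeta>1: "1 \<le> \<zeta>" "\<zeta> * \<eta> * (2 * \<kappa> * (real k + 1)) * real k \<le> 1"
  shows "(\<Sum>\<gamma>\<in>tame_walks N d m k. wt p (N * d) (card (step_edge ` set \<gamma>)))
    \<le> (\<Sum>q\<in>{1..k div 2}. cycle_weight p N d q) + real (N * d) * (\<theta>' ^ k * (2 * \<kappa> * (real k + 1)) / \<zeta>\<^sup>2)"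
proof -
  let ?w = "\<lambda>\<gamma>. wt p (N * d) (card (step_edge ` set \<gamma>))"
  let ?H = "half_edges N d"
  let ?few = "\<lambda>\<gamma>. card (step_edge ` set \<gamma>) \<le> card (fst ` \<Union>(step_edge ` set \<gamma>))"
  let ?al = "\<lambda>\<gamma>. tangle_free m (step_edge ` set \<gamma>)"
  have kN: "2 * k \<le> N * d" using K by simp
  have ex: "exploration N d p {} z ?al k K \<kappa> \<zeta> \<theta>' \<eta>" if z: "z \<in> ?H" for z
  proof
    show "2 \<le> d" "0 \<le> p" "z \<in> ?H" by (fact d p z)+
    show "tangle_free m (step_edge ` set \<gamma>)" if "tangle_free m (step_edge ` set (s # \<gamma>))" for s \<gamma>
      by (rule tangle_free_subset[OF that]) auto
    show "card ({} :: half set set) + k \<le> K" "2 * K < N * d" using K by simp_all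
    show "\<theta>' = (real d - 1) * real (N * d) * (p / (real (N * d) - 2 * real K))"
      "\<eta> = real d * (2 * real K + 1) / real (N * d)" by (fact \<theta>' \<eta>)+
    show "1 \<le> \<kappa>" using \<kappa> by simp
    show "0 \<le> \<zeta>" "\<zeta> * \<eta> * (2 * \<kappa> * (real k + 1)) * real k \<le> 1" using \<zeta>1 by simp_all
    fix \<gamma> r assume v: "exploration_base.valid N d {} z ?al \<gamma>" and lr: "length \<gamma> + r \<le> k"
    interpret exploration_base N d p "{}" z ?al .
    have e: "edges \<gamma> = step_edge ` set \<gamma>" by (simp add: edges_def)
    have tf: "tangle_free m (edges \<gamma>)" using v unfolding valid_def e by blast
    have pm: "partial_matching ?H (edges \<gamma>)" by (rule valid_partial_matching[OF v])
    have ce: "card (edges \<gamma>) \<le> k" using card_edges_valid[of \<gamma>] lr by simp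
    have "card (old_runs r \<gamma>) \<le> card {\<delta>. length \<delta> = r \<and> nb_path (edges \<gamma>) \<delta> (fst (start \<gamma> z))}"
      using old_run_path by (intro card_mono finite_nb_paths[OF pm card_half_edges(2)] subsetI) simp
    also have "\<dots> \<le> (4 * card (edges \<gamma>) + 1) ^ (r div l + 1)"
      by (rule card_nb_paths[OF tf pm card_half_edges(2) l(1,2)])
    also have "\<dots> \<le> (4 * k + 1) ^ (r div l + 1)" using ce by (intro power_mono) auto
    finally have "real (card (old_runs r \<gamma>)) \<le> real ((4 * k + 1) ^ (r div l + 1))" by (rule of_nat_mono)
    also have "\<dots> = (4 * real k + 1) * (4 * real k + 1) ^ (r div l)"
      by (simp add: distrib_right add.commute)
    \<comment> \<open>Each full block of length \<open>l\<close> costs at most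
      \<open>\<theta>' ^ l\<close> by assumption, and \<open>\<kappa>\<close> absorbs the last,
      incomplete one.\<close>
    also have "\<dots> \<le> \<kappa> * (\<theta>' ^ l) ^ (r div l)"
      using \<kappa> l(3) by (intro mult_mono power_mono) auto
    also have "(\<theta>' ^ l) ^ (r div l) = \<theta>' ^ (l * (r div l))" by (simp only: power_mult)
    also have "\<kappa> * \<theta>' ^ (l * (r div l)) \<le> \<kappa> * \<theta>' ^ r"
      using \<theta>'(2) \<kappa> by (intro mult_left_mono power_increasing) auto
    finally show "real (card (old_runs r \<gamma>)) \<le> \<kappa> * \<theta>' ^ r" .
  qed
  define A where "A = {\<gamma> \<in> closed_candidates N d k. \<not> simple \<gamma> \<and> ?few \<gamma>}"
  define Bz where "Bz z = {\<gamma>. length \<gamma> = k \<and> exploration_base.valid N d {} z ?al \<gamma> \<and> 2 \<le> exploration_base.coll {} z \<gamma>}" for z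
  have finB: "finite (Bz z)" if "z \<in> ?H" for z
  proof -
    interpret exploration N d p "{}" z ?al k K \<kappa> \<zeta> \<theta>' \<eta> by (rule ex[OF that])
    show ?thesis unfolding Bz_def using finite_extensions[of k "[]"] by (rule finite_subset[rotated]) auto
  qed
  have wB: "0 \<le> ?w \<gamma>" if "\<gamma> \<in> Bz z" for \<gamma> z
  proof (intro wt_nonneg p)
    have "card (step_edge ` set \<gamma>) \<le> k"
      using that card_image_le[of "set \<gamma>" step_edge] card_length[of \<gamma>] by (simp add: Bz_def)
    then show "2 * card (step_edge ` set \<gamma>) \<le> N * d" using kN by simp
  qed
  have wA: "0 \<le> ?w \<gamma>" if "\<gamma> \<in> A" for \<gamma> using that by (intro closed_wt_nonneg[OF _ p kN]) (simp add: A_def)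
  have finA: "finite A" by (rule finite_subset[OF _ finite_closed_candidates[of N d k]]) (simp add: A_def)
  have finBB: "finite (\<Union>z\<in>?H. Bz z)" using finB card_half_edges(2)[of N d] by simp
  have cover: "tame_walks N d m k \<subseteq> A \<union> (\<Union>z\<in>?H. Bz z)"
  proof
    fix \<gamma> assume "\<gamma> \<in> tame_walks N d m k"
    then have g: "\<gamma> \<in> closed_candidates N d k" "\<not> simple \<gamma>" "?al \<gamma>" by (simp_all add: tame_walks_def)
    show "\<gamma> \<in> A \<union> (\<Union>z\<in>?H. Bz z)"
    proof (cases "?few \<gamma>")
      case True
      then show ?thesis using g by (simp add: A_def)
    next
      case False
      define z where "z = fst (hd \<gamma>)"
      have z: "z \<in> ?H" unfolding z_def by (rule closed_candidate_card(2)[OF g(1)])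
      interpret exploration N d p "{}" z ?al k K \<kappa> \<zeta> \<theta>' \<eta> by (rule ex[OF z])
      have e: "edges \<delta> = step_edge ` set \<delta>" for \<delta> by (simp add: edges_def)
      have v: "valid \<gamma>" unfolding valid_def e using g by (simp add: closed_candidates_def z_def)
      have "card (visited \<gamma>) = card (fst ` \<Union>(step_edge ` set \<gamma>))"
        unfolding visited_def e by (rule arg_cong[OF insert_absorb[OF closed_candidate_card(3)[OF g(1)], folded z_def]])
      moreover have "card (edges \<gamma>) + card (visited []) = card (visited \<gamma>) + card (edges []) + coll \<gamma>"
        by (rule euler_count[OF v allowed_tl])
      moreover have "card (visited []) = 1" "card (edges []) = 0" by (simp_all add: visited_def e)
      \<comment> \<open>Starting from one vertex and no edge, collisions equal edges minus vertices
        plus 1: one is spent on closing up, a second one on the excess edge.\<close>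
      ultimately have "2 \<le> coll \<gamma>" using False unfolding e by linarith
      moreover have "length \<gamma> = k" using g by (simp add: closed_candidates_def)
      ultimately have "\<gamma> \<in> Bz z" unfolding Bz_def using v by simp
      then show ?thesis using z by blast
    qed
  qed
  have "sum ?w (tame_walks N d m k) \<le> sum ?w (A \<union> (\<Union>z\<in>?H. Bz z))"
    using finA finBB cover wA wB by (intro sum_mono2) auto
  also have "\<dots> \<le> sum ?w A + sum ?w (\<Union>z\<in>?H. Bz z)"
  proof -
    have "0 \<le> sum ?w (A \<inter> (\<Union>z\<in>?H. Bz z))" using wA by (intro sum_nonneg) simp
    then show ?thesis using sum.union_inter[OF finA finBB, of ?w] by linarith
  qed
  also have "sum ?w A \<le> (\<Sum>q\<in>{1..k div 2}. cycle_weight p N d q)"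
    unfolding A_def by (rule periodic_sum[OF p kN])
  also have "sum ?w (\<Union>z\<in>?H. Bz z) \<le> (\<Sum>z\<in>?H. sum ?w (Bz z))"
    using card_half_edges(2)[of N d] finB wB by (intro sum_UNION_le) auto
  also have "\<dots> \<le> (\<Sum>z\<in>?H. \<theta>' ^ k * (2 * \<kappa> * (real k + 1)) / \<zeta>\<^sup>2)"
  proof (rule sum_mono)
    fix z assume z: "z \<in> ?H"
    interpret exploration N d p "{}" z ?al k K \<kappa> \<zeta> \<theta>' \<eta> by (rule ex[OF z])
    have e: "edges \<delta> = step_edge ` set \<delta>" for \<delta> by (simp add: edges_def)
    have v0: "valid []" unfolding valid_def e by (simp add: tangle_free_def partial_matching_def)
    show "sum ?w (Bz z) \<le> \<theta>' ^ k * (2 * \<kappa> * (real k + 1)) / \<zeta>\<^sup>2"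
      using exploration_sum_coll[OF v0 \<zeta>1(1), of 2] unfolding Bz_def e by simp
  qed
  also have "\<dots> = real (N * d) * (\<theta>' ^ k * (2 * \<kappa> * (real k + 1)) / \<zeta>\<^sup>2)"
    using card_half_edges(1)[of N d] by simp
  finally show ?thesis by simp
qed

section \<open>Pairs of cycles\<close>

lemma finite_cycles: "finite (cycles N d k)"
  by (rule finite_subset[OF _ finite_closed_candidates[of N d k]]) (simp add: cycles_def)

text \<open>A simple closed walk visits \<open>k\<close> vertices and has at most \<open>k\<close>
  edges, so it falls under \<open>unicyclic_walk\<close>. Two half-edges at each vertex then give
  exactly \<open>k\<close> edges.\<close>

lemma cycle_structure:
  assumes g: "\<gamma> \<in> cycles N d k"
  shows "card (step_edge ` set \<gamma>) = k" and "card (fst ` \<Union>(step_edge ` set \<gamma>)) = k"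
    and "fst ` \<Union>(step_edge ` set \<gamma>) = (\<lambda>s. fst (fst s)) ` set \<gamma>"
    and "\<And>w. w \<in> fst ` \<Union>(step_edge ` set \<gamma>) \<Longrightarrow> card {x \<in> \<Union>(step_edge ` set \<gamma>). fst x = w} = 2"
proof -
  let ?\<Gamma> = "step_edge ` set \<gamma>"
  have c: "\<gamma> \<in> closed_candidates N d k" and "simple \<gamma>" using g by (simp_all add: cycles_def)
  then have l: "length \<gamma> = k" "0 < k" and pmg: "partial_matching (half_edges N d) ?\<Gamma>"
    and dist: "distinct (map (\<lambda>s. fst (fst s)) \<gamma>)" by (auto simp: closed_candidates_def simple_def)
  have finH: "finite (half_edges N d)" by (rule card_half_edges(2))
  have finU: "finite (\<Union>?\<Gamma>)" using partial_matchingD(1)[OF pmg] by (intro finite_subset[OF _ finH]) blast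
  have cs: "card ((\<lambda>s. fst (fst s)) ` set \<gamma>) = k" using distinct_card[OF dist] l by simp
  define s where "s i = \<gamma> ! (i mod k)" for i
  have rng: "range s = set \<gamma>" unfolding s_def[abs_def] by (rule range_nth_mod[OF l])
  have fol: "follows (s i) (fst (s (Suc i)))" for i unfolding s_def by (rule cyclic_follows[OF c])
  show V: "fst ` \<Union>?\<Gamma> = (\<lambda>s. fst (fst s)) ` set \<gamma>"
  proof (intro equalityI subsetI)
    fix v assume "v \<in> fst ` \<Union>?\<Gamma>"
    then obtain h t where "t \<in> set \<gamma>" "h \<in> step_edge t" "v = fst h" by blast
    then obtain i where "h \<in> step_edge (s i)" unfolding rng[symmetric] by blast
    then have "v = fst (fst (s i)) \<or> v = fst (fst (s (Suc i)))" using fol[of i] \<open>v = fst h\<close>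
      by (auto simp: step_edge_def follows_def)
    then have "v \<in> (\<lambda>s. fst (fst s)) ` range s" by blast
    then show "v \<in> (\<lambda>s. fst (fst s)) ` set \<gamma>" unfolding rng .
  next
    fix v assume "v \<in> (\<lambda>s. fst (fst s)) ` set \<gamma>"
    then obtain t where t: "t \<in> set \<gamma>" "v = fst (fst t)" by blast
    then have "fst t \<in> \<Union>?\<Gamma>" by (intro UnionI[of "step_edge t"]) (auto simp: step_edge_def)
    then show "v \<in> fst ` \<Union>?\<Gamma>" unfolding t(2) by (rule imageI)
  qed
  show cV: "card (fst ` \<Union>?\<Gamma>) = k" unfolding V by (rule cs)
  interpret unicyclic_walk "half_edges N d" s k
  proof
    show "card (step_edge ` range s) \<le> card (fst ` \<Union>(step_edge ` range s))"
      unfolding rng cV by (rule closed_candidate_card(1)[OF c])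
    show "follows (s i) (fst (s (Suc i)))" for i by (rule fol)
  qed (use l pmg rng finH in \<open>simp_all add: s_def\<close>)
  show two: "card {x \<in> \<Union>?\<Gamma>. fst x = w} = 2" if w: "w \<in> fst ` \<Union>?\<Gamma>" for w
  proof -
    obtain i where "w = u i" using w vertices unfolding rng by blast
    then have "w = u (Suc (i + k - 1))" using l(2) period[of i] by simp
    moreover have "x (Suc j) \<noteq> y j" for j using vert(2)[of j] by simp
    ultimately show ?thesis using half[of "i + k - 1"] unfolding rng by simp
  qed
  have "2 * card ?\<Gamma> = (\<Sum>v\<in>fst ` \<Union>?\<Gamma>. card {x \<in> \<Union>?\<Gamma>. fst x = v})"
    using sum_card_fibres[OF finU, of fst] card_Union_partial_matching[OF pmg finH] by simp
  also have "\<dots> = 2 * k" using two cV by simp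
  finally show "card ?\<Gamma> = k" by simp
qed

section \<open>Counting cycles\<close>

definition turns :: "nat \<Rightarrow> nat \<Rightarrow> step set" where
  "turns N d = {(x, y). x \<in> half_edges N d \<and> y \<in> half_edges N d \<and> fst x = fst y \<and> x \<noteq> y}"

lemma turns_at:
  "card {t \<in> turns N d. fst (fst t) = v} = (if v < N then d * (d - 1) else 0)" "finite (turns N d)"
proof -
  show "finite (turns N d)"
    by (rule finite_subset[of _ "half_edges N d \<times> half_edges N d"]) (use card_half_edges(2)[of N d] in \<open>auto simp: turns_def\<close>)
  show "card {t \<in> turns N d. fst (fst t) = v} = (if v < N then d * (d - 1) else 0)"
  proof (cases "v < N")
    case True
    have "{t \<in> turns N d. fst (fst t) = v} = (\<lambda>(i, j). ((v, i), (v, j))) ` (Sigma {..<d} (\<lambda>i. {..<d} - {i}))"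
      using True by (force simp: turns_def half_edges_def)
    moreover have "inj_on (\<lambda>(i, j). ((v, i), (v, j))) (Sigma {..<d} (\<lambda>i. {..<d} - {i}))" by (auto simp: inj_on_def)
    moreover have "card (Sigma {..<d} (\<lambda>i. {..<d} - {i})) = d * (d - 1)" by (simp add: card_SigmaI)
    ultimately show ?thesis using True card_image by fastforce
  next
    case False
    then have "{t \<in> turns N d. fst (fst t) = v} = {}" by (auto simp: turns_def half_edges_def)
    then show ?thesis using False by (simp only: card.empty if_False)
  qed
qed

lemma card_turns: "card {t \<in> turns N d. fst (fst t) \<in> S} = card (S \<inter> {..<N}) * (d * (d - 1))" if "finite S"
proof -
  let ?T = "{t \<in> turns N d. fst (fst t) \<in> S}"
  have "?T = (\<Union>v\<in>S. {t \<in> turns N d. fst (fst t) = v})" by blast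
  then have "card ?T = (\<Sum>v\<in>S. card {t \<in> turns N d. fst (fst t) = v})"
    using that turns_at(2)[of N d] by (simp only:) (intro card_UN_disjoint, auto)
  also have "\<dots> = (\<Sum>v\<in>S \<inter> {..<N}. d * (d - 1))"
    unfolding turns_at(1) using that by (intro sum.mono_neutral_cong_right) auto
  finally show ?thesis by simp
qed

lemma card_turns_all: "card (turns N d) = N * (d * (d - 1))"
proof -
  have "{t \<in> turns N d. fst (fst t) \<in> {..<N}} = turns N d" by (auto simp: turns_def half_edges_def)
  then show ?thesis using card_turns[of "{..<N}" N d] by simp
qed

lemma rotate1_eqD: "rotate1 xs = rotate1 ys \<Longrightarrow> xs = ys"
  by (cases xs; cases ys) auto

text \<open>Grouping the two half-edges that a closed walk uses at each vertex it passes.\<close>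

lemma card_cycles_le: "card (cycles N d k) \<le> (N * (d * (d - 1))) ^ k"
proof -
  let ?f = "\<lambda>\<gamma> :: step list. zip (rotate1 (map fst \<gamma>)) (map snd \<gamma>)"
  have inj: "inj_on ?f (cycles N d k)"
  proof (rule inj_onI)
    fix \<gamma> \<gamma>' assume a: "\<gamma> \<in> cycles N d k" "\<gamma>' \<in> cycles N d k" "?f \<gamma> = ?f \<gamma>'"
    have l: "length \<gamma> = k" "length \<gamma>' = k" using a by (simp_all add: cycles_def closed_candidates_def)
    have "map fst (?f \<gamma>) = map fst (?f \<gamma>')" "map snd (?f \<gamma>) = map snd (?f \<gamma>')" using a(3) by simp_all
    then have r: "rotate1 (map fst \<gamma>) = rotate1 (map fst \<gamma>')" and s: "map snd \<gamma> = map snd \<gamma>'" using l by simp_all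
    then have "map fst \<gamma> = map fst \<gamma>'" by (intro rotate1_eqD[OF r])
    then show "\<gamma> = \<gamma>'" using s by (rule pair_list_eqI)
  qed
  have "?f ` cycles N d k \<subseteq> {c. set c \<subseteq> turns N d \<and> length c = k}"
  proof
    fix c assume "c \<in> ?f ` cycles N d k"
    then obtain \<gamma> where g: "\<gamma> \<in> closed_candidates N d k" "c = ?f \<gamma>" by (auto simp: cycles_def)
    have l: "length \<gamma> = k" "0 < k" and pm: "partial_matching (half_edges N d) (step_edge ` set \<gamma>)"
      using g by (auto simp: closed_candidates_def)
    have H: "fst s \<in> half_edges N d \<and> snd s \<in> half_edges N d" if "s \<in> set \<gamma>" for s
      using that by (intro step_edges_half partial_matchingD(1)[OF pm] imageI)
    have "t \<in> turns N d" if t: "t \<in> set c" for t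
    proof -
      obtain i where i: "i < k" "t = c ! i" using t l g(2) by (auto simp: in_set_conv_nth)
      have "t = (fst (\<gamma> ! (Suc i mod k)), snd (\<gamma> ! i))"
        using i l g(2) by (simp add: nth_rotate1)
      moreover have "follows (\<gamma> ! i) (fst (\<gamma> ! (Suc i mod k)))" using cyclic_follows[OF g(1), of i] i(1) by simp
      moreover have "\<gamma> ! i \<in> set \<gamma>" "\<gamma> ! (Suc i mod k) \<in> set \<gamma>" using i(1) l by simp_all
      ultimately show ?thesis using H by (auto simp: turns_def follows_def)
    qed
    moreover have "length c = k" using g(2) l by simp
    ultimately show "c \<in> {c. set c \<subseteq> turns N d \<and> length c = k}" by blast
  qed
  then have "card (cycles N d k) \<le> card {c. set c \<subseteq> turns N d \<and> length c = k}"
    using finite_lists_length_eq[OF turns_at(2)] by (intro card_inj_on_le[OF inj])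
  then show ?thesis unfolding card_lists_length_eq[OF turns_at(2)] card_turns_all .
qed

definition turn_lists :: "nat \<Rightarrow> nat \<Rightarrow> nat \<Rightarrow> step list set" where
  "turn_lists N d k = {c. length c = k \<and> set c \<subseteq> turns N d \<and> distinct (map (\<lambda>t. fst (fst t)) c)}"

text \<open>At each stage at most \<open>k\<close> vertices are excluded, and every other vertex
  offers \<open>d * (d - 1)\<close> turns.\<close>

lemma card_turn_lists: "((N - k) * (d * (d - 1))) ^ j \<le> card (turn_lists N d j)" if "j \<le> Suc k"
  using that
proof (induction j)
  case 0
  have "turn_lists N d 0 = {[]}" by (auto simp: turn_lists_def)
  then show ?case by simp
next
  case (Suc j)
  let ?V = "\<lambda>c :: step list. (\<lambda>t. fst (fst t)) ` set c"
  let ?A = "\<lambda>c. {t \<in> turns N d. fst (fst t) \<in> {..<N} - ?V c}"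
  have fin: "finite (turn_lists N d j)"
    by (rule finite_subset[OF _ finite_lists_length_eq[OF turns_at(2)[of N d], of j]]) (auto simp: turn_lists_def)
  have eq: "turn_lists N d (Suc j) = (\<Union>c\<in>turn_lists N d j. (\<lambda>t. t # c) ` ?A c)"
  proof (intro equalityI subsetI)
    fix c assume c: "c \<in> turn_lists N d (Suc j)"
    then obtain t c' where e: "c = t # c'" by (cases c) (auto simp: turn_lists_def)
    have "fst (fst t) < N" using c e by (auto simp: turn_lists_def turns_def half_edges_def)
    then have "t \<in> ?A c'" "c' \<in> turn_lists N d j" using c e by (auto simp: turn_lists_def)
    then show "c \<in> (\<Union>c\<in>turn_lists N d j. (\<lambda>t. t # c) ` ?A c)" unfolding e by blast
  qed (auto simp: turn_lists_def)
  have "((N - k) * (d * (d - 1))) ^ Suc j \<le> card (turn_lists N d j) * ((N - k) * (d * (d - 1)))"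
    using Suc by (simp add: mult.commute mult_le_mono)
  also have "\<dots> = (\<Sum>c\<in>turn_lists N d j. (N - k) * (d * (d - 1)))" by simp
  also have "\<dots> \<le> (\<Sum>c\<in>turn_lists N d j. card ((\<lambda>t. t # c) ` ?A c))"
  proof (rule sum_mono)
    fix c assume c: "c \<in> turn_lists N d j"
    have "card (?V c) \<le> k" using c Suc.prems card_image_le[of "set c" "\<lambda>t. fst (fst t)"] card_length[of c] by (simp add: turn_lists_def)
    then have "N - k \<le> card ({..<N} - ?V c)" using diff_card_le_card_Diff[of "?V c" "{..<N}"] by simp
    moreover have "({..<N} - ?V c) \<inter> {..<N} = {..<N} - ?V c" by blast
    ultimately have "(N - k) * (d * (d - 1)) \<le> card (?A c)"
      using card_turns[of "{..<N} - ?V c" N d] by (simp add: mult_le_mono)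
    also have "card (?A c) = card ((\<lambda>t. t # c) ` ?A c)" by (rule card_image[symmetric]) (simp add: inj_on_def)
    finally show "(N - k) * (d * (d - 1)) \<le> card ((\<lambda>t. t # c) ` ?A c)" .
  qed
  also have "\<dots> = card (turn_lists N d (Suc j))"
    unfolding eq using fin turns_at(2)[of N d] by (intro card_UN_disjoint[symmetric]) auto
  finally show ?case .
qed

text \<open>Joining turns at distinct vertices cyclically always gives a simple closed walk: no
  half-edge is used twice, so the edges form a partial matching, also for loops and double
  edges.\<close>

lemma card_cycles_ge:
  assumes "0 < k"
  shows "((N - k) * (d * (d - 1))) ^ k \<le> card (cycles N d k)"
proof -
  let ?f = "\<lambda>c :: step list. zip (map fst c) (rotate1 (map snd c))"
  have inj: "inj_on ?f (turn_lists N d k)"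
  proof (rule inj_onI)
    fix c c' assume a: "c \<in> turn_lists N d k" "c' \<in> turn_lists N d k" "?f c = ?f c'"
    have l: "length c = k" "length c' = k" using a by (simp_all add: turn_lists_def)
    have "map fst (?f c) = map fst (?f c')" "map snd (?f c) = map snd (?f c')" using a(3) by simp_all
    then have s: "map fst c = map fst c'" and r: "rotate1 (map snd c) = rotate1 (map snd c')" using l by simp_all
    then have "map snd c = map snd c'" by (intro rotate1_eqD[OF r])
    then show "c = c'" by (rule pair_list_eqI[OF s])
  qed
  have "?f ` turn_lists N d k \<subseteq> cycles N d k"
  proof
    fix \<gamma> assume "\<gamma> \<in> ?f ` turn_lists N d k"
    then obtain c where c: "c \<in> turn_lists N d k" and g: "\<gamma> = ?f c" by blast
    let ?s = "\<lambda>i. Suc i mod k"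
    have l: "length c = k" "set c \<subseteq> turns N d" and dist: "distinct (map (\<lambda>t. fst (fst t)) c)"
      using c by (simp_all add: turn_lists_def)
    have lg: "length \<gamma> = k" using g l by simp
    have sk: "?s i < k" for i using assms by simp
    have gi: "\<gamma> ! i = (fst (c ! i), snd (c ! ?s i))" if "i < k" for i
      using that l g sk by (simp add: nth_rotate1)
    have turn: "fst (c ! i) \<in> half_edges N d" "snd (c ! i) \<in> half_edges N d" "fst (snd (c ! i)) = fst (fst (c ! i))"
      "fst (c ! i) \<noteq> snd (c ! i)" if "i < k" for i
    proof -
      have "c ! i \<in> turns N d" using l that nth_mem[of i c] by blast
      then show "fst (c ! i) \<in> half_edges N d" "snd (c ! i) \<in> half_edges N d" "fst (snd (c ! i)) = fst (fst (c ! i))"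
        "fst (c ! i) \<noteq> snd (c ! i)" by (auto simp: turns_def)
    qed
    have vd: "i = j" if "i < k" "j < k" "fst (fst (c ! i)) = fst (fst (c ! j))" for i j
      using that dist l by (auto simp: distinct_conv_nth)
    have xy: "fst (c ! i) \<noteq> snd (c ! j)" if "i < k" "j < k" for i j
      using that vd[of i j] turn(3)[of j] turn(4)[of i] by auto
    have edge: "\<exists>i<k. e = step_edge (\<gamma> ! i)" if "e \<in> step_edge ` set \<gamma>" for e
      using that lg by (auto simp: set_conv_nth)
    have pm: "partial_matching (half_edges N d) (step_edge ` set \<gamma>)"
      unfolding partial_matching_def
    proof (intro conjI ballI pairwiseI)
      fix e assume "e \<in> step_edge ` set \<gamma>"
      then obtain i where i: "i < k" "e = step_edge (\<gamma> ! i)" using edge by blast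
      then have e: "e = {fst (c ! i), snd (c ! ?s i)}" by (simp add: gi step_edge_def)
      show "e \<subseteq> half_edges N d" using turn i(1) sk unfolding e by simp
      show "card e = 2" using xy[OF i(1) sk] unfolding e by simp
      fix e' assume "e' \<in> step_edge ` set \<gamma>" and ne: "e \<noteq> e'"
      then obtain j where j: "j < k" "e' = step_edge (\<gamma> ! j)" using edge by blast
      then have e': "e' = {fst (c ! j), snd (c ! ?s j)}" by (simp add: gi step_edge_def)
      have ij: "i \<noteq> j" using ne i j by auto
      have "fst (c ! i) \<noteq> fst (c ! j)" using vd[OF i(1) j(1)] ij by auto
      moreover have "snd (c ! ?s i) \<noteq> snd (c ! ?s j)"
      proof
        assume "snd (c ! ?s i) = snd (c ! ?s j)"
        then have "fst (fst (c ! ?s i)) = fst (fst (c ! ?s j))" using turn(3)[OF sk] by metis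
        then have "?s i = ?s j" by (rule vd[OF sk sk])
        then show False using i(1) j(1) ij by (simp add: mod_Suc split: if_splits)
      qed
      ultimately show "disjnt e e'" using xy[OF i(1) sk] xy[OF j(1) sk] unfolding e e' disjnt_def by auto
    qed
    have "nb_walk UNIV \<gamma> (fst (hd \<gamma>))"
      unfolding nb_walk_nth lg
    proof (intro allI impI)
      fix i assume i: "i < k"
      have "\<gamma> \<noteq> []" using lg assms by auto
      then have "fst (hd \<gamma>) = fst (\<gamma> ! 0)" by (simp add: hd_conv_nth)
      moreover have "\<not> Suc i < k \<Longrightarrow> Suc i mod k = 0" using i by (simp add: mod_Suc)
      ultimately have "(if Suc i < k then fst (\<gamma> ! Suc i) else fst (hd \<gamma>)) = fst (c ! ?s i)"
        using gi[of "Suc i"] gi[of 0] assms by simp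
      then show "follows (\<gamma> ! i) (if Suc i < k then fst (\<gamma> ! Suc i) else fst (hd \<gamma>))"
        using gi[OF i] turn(3,4)[OF sk[of i]] by (simp add: follows_def)
    qed
    moreover have "simple \<gamma>"
    proof -
      have "map (\<lambda>s. fst (fst s)) \<gamma> = map (\<lambda>t. fst (fst t)) c"
        by (rule nth_equalityI) (use lg l gi in auto)
      then show ?thesis using dist by (simp add: simple_def)
    qed
    moreover have "\<gamma> \<noteq> []" using lg assms by auto
    ultimately show "\<gamma> \<in> cycles N d k" using lg pm by (simp add: cycles_def closed_candidates_def)
  qed
  then have "card (turn_lists N d k) \<le> card (cycles N d k)" by (intro card_inj_on_le[OF inj] finite_cycles)
  then show ?thesis using card_turn_lists[of k k N d] by simp
qed

text \<open>On a cycle a path is determined by its first half-edge, so the bound is the number of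
  half-edges, whatever the length \<open>m\<close>.\<close>

lemma cycle_paths:
  assumes g: "\<gamma> \<in> cycles N d k" and k: "0 < k"
  shows "card {\<delta>. length \<delta> = m \<and> nb_path (step_edge ` set \<gamma>) \<delta> v} \<le> 2 * k"
proof (cases m)
  case 0
  have "{\<delta>. length \<delta> = m \<and> nb_path (step_edge ` set \<gamma>) \<delta> v} = {[]}" unfolding 0 by auto
  then show ?thesis using k by simp
next
  case (Suc j)
  let ?\<Gamma> = "step_edge ` set \<gamma>"
  have pm: "partial_matching (half_edges N d) ?\<Gamma>" using g by (simp add: cycles_def closed_candidates_def)
  have finH: "finite (half_edges N d)" by (rule card_half_edges(2))
  have finU: "finite (\<Union>?\<Gamma>)" using partial_matchingD(1)[OF pm] by (intro finite_subset[OF _ finH]) blast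
  have "card {\<delta>. length \<delta> = m \<and> nb_path ?\<Gamma> \<delta> v} \<le> card (\<Union>?\<Gamma>)"
  proof (rule card_inj_on_le[of "\<lambda>\<delta>. fst (hd \<delta>)"])
    show "inj_on (\<lambda>\<delta>. fst (hd \<delta>)) {\<delta>. length \<delta> = m \<and> nb_path ?\<Gamma> \<delta> v}"
    proof (rule inj_onI)
      fix \<delta> \<delta>' assume a: "\<delta> \<in> {\<delta>. length \<delta> = m \<and> nb_path ?\<Gamma> \<delta> v}" "\<delta>' \<in> {\<delta>. length \<delta> = m \<and> nb_path ?\<Gamma> \<delta> v}"
        "fst (hd \<delta>) = fst (hd \<delta>')"
      show "\<delta> = \<delta>'"
        by (rule two_regular_deterministic[OF pm finH cycle_structure(4)[OF g], of \<delta> v \<delta>']) (use a Suc in auto)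
    qed
    show "(\<lambda>\<delta>. fst (hd \<delta>)) ` {\<delta>. length \<delta> = m \<and> nb_path ?\<Gamma> \<delta> v} \<subseteq> \<Union>?\<Gamma>"
    proof
      fix x assume "x \<in> (\<lambda>\<delta>. fst (hd \<delta>)) ` {\<delta>. length \<delta> = m \<and> nb_path ?\<Gamma> \<delta> v}"
      then obtain \<delta> where \<delta>: "length \<delta> = m" "nb_path ?\<Gamma> \<delta> v" "x = fst (hd \<delta>)" by blast
      then have "hd \<delta> \<in> set \<delta>" using Suc by (intro hd_in_set) auto
      then have "step_edge (hd \<delta>) \<in> ?\<Gamma>" by (rule nb_path_edges[OF \<delta>(2)])
      then show "x \<in> \<Union>?\<Gamma>" unfolding \<delta>(3) by (rule UnionI) (simp add: step_edge_def)
    qed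
  qed (rule finU)
  also have "\<dots> = 2 * k" using card_Union_partial_matching[OF pm finH] cycle_structure(1)[OF g] by simp
  finally show ?thesis .
qed

text \<open>A proper part of a cycle is a forest.\<close>

lemma cycles_overlap:
  assumes g: "\<gamma> \<in> cycles N d k" and V: "fst ` \<Union>\<Gamma> = V"
    and meet: "V \<inter> fst ` \<Union>(step_edge ` set \<gamma>) \<noteq> {}" and ns: "\<not> step_edge ` set \<gamma> \<subseteq> \<Gamma>"
  shows "card (step_edge ` set \<gamma> \<inter> \<Gamma>) < card (V \<inter> fst ` \<Union>(step_edge ` set \<gamma>))"
proof -
  have c: "\<gamma> \<in> closed_candidates N d k" and "simple \<gamma>" using g by (simp_all add: cycles_def)
  then have l: "length \<gamma> = k" "0 < k" and dist: "distinct (map (\<lambda>s. fst (fst s)) \<gamma>)"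
    by (auto simp: closed_candidates_def simple_def)
  have V': "fst ` \<Union>(step_edge ` set \<gamma>) = (\<lambda>s. fst (fst s)) ` set \<gamma>" by (rule cycle_structure(3)[OF g])
  let ?I = "{s \<in> set \<gamma>. fst (fst s) \<in> V}"
  let ?O = "{s \<in> set \<gamma>. step_edge s \<in> \<Gamma>}"
  have inj: "inj_on (\<lambda>s. fst (fst s)) (set \<gamma>)" using dist by (simp add: distinct_map)
  have cI: "card (V \<inter> fst ` \<Union>(step_edge ` set \<gamma>)) = card ?I"
  proof -
    have e: "V \<inter> (\<lambda>s. fst (fst s)) ` set \<gamma> = (\<lambda>s. fst (fst s)) ` ?I" by blast
    have "inj_on (\<lambda>s. fst (fst s)) ?I" using inj by (rule inj_on_subset) blast
    then show ?thesis unfolding V' e by (rule card_image)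
  qed
  have sub: "?O \<subseteq> ?I"
  proof
    fix s assume s: "s \<in> ?O"
    then have "fst s \<in> \<Union>\<Gamma>" by (intro UnionI[of "step_edge s"]) (auto simp: step_edge_def)
    then have "fst (fst s) \<in> V" unfolding V[symmetric] by (rule imageI)
    then show "s \<in> ?I" using s by simp
  qed
  \<comment> \<open>If every step starting in \<open>V\<close> used an edge of
    \<open>\<Gamma>\<close>, the walk could never leave \<open>V\<close>; being cyclic, it would
    have all its edges in \<open>\<Gamma>\<close>.\<close>
  have "?O \<noteq> ?I"
  proof
    assume eq: "?O = ?I"
    define s where "s i = \<gamma> ! (i mod k)" for i
    have rng: "range s = set \<gamma>" unfolding s_def[abs_def] by (rule range_nth_mod[OF l])
    have fol: "follows (s i) (fst (s (Suc i)))" for i unfolding s_def by (rule cyclic_follows[OF c])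
    have step: "s (Suc i) \<in> ?I" if "s i \<in> ?I" for i
    proof -
      have "step_edge (s i) \<in> \<Gamma>" using that eq by blast
      then have "snd (s i) \<in> \<Union>\<Gamma>" by (rule UnionI) (simp add: step_edge_def)
      then have "fst (snd (s i)) \<in> V" unfolding V[symmetric] by (rule imageI)
      then have "fst (fst (s (Suc i))) \<in> V" using fol[of i] by (simp add: follows_def)
      moreover have "s (Suc i) \<in> set \<gamma>" unfolding rng[symmetric] by (rule rangeI)
      ultimately show ?thesis by simp
    qed
    obtain t where "t \<in> ?I" using meet unfolding V' by blast
    then have "t \<in> range s" unfolding rng by simp
    then obtain i0 where "t = s i0" by (rule rangeE)
    then have i0: "s i0 \<in> ?I" using \<open>t \<in> ?I\<close> by simp
    have all: "s (i0 + j) \<in> ?I" for j by (induction j) (use i0 step in simp_all)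
    have "s i \<in> ?I" for i
    proof -
      have "i0 + (i + i0 * (k - 1)) = i + i0 * k" using l(2) by (cases k) simp_all
      moreover have "s (i + i0 * k) = s i" unfolding s_def by simp
      ultimately show ?thesis using all[of "i + i0 * (k - 1)"] by (simp only:)
    qed
    then have "range s \<subseteq> ?I" by (rule image_subsetI)
    then have "set \<gamma> \<subseteq> ?O" unfolding rng eq .
    then show False using ns by blast
  qed
  then have "?O \<subset> ?I" using sub by blast
  then have "card ?O < card ?I" by (intro psubset_card_mono) auto
  moreover have "card (step_edge ` set \<gamma> \<inter> \<Gamma>) \<le> card ?O"
  proof -
    have "step_edge ` set \<gamma> \<inter> \<Gamma> = step_edge ` ?O" by blast
    then show ?thesis using card_image_le[of ?O step_edge] by simp
  qed
  ultimately show ?thesis unfolding cI by simp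
qed

text \<open>The step after a reversed \<open>s'\<close> starts at the vertex where \<open>s'\<close> starts, hence is \<open>s'\<close>, a backtrack.\<close>

lemma simple_no_return:
  assumes "simple (\<delta> @ \<gamma>)" "nb_walk UNIV (\<delta> @ \<gamma>) z" "s \<in> set \<delta>" "s' \<in> set \<gamma>"
  shows "step_edge s \<noteq> step_edge s'"
proof
  assume eq: "step_edge s = step_edge s'"
  have dist: "distinct (map (\<lambda>s. fst (fst s)) (\<delta> @ \<gamma>))" using assms(1) by (simp add: simple_def)
  have "fst (fst s) \<noteq> fst (fst s')" using dist assms(3,4) by force
  then have rev: "fst s = snd s'" "snd s = fst s'" using eq by (auto simp: step_edge_def doubleton_eq_iff)
  obtain i where i: "i < length \<delta>" "s = \<delta> ! i" using assms(3) by (auto simp: in_set_conv_nth)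
  obtain j where j: "j < length \<gamma>" "s' = \<gamma> ! j" using assms(4) by (auto simp: in_set_conv_nth)
  let ?\<sigma> = "\<delta> @ \<gamma>"
  have si: "?\<sigma> ! i = s" and sj: "?\<sigma> ! (length \<delta> + j) = s'" using i j by (simp_all add: nth_append)
  have lt: "Suc i < length ?\<sigma>" "length \<delta> + j < length ?\<sigma>" using i j by auto
  have "follows (?\<sigma> ! i) (if Suc i < length ?\<sigma> then fst (?\<sigma> ! Suc i) else z)"
    using assms(2) lt(1) unfolding nb_walk_nth by (meson Suc_lessD)
  then have f: "follows s (fst (?\<sigma> ! Suc i))" using lt(1) si by simp
  then have "fst (fst (?\<sigma> ! Suc i)) = fst (fst (?\<sigma> ! (length \<delta> + j)))" using rev sj by (simp add: follows_def)
  moreover have "map (\<lambda>s. fst (fst s)) ?\<sigma> ! Suc i = fst (fst (?\<sigma> ! Suc i))"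
    "map (\<lambda>s. fst (fst s)) ?\<sigma> ! (length \<delta> + j) = fst (fst (?\<sigma> ! (length \<delta> + j)))"
    using lt by (simp_all only: nth_map)
  ultimately have "Suc i = length \<delta> + j"
    using dist lt unfolding distinct_conv_nth length_map by metis
  then have "?\<sigma> ! Suc i = s'" using sj by simp
  then show False using f rev by (simp add: follows_def)
qed

text \<open>The second moment with one cycle fixed. Vertex-disjoint partners give the main term,
  partners on the same edges differ by start and direction only. Any other partner is explored with
  the fixed cycle as \<open>\<Gamma>0\<close>: it collides once if it starts on that cycle, which
  leaves at most \<open>k * d\<close> starts, and twice if it starts elsewhere. Either way a factor
  of order \<open>1 / N\<close> is gained up to logarithms.\<close>

lemma cycle_pair_sum:
  fixes p \<zeta> \<theta>' \<eta> \<kappa> :: real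
  assumes d: "2 \<le> d" and p: "0 \<le> p" and k: "0 < k" and K: "2 * k \<le> K" "2 * K < N * d"
    and \<theta>': "\<theta>' = (real d - 1) * real (N * d) * (p / (real (N * d) - 2 * real K))" "1 \<le> \<theta>'"
    and \<eta>: "\<eta> = real d * (2 * real K + 1) / real (N * d)"
    and \<kappa>: "2 * real k \<le> \<kappa>"
    and \<zeta>1: "1 \<le> \<zeta>" "\<zeta> * \<eta> * (2 * \<kappa> * (real k + 1)) * real k \<le> 1"
    and g: "\<gamma> \<in> cycles N d k"
  shows "(\<Sum>\<gamma>'\<in>{\<gamma>' \<in> cycles N d k. partial_matching (half_edges N d) (step_edge ` set \<gamma> \<union> step_edge ` set \<gamma>')}.
      wt p (N * d) (card (step_edge ` set \<gamma> \<union> step_edge ` set \<gamma>')))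
    \<le> real (card (cycles N d k)) * wt p (N * d) (2 * k) +
      wt p (N * d) k * (2 * real k + real (k * d) * (\<theta>' ^ k * (2 * \<kappa> * (real k + 1)) / \<zeta>)
        + real (N * d) * (\<theta>' ^ k * (2 * \<kappa> * (real k + 1)) / \<zeta>\<^sup>2))"
proof -
  let ?H = "half_edges N d"
  let ?S = "\<lambda>\<delta> :: step list. step_edge ` set \<delta>"
  define \<Gamma> where "\<Gamma> = ?S \<gamma>"
  define V where "V = fst ` \<Union>\<Gamma>"
  let ?w = "\<lambda>\<delta>. wt p (N * d) (card (\<Gamma> \<union> ?S \<delta>))"
  let ?V = "\<lambda>\<delta> :: step list. fst ` \<Union>(?S \<delta>)"
  have k1: "1 \<le> \<kappa>" using k \<kappa> by linarith
  have finH: "finite ?H" by (rule card_half_edges(2))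
  have pm\<Gamma>: "partial_matching ?H \<Gamma>" using g by (simp add: \<Gamma>_def cycles_def closed_candidates_def)
  have fin\<Gamma>: "finite \<Gamma>" by (simp add: \<Gamma>_def)
  have c\<Gamma>: "card \<Gamma> = k" unfolding \<Gamma>_def by (rule cycle_structure(1)[OF g])
  have cV: "card V = k" unfolding V_def \<Gamma>_def by (rule cycle_structure(2)[OF g])
  have finV: "finite V" using cV k by (intro card_ge_0_finite) simp
  have VN: "V \<subseteq> {..<N}" using partial_matchingD(1)[OF pm\<Gamma>] by (force simp: V_def half_edges_def)
  have wnn: "0 \<le> ?w \<delta>" if "length \<delta> = k" for \<delta>
  proof (intro wt_nonneg p)
    have "card (\<Gamma> \<union> ?S \<delta>) \<le> k + k"
      using card_Un_le[of \<Gamma> "?S \<delta>"] c\<Gamma> card_image_le[of "set \<delta>" step_edge] card_length[of \<delta>] that by simp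
    then show "2 * card (\<Gamma> \<union> ?S \<delta>) \<le> N * d" using K by simp
  qed
  have ex: "exploration N d p \<Gamma> z simple k K \<kappa> \<zeta> \<theta>' \<eta>" if z: "z \<in> ?H" for z
  proof
    show "2 \<le> d" "0 \<le> p" "z \<in> ?H" by (fact d p z)+
    show "simple \<delta>" if "simple (s # \<delta>)" for s \<delta> using that by (simp add: simple_def)
    show "card \<Gamma> + k \<le> K" "2 * K < N * d" using K c\<Gamma> by simp_all
    show "\<theta>' = (real d - 1) * real (N * d) * (p / (real (N * d) - 2 * real K))"
      "\<eta> = real d * (2 * real K + 1) / real (N * d)" by (fact \<theta>' \<eta>)+
    show "1 \<le> \<kappa>" by (rule k1)
    show "0 \<le> \<zeta>" "\<zeta> * \<eta> * (2 * \<kappa> * (real k + 1)) * real k \<le> 1" using \<zeta>1 by simp_all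
    fix \<delta> r assume v: "exploration_base.valid N d \<Gamma> z simple \<delta>"
    interpret exploration_base N d p \<Gamma> z simple .
    \<comment> \<open>A simple walk cannot retrace its own edges, so an old run stays on the fixed
      cycle, where few paths exist.\<close>
    have sub: "old_runs r \<delta> \<subseteq> {\<sigma>. length \<sigma> = r \<and> nb_path \<Gamma> \<sigma> (fst (start \<delta> z))}"
    proof
      fix \<sigma> assume \<sigma>: "\<sigma> \<in> old_runs r \<delta>"
      then have "simple (\<sigma> @ \<delta>)" "nb_walk UNIV (\<sigma> @ \<delta>) z" and o: "step_edge ` set \<sigma> \<subseteq> edges \<delta>"
        by (simp_all add: old_runs_def valid_def)
      note nr = simple_no_return[OF this(1,2)]
      have "step_edge s \<in> \<Gamma>" if "s \<in> set \<sigma>" for s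
      proof -
        have "step_edge s \<in> \<Gamma> \<union> step_edge ` set \<delta>" using o that by (auto simp: edges_def)
        moreover have "step_edge s \<notin> step_edge ` set \<delta>" using nr[OF that] by blast
        ultimately show ?thesis by blast
      qed
      then have "nb_path \<Gamma> \<sigma> (fst (start \<delta> z))" by (rule nb_path_mono[OF old_run_path(2)[OF \<sigma>]])
      then show "\<sigma> \<in> {\<sigma>. length \<sigma> = r \<and> nb_path \<Gamma> \<sigma> (fst (start \<delta> z))}" using old_run_path(1)[OF \<sigma>] by simp
    qed
    have "card (old_runs r \<delta>) \<le> card {\<sigma>. length \<sigma> = r \<and> nb_path \<Gamma> \<sigma> (fst (start \<delta> z))}"
      by (intro card_mono finite_nb_paths[OF pm\<Gamma> finH] sub)
    also have "\<dots> \<le> 2 * k" unfolding \<Gamma>_def by (rule cycle_paths[OF g k])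
    finally have "real (card (old_runs r \<delta>)) \<le> 2 * real k" by simp
    also have "\<dots> \<le> \<kappa> * 1" using \<kappa> by simp
    also have "\<dots> \<le> \<kappa> * \<theta>' ^ r" using k1 \<theta>'(2) by (intro mult_left_mono one_le_power) auto
    finally show "real (card (old_runs r \<delta>)) \<le> \<kappa> * \<theta>' ^ r" .
  qed
  define S where "S = {\<delta> \<in> cycles N d k. partial_matching ?H (\<Gamma> \<union> ?S \<delta>)}"
  define D where "D = {\<delta> \<in> S. V \<inter> ?V \<delta> = {}}"
  define Q where "Q = {\<delta> \<in> S. ?S \<delta> \<subseteq> \<Gamma>}"
  define B where "B c z = {\<delta>. length \<delta> = k \<and> exploration_base.valid N d \<Gamma> z simple \<delta> \<and> c \<le> exploration_base.coll \<Gamma> z \<delta>}" for c z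
  define H1 where "H1 = {z \<in> ?H. fst z \<in> V}"
  have finS: "finite S" unfolding S_def using finite_cycles[of N d k] by simp
  have finB: "finite (B c z)" if "z \<in> ?H" for c z
  proof -
    interpret exploration N d p \<Gamma> z simple k K \<kappa> \<zeta> \<theta>' \<eta> by (rule ex[OF that])
    show ?thesis unfolding B_def using finite_extensions[of k "[]"] by (rule finite_subset[rotated]) auto
  qed
  have finH1: "finite H1" "card H1 \<le> k * d"
  proof -
    have "H1 \<subseteq> V \<times> {..<d}" by (auto simp: H1_def half_edges_def)
    moreover have "finite (V \<times> {..<d})" "card (V \<times> {..<d}) = k * d" using finV cV by simp_all
    ultimately show "finite H1" "card H1 \<le> k * d" using card_mono finite_subset by metis+
  qed
  have wS: "0 \<le> ?w \<delta>" if "\<delta> \<in> S" for \<delta> using that by (intro wnn) (simp add: S_def cycles_def closed_candidates_def)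
  have wB: "0 \<le> ?w \<delta>" if "\<delta> \<in> B c z" for \<delta> c z using that by (intro wnn) (simp add: B_def)
  have cover: "S \<subseteq> (D \<union> Q) \<union> ((\<Union>z\<in>H1. B 1 z) \<union> (\<Union>z\<in>?H. B 2 z))"
  proof
    fix \<delta> assume \<delta>: "\<delta> \<in> S"
    then have dc: "\<delta> \<in> cycles N d k" and pm: "partial_matching ?H (\<Gamma> \<union> ?S \<delta>)" by (simp_all add: S_def)
    have dcc: "\<delta> \<in> closed_candidates N d k" "simple \<delta>" using dc by (simp_all add: cycles_def)
    show "\<delta> \<in> (D \<union> Q) \<union> ((\<Union>z\<in>H1. B 1 z) \<union> (\<Union>z\<in>?H. B 2 z))"
    proof (cases "\<delta> \<in> D \<union> Q")
      case False
      then have meet: "V \<inter> ?V \<delta> \<noteq> {}" and ns: "\<not> ?S \<delta> \<subseteq> \<Gamma>" using \<delta> by (auto simp: D_def Q_def)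
      define z where "z = fst (hd \<delta>)"
      have z: "z \<in> ?H" unfolding z_def by (rule closed_candidate_card(2)[OF dcc(1)])
      have zV: "fst z \<in> ?V \<delta>" unfolding z_def by (rule closed_candidate_card(3)[OF dcc(1)])
      interpret exploration N d p \<Gamma> z simple k K \<kappa> \<zeta> \<theta>' \<eta> by (rule ex[OF z])
      have v: "valid \<delta>" unfolding valid_def edges_def using dcc pm by (simp add: closed_candidates_def z_def)
      have ld: "length \<delta> = k" using dcc(1) by (simp add: closed_candidates_def)
      have finVd: "finite (?V \<delta>)" using cycle_structure(2)[OF dc] k by (intro card_ge_0_finite) simp
      \<comment> \<open>With \<open>e1\<close> to \<open>e5\<close>, collisions equal shared
        vertices minus shared edges, plus 1 if the start is off the fixed cycle; this strict
        inequality provides the first of them.\<close>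
      have ov: "card (?S \<delta> \<inter> \<Gamma>) < card (V \<inter> ?V \<delta>)"
        by (rule cycles_overlap[OF dc _ meet ns]) (simp add: V_def)
      have e1: "card (edges \<delta>) + card (?S \<delta> \<inter> \<Gamma>) = 2 * k"
        unfolding edges_def using card_Un_Int[OF fin\<Gamma>, of "?S \<delta>"] c\<Gamma> cycle_structure(1)[OF dc]
        by (simp add: Int_commute)
      have "visited \<delta> = V \<union> ?V \<delta>"
        unfolding visited_def edges_def V_def using zV by (simp add: image_Un insert_absorb)
      then have e2: "card (visited \<delta>) + card (V \<inter> ?V \<delta>) = 2 * k"
        using card_Un_Int[OF finV finVd] cV cycle_structure(2)[OF dc] by simp
      have e3: "card (edges \<delta>) + card (visited []) = card (visited \<delta>) + card (edges []) + coll \<delta>"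
        by (rule euler_count[OF v allowed_tl])
      have e4: "card (edges []) = k" by (simp add: edges_def c\<Gamma>)
      have e5: "visited [] = insert (fst z) V" by (simp add: visited_def edges_def V_def)
      show ?thesis
      proof (cases "fst z \<in> V")
        case True
        then have "card (visited []) = k" unfolding e5 using cV by (simp add: insert_absorb)
        then have "1 \<le> coll \<delta>" using ov e1 e2 e3 e4 by linarith
        then have "\<delta> \<in> B 1 z" using v ld unfolding B_def by simp
        moreover have "z \<in> H1" using z True by (simp add: H1_def)
        ultimately show ?thesis by blast
      next
        case False
        then have "card (visited []) = k + 1" unfolding e5 using cV finV by simp
        then have "2 \<le> coll \<delta>" using ov e1 e2 e3 e4 by linarith
        then have "\<delta> \<in> B 2 z" using v ld unfolding B_def by simp
        then show ?thesis using z by blast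
      qed
    qed simp
  qed
  have DQ: "sum ?w D \<le> real (card (cycles N d k)) * wt p (N * d) (2 * k)"
  proof -
    have "?w \<delta> = wt p (N * d) (2 * k)" if "\<delta> \<in> D" for \<delta>
    proof -
      have dc: "\<delta> \<in> cycles N d k" and dis: "V \<inter> ?V \<delta> = {}" using that by (simp_all add: D_def S_def)
      have "e = {}" if "e \<in> \<Gamma>" "e \<in> ?S \<delta>" for e
      proof (rule ccontr)
        assume "e \<noteq> {}"
        then obtain h where "h \<in> e" by blast
        then have "fst h \<in> V" "fst h \<in> ?V \<delta>" using that by (auto simp: V_def)
        then show False using dis by blast
      qed
      moreover have "e \<noteq> {}" if "e \<in> \<Gamma>" for e using partial_matchingD(2)[OF pm\<Gamma> that] by auto
      ultimately have "\<Gamma> \<inter> ?S \<delta> = {}" by blast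
      then have "card (\<Gamma> \<union> ?S \<delta>) = 2 * k" using card_Un_disjoint[OF fin\<Gamma>, of "?S \<delta>"] c\<Gamma> cycle_structure(1)[OF dc] by simp
      then show ?thesis by simp
    qed
    then have "sum ?w D = real (card D) * wt p (N * d) (2 * k)" by simp
    moreover have "card D \<le> card (cycles N d k)" by (rule card_mono[OF finite_cycles]) (auto simp: D_def S_def)
    moreover have "0 \<le> wt p (N * d) (2 * k)" using K p by (intro wt_nonneg) auto
    ultimately show ?thesis by (simp add: mult_right_mono)
  qed
  have QQ: "sum ?w Q \<le> real (2 * k) * wt p (N * d) k"
  proof -
    have "?w \<delta> = wt p (N * d) k" if "\<delta> \<in> Q" for \<delta>
    proof -
      have "\<Gamma> \<union> ?S \<delta> = \<Gamma>" using that by (auto simp: Q_def)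
      then show ?thesis using c\<Gamma> by simp
    qed
    then have "sum ?w Q = real (card Q) * wt p (N * d) k" by simp
    have "card Q \<le> 2 * k"
    proof -
      have finU: "finite (\<Union>\<Gamma>)" using partial_matchingD(1)[OF pm\<Gamma>] by (intro finite_subset[OF _ finH]) blast
      have path: "length \<delta> = k" "\<delta> \<noteq> []" "nb_path \<Gamma> \<delta> (fst (fst (hd \<delta>)))" "fst (hd \<delta>) \<in> \<Union>\<Gamma>" if "\<delta> \<in> Q" for \<delta>
      proof -
        have c: "\<delta> \<in> closed_candidates N d k" and sub: "?S \<delta> \<subseteq> \<Gamma>" using that by (simp_all add: Q_def S_def cycles_def)
        show "length \<delta> = k" "\<delta> \<noteq> []" using c by (simp_all add: closed_candidates_def)
        have "nb_walk UNIV \<delta> (fst (hd \<delta>))" using c by (simp add: closed_candidates_def)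
        from nb_walk_mono[OF this sub] show "nb_path \<Gamma> \<delta> (fst (fst (hd \<delta>)))" by (rule nb_walk_path)
        have "step_edge (hd \<delta>) \<in> \<Gamma>" using sub \<open>\<delta> \<noteq> []\<close> by auto
        then show "fst (hd \<delta>) \<in> \<Union>\<Gamma>" by (rule UnionI) (simp add: step_edge_def)
      qed
      have "card Q \<le> card (\<Union>\<Gamma>)"
      proof (rule card_inj_on_le[of "\<lambda>\<delta>. fst (hd \<delta>)"])
        show "inj_on (\<lambda>\<delta>. fst (hd \<delta>)) Q"
        proof (rule inj_onI)
          fix \<delta> \<delta>' assume a: "\<delta> \<in> Q" "\<delta>' \<in> Q" "fst (hd \<delta>) = fst (hd \<delta>')"
          show "\<delta> = \<delta>'"
            by (rule two_regular_deterministic[OF pm\<Gamma> finH cycle_structure(4)[OF g, folded \<Gamma>_def], of \<delta> "fst (fst (hd \<delta>))" \<delta>'])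
              (use path[OF a(1)] path[OF a(2)] a(3) in simp_all)
        qed
        show "(\<lambda>\<delta>. fst (hd \<delta>)) ` Q \<subseteq> \<Union>\<Gamma>" using path(4) by blast
      qed (rule finU)
      then show ?thesis using card_Union_partial_matching[OF pm\<Gamma> finH] c\<Gamma> by simp
    qed
    then have "real (card Q) \<le> real (2 * k)" by (rule of_nat_mono)
    moreover have "0 \<le> wt p (N * d) k" using K p by (intro wt_nonneg) auto
    ultimately show ?thesis using \<open>sum ?w Q = _\<close> by (simp only: mult_right_mono)
  qed
  have BB: "sum ?w (B c z) \<le> wt p (N * d) k * (\<theta>' ^ k * (2 * \<kappa> * (real k + 1)) / \<zeta> ^ c)" if z: "z \<in> ?H" and "B c z \<noteq> {}" for c z
  proof -
    interpret exploration N d p \<Gamma> z simple k K \<kappa> \<zeta> \<theta>' \<eta> by (rule ex[OF z])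
    have v0: "valid []" unfolding valid_def edges_def using pm\<Gamma> by (simp add: simple_def)
    show ?thesis using exploration_sum_coll[OF v0 \<zeta>1(1), of c] unfolding B_def edges_def c\<Gamma> by simp
  qed
  have BB': "sum ?w (B c z) \<le> wt p (N * d) k * (\<theta>' ^ k * (2 * \<kappa> * (real k + 1)) / \<zeta> ^ c)" if z: "z \<in> ?H" for c z
  proof (cases "B c z = {}")
    case True
    have "0 \<le> wt p (N * d) k" using K p by (intro wt_nonneg) auto
    then show ?thesis using True k1 \<theta>'(2) \<zeta>1 by simp
  qed (rule BB[OF z])
  have un: "sum ?w (A \<union> A') \<le> sum ?w A + sum ?w A'" if "finite A" "finite A'" "\<And>\<delta>. \<delta> \<in> A \<Longrightarrow> 0 \<le> ?w \<delta>" for A A'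
  proof -
    have "0 \<le> sum ?w (A \<inter> A')" using that(3) by (intro sum_nonneg) simp
    then show ?thesis using sum.union_inter[OF that(1,2), of ?w] by linarith
  qed
  let ?U1 = "\<Union>z\<in>H1. B 1 z" and ?U2 = "\<Union>z\<in>?H. B 2 z"
  have H1H: "H1 \<subseteq> ?H" by (auto simp: H1_def)
  have finU: "finite ?U1" "finite ?U2" using finH1 finH finB H1H by auto
  have finDQ: "finite D" "finite Q" using finS by (simp_all add: D_def Q_def)
  have wDQ: "0 \<le> ?w \<delta>" if "\<delta> \<in> D \<union> Q" for \<delta> using that by (intro wS) (auto simp: D_def Q_def)
  have "sum ?w S \<le> sum ?w ((D \<union> Q) \<union> (?U1 \<union> ?U2))"
    using cover finU finDQ wDQ wB by (intro sum_mono2) auto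
  also have "\<dots> \<le> sum ?w (D \<union> Q) + sum ?w (?U1 \<union> ?U2)" using finU finDQ wDQ by (intro un) auto
  also have "\<dots> \<le> (sum ?w D + sum ?w Q) + (sum ?w ?U1 + sum ?w ?U2)"
    using finU finDQ wDQ wB by (intro add_mono un) auto
  also have "sum ?w ?U1 \<le> (\<Sum>z\<in>H1. sum ?w (B 1 z))" using finH1 finB wB H1H by (intro sum_UNION_le) auto
  also have "\<dots> \<le> (\<Sum>z\<in>H1. wt p (N * d) k * (\<theta>' ^ k * (2 * \<kappa> * (real k + 1)) / \<zeta> ^ 1))"
    using BB' H1H by (intro sum_mono) blast
  also have "\<dots> \<le> real (k * d) * (wt p (N * d) k * (\<theta>' ^ k * (2 * \<kappa> * (real k + 1)) / \<zeta> ^ 1))"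
  proof -
    have "0 \<le> wt p (N * d) k" using K p by (intro wt_nonneg) auto
    then have "0 \<le> wt p (N * d) k * (\<theta>' ^ k * (2 * \<kappa> * (real k + 1)) / \<zeta> ^ 1)" using k1 \<theta>'(2) \<zeta>1 by simp
    moreover have "real (card H1) \<le> real (k * d)" by (rule of_nat_mono[OF finH1(2)])
    ultimately show ?thesis unfolding sum_constant by (intro mult_right_mono)
  qed
  also have "sum ?w ?U2 \<le> (\<Sum>z\<in>?H. sum ?w (B 2 z))" using finH finB wB by (intro sum_UNION_le) auto
  also have "\<dots> \<le> (\<Sum>z\<in>?H. wt p (N * d) k * (\<theta>' ^ k * (2 * \<kappa> * (real k + 1)) / \<zeta>\<^sup>2))"
    using BB' by (intro sum_mono) blast
  also have "\<dots> = real (N * d) * (wt p (N * d) k * (\<theta>' ^ k * (2 * \<kappa> * (real k + 1)) / \<zeta>\<^sup>2))"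
    unfolding sum_constant card_half_edges(1) ..
  finally have "sum ?w S \<le> (sum ?w D + sum ?w Q) + (real (k * d) * (wt p (N * d) k * (\<theta>' ^ k * (2 * \<kappa> * (real k + 1)) / \<zeta> ^ 1))
      + real (N * d) * (wt p (N * d) k * (\<theta>' ^ k * (2 * \<kappa> * (real k + 1)) / \<zeta>\<^sup>2)))"
    by simp
  then have "sum ?w S \<le> real (card (cycles N d k)) * wt p (N * d) (2 * k) + real (2 * k) * wt p (N * d) k
     + (real (k * d) * (wt p (N * d) k * (\<theta>' ^ k * (2 * \<kappa> * (real k + 1)) / \<zeta> ^ 1))
      + real (N * d) * (wt p (N * d) k * (\<theta>' ^ k * (2 * \<kappa> * (real k + 1)) / \<zeta>\<^sup>2)))"
    using DQ QQ by linarith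
  also have "\<dots> = real (card (cycles N d k)) * wt p (N * d) (2 * k) +
      wt p (N * d) k * (2 * real k + real (k * d) * (\<theta>' ^ k * (2 * \<kappa> * (real k + 1)) / \<zeta>)
        + real (N * d) * (\<theta>' ^ k * (2 * \<kappa> * (real k + 1)) / \<zeta>\<^sup>2))"
    by (simp only: distrib_left mult_ac power_one_right of_nat_mult of_nat_numeral add_ac)
  finally show ?thesis unfolding S_def \<Gamma>_def .
qed

section \<open>Concentration\<close>

lemma expectation_count_present:
  assumes "finite (set_pmf M)" "finite A"
  shows "measure_pmf.expectation M (\<lambda>E. real (card {a \<in> A. F a \<subseteq> E})) = (\<Sum>a\<in>A. measure_pmf.prob M {E. F a \<subseteq> E})"
proof -
  have "real (card {a \<in> A. F a \<subseteq> E}) = (\<Sum>a\<in>A. indicator {E. F a \<subseteq> E} E)" for E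
  proof -
    have "(\<Sum>a\<in>A. indicator {E. F a \<subseteq> E} E) = (\<Sum>a\<in>A. if F a \<subseteq> E then 1 else (0::real))"
      by (intro sum.cong refl) (simp add: indicator_def)
    also have "\<dots> = real (card {a \<in> A. F a \<subseteq> E})" using assms(2) by (simp add: sum.If_cases Int_def)
    finally show ?thesis by simp
  qed
  then have "measure_pmf.expectation M (\<lambda>E. real (card {a \<in> A. F a \<subseteq> E}))
      = measure_pmf.expectation M (\<lambda>E. \<Sum>a\<in>A. indicator {E. F a \<subseteq> E} E)" by presburger
  also have "\<dots> = (\<Sum>a\<in>A. measure_pmf.expectation M (indicator {E. F a \<subseteq> E}))"
    by (intro Bochner_Integration.integral_sum integrable_measure_pmf_finite assms(1))
  finally show ?thesis by simp
qed

lemma closed_walks_candidates: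
  assumes "partial_matching (half_edges N d) E"
  shows "closed_walks E k = {\<gamma> \<in> closed_candidates N d k. step_edge ` set \<gamma> \<subseteq> E}"
proof (intro equalityI subsetI)
  fix \<gamma> assume "\<gamma> \<in> closed_walks E k"
  then have g: "length \<gamma> = k" "\<gamma> \<noteq> []" "nb_walk E \<gamma> (fst (hd \<gamma>))" by (simp_all add: closed_walks_def)
  have sub: "step_edge ` set \<gamma> \<subseteq> E" by (rule nb_walk_edges[OF g(3)])
  show "\<gamma> \<in> {\<gamma> \<in> closed_candidates N d k. step_edge ` set \<gamma> \<subseteq> E}"
    using g sub nb_walk_mono[OF g(3), of UNIV] partial_matching_subset[OF assms sub]
    by (simp add: closed_candidates_def)
next
  fix \<gamma> assume "\<gamma> \<in> {\<gamma> \<in> closed_candidates N d k. step_edge ` set \<gamma> \<subseteq> E}"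
  then have g: "length \<gamma> = k" "\<gamma> \<noteq> []" "nb_walk UNIV \<gamma> (fst (hd \<gamma>))" "step_edge ` set \<gamma> \<subseteq> E"
    by (simp_all add: closed_candidates_def)
  show "\<gamma> \<in> closed_walks E k" using g(1,2) nb_walk_mono[OF g(3,4)] by (simp add: closed_walks_def)
qed

definition cycle_count :: "nat \<Rightarrow> nat \<Rightarrow> nat \<Rightarrow> half set set \<Rightarrow> real" where
  "cycle_count N d k E = real (card {\<gamma> \<in> cycles N d k. step_edge ` set \<gamma> \<subseteq> E})"

definition tame_count :: "nat \<Rightarrow> nat \<Rightarrow> nat \<Rightarrow> nat \<Rightarrow> half set set \<Rightarrow> real" where
  "tame_count N d m k E = real (card {\<gamma> \<in> tame_walks N d m k. step_edge ` set \<gamma> \<subseteq> E})"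

lemma card_closed_walks:
  assumes "partial_matching (half_edges N d) E" "tangle_free m E"
  shows "real (card (closed_walks E k)) = cycle_count N d k E + tame_count N d m k E"
proof -
  have finE: "finite E" by (rule partial_matching_finite[OF assms(1) card_half_edges(2)])
  have "closed_walks E k = {\<gamma> \<in> cycles N d k. step_edge ` set \<gamma> \<subseteq> E} \<union> {\<gamma> \<in> tame_walks N d m k. step_edge ` set \<gamma> \<subseteq> E}"
    unfolding closed_walks_candidates[OF assms(1)] using tangle_free_subset[OF assms(2) _ finE]
    by (auto simp: cycles_def tame_walks_def)
  moreover have "finite {\<gamma> \<in> cycles N d k. step_edge ` set \<gamma> \<subseteq> E}" using finite_cycles[of N d k] by simp
  moreover have "finite {\<gamma> \<in> tame_walks N d m k. step_edge ` set \<gamma> \<subseteq> E}"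
    by (rule finite_subset[OF _ finite_closed_candidates[of N d k]]) (auto simp: tame_walks_def)
  moreover have "{\<gamma> \<in> cycles N d k. step_edge ` set \<gamma> \<subseteq> E} \<inter> {\<gamma> \<in> tame_walks N d m k. step_edge ` set \<gamma> \<subseteq> E} = {}"
    by (auto simp: cycles_def tame_walks_def)
  ultimately show ?thesis by (simp add: card_Un_disjoint cycle_count_def tame_count_def)
qed

text \<open>The bound \<open>100 * k ^ 4 \<le> N\<close> makes the collision reward
  \<open>\<zeta>\<close> at least 1. The bound on \<open>\<theta> ^ (k div 2)\<close> makes the main
  term \<open>\<theta> ^ k\<close> at least \<open>N\<close> and so dominate both the periodic walks
  and the coincident pairs.\<close>

locale walk_moments =
  fixes N d k :: nat and p \<theta> :: real
  assumes d3: "3 \<le> d" and ev: "even (N * d)" and p: "0 < p" "p \<le> 1"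
    and \<theta>: "\<theta> = p * (real d - 1)" "1 < \<theta>"
    and k: "even k" "0 < k" and N: "100 * k ^ 4 \<le> N" and \<theta>N: "sqrt (real N) \<le> \<theta> ^ (k div 2)"
begin

abbreviation "M \<equiv> edge_model N d p"
abbreviation "n \<equiv> N * d"
text \<open>The value \<open>K = 2 * k\<close> suits pairs of cycles and is generous for single
  walks, so one \<open>\<theta>'\<close> serves both moments.\<close>

definition \<theta>' :: real where "\<theta>' = (real d - 1) * real n * (p / (real n - 2 * real (2 * k)))"
text \<open>The exploration constant for \<open>\<kappa> = 4 * k + 1\<close>, which meets the
  requirements of \<open>tame_sum\<close> and of \<open>cycle_pair_sum\<close>.\<close>

definition g :: real where "g = 2 * (4 * real k + 1) * (real k + 1)"
text \<open>Chosen so that \<open>\<zeta> = N / h\<close> turns the smallness condition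
  \<open>\<zeta> * \<eta> * g * k \<le> 1\<close> into an equality at
  \<open>K = 2 * k\<close>.\<close>

definition h :: real where "h = (4 * real k + 1) * g * real k"
definition \<zeta> :: real where "\<zeta> = real N / h"
text \<open>The total loss, over \<open>k\<close> factors, from replacing \<open>N * d\<close> by
  \<open>N * d - 4 * k\<close> in the denominators.\<close>

definition \<rho> :: real where "\<rho> = (\<theta>' / \<theta>) ^ k"
text \<open>A common unit for all errors. The power 10 arises in \<open>noise2\<close> from
  \<open>g\<close>, of order \<open>k^2\<close>, and the square of \<open>1 / \<zeta>\<close>, of
  order \<open>k^8 / N^2\<close>.\<close>

definition D :: real where "D = real d * real k ^ 10 / real N"

lemma k1: "1 \<le> real k" using k by simp

lemma pow_le: "i \<le> j \<Longrightarrow> real k ^ i \<le> real k ^ j"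
  by (rule power_increasing[OF _ k1])

lemma pow1: "1 \<le> j \<Longrightarrow> real k \<le> real k ^ j"
  using pow_le[of 1 j] by (simp only: power_one_right)

lemma N_real: "100 * real k ^ 4 \<le> real N"
  using of_nat_mono[OF N, where ?'a = real] by simp

lemma N0: "0 < real N" "1 \<le> real N"
  using N_real one_le_power[OF k1, of 4] by linarith+

lemma n_real: "real n = real N * real d" "3 * real N \<le> real n"
  using d3 mult_left_mono[of 3 "real d" "real N"] by simp_all

lemma n_big: "8 * real k ^ 2 \<le> real n" "8 * real k \<le> real n" "8 * k \<le> n"
proof -
  show a: "8 * real k ^ 2 \<le> real n" using N_real pow_le[of 2 4] n_real(2) zero_le_power[of "real k" 4] N0 by linarith
  show b: "8 * real k \<le> real n" using a pow1[of 2] by linarith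
  show "8 * k \<le> n" using b of_nat_le_iff[of "8 * k" n, where ?'a = real] by simp
qed

lemma finM: "finite (set_pmf M)" by (rule finite_edge_model[OF ev])

lemma \<theta>'_ratio: "\<theta>' / \<theta> = 1 / (1 - 4 * real k / real n)" "1 \<le> \<theta>' / \<theta>"
proof -
  have n0: "0 < real n" using n_real N0 by linarith
  have e: "1 - 4 * real k / real n = (real n - 4 * real k) / real n" using n0 by (simp add: diff_divide_distrib del: of_nat_mult)
  have pos: "0 < real n - 4 * real k" using n_big(2) k1 by linarith
  have k4: "2 * real (2 * k) = 4 * real k" by simp
  have "\<theta>' = \<theta> * (real n / (real n - 4 * real k))" unfolding \<theta>'_def \<theta>(1) k4 by (simp add: mult_ac del: of_nat_mult)
  then show 1: "\<theta>' / \<theta> = 1 / (1 - 4 * real k / real n)" unfolding e using \<theta>(2) by (simp del: of_nat_mult)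
  have "1 - 4 * real k / real n \<le> 1" "0 < 1 - 4 * real k / real n" unfolding e using pos n0 by (simp_all del: of_nat_mult)
  then show "1 \<le> \<theta>' / \<theta>" unfolding 1 by simp
qed

lemma \<theta>'_ge: "\<theta> \<le> \<theta>'" "1 \<le> \<theta>'" "\<theta>' ^ k = \<theta> ^ k * \<rho>"
proof -
  show "\<theta> \<le> \<theta>'" using \<theta>'_ratio(2) \<theta>(2) by (simp add: le_divide_eq)
  then show "1 \<le> \<theta>'" using \<theta>(2) by simp
  show "\<theta>' ^ k = \<theta> ^ k * \<rho>" using \<theta>(2) by (simp add: \<rho>_def power_divide)
qed

lemma \<rho>_bounds: "1 \<le> \<rho>" "\<rho> \<le> 1 + 4 * real k ^ 2 / real N" "\<rho> \<le> 2"
proof -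
  show 1: "1 \<le> \<rho>" unfolding \<rho>_def by (rule one_le_power[OF \<theta>'_ratio(2)])
  have n0: "0 < real n" using n_real N0 by linarith
  define y where "y = 4 * real k ^ 2 / real n"
  have y: "0 \<le> y" "y \<le> 1 / 2" unfolding y_def using n_big(1) n0 by (simp_all add: divide_le_eq del: of_nat_mult)
  have "1 - y = 1 + real k * (- (4 * real k / real n))" unfolding y_def by (simp add: power2_eq_square del: of_nat_mult)
  also have "\<dots> \<le> (1 + - (4 * real k / real n)) ^ k"
  proof (rule Bernoulli_inequality)
    have "4 * real k / real n \<le> 1" using n_big(2) n0 by (simp add: divide_le_eq del: of_nat_mult)
    then show "- 1 \<le> - (4 * real k / real n)" by linarith
  qed
  finally have b: "1 - y \<le> (1 - 4 * real k / real n) ^ k" by simp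
  have "\<rho> = 1 / (1 - 4 * real k / real n) ^ k" unfolding \<rho>_def \<theta>'_ratio(1) by (simp add: power_divide del: of_nat_mult)
  also have "\<dots> \<le> 1 / (1 - y)" using b y by (intro divide_left_mono) auto
  also have "\<dots> \<le> 1 + 2 * y"
  proof -
    have "0 \<le> y * (1 - 2 * y)" using y by (intro mult_nonneg_nonneg) auto
    then have "1 \<le> (1 + 2 * y) * (1 - y)" by (simp add: algebra_simps)
    then show ?thesis using y by (simp add: divide_le_eq)
  qed
  also have "2 * y \<le> 4 * real k ^ 2 / real N"
  proof -
    have "4 * real k ^ 2 / real n \<le> 4 * real k ^ 2 / real N" using n_real N0 by (intro divide_left_mono) auto
    moreover have "4 * real k ^ 2 / real n * 3 \<le> 4 * real k ^ 2 / real N"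
    proof -
      have "4 * real k ^ 2 * 3 * real N \<le> 4 * real k ^ 2 * real n"
        using mult_left_mono[OF n_real(2), of "4 * real k ^ 2"] by (simp add: mult_ac del: of_nat_mult)
      then show ?thesis using N0 n0 by (simp add: field_simps del: of_nat_mult)
    qed
    ultimately show ?thesis using y(1) unfolding y_def by linarith
  qed
  finally show 2: "\<rho> \<le> 1 + 4 * real k ^ 2 / real N" by simp
  have "4 * real k ^ 2 \<le> real N" using N_real pow_le[of 2 4] zero_le_power[of "real k" 4] by linarith
  then have "4 * real k ^ 2 / real N \<le> 1" using N0 by simp
  then show "\<rho> \<le> 2" using 2 by linarith
qed

lemma g_bounds: "0 < g" "g \<le> 20 * real k ^ 2"
proof -
  show "0 < g" using k1 by (simp add: g_def)
  have "(4 * real k + 1) * (real k + 1) \<le> (5 * real k) * (2 * real k)" using k1 by (intro mult_mono) auto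
  then show "g \<le> 20 * real k ^ 2" by (simp add: g_def power2_eq_square algebra_simps)
qed

lemma h_bounds: "0 < h" "h \<le> 100 * real k ^ 4"
proof -
  show "0 < h" using k1 g_bounds by (simp add: h_def)
  have "(4 * real k + 1) * g \<le> (5 * real k) * (20 * real k ^ 2)" using k1 g_bounds by (intro mult_mono) auto
  then have "(4 * real k + 1) * g * real k \<le> (5 * real k) * (20 * real k ^ 2) * real k" using k1 by (intro mult_right_mono) auto
  then show "h \<le> 100 * real k ^ 4" by (simp add: h_def power2_eq_square power4_eq_xxxx)
qed

lemma \<zeta>_facts: "1 \<le> \<zeta>" "\<zeta> * (real d * (2 * real (2 * k) + 1) / real n) * (2 * (4 * real k + 1) * (real k + 1)) * real k \<le> 1"
  "1 / \<zeta> \<le> 100 * real k ^ 4 / real N"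
proof -
  show "1 \<le> \<zeta>" unfolding \<zeta>_def using h_bounds N_real by simp
  have "1 / \<zeta> = h / real N" by (simp add: \<zeta>_def)
  also have "\<dots> \<le> 100 * real k ^ 4 / real N" using h_bounds N0 by (intro divide_right_mono) auto
  finally show "1 / \<zeta> \<le> 100 * real k ^ 4 / real N" .
  have e: "real d * (2 * real (2 * k) + 1) / real n = (4 * real k + 1) / real N"
    using d3 N0 by (simp add: field_simps)
  show "\<zeta> * (real d * (2 * real (2 * k) + 1) / real n) * (2 * (4 * real k + 1) * (real k + 1)) * real k \<le> 1"
    unfolding e g_def[symmetric] using N0 h_bounds by (simp add: \<zeta>_def h_def)
qed

lemma D_bounds: "0 \<le> D" "i \<le> 10 \<Longrightarrow> real k ^ i / real N \<le> D" "i \<le> 10 \<Longrightarrow> real d * real k ^ i / real N \<le> D"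
proof -
  show "0 \<le> D" by (simp add: D_def)
  show 3: "real d * real k ^ i / real N \<le> D" if "i \<le> 10" for i
    unfolding D_def using pow_le[OF that] by (intro divide_right_mono mult_left_mono) auto
  show "real k ^ i / real N \<le> D" if "i \<le> 10" for i
  proof -
    have "1 * real k ^ i / real N \<le> real d * real k ^ i / real N" using d3 by (intro divide_right_mono mult_right_mono) auto
    then show ?thesis using 3[OF that] by simp
  qed
qed

lemma noise1: "real (k * d) * (\<theta>' ^ k * g / \<zeta>) \<le> \<theta> ^ k * (4000 * D)"
proof -
  have t: "0 \<le> \<theta> ^ k" using \<theta> by simp
  have "real (k * d) * (\<theta>' ^ k * g / \<zeta>) = \<theta> ^ k * (real (k * d) * (\<rho> * g * (1 / \<zeta>)))"
    unfolding \<theta>'_ge(3) by simp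
  also have "\<dots> \<le> \<theta> ^ k * (real (k * d) * (2 * (20 * real k ^ 2) * (100 * real k ^ 4 / real N)))"
    using t \<rho>_bounds g_bounds \<zeta>_facts by (intro mult_left_mono mult_mono) auto
  also have "real (k * d) * (2 * (20 * real k ^ 2) * (100 * real k ^ 4 / real N)) = 4000 * (real d * real k ^ 7 / real N)"
    by (simp add: eval_nat_numeral)
  also have "\<theta> ^ k * (4000 * (real d * real k ^ 7 / real N)) \<le> \<theta> ^ k * (4000 * D)"
    using t D_bounds(3)[of 7] by (intro mult_left_mono) auto
  finally show ?thesis .
qed

lemma noise2: "real n * (\<theta>' ^ k * g / \<zeta>\<^sup>2) \<le> \<theta> ^ k * (400000 * D)"
proof -
  have t: "0 \<le> \<theta> ^ k" using \<theta> by simp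
  have z: "0 \<le> 1 / \<zeta>" using \<zeta>_facts(1) by simp
  have "real n * (\<theta>' ^ k * g / \<zeta>\<^sup>2) = \<theta> ^ k * (real n * (\<rho> * g * (1 / \<zeta>)\<^sup>2))"
    unfolding \<theta>'_ge(3) by (simp add: power_divide)
  also have "\<dots> \<le> \<theta> ^ k * (real n * (2 * (20 * real k ^ 2) * (100 * real k ^ 4 / real N)\<^sup>2))"
    using t \<rho>_bounds g_bounds \<zeta>_facts z by (intro mult_left_mono mult_mono power_mono) auto
  also have "real n * (2 * (20 * real k ^ 2) * (100 * real k ^ 4 / real N)\<^sup>2) = 400000 * D"
    using N0 by (simp add: D_def eval_nat_numeral)
  finally show ?thesis .
qed

lemma \<theta>_pow: "real N \<le> \<theta> ^ k"
proof -
  have e: "\<theta> ^ k = \<theta> ^ (k div 2) * \<theta> ^ (k div 2)"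
    using k(1) by (auto simp: power_add[symmetric] mult_2[symmetric])
  have "real N = sqrt (real N) * sqrt (real N)" by simp
  also have "\<dots> \<le> \<theta> ^ (k div 2) * \<theta> ^ (k div 2)" using \<theta>N \<theta>(2) by (intro mult_mono) auto
  finally show ?thesis unfolding e .
qed

lemma wt_cycle: "\<gamma> \<in> cycles N d q \<Longrightarrow> wt p n (card (step_edge ` set \<gamma>)) = wt p n q"
  by (simp add: cycle_structure(1))

lemma cycle_weight_eq: "cycle_weight p N d q = real (card (cycles N d q)) * wt p n q"
  by (simp add: cycle_weight_def wt_cycle)

text \<open>Used with \<open>i = 1\<close> for the first moment and with \<open>i = 2\<close> for
  the disjoint pairs in the second one.\<close>

lemma count_weight_le: "q \<le> k \<Longrightarrow> j \<le> 2 * k \<Longrightarrow> i * q = j \<Longrightarrow> real (card (cycles N d q)) ^ i * wt p n j \<le> \<theta>' ^ j"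
proof -
  assume q: "q \<le> k" "j \<le> 2 * k" "i * q = j"
  have nn: "2 * (2 * k) < n" using n_big(3) k(2) by linarith
  have "card (cycles N d q) ^ i \<le> ((N * (d * (d - 1))) ^ q) ^ i" by (intro power_mono card_cycles_le) simp
  also have "\<dots> = (N * (d * (d - 1))) ^ j" using q(3) by (simp add: power_mult[symmetric] mult.commute)
  finally have "real (card (cycles N d q) ^ i) \<le> real ((N * (d * (d - 1))) ^ j)" by (rule of_nat_mono)
  then have c: "real (card (cycles N d q)) ^ i \<le> ((real d - 1) * real n) ^ j"
    using d3 by (simp add: of_nat_diff mult_ac)
  have w: "wt p n j \<le> (p / (real n - 2 * real (2 * k))) ^ j" using p by (intro wt_le q nn) auto
  have "real (card (cycles N d q)) ^ i * wt p n j \<le> ((real d - 1) * real n) ^ j * (p / (real n - 2 * real (2 * k))) ^ j"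
  proof (rule mult_mono[OF c w])
    show "0 \<le> ((real d - 1) * real n) ^ j" using d3 by (intro zero_le_power mult_nonneg_nonneg) auto
    show "0 \<le> wt p n j" using p nn q by (intro wt_nonneg) auto
  qed
  also have "\<dots> = \<theta>' ^ j" unfolding \<theta>'_def power_mult_distrib ..
  finally show ?thesis .
qed

lemma cycle_weight_le: "q \<le> k \<Longrightarrow> cycle_weight p N d q \<le> \<theta>' ^ q"
  using count_weight_le[of q q 1] by (simp add: cycle_weight_eq)

lemma cycle_weight_ge: "\<theta> ^ k * (1 - real k ^ 2 / real N) \<le> cycle_weight p N d k"
proof -
  have kN: "k \<le> N" 
  proof -
    have "real k \<le> real N" using N_real pow1[of 4] k1 by linarith
    then show ?thesis by simp
  qed
  have b: "1 - real k ^ 2 / real N \<le> (1 - real k / real N) ^ k"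
  proof -
    have "1 + real k * (- (real k / real N)) \<le> (1 + - (real k / real N)) ^ k"
      using kN N0 by (intro Bernoulli_inequality) (simp add: divide_le_eq)
    then show ?thesis by (simp add: power2_eq_square)
  qed
  have "\<theta> ^ k * (1 - real k ^ 2 / real N) \<le> \<theta> ^ k * (1 - real k / real N) ^ k"
    using b \<theta> by (intro mult_left_mono) auto
  also have "\<dots> = ((real N - real k) * (real d * (real d - 1))) ^ k * (p / real n) ^ k"
  proof -
    have "\<theta> * (1 - real k / real N) = ((real N - real k) * (real d * (real d - 1))) * (p / real n)"
      using N0 d3 unfolding \<theta>(1) by (simp add: field_simps)
    then show ?thesis by (simp only: power_mult_distrib[symmetric])
  qed
  also have "\<dots> \<le> real (card (cycles N d k)) * wt p n k"
  proof (rule mult_mono)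
    have "real (((N - k) * (d * (d - 1))) ^ k) \<le> real (card (cycles N d k))"
      using card_cycles_ge[OF k(2)] by (rule of_nat_mono)
    then show "((real N - real k) * (real d * (real d - 1))) ^ k \<le> real (card (cycles N d k))"
      using kN d3 by (simp add: of_nat_diff)
    show "(p / real n) ^ k \<le> wt p n k" using p n_big(3) by (intro wt_ge) auto
  qed (use p in auto)
  finally show ?thesis by (simp add: cycle_weight_eq)
qed

lemma expectation_cycle_count: "measure_pmf.expectation M (cycle_count N d k) = cycle_weight p N d k"
proof -
  have "measure_pmf.expectation M (cycle_count N d k) = (\<Sum>\<gamma>\<in>cycles N d k. measure_pmf.prob M {E. step_edge ` set \<gamma> \<subseteq> E})"
    unfolding cycle_count_def[abs_def] by (rule expectation_count_present[OF finM finite_cycles])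
  also have "\<dots> = cycle_weight p N d k"
    unfolding cycle_weight_def prob_edges_present_le[OF ev less_imp_le[OF p(1)] p(2)]
    by (intro sum.cong refl) (simp add: cycles_def closed_candidates_def)
  finally show ?thesis .
qed

lemma expectation_cycle_count_sq:
  "measure_pmf.expectation M (\<lambda>E. (cycle_count N d k E)\<^sup>2) \<le> \<theta> ^ k * \<theta> ^ k * (\<rho>\<^sup>2 + \<rho> * (404002 * D))"
proof -
  let ?C = "cycles N d k"
  let ?S = "\<lambda>\<gamma> :: step list. step_edge ` set \<gamma>"
  define R where "R = 2 * real k + real (k * d) * (\<theta>' ^ k * g / \<zeta>) + real n * (\<theta>' ^ k * g / \<zeta>\<^sup>2)"
  have R0: "0 \<le> R" unfolding R_def using \<theta>'_ge(2) g_bounds(1) \<zeta>_facts(1)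
    by (intro add_nonneg_nonneg mult_nonneg_nonneg divide_nonneg_nonneg) auto
  have sq: "(cycle_count N d k E)\<^sup>2 = real (card {q \<in> ?C \<times> ?C. ?S (fst q) \<union> ?S (snd q) \<subseteq> E})" for E
  proof -
    have "{q \<in> ?C \<times> ?C. ?S (fst q) \<union> ?S (snd q) \<subseteq> E} = {\<gamma> \<in> ?C. ?S \<gamma> \<subseteq> E} \<times> {\<gamma> \<in> ?C. ?S \<gamma> \<subseteq> E}" by auto
    then show ?thesis by (simp add: cycle_count_def card_cartesian_product power2_eq_square)
  qed
  have "measure_pmf.expectation M (\<lambda>E. (cycle_count N d k E)\<^sup>2)
      = (\<Sum>q\<in>?C \<times> ?C. measure_pmf.prob M {E. ?S (fst q) \<union> ?S (snd q) \<subseteq> E})"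
    unfolding sq using finite_cycles by (intro expectation_count_present[OF finM] finite_cartesian_product)
  also have "\<dots> = (\<Sum>\<gamma>\<in>?C. \<Sum>\<gamma>'\<in>?C. measure_pmf.prob M {E. ?S \<gamma> \<union> ?S \<gamma>' \<subseteq> E})"
    by (simp add: sum.cartesian_product split_def)
  also have "\<dots> = (\<Sum>\<gamma>\<in>?C. \<Sum>\<gamma>'\<in>{\<gamma>' \<in> ?C. partial_matching (half_edges N d) (?S \<gamma> \<union> ?S \<gamma>')}. wt p n (card (?S \<gamma> \<union> ?S \<gamma>')))"
    unfolding prob_edges_present_le[OF ev less_imp_le[OF p(1)] p(2)]
    by (simp only: sum.inter_filter[OF finite_cycles])
  also have "\<dots> \<le> (\<Sum>\<gamma>\<in>?C. real (card ?C) * wt p n (2 * k) + wt p n k * R)"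
  proof (rule sum_mono)
    fix \<gamma> assume \<gamma>: "\<gamma> \<in> ?C"
    have nn: "2 * (2 * k) < n" using n_big(3) k(2) by linarith
    show "(\<Sum>\<gamma>'\<in>{\<gamma>' \<in> ?C. partial_matching (half_edges N d) (?S \<gamma> \<union> ?S \<gamma>')}. wt p n (card (?S \<gamma> \<union> ?S \<gamma>')))
        \<le> real (card ?C) * wt p n (2 * k) + wt p n k * R"
      unfolding g_def R_def
      by (rule cycle_pair_sum[OF _ less_imp_le[OF p(1)] k(2) order_refl nn \<theta>'_def \<theta>'_ge(2) refl _ \<zeta>_facts(1,2) \<gamma>])
        (use d3 in auto)
  qed
  also have "\<dots> = real (card ?C) ^ 2 * wt p n (2 * k) + cycle_weight p N d k * R"
    by (simp add: cycle_weight_eq power2_eq_square algebra_simps)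
  also have "\<dots> \<le> \<theta>' ^ (2 * k) + \<theta>' ^ k * (\<theta> ^ k * (404002 * D))"
  proof (rule add_mono)
    show "real (card ?C) ^ 2 * wt p n (2 * k) \<le> \<theta>' ^ (2 * k)" by (rule count_weight_le) auto
    have "2 * real k * real N \<le> 2 * real k * \<theta> ^ k" using \<theta>_pow by (intro mult_left_mono) auto
    then have "2 * real k \<le> \<theta> ^ k * (2 * (real k ^ 1 / real N))" using N0 by (simp add: field_simps)
    also have "\<dots> \<le> \<theta> ^ k * (2 * D)" using D_bounds(2)[of 1] \<theta> by (intro mult_left_mono) auto
    finally have "R \<le> \<theta> ^ k * (2 * D) + \<theta> ^ k * (4000 * D) + \<theta> ^ k * (400000 * D)"
      using noise1 noise2 unfolding R_def by linarith
    then have "R \<le> \<theta> ^ k * (404002 * D)" by (simp add: algebra_simps)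
    moreover have "0 \<le> \<theta> ^ k * (404002 * D)" using D_bounds(1) \<theta> by simp
    ultimately show "cycle_weight p N d k * R \<le> \<theta>' ^ k * (\<theta> ^ k * (404002 * D))"
      using cycle_weight_le[of k] \<theta>'_ge(2) R0
      by (intro mult_mono) auto
  qed
  also have "\<dots> = \<theta> ^ k * \<theta> ^ k * (\<rho>\<^sup>2 + \<rho> * (404002 * D))"
    unfolding mult_2 power_add \<theta>'_ge(3) by (simp add: power2_eq_square algebra_simps)
  finally show ?thesis .
qed

text \<open>Centred at \<open>\<theta> ^ k\<close> instead of the mean. The main terms
  \<open>\<rho>\<^sup>2 - 2 + 1\<close> cancel up to \<open>k^2 / N\<close>, and the remaining
  constants add up to less than a million.\<close>

lemma cycle_deviation: "measure_pmf.expectation M (\<lambda>E. (cycle_count N d k E / \<theta> ^ k - 1)\<^sup>2) \<le> 1000000 * D"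
proof -
  have t: "0 < \<theta> ^ k" using \<theta> by simp
  have int: "integrable (measure_pmf M) f" for f :: "half set set \<Rightarrow> real" by (rule integrable_measure_pmf_finite[OF finM])
  have "(cycle_count N d k E / \<theta> ^ k - 1)\<^sup>2 = (cycle_count N d k E)\<^sup>2 / (\<theta> ^ k * \<theta> ^ k) - 2 / \<theta> ^ k * cycle_count N d k E + 1" for E
    by (simp add: power2_eq_square algebra_simps)
  then have "measure_pmf.expectation M (\<lambda>E. (cycle_count N d k E / \<theta> ^ k - 1)\<^sup>2)
      = measure_pmf.expectation M (\<lambda>E. (cycle_count N d k E)\<^sup>2) / (\<theta> ^ k * \<theta> ^ k) - 2 / \<theta> ^ k * cycle_weight p N d k + 1"
    using int by (simp add: Bochner_Integration.integral_add Bochner_Integration.integral_diff expectation_cycle_count)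
  also have "\<dots> \<le> (\<rho>\<^sup>2 + \<rho> * (404002 * D)) - 2 * (1 - real k ^ 2 / real N) + 1"
  proof -
    have "measure_pmf.expectation M (\<lambda>E. (cycle_count N d k E)\<^sup>2) / (\<theta> ^ k * \<theta> ^ k) \<le> \<rho>\<^sup>2 + \<rho> * (404002 * D)"
      using expectation_cycle_count_sq t by (subst pos_divide_le_eq) (simp_all only: mult_pos_pos mult_ac)
    moreover have "2 * (1 - real k ^ 2 / real N) \<le> 2 / \<theta> ^ k * cycle_weight p N d k"
    proof -
      have "2 * (1 - real k ^ 2 / real N) = 2 / \<theta> ^ k * (\<theta> ^ k * (1 - real k ^ 2 / real N))" using \<theta>(2) by simp
      also have "\<dots> \<le> 2 / \<theta> ^ k * cycle_weight p N d k" using t by (intro mult_left_mono cycle_weight_ge) auto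
      finally show ?thesis .
    qed
    ultimately show ?thesis by linarith
  qed
  also have "\<rho>\<^sup>2 \<le> 1 + 12 * (real k ^ 2 / real N)"
  proof -
    have "(\<rho> - 1) * (\<rho> + 1) \<le> (4 * real k ^ 2 / real N) * 3" using \<rho>_bounds by (intro mult_mono) auto
    then show ?thesis by (simp add: power2_eq_square algebra_simps)
  qed
  also have "\<rho> * (404002 * D) \<le> 2 * (404002 * D)" using \<rho>_bounds D_bounds(1) by (intro mult_right_mono) auto
  finally show ?thesis using D_bounds(1) D_bounds(2)[of 2] by (simp add: algebra_simps)
qed

text \<open>Periodic walks have weight at most about \<open>k * \<theta> ^ (k div 2)\<close>, which
  relative to \<open>\<theta> ^ k\<close> is \<open>k / sqrt N\<close>; walks with two collisions
  are covered by \<open>noise2\<close>.\<close>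

lemma tame_expectation:
  assumes l: "3 * (l + 1) \<le> m" "0 < l" "4 * real k + 1 \<le> \<theta> ^ l"
  shows "measure_pmf.expectation M (\<lambda>E. tame_count N d m k E / \<theta> ^ k) \<le> real k / sqrt (real N) + 400000 * D"
proof -
  have t: "0 < \<theta> ^ k" using \<theta>(2) by simp
  have fin: "finite (tame_walks N d m k)"
    by (rule finite_subset[OF _ finite_closed_candidates[of N d k]]) (auto simp: tame_walks_def)
  have nn: "2 * (2 * k) < n" using n_big(3) k(2) by linarith
  have l': "4 * real k + 1 \<le> \<theta>' ^ l" using l(3) power_mono[OF \<theta>'_ge(1), of l] \<theta> by simp
  have "measure_pmf.expectation M (tame_count N d m k) = (\<Sum>\<gamma>\<in>tame_walks N d m k. measure_pmf.prob M {E. step_edge ` set \<gamma> \<subseteq> E})"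
    unfolding tame_count_def[abs_def] by (rule expectation_count_present[OF finM fin])
  also have "\<dots> = (\<Sum>\<gamma>\<in>tame_walks N d m k. wt p n (card (step_edge ` set \<gamma>)))"
    unfolding prob_edges_present_le[OF ev less_imp_le[OF p(1)] p(2)]
    by (intro sum.cong refl) (simp add: tame_walks_def closed_candidates_def)
  also have "\<dots> \<le> (\<Sum>q\<in>{1..k div 2}. cycle_weight p N d q) + real n * (\<theta>' ^ k * g / \<zeta>\<^sup>2)"
    unfolding g_def by (rule tame_sum[OF _ less_imp_le[OF p(1)] _ nn \<theta>'_def \<theta>'_ge(2) refl l(1,2) l' order_refl \<zeta>_facts(1,2)])
      (use d3 in auto)
  also have "(\<Sum>q\<in>{1..k div 2}. cycle_weight p N d q) \<le> (\<Sum>q\<in>{1..k div 2}. \<theta>' ^ (k div 2))"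
  proof (rule sum_mono)
    fix q assume q: "q \<in> {1..k div 2}"
    then have "cycle_weight p N d q \<le> \<theta>' ^ q" by (intro cycle_weight_le) auto
    also have "\<dots> \<le> \<theta>' ^ (k div 2)" using q \<theta>'_ge(2) by (intro power_increasing) auto
    finally show "cycle_weight p N d q \<le> \<theta>' ^ (k div 2)" .
  qed
  also have "\<dots> = real (k div 2) * \<theta>' ^ (k div 2)" by simp
  also have "\<dots> \<le> \<theta> ^ k * (real k / sqrt (real N))"
  proof -
    have e: "\<theta> ^ k = \<theta> ^ (k div 2) * \<theta> ^ (k div 2)"
      using k(1) by (auto simp: power_add[symmetric] mult_2[symmetric])
    have "\<theta>' ^ (k div 2) = \<theta> ^ (k div 2) * (\<theta>' / \<theta>) ^ (k div 2)" using \<theta>(2) by (simp add: power_divide)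
    also have "(\<theta>' / \<theta>) ^ (k div 2) \<le> \<rho>" unfolding \<rho>_def using \<theta>'_ratio(2) by (intro power_increasing) auto
    also have "\<rho> \<le> 2" by (rule \<rho>_bounds(3))
    finally have "\<theta>' ^ (k div 2) \<le> \<theta> ^ (k div 2) * 2" using \<theta>(2) by simp
    then have "real (k div 2) * \<theta>' ^ (k div 2) \<le> real (k div 2) * (\<theta> ^ (k div 2) * 2)" by (intro mult_left_mono) auto
    also have "\<dots> = real k * \<theta> ^ (k div 2)" using k(1) by (simp add: real_of_nat_div)
    also have "\<dots> \<le> \<theta> ^ k * (real k / sqrt (real N))"
    proof -
      have "real k * \<theta> ^ (k div 2) * sqrt (real N) \<le> real k * \<theta> ^ (k div 2) * \<theta> ^ (k div 2)"
        using \<theta>N \<theta>(2) by (intro mult_left_mono) auto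
      then show ?thesis unfolding e using N0 by (simp add: le_divide_eq mult_ac)
    qed
    finally show ?thesis .
  qed
  also have "real n * (\<theta>' ^ k * g / \<zeta>\<^sup>2) \<le> \<theta> ^ k * (400000 * D)" by (rule noise2)
  finally have "measure_pmf.expectation M (tame_count N d m k) \<le> \<theta> ^ k * (real k / sqrt (real N) + 400000 * D)"
    by (simp add: distrib_left)
  then show ?thesis using t by (simp add: divide_le_eq mult.commute)
qed

text \<open>Second-moment Markov for the simple walks and first-moment Markov for the others.
  Tangle-freeness belongs to the event because only then do these two classes exhaust the closed
  walks.\<close>

lemma closed_walk_concentration:
  assumes l: "3 * (l + 1) \<le> m" "0 < l" "4 * real k + 1 \<le> \<theta> ^ l" and \<epsilon>: "0 < \<epsilon>"
  shows "measure_pmf.prob M {E. tangle_free m E \<and> 2 * \<epsilon> < \<bar>real (card (closed_walks E k)) / \<theta> ^ k - 1\<bar>}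
    \<le> 1000000 * D / \<epsilon>\<^sup>2 + (real k / sqrt (real N) + 400000 * D) / \<epsilon>"
proof -
  let ?f = "\<lambda>E. (cycle_count N d k E / \<theta> ^ k - 1)\<^sup>2" and ?h = "\<lambda>E. tame_count N d m k E / \<theta> ^ k"
  have t: "0 < \<theta> ^ k" using \<theta>(2) by simp
  have int: "integrable (measure_pmf M) f" for f :: "half set set \<Rightarrow> real" by (rule integrable_measure_pmf_finite[OF finM])
  have A: "measure_pmf.prob M {E. \<epsilon>\<^sup>2 \<le> ?f E} \<le> 1000000 * D / \<epsilon>\<^sup>2"
  proof -
    have "measure_pmf.prob M {E \<in> space (measure_pmf M). \<epsilon>\<^sup>2 \<le> ?f E} \<le> measure_pmf.expectation M ?f / \<epsilon>\<^sup>2"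
      using \<epsilon> by (intro integral_Markov_inequality_measure[OF int, of UNIV]) auto
    also have "\<dots> \<le> 1000000 * D / \<epsilon>\<^sup>2" by (intro divide_right_mono cycle_deviation) simp
    finally show ?thesis by simp
  qed
  have B: "measure_pmf.prob M {E. \<epsilon> \<le> ?h E} \<le> (real k / sqrt (real N) + 400000 * D) / \<epsilon>"
  proof -
    have "measure_pmf.prob M {E \<in> space (measure_pmf M). \<epsilon> \<le> ?h E} \<le> measure_pmf.expectation M ?h / \<epsilon>"
      using \<epsilon> t by (intro integral_Markov_inequality_measure[OF int, of UNIV]) (auto simp: tame_count_def)
    also have "\<dots> \<le> (real k / sqrt (real N) + 400000 * D) / \<epsilon>" using \<epsilon> by (intro divide_right_mono tame_expectation[OF l]) auto
    finally show ?thesis by simp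
  qed
  let ?Z = "{E. tangle_free m E \<and> 2 * \<epsilon> < \<bar>real (card (closed_walks E k)) / \<theta> ^ k - 1\<bar>}"
  have "measure_pmf.prob M ?Z = measure_pmf.prob M (?Z \<inter> set_pmf M)" by (rule measure_Int_set_pmf[symmetric])
  also have "\<dots> \<le> measure_pmf.prob M ({E. \<epsilon>\<^sup>2 \<le> ?f E} \<union> {E. \<epsilon> \<le> ?h E})"
  proof (rule measure_pmf.finite_measure_mono)
    show "?Z \<inter> set_pmf M \<subseteq> {E. \<epsilon>\<^sup>2 \<le> ?f E} \<union> {E. \<epsilon> \<le> ?h E}"
    proof
      fix E assume E: "E \<in> ?Z \<inter> set_pmf M"
      then have "partial_matching (half_edges N d) E" "tangle_free m E" using set_edge_model[OF ev] by auto
      from card_closed_walks[OF this, of k]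
      have s: "real (card (closed_walks E k)) / \<theta> ^ k - 1 = (cycle_count N d k E / \<theta> ^ k - 1) + ?h E"
        by (simp add: add_divide_distrib)
      have "0 \<le> ?h E" using t by (simp add: tame_count_def)
      then have "2 * \<epsilon> < \<bar>cycle_count N d k E / \<theta> ^ k - 1\<bar> + ?h E" using E s by auto
      then have "\<epsilon> \<le> \<bar>cycle_count N d k E / \<theta> ^ k - 1\<bar> \<or> \<epsilon> \<le> ?h E" by linarith
      then show "E \<in> {E. \<epsilon>\<^sup>2 \<le> ?f E} \<union> {E. \<epsilon> \<le> ?h E}"
        using \<epsilon> by (auto simp: abs_le_square_iff[symmetric])
    qed
  qed simp
  also have "\<dots> \<le> measure_pmf.prob M {E. \<epsilon>\<^sup>2 \<le> ?f E} + measure_pmf.prob M {E. \<epsilon> \<le> ?h E}"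
    by (rule measure_Un_le) simp_all
  finally show ?thesis using A B by linarith
qed

end

section \<open>Probability of the spectral event and choice of the parameters\<close>

lemma spectral_event:
  fixes \<epsilon> t :: real
  assumes w: "walk_moments N d k p \<theta>" "walk_moments N d (2 * k) p \<theta>" and N: "2 \<le> N"
    and \<theta>: "sqrt (real d - 1) < \<theta>" "\<theta> < real d - 1" and \<epsilon>: "0 < \<epsilon>" "\<epsilon> \<le> 1 / 10"
    and noise: "real (N * d) * (sqrt (real d - 1) / \<theta>) ^ k \<le> \<epsilon>"
    and l: "3 * (l + 1) \<le> m" "0 < l" "4 * real (2 * k) + 1 \<le> \<theta> ^ l"
    and t: "sqrt (real d - 1) < t" "t < \<theta>" "6 * \<epsilon> < (t / \<theta>) ^ k"
  defines "F \<equiv> \<lambda>k. 1000000 * (real d * real k ^ 10 / real N) / (\<epsilon> / 2)\<^sup>2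
      + (real k / sqrt (real N) + 400000 * (real d * real k ^ 10 / real N)) / (\<epsilon> / 2)"
  shows "1 - (measure_pmf.prob (edge_model N d p) {E. \<not> tangle_free m E} + F k + F (2 * k))
    \<le> measure_pmf.prob (edge_model N d p)
      {E. \<bar>graph_eigenvalue 1 (tree_extension d (paired_multigraph N E)) - (\<theta> + (real d - 1) / \<theta>)\<bar> \<le> 4 * \<epsilon> * \<theta>
        \<and> graph_eigenvalue 2 (tree_extension d (paired_multigraph N E)) \<le> t + (real d - 1) / t}"
proof -
  interpret k1: walk_moments N d k p \<theta> by (rule w(1))
  interpret k2: walk_moments N d "2 * k" p \<theta> by (rule w(2))
  let ?M = "edge_model N d p"
  let ?good = "{E. \<bar>graph_eigenvalue 1 (tree_extension d (paired_multigraph N E)) - (\<theta> + (real d - 1) / \<theta>)\<bar> \<le> 4 * \<epsilon> * \<theta>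
        \<and> graph_eigenvalue 2 (tree_extension d (paired_multigraph N E)) \<le> t + (real d - 1) / t}"
  let ?T = "{E. \<not> tangle_free m E}"
  define Z where "Z k = {E. tangle_free m E \<and> 2 * (\<epsilon> / 2) < \<bar>real (card (closed_walks E k)) / \<theta> ^ k - 1\<bar>}" for k
  have e2: "0 < \<epsilon> / 2" using \<epsilon> by simp
  have Z1: "measure_pmf.prob ?M (Z k) \<le> F k"
    unfolding Z_def F_def k1.D_def[symmetric]
    by (rule k1.closed_walk_concentration[OF l(1,2) _ e2]) (use l(3) in simp)
  have Z2: "measure_pmf.prob ?M (Z (2 * k)) \<le> F (2 * k)"
    unfolding Z_def F_def k2.D_def[symmetric]
    by (rule k2.closed_walk_concentration[OF l e2])
  have "- ?good \<inter> set_pmf ?M \<subseteq> ?T \<union> (Z k \<union> Z (2 * k))"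
  proof
    fix E assume E: "E \<in> - ?good \<inter> set_pmf ?M"
    show "E \<in> ?T \<union> (Z k \<union> Z (2 * k))"
    proof (rule ccontr)
      assume n: "E \<notin> ?T \<union> (Z k \<union> Z (2 * k))"
      interpret half_edge_graph N d E
        by standard (use set_edge_model[OF k1.ev, of E p] E k1.d3 in auto)
      have c: "\<bar>real (card (closed_walks E k)) / \<theta> ^ k - 1\<bar> \<le> \<epsilon>"
        "\<bar>real (card (closed_walks E (2 * k))) / \<theta> ^ (2 * k) - 1\<bar> \<le> \<epsilon>"
        using n by (simp_all add: Z_def)
      note ev = eigenvalues_from_closed_walks[OF N \<theta> k1.k \<epsilon> c noise]
      have "E \<in> ?good" using ev(1) ev(2)[OF t] by simp
      then show False using E by blast
    qed
  qed
  then have "measure_pmf.prob ?M (- ?good \<inter> set_pmf ?M) \<le> measure_pmf.prob ?M (?T \<union> (Z k \<union> Z (2 * k)))"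
    by (rule measure_pmf.finite_measure_mono) simp
  also have "\<dots> \<le> measure_pmf.prob ?M ?T + (measure_pmf.prob ?M (Z k) + measure_pmf.prob ?M (Z (2 * k)))"
    by (intro order_trans[OF measure_Un_le] add_left_mono measure_Un_le) simp_all
  finally have "measure_pmf.prob ?M (- ?good) \<le> measure_pmf.prob ?M ?T + F k + F (2 * k)"
    using Z1 Z2 unfolding measure_Int_set_pmf by linarith
  moreover have "measure_pmf.prob ?M (- ?good) = 1 - measure_pmf.prob ?M ?good"
    using measure_pmf.prob_compl[of ?good ?M] by (simp add: Compl_eq_Diff_UNIV)
  ultimately show ?thesis by linarith
qed

theorem proposition3p3:
  fixes d :: nat and \<mu> :: real
  assumes "d \<ge> 3"
    and "2 * sqrt (real d - 1) < \<mu>"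
    and "\<mu> < real d"
  shows "\<exists>\<delta>>0. \<exists>C.
    ((\<lambda>N. measure_pmf.prob (random_graph N d \<mu>)
        {G. \<bar>graph_eigenvalue 1 G - \<mu>\<bar> \<le> C * real N powr (-0.05)
          \<and> graph_eigenvalue 2 G \<le> (1 - \<delta>) * \<mu>})
      \<longlongrightarrow> 1) (inf sequentially (principal {N. even (N * d)}))"
proof -
  define \<theta> where "\<theta> = theta d \<mu>"
  define L where "L = sqrt (real d - 1)"
  have \<theta>: "\<theta>\<^sup>2 - \<mu> * \<theta> + real d - 1 = 0" "L < \<theta>" "\<theta> < real d - 1"
    using theI'[OF theta_ex1[OF assms]] unfolding theta_def[symmetric] \<theta>_def[symmetric] L_def by simp_all
  have L: "1 < L" "L * L = real d - 1" using assms(1) by (simp_all add: L_def)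
  have \<theta>1: "1 < \<theta>" using L \<theta> by simp
  have \<mu>: "\<mu> = \<theta> + (real d - 1) / \<theta>" using \<theta>(1) \<theta>1 by (simp add: field_simps power2_eq_square)
  define p where "p = \<theta> / (real d - 1)"
  have p: "0 < p" "p \<le> 1" "\<theta> = p * (real d - 1)" using \<theta> \<theta>1 by (simp_all add: p_def)
  define a where "a = ln (\<theta> / L)"
  have a: "0 < a" "exp a = \<theta> / L" using L \<theta> by (simp_all add: a_def)
  \<comment> \<open>Since \<open>k\<close> is about \<open>2 * ln N / a\<close>, the ratio
    \<open>(t / \<theta>) ^ k\<close> is of order \<open>N powr (-0.05)\<close>, which exceeds the
    required \<open>6 * \<epsilon> N\<close>; still \<open>t\<close> stays above
    \<open>L\<close>.\<close>
  define t where "t = \<theta> * exp (- (a / 40))"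
  have t: "L < t" "t < \<theta>"
  proof -
    have "L = \<theta> * exp (- a)" using a L \<theta>1 by (simp add: exp_minus field_simps)
    also have "\<dots> < t" unfolding t_def using a \<theta>1 by (intro mult_strict_left_mono) auto
    finally show "L < t" .
    show "t < \<theta>" unfolding t_def using a \<theta>1 by simp
  qed
  define \<delta> where "\<delta> = 1 - (t + (real d - 1) / t) / \<mu>"
  have \<mu>0: "0 < \<mu>" using \<mu> \<theta>1 assms(1) by (simp add: add_pos_nonneg)
  have \<delta>: "0 < \<delta>" "t + (real d - 1) / t = (1 - \<delta>) * \<mu>"
  proof -
    have "L * L < t * \<theta>" using t L \<theta>(2) by (intro mult_strict_mono) auto
    then have c: "(real d - 1) / (t * \<theta>) < 1" using L t \<theta>1 by (simp add: divide_less_eq)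
    have "(\<theta> + (real d - 1) / \<theta>) - (t + (real d - 1) / t) = (\<theta> - t) * (1 - (real d - 1) / (t * \<theta>))"
      using L t \<theta>1 by (simp add: field_simps)
    moreover have "0 < (\<theta> - t) * (1 - (real d - 1) / (t * \<theta>))" using c t by (intro mult_pos_pos) auto
    ultimately have "t + (real d - 1) / t < \<mu>" unfolding \<mu> by linarith
    then show "0 < \<delta>" "t + (real d - 1) / t = (1 - \<delta>) * \<mu>" using \<mu>0 by (simp_all add: \<delta>_def)
  qed
  define W where "W = ln (2 * real d * exp 2)"
  have W: "0 < W" "exp W = 2 * real d * exp 2"
  proof -
    have "1 * 1 < (2 * real d) * exp 2" using assms(1) by (intro mult_strict_mono) auto
    then show "0 < W" "exp W = 2 * real d * exp 2" by (simp_all add: W_def)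
  qed
  \<comment> \<open>With this \<open>b\<close>, \<open>m N\<close> is about
    \<open>ln N / (2 * W)\<close>, so the exponential factor in \<open>prob_tangle\<close> is of
    order \<open>sqrt N\<close> against the denominator \<open>N\<close>.\<close>
  define b where "b = 1 / (6 * W)"
  have b: "0 < b" using W by (simp add: b_def)
  define j where "j N = nat \<lceil>ln (real N) / a\<rceil>" for N
  \<comment> \<open>The choice of \<open>j\<close> gives
    \<open>(\<theta> / L) ^ j N \<ge> N\<close>. Doubling makes the length even and squares this, so
    the noise is at most \<open>d / N\<close>.\<close>
  define k where "k N = 2 * j N" for N
  define l where "l N = nat \<lceil>b * ln (real N)\<rceil>" for N
  define m where "m N = 3 * (l N + 1)" for N
  \<comment> \<open>The failure bounds are of order \<open>1 / (N * \<epsilon>\<^sup>2)\<close> and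
    \<open>1 / (sqrt N * \<epsilon>)\<close> up to logarithms, and both vanish for the exponent 0.1.
    It must also leave a gap to the exponent 0.05 attached to \<open>t\<close>.\<close>
  define \<epsilon> where "\<epsilon> N = real N powr (- 0.1)" for N :: nat
  \<comment> \<open>A bound for \<open>2 * k N = 4 * j N\<close>, hence for both walk lengths; the 4
    covers the rounding in \<open>j\<close>.\<close>
  define U where "U N = 4 * (ln (real N) / a) + 4" for N
  define F where "F N k = 1000000 * (real d * real k ^ 10 / real N) / (\<epsilon> N / 2)\<^sup>2
      + (real k / sqrt (real N) + 400000 * (real d * real k ^ 10 / real N)) / (\<epsilon> N / 2)" for N k
  define G where "G N = 1000000 * (real d * U N ^ 10 / real N) / (\<epsilon> N / 2)\<^sup>2
      + (U N / sqrt (real N) + 400000 * (real d * U N ^ 10 / real N)) / (\<epsilon> N / 2)" for N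
  \<comment> \<open>The bound of \<open>prob_tangle\<close> with the rounding in \<open>l\<close>
    made explicit: \<open>m N\<close> is at most \<open>3 * b * ln N + 6\<close>, and
    \<open>m N + 1\<close> appears in the exponent.\<close>
  define T where "T N = (3 * (b * ln (real N)) + 6) ^ 3 * exp ((3 * (b * ln (real N)) + 7) * W) / real N" for N :: nat
  have lim: "G \<longlonglongrightarrow> 0"
    unfolding G_def U_def \<epsilon>_def using a(1) by real_asymp
  have limT: "T \<longlonglongrightarrow> 0"
  proof -
    have e: "exp ((3 * (b * ln (real N)) + 7) * W) = exp (ln (real N) / 2) * exp (7 * W)" for N
      using W by (simp add: b_def exp_add[symmetric] field_simps)
    show ?thesis unfolding T_def e using b by real_asymp
  qed
  have ev: "eventually (\<lambda>N. 2 \<le> N \<and> 100 * U N ^ 4 \<le> real N \<and> \<epsilon> N \<le> 1 / 10 \<and> real N * real d \<le> \<epsilon> N * real N ^ 2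
      \<and> 4 * U N + 1 \<le> exp (b * ln (real N) * ln \<theta>) \<and> 6 * \<epsilon> N < exp (- (a / 40) * (2 * (ln (real N) / a) + 2))
      \<and> 4 * (3 * (b * ln (real N)) + 7) \<le> real N * real d) sequentially"
  proof (intro eventually_conj)
    show "eventually (\<lambda>N. 100 * U N ^ 4 \<le> real N) sequentially" unfolding U_def using a(1) by real_asymp
    show "eventually (\<lambda>N. \<epsilon> N \<le> 1 / 10) sequentially" unfolding \<epsilon>_def by real_asymp
    show "eventually (\<lambda>N. real N * real d \<le> \<epsilon> N * real N ^ 2) sequentially" unfolding \<epsilon>_def by real_asymp
    show "eventually (\<lambda>N. 4 * U N + 1 \<le> exp (b * ln (real N) * ln \<theta>)) sequentially"
      unfolding U_def using a(1) b \<theta>1 by real_asymp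
    have e: "exp (- (a / 40) * (2 * (ln (real N) / a) + 2)) = exp (- (ln (real N) / 20)) * exp (- (a / 20))" for N
      using a(1) by (simp add: exp_add[symmetric] field_simps)
    show "eventually (\<lambda>N. 6 * \<epsilon> N < exp (- (a / 40) * (2 * (ln (real N) / a) + 2))) sequentially"
      unfolding \<epsilon>_def e using a(1) by real_asymp
    show "eventually (\<lambda>N. 4 * (3 * (b * ln (real N)) + 7) \<le> real N * real d) sequentially"
      using b assms(1) by real_asymp
    show "eventually (\<lambda>N::nat. 2 \<le> N) sequentially" by (rule eventually_ge_at_top)
  qed
  define A where "A N = {G :: (nat \<times> nat list) multigraph. \<bar>graph_eigenvalue 1 G - \<mu>\<bar> \<le> 4 * \<theta> * real N powr (-0.05) \<and> graph_eigenvalue 2 G \<le> (1 - \<delta>) * \<mu>}" for N :: nat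
  have main: "eventually (\<lambda>N. even (N * d) \<longrightarrow> 1 - (T N + 2 * G N) \<le> measure_pmf.prob (random_graph N d \<mu>) (A N)) sequentially"
    using ev
  proof eventually_elim
    case (elim N)
    show ?case
    proof
      assume even: "even (N * d)"
      have x: "1 < real N" "0 < ln (real N)" using elim by simp_all
      have j: "ln (real N) / a \<le> real (j N)" "real (j N) \<le> ln (real N) / a + 1" "0 < j N"
      proof -
        have "0 < ln (real N) / a" using x a by simp
        then show "ln (real N) / a \<le> real (j N)" "real (j N) \<le> ln (real N) / a + 1" "0 < j N"
          unfolding j_def by linarith+
      qed
      have l: "b * ln (real N) \<le> real (l N)" "real (l N) \<le> b * ln (real N) + 1" "0 < l N"
      proof -
        have "0 < b * ln (real N)" using x b by simp
        then show "b * ln (real N) \<le> real (l N)" "real (l N) \<le> b * ln (real N) + 1" "0 < l N"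
          unfolding l_def by linarith+
      qed
      have k: "even (k N)" "0 < k N" "even (2 * k N)" "0 < 2 * k N" "real (k N) \<le> U N" "real (2 * k N) \<le> U N"
      proof -
        have "0 \<le> ln (real N) / a" using x a by simp
        then show "even (k N)" "0 < k N" "even (2 * k N)" "0 < 2 * k N" "real (k N) \<le> U N" "real (2 * k N) \<le> U N"
          using j by (simp_all add: k_def U_def)
      qed
      have rj: "real N \<le> (\<theta> / L) ^ j N"
      proof -
        have "real N = exp (ln (real N))" using x by simp
        also have "\<dots> \<le> exp (real (j N) * a)" using j(1) a(1) by (simp add: divide_le_eq)
        also have "\<dots> = (\<theta> / L) ^ j N" unfolding a(2)[symmetric] by (rule exp_of_nat_mult)
        finally show ?thesis .
      qed
      have \<theta>j: "sqrt (real N) \<le> \<theta> ^ i" if "j N \<le> i" for i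
      proof -
        have "sqrt (real N) \<le> real N" using x by (intro real_le_lsqrt) (auto simp: power2_eq_square)
        also have "\<dots> \<le> (\<theta> / L) ^ j N" by (rule rj)
        also have "\<dots> \<le> \<theta> ^ j N" using L \<theta>1 by (intro power_mono) (auto simp: divide_le_eq)
        also have "\<dots> \<le> \<theta> ^ i" using \<theta>1 that by (intro power_increasing) auto
        finally show ?thesis .
      qed
      have w: "walk_moments N d q p \<theta>" if "even q" "0 < q" "real q \<le> U N" "j N \<le> q div 2" for q
      proof
        show "100 * q ^ 4 \<le> N"
        proof -
          have "real q ^ 4 \<le> U N ^ 4" using that by (intro power_mono) auto
          then have "real (100 * q ^ 4) \<le> real N" using elim by simp
          then show ?thesis by (simp only: of_nat_le_iff)
        qed
        show "sqrt (real N) \<le> \<theta> ^ (q div 2)" by (rule \<theta>j[OF that(4)])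
      qed (use assms(1) even p \<theta>1 that in auto)
      have w1: "walk_moments N d (k N) p \<theta>" by (rule w) (use k in \<open>auto simp: k_def\<close>)
      have w2: "walk_moments N d (2 * k N) p \<theta>" by (rule w) (use k in \<open>auto simp: k_def\<close>)
      have noise: "real (N * d) * (sqrt (real d - 1) / \<theta>) ^ k N \<le> \<epsilon> N"
      proof -
        have "(sqrt (real d - 1) / \<theta>) ^ k N = 1 / ((\<theta> / L) ^ j N) ^ 2"
          unfolding k_def L_def[symmetric] by (simp add: power_divide power_mult[symmetric] mult.commute)
        also have "\<dots> \<le> 1 / real N ^ 2" using rj x L \<theta>1
          by (intro divide_left_mono power_mono mult_pos_pos zero_less_power divide_pos_pos) auto
        finally have "real (N * d) * (sqrt (real d - 1) / \<theta>) ^ k N \<le> real (N * d) * (1 / real N ^ 2)"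
          by (intro mult_left_mono) auto
        also have "\<dots> \<le> \<epsilon> N" using elim x by (simp add: divide_le_eq)
        finally show ?thesis .
      qed
      have \<theta>l: "4 * real (2 * k N) + 1 \<le> \<theta> ^ l N"
      proof -
        have "4 * real (2 * k N) + 1 \<le> exp (b * ln (real N) * ln \<theta>)" using elim k(6) by linarith
        also have "\<dots> \<le> exp (real (l N) * ln \<theta>)" using l(1) \<theta>1 by (simp add: mult_right_mono)
        also have "\<dots> = \<theta> ^ l N" using \<theta>1 by (simp add: exp_of_nat_mult)
        finally show ?thesis .
      qed
      have tk: "6 * \<epsilon> N < (t / \<theta>) ^ k N"
      proof -
        have "6 * \<epsilon> N < exp (- (a / 40) * (2 * (ln (real N) / a) + 2))" using elim by blast
        also have "\<dots> \<le> exp (real (k N) * (- (a / 40)))"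
        proof -
          have "real (k N) * (a / 40) \<le> (2 * (ln (real N) / a) + 2) * (a / 40)"
            using j(2) a(1) by (intro mult_right_mono) (auto simp: k_def)
          then show ?thesis by (simp add: mult.commute)
        qed
        also have "\<dots> = exp (- (a / 40)) ^ k N" by (rule exp_of_nat_mult)
        also have "exp (- (a / 40)) = t / \<theta>" using \<theta>1 by (simp add: t_def)
        finally show ?thesis .
      qed
      have tan: "measure_pmf.prob (edge_model N d p) {E. \<not> tangle_free (m N) E} \<le> T N"
      proof -
        have mr: "real (m N) \<le> 3 * (b * ln (real N)) + 6" using l(2) by (simp add: m_def)
        have "4 * (m N + 1) \<le> N * d"
        proof -
          have "real (4 * (m N + 1)) \<le> 4 * (3 * (b * ln (real N)) + 7)" using mr by simp
          also have "\<dots> \<le> real (N * d)" using elim by simp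
          finally show ?thesis by (simp only: of_nat_le_iff)
        qed
        then have "measure_pmf.prob (edge_model N d p) {E. \<not> tangle_free (m N) E}
            \<le> real (m N) ^ 3 * (2 * real d * exp 2) ^ (m N + 1) / real N"
          using even p assms(1) x by (intro prob_tangle) auto
        also have "\<dots> \<le> T N"
        proof -
          have "(2 * real d * exp 2) ^ (m N + 1) = exp (real (m N + 1) * W)" unfolding W(2)[symmetric] by (rule exp_of_nat_mult[symmetric])
          also have "\<dots> \<le> exp ((3 * (b * ln (real N)) + 7) * W)" using mr W(1) by (simp add: mult_right_mono)
          finally show ?thesis unfolding T_def using mr by (intro divide_right_mono mult_mono power_mono) auto
        qed
        finally show ?thesis .
      qed
      have \<epsilon>0: "0 < \<epsilon> N" using x by (simp add: \<epsilon>_def)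
      have FG: "F N q \<le> G N" if "real q \<le> U N" for q
        unfolding F_def G_def using that \<epsilon>0
        by (intro add_mono divide_right_mono mult_left_mono power_mono) auto
      let ?B = "{E. \<bar>graph_eigenvalue 1 (tree_extension d (paired_multigraph N E)) - (\<theta> + (real d - 1) / \<theta>)\<bar> \<le> 4 * \<epsilon> N * \<theta>
        \<and> graph_eigenvalue 2 (tree_extension d (paired_multigraph N E)) \<le> t + (real d - 1) / t}"
      have "1 - (T N + 2 * G N) \<le> 1 - (measure_pmf.prob (edge_model N d p) {E. \<not> tangle_free (m N) E} + F N (k N) + F N (2 * k N))"
        using tan FG[OF k(5)] FG[OF k(6)] by linarith
      also have "\<dots> \<le> measure_pmf.prob (edge_model N d p) ?B"
        unfolding F_def
        by (rule spectral_event[OF w1 w2 _ \<theta>(2,3)[unfolded L_def] \<epsilon>0 _ noise _ l(3) \<theta>l t[unfolded L_def] tk])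
          (use elim in \<open>auto simp: m_def\<close>)
      also have "\<dots> \<le> measure_pmf.prob (edge_model N d p) ((\<lambda>E. tree_extension d (paired_multigraph N E)) -` A N)"
      proof (rule measure_pmf.finite_measure_mono)
        have "\<epsilon> N \<le> real N powr (-0.05)" unfolding \<epsilon>_def using x by (intro powr_mono) auto
        then have "4 * \<epsilon> N * \<theta> \<le> 4 * \<theta> * real N powr (-0.05)" using \<theta>1 by simp
        then show "?B \<subseteq> (\<lambda>E. tree_extension d (paired_multigraph N E)) -` A N"
          unfolding A_def \<mu>[symmetric] \<delta>(2) by auto
      qed simp
      also have "\<dots> = measure_pmf.prob (random_graph N d \<mu>) (A N)"
        unfolding random_graph_def edge_model_def p_def \<theta>_def by simp
      finally show "1 - (T N + 2 * G N) \<le> measure_pmf.prob (random_graph N d \<mu>) (A N)" .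
    qed
  qed
  have "((\<lambda>N. measure_pmf.prob (random_graph N d \<mu>) (A N)) \<longlongrightarrow> 1) (inf sequentially (principal {N. even (N * d)}))"
  proof (rule tendsto_sandwich)
    show "eventually (\<lambda>N. 1 - (T N + 2 * G N) \<le> measure_pmf.prob (random_graph N d \<mu>) (A N)) (inf sequentially (principal {N. even (N * d)}))"
      unfolding eventually_inf_principal using main by eventually_elim simp
    show "eventually (\<lambda>N. measure_pmf.prob (random_graph N d \<mu>) (A N) \<le> 1) (inf sequentially (principal {N. even (N * d)}))"
      by (rule always_eventually) simp
    have "(\<lambda>N. 1 - (T N + 2 * G N)) \<longlonglongrightarrow> 1 - (0 + 2 * 0)" by (intro tendsto_intros lim limT)
    then show "((\<lambda>N. 1 - (T N + 2 * G N)) \<longlongrightarrow> 1) (inf sequentially (principal {N. even (N * d)}))"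
      by (intro tendsto_mono[OF inf_le1]) simp
  qed simp
  then show ?thesis unfolding A_def using \<delta>(1) by (intro exI[of _ \<delta>] conjI exI[of _ "4 * \<theta>"])
qed

end
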